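(* Let $\varphi$ be a Finsler norm in $\mathbb{R}^{d}$, $U\subseteq\mathbb{R}^{d}$ an open set, and $u:U\to\mathbb{R}$ a continuous function. The following are equivalent: (i) $u\in W^{1,\infty}_{\mathrm{loc}}(U)$ and for every open $V\subset\subset U$, $\mathrm{Lip}_{\varphi}(u;\overline V)=\min\{\mathrm{Lip}_\varphi(v;\overline V): v:\overline V\to\mathbb{R},\ v=u\text{ on }\partial V\}$; (ii) $u\in W^{1,\infty}_{\mathrm{loc}}(U)$ and for every open $V\subset\subset U$, $\|\varphi^{*}(Du)\|_{L^\infty(V)}=\min\{\|\varphi^{*}(Dv)\|_{L^\infty(V)}: v:\overline V\to\mathbb{R},\ v=u\text{ on }\partial V\}$; (iii) $u\in CCA_{\varphi}(U)\cap CCB_{\varphi}(U)$; (iv) $u\in \mathrm{Sub}_{\varphi}(U)\cap \mathrm{Super}_{\varphi}(U)$.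
   Context: A Finsler norm in $\mathbb{R}^d$ is a convex function $\varphi:\mathbb{R}^d\to[0,+\infty)$ with $\varphi(\lambda x)=\lambda\varphi(x)$ for all $\lambda>0$ and $\varphi(x)>0$ for $x\ne0$ (no symmetry is assumed). Its dual norm is $\varphi^{*}(p)=\max\{\langle p,q\rangle : \varphi(q)\le1\}$, and $\partial\varphi^{*}$ is the subdifferential of $\varphi^{*}$ (so $\partial\varphi^*(0)=\{\varphi\le 1\}$). For $p\in\mathbb{R}^d$ and a symmetric $d\times d$ matrix $X$, $$G_{\varphi}^{*}(p,X)=\max\{\langle Xq,q\rangle: q\in\partial\varphi^{*}(p)\},\qquad G_{*}^{\varphi}(p,X)=\min\{\langle Xq,q\rangle: q\in\partial\varphi^{*}(p)\}.$$ $V\subset\subset U$ means $\overline V$ is compact and $\overline V\subseteq U$. The $\varphi$-Lipschitz seminorm is $\mathrm{Lip}_\varphi(v;\overline V)=\inf\{C>0: v(x)-v(y)\le C\varphi(x-y)\ \forall x,y\in\overline V\}$ (with $\inf\emptyset=+\infty$). In (ii) the competitors $v$ are continuous on $\overline V$ and locally Lipschitz in $V$, so that $Dv$ exists a.e. in $V$. $USC(U)$, $LSC(U)$ are the real-valued upper/lower semicontinuous functions on $U$. $\mathrm{Sub}_\varphi(U)$ is the set of $u\in USC(U)$ such that whenever $x_0\in U$, $\eta$ is smooth near $x_0$ and $u-\eta$ has a local maximum at $x_0$, then $-G_\varphi^*(D\eta(x_0),D^2\eta(x_0))\le0$. $\mathrm{Super}_\varphi(U)$ is the set of $v\in LSC(U)$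 such that whenever $x_0\in U$, $\eta$ is smooth near $x_0$ and $v-\eta$ has a local minimum at $x_0$, then $-G_*^\varphi(D\eta(x_0),D^2\eta(x_0))\ge0$. $CCA_\varphi(U)$ is the set of $u\in USC(U)$ such that for every (nonempty) open $V\subset\subset U$, $z\in\mathbb{R}^d\setminus V$ and $\lambda>0$, $\max_{x\in\overline V}\,(u(x)-\lambda\varphi(x-z))=\max_{x\in\partial V}\,(u(x)-\lambda\varphi(x-z))$. $CCB_\varphi(U)$ is the set of $v\in LSC(U)$ such that for all such $V,z,\lambda$, $\min_{x\in\overline V}\,(v(x)+\lambda\varphi(z-x))=\min_{x\in\partial V}\,(v(x)+\lambda\varphi(z-x))$. *)

theory Defs
  imports "HOL-Analysis.Analysis" "HOL-Probability.Essential_Supremum"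
begin

text \<open>
  A function on a subset of \<open>real ^ 'n\<close> is represented by a total function; every notion below
  depends only on its values on the set in question.
\<close>

definition compactly_contained :: "'a::topological_space set \<Rightarrow> 'a set \<Rightarrow> bool"
    (infix \<open>\<subset>\<subset>\<close> 50) where
  "V \<subset>\<subset> U \<longleftrightarrow> compact (closure V) \<and> closure V \<subseteq> U"

definition is_minimum :: "'a::order \<Rightarrow> 'a set \<Rightarrow> bool" where
  "is_minimum m S \<longleftrightarrow> m \<in> S \<and> (\<forall>s\<in>S. m \<le> s)"


subsection \<open>Finsler norms\<close>

definition finsler_norm :: "(real ^ 'n \<Rightarrow> real) \<Rightarrow> bool" where
  "finsler_norm \<phi> \<longleftrightarrow> convex_on UNIV \<phi> \<and> (\<forall>x. 0 \<le> \<phi> x) \<and>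
     (\<forall>r>0. \<forall>x. \<phi> (r *\<^sub>R x) = r * \<phi> x) \<and> (\<forall>x. x \<noteq> 0 \<longrightarrow> 0 < \<phi> x)"

text \<open>
  For a Finsler norm the suprema and infima in the next definitions are taken over the values of a
  continuous function on a nonempty compact set, so they are maxima and minima.
\<close>

definition dual_norm :: "(real ^ 'n \<Rightarrow> real) \<Rightarrow> real ^ 'n \<Rightarrow> real" where
  "dual_norm \<phi> p = (SUP q\<in>{q. \<phi> q \<le> 1}. p \<bullet> q)"

definition subdifferential :: "('a::real_inner \<Rightarrow> real) \<Rightarrow> 'a \<Rightarrow> 'a set" where
  "subdifferential f p = {q. \<forall>p'. f p + q \<bullet> (p' - p) \<le> f p'}"

definition G_upper :: "(real ^ 'n \<Rightarrow> real) \<Rightarrow> real ^ 'n \<Rightarrow> real ^ 'n ^ 'n \<Rightarrow> real" where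
  "G_upper \<phi> p X = (SUP q\<in>subdifferential (dual_norm \<phi>) p. (X *v q) \<bullet> q)"

definition G_lower :: "(real ^ 'n \<Rightarrow> real) \<Rightarrow> real ^ 'n \<Rightarrow> real ^ 'n ^ 'n \<Rightarrow> real" where
  "G_lower \<phi> p X = (INF q\<in>subdifferential (dual_norm \<phi>) p. (X *v q) \<bullet> q)"


subsection \<open>Derivatives and smooth functions\<close>

definition partial_deriv :: "'n \<Rightarrow> (real ^ 'n \<Rightarrow> real) \<Rightarrow> real ^ 'n \<Rightarrow> real" where
  "partial_deriv i f x = frechet_derivative f (at x) (axis i 1)"

text \<open>The value of \<open>grad f x\<close> is arbitrary where \<open>f\<close> is not differentiable.\<close>

definition grad :: "(real ^ 'n \<Rightarrow> real) \<Rightarrow> real ^ 'n \<Rightarrow> real ^ 'n" where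
  "grad f x = (\<chi> i. partial_deriv i f x)"

definition hessian :: "(real ^ 'n \<Rightarrow> real) \<Rightarrow> real ^ 'n \<Rightarrow> real ^ 'n ^ 'n" where
  "hessian f x = jacobian (grad f) (at x)"

text \<open>The following two are meant for open sets \<open>S\<close>.\<close>

primrec Ck_on :: "nat \<Rightarrow> (real ^ 'n) set \<Rightarrow> (real ^ 'n \<Rightarrow> real) \<Rightarrow> bool" where
  "Ck_on 0 S f \<longleftrightarrow> continuous_on S f"
| "Ck_on (Suc k) S f \<longleftrightarrow>
     (\<forall>x\<in>S. f differentiable (at x)) \<and> (\<forall>i. Ck_on k S (partial_deriv i f))"

definition smooth_on :: "(real ^ 'n) set \<Rightarrow> (real ^ 'n \<Rightarrow> real) \<Rightarrow> bool" where
  "smooth_on S f \<longleftrightarrow> (\<forall>k. Ck_on k S f)"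

definition smooth_near :: "real ^ 'n \<Rightarrow> (real ^ 'n \<Rightarrow> real) \<Rightarrow> bool" where
  "smooth_near x f \<longleftrightarrow> (\<exists>S. open S \<and> x \<in> S \<and> smooth_on S f)"


subsection \<open>Local Sobolev space of exponent infinity\<close>

text \<open>
  The Lebesgue (complete) measure is used so that functions defined only almost everywhere,
  such as gradients of locally Lipschitz functions, are measurable.
\<close>

definition Linf_norm :: "(real ^ 'n) set \<Rightarrow> (real ^ 'n \<Rightarrow> real) \<Rightarrow> ennreal" where
  "Linf_norm V f = esssup (lebesgue_on V) (\<lambda>x. ennreal \<bar>f x\<bar>)"

definition Linf_loc :: "(real ^ 'n) set \<Rightarrow> (real ^ 'n \<Rightarrow> real) set" where
  "Linf_loc U = {f. f \<in> borel_measurable (lebesgue_on U) \<and>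
     (\<forall>V. open V \<and> V \<subset>\<subset> U \<longrightarrow> Linf_norm V f < \<infinity>)}"

definition test_function :: "(real ^ 'n) set \<Rightarrow> (real ^ 'n \<Rightarrow> real) \<Rightarrow> bool" where
  "test_function U \<psi> \<longleftrightarrow> smooth_on UNIV \<psi> \<and> {x. \<psi> x \<noteq> 0} \<subset>\<subset> U"

definition weak_partial_deriv ::
    "(real ^ 'n) set \<Rightarrow> 'n \<Rightarrow> (real ^ 'n \<Rightarrow> real) \<Rightarrow> (real ^ 'n \<Rightarrow> real) \<Rightarrow> bool" where
  "weak_partial_deriv U i u g \<longleftrightarrow> (\<forall>\<psi>. test_function U \<psi> \<longrightarrow>
     (LINT x|lebesgue_on U. u x * partial_deriv i \<psi> x) = - (LINT x|lebesgue_on U. g x * \<psi> x))"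

definition W1inf_loc :: "(real ^ 'n) set \<Rightarrow> (real ^ 'n \<Rightarrow> real) set" where
  "W1inf_loc U = {u. u \<in> Linf_loc U \<and> (\<forall>i. \<exists>g. g \<in> Linf_loc U \<and> weak_partial_deriv U i u g)}"


subsection \<open>Absolute minimizers\<close>

definition Lip :: "(real ^ 'n \<Rightarrow> real) \<Rightarrow> (real ^ 'n) set \<Rightarrow> (real ^ 'n \<Rightarrow> real) \<Rightarrow> ennreal" where
  "Lip \<phi> K v = Inf {ennreal C | C. C > 0 \<and> (\<forall>x\<in>K. \<forall>y\<in>K. v x - v y \<le> C * \<phi> (x - y))}"

definition locally_lipschitz_on :: "'a::metric_space set \<Rightarrow> ('a \<Rightarrow> 'b::metric_space) \<Rightarrow> bool" where
  "locally_lipschitz_on V v \<longleftrightarrow> (\<forall>x\<in>V. \<exists>r>0. \<exists>L. L-lipschitz_on (ball x r \<inter> V) v)"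

definition abs_min_Lip :: "(real ^ 'n \<Rightarrow> real) \<Rightarrow> (real ^ 'n) set \<Rightarrow> (real ^ 'n \<Rightarrow> real) set" where
  "abs_min_Lip \<phi> U = {u. u \<in> W1inf_loc U \<and>
     (\<forall>V. open V \<and> V \<subset>\<subset> U \<longrightarrow>
        is_minimum (Lip \<phi> (closure V) u)
          {Lip \<phi> (closure V) v | v. \<forall>x\<in>frontier V. v x = u x})}"

text \<open>
  Continuous functions in \<open>W1inf_loc U\<close> are locally Lipschitz, hence differentiable almost
  everywhere with \<open>grad\<close> a weak gradient.
\<close>

definition abs_min_grad :: "(real ^ 'n \<Rightarrow> real) \<Rightarrow> (real ^ 'n) set \<Rightarrow> (real ^ 'n \<Rightarrow> real) set" where
  "abs_min_grad \<phi> U = {u. u \<in> W1inf_loc U \<and>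
     (\<forall>V. open V \<and> V \<subset>\<subset> U \<longrightarrow>
        is_minimum (Linf_norm V (\<lambda>x. dual_norm \<phi> (grad u x)))
          {Linf_norm V (\<lambda>x. dual_norm \<phi> (grad v x)) | v.
             continuous_on (closure V) v \<and> locally_lipschitz_on V v \<and>
             (\<forall>x\<in>frontier V. v x = u x)})}"


subsection \<open>Viscosity sub- and supersolutions\<close>

definition USC :: "'a::topological_space set \<Rightarrow> ('a \<Rightarrow> real) set" where
  "USC U = {u. \<forall>x\<in>U. \<forall>c>u x. \<forall>\<^sub>F y in at x within U. u y < c}"

definition LSC :: "'a::topological_space set \<Rightarrow> ('a \<Rightarrow> real) set" where
  "LSC U = {v. \<forall>x\<in>U. \<forall>c<v x. \<forall>\<^sub>F y in at x within U. c < v y}"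

text \<open>Local extrema are taken over full neighbourhoods, since \<open>U\<close> is meant to be open.\<close>

definition Sub :: "(real ^ 'n \<Rightarrow> real) \<Rightarrow> (real ^ 'n) set \<Rightarrow> (real ^ 'n \<Rightarrow> real) set" where
  "Sub \<phi> U = {u. u \<in> USC U \<and>
     (\<forall>x0\<in>U. \<forall>\<eta>. smooth_near x0 \<eta> \<and> (\<forall>\<^sub>F x in nhds x0. u x - \<eta> x \<le> u x0 - \<eta> x0) \<longrightarrow>
        - G_upper \<phi> (grad \<eta> x0) (hessian \<eta> x0) \<le> 0)}"

definition Super :: "(real ^ 'n \<Rightarrow> real) \<Rightarrow> (real ^ 'n) set \<Rightarrow> (real ^ 'n \<Rightarrow> real) set" where
  "Super \<phi> U = {v. v \<in> LSC U \<and>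
     (\<forall>x0\<in>U. \<forall>\<eta>. smooth_near x0 \<eta> \<and> (\<forall>\<^sub>F x in nhds x0. v x0 - \<eta> x0 \<le> v x - \<eta> x) \<longrightarrow>
        - G_lower \<phi> (grad \<eta> x0) (hessian \<eta> x0) \<ge> 0)}"


subsection \<open>Comparison with cones\<close>

text \<open>
  The suprema (infima) below are over nonempty compact subsets of \<open>U\<close>, where an upper (lower)
  semicontinuous function attains them.
\<close>

definition CCA :: "(real ^ 'n \<Rightarrow> real) \<Rightarrow> (real ^ 'n) set \<Rightarrow> (real ^ 'n \<Rightarrow> real) set" where
  "CCA \<phi> U = {u. u \<in> USC U \<and>
     (\<forall>V z \<mu>. open V \<and> V \<noteq> {} \<and> V \<subset>\<subset> U \<and> z \<notin> V \<and> \<mu> > 0 \<longrightarrow>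
        (SUP x\<in>closure V. u x - \<mu> * \<phi> (x - z)) = (SUP x\<in>frontier V. u x - \<mu> * \<phi> (x - z)))}"

definition CCB :: "(real ^ 'n \<Rightarrow> real) \<Rightarrow> (real ^ 'n) set \<Rightarrow> (real ^ 'n \<Rightarrow> real) set" where
  "CCB \<phi> U = {v. v \<in> LSC U \<and>
     (\<forall>V z \<mu>. open V \<and> V \<noteq> {} \<and> V \<subset>\<subset> U \<and> z \<notin> V \<and> \<mu> > 0 \<longrightarrow>
        (INF x\<in>closure V. v x + \<mu> * \<phi> (z - x)) = (INF x\<in>frontier V. v x + \<mu> * \<phi> (z - x)))}"

end

theory Submission imports Defs begin

text \<open>
  Replacing \<open>u\<close> by \<open>- u\<close> and \<open>\<phi>\<close> by its reflection exchanges the notions of sub- and superextremality,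
  so it suffices to relate comparison with cones from above to each of the other properties.

  If \<open>u\<close> satisfies comparison with cones from above, then from every point where \<open>u\<close> has upper slope at
  least \<open>\<kappa>\<close> it can be followed by steps along which it rises with slope at least \<open>\<kappa>\<close>, and the slope
  never drops. At a superjet \<open>(p, X)\<close> with negative \<open>G_upper \<phi> p X\<close> this is impossible, so \<open>u\<close> is a
  subsolution. A competitor whose gradient is bounded by \<open>L < \<kappa>\<close> cannot keep up with such steps,
  so \<open>u\<close> would lie strictly below the competitor at their starting point; by reflection it would also lie
  strictly above it. Conversely, if comparison with a cone fails, then on some open set the
  cone itself is a better competitor than \<open>u\<close>.

  A subsolution is compared with a cone through the log-Laplace transform
  \<open>ln (\<integral> exp (N * (p \<bullet> x)) dp) / N\<close> over the polar body \<open>{p. dual_norm \<phi> p \<le> 1}\<close>, a smooth approximation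
  of \<open>\<phi>\<close>. Its second derivative in the directions of the subdifferential of the dual norm at its
  gradient is of order \<open>1 / N\<close>, with a constant that depends only on the dimension, so a concave
  perturbation of the approximate cone is a strict supersolution although \<open>\<phi>\<close> need not be smooth.

  Gradient bounds are turned into Lipschitz bounds on segments by averaging over parallel segments,
  along almost all of which Rademacher's theorem gives differentiability almost everywhere.
\<close>

subsection \<open>Finsler norms\<close>

text \<open>The obstacle lies in the passage from the viscosity inequality to cones. The
  subdifferential of the dual norm is set-valued, \<open>G_upper\<close> sees all of it, and an
  arbitrary smoothing of \<phi> gives no control of second derivatives in those directions. For the
  log-Laplace transform the Hessian is \<open>N\<close> times the covariance of a tilted measure on
  the polar body, and the gradient is its barycentre \<open>b\<close>. If \<open>q\<close> lies in
  the subdifferential at \<open>b\<close>, then the affine function \<open>1 - p \<bullet> q\<close>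
  is nonnegative on the polar body and its mean is \<open>1 - dual_norm \<phi> b\<close>, of order
  \<open>1 / N\<close>. Under the tilted measure the variance of a nonnegative affine function is at
  most a constant times the square of its mean, so the second derivative along \<open>q\<close> is
  \<open>N\<close> times a quantity of order \<open>1 / N^2\<close>. The factors
  \<open>2 ^ CARD('n)\<close> come from contracting a convex body by 1/2, which costs exactly that
  factor in volume and improves every exponent in a way that is uniform in \<open>N\<close>.\<close>

locale finsler =
  fixes \<phi> :: "real ^ 'n \<Rightarrow> real"
  assumes finsler: "finsler_norm \<phi>"
begin

lemma convex_phi: "convex_on UNIV \<phi>" and phi_nonneg [simp]: "0 \<le> \<phi> x"
  and phi_pos: "x \<noteq> 0 \<Longrightarrow> 0 < \<phi> x"
  using finsler by (auto simp: finsler_norm_def)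

lemma phi_zero [simp]: "\<phi> 0 = 0"
proof -
  have "\<phi> (2 *\<^sub>R 0) = 2 * \<phi> 0" using finsler unfolding finsler_norm_def by (meson zero_less_numeral)
  then show ?thesis by simp
qed

lemma phi_scale: "0 \<le> r \<Longrightarrow> \<phi> (r *\<^sub>R x) = r * \<phi> x"
  using finsler by (cases "r = 0") (auto simp: finsler_norm_def)

lemma phi_eq_0 [simp]: "\<phi> x = 0 \<longleftrightarrow> x = 0"
  using phi_pos[of x] by (cases "x = 0") auto

lemma phi_triangle: "\<phi> (x + y) \<le> \<phi> x + \<phi> y"
proof -
  have "\<phi> ((1 - 1/2) *\<^sub>R (2 *\<^sub>R x) + (1/2) *\<^sub>R (2 *\<^sub>R y)) \<le> (1 - 1/2) * \<phi> (2 *\<^sub>R x) + (1/2) * \<phi> (2 *\<^sub>R y)"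
    by (rule convex_onD[OF convex_phi]) auto
  then show ?thesis by (simp add: phi_scale)
qed

lemma phi_triangle3: "\<phi> (x - z) \<le> \<phi> (x - y) + \<phi> (y - z)"
  using phi_triangle[of "x - y" "y - z"] by simp

lemma continuous_phi: "continuous_on S \<phi>"
  using convex_on_continuous[OF open_UNIV convex_phi] continuous_on_subset by blast

lemma continuous_on_phi [continuous_intros]: "continuous_on S f \<Longrightarrow> continuous_on S (\<lambda>x. \<phi> (f x))"
  using continuous_on_compose2[OF continuous_phi[of UNIV]] by auto

lemma tendsto_phi [tendsto_intros]: "(f \<longlongrightarrow> l) F \<Longrightarrow> ((\<lambda>x. \<phi> (f x)) \<longlongrightarrow> \<phi> l) F"
  using continuous_phi[of UNIV] by (metis UNIV_I continuous_on_eq_continuous_at isCont_tendsto_compose open_UNIV)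

lemma phi_bounds:
  obtains m M where "0 < m" "0 < M" "\<And>x. m * norm x \<le> \<phi> x" "\<And>x. \<phi> x \<le> M * norm x"
proof -
  have "sphere 0 1 \<noteq> ({} :: (real^'n) set)" by simp
  then obtain a where a: "a \<in> sphere 0 1" "\<And>y. y \<in> sphere 0 1 \<Longrightarrow> \<phi> a \<le> \<phi> y"
    using continuous_attains_inf[OF compact_sphere _ continuous_phi] by metis
  obtain b where b: "b \<in> sphere 0 1" "\<And>y. y \<in> sphere 0 1 \<Longrightarrow> \<phi> y \<le> \<phi> b"
    using continuous_attains_sup[OF compact_sphere _ continuous_phi] \<open>sphere 0 1 \<noteq> {}\<close> by metis
  have eq: "\<phi> x = norm x * \<phi> (x /\<^sub>R norm x)" if "x \<noteq> 0" for x
    using that by (simp add: phi_scale)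
  have in_s: "x /\<^sub>R norm x \<in> sphere 0 1" if "x \<noteq> 0" for x :: "real^'n" using that by simp
  show ?thesis
  proof
    show "0 < \<phi> a" "0 < \<phi> b" using a(1) b(1) by (auto intro!: phi_pos)
    show "\<phi> a * norm x \<le> \<phi> x" for x
      using eq[of x] a(2)[OF in_s[of x]] by (cases "x = 0") (auto simp: mult.commute mult_left_mono)
    show "\<phi> x \<le> \<phi> b * norm x" for x
      using eq[of x] b(2)[OF in_s[of x]] by (cases "x = 0") (auto simp: mult.commute mult_left_mono)
  qed
qed

text \<open>Distances are measured from the centre outwards; the order of the arguments matters
  because \<phi> is not symmetric.\<close>

definition pball :: "real ^ 'n \<Rightarrow> real \<Rightarrow> (real ^ 'n) set" where
  "pball x r = {y. \<phi> (y - x) \<le> r}"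

lemma pball_cball: obtains M where "0 < M" "\<And>x r. pball x r \<subseteq> cball x (M * r)"
proof -
  obtain m M where m: "0 < m" "\<And>x. m * norm x \<le> \<phi> x" using phi_bounds by metis
  show ?thesis
  proof
    show "0 < 1 / m" using m by simp
    show "pball x r \<subseteq> cball x (1 / m * r)" for x r
    proof
      fix y assume "y \<in> pball x r"
      then have "m * norm (y - x) \<le> r" using m(2)[of "y - x"] by (simp add: pball_def)
      then show "y \<in> cball x (1 / m * r)"
        using m(1) by (simp add: dist_norm norm_minus_commute field_simps)
    qed
  qed
qed

lemma compact_pball: "compact (pball x r)"
proof -
  obtain M where "pball x r \<subseteq> cball x (M * r)" using pball_cball by metis
  then have "bounded (pball x r)" by (meson bounded_cball bounded_subset)
  moreover have "closed (pball x r)" unfolding pball_def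
    by (intro closed_Collect_le continuous_intros)
  ultimately show ?thesis using compact_eq_bounded_closed by blast
qed

lemma center_in_pball: "0 \<le> r \<Longrightarrow> x \<in> pball x r"
  by (simp add: pball_def)

lemma open_pball_less: "open {y. \<phi> (y - x) < r}"
  by (intro open_Collect_less continuous_intros)

lemma pball_subset_open:
  assumes "open S" "x \<in> S"
  obtains r0 where "0 < r0" "\<And>r. r \<le> r0 \<Longrightarrow> pball x r \<subseteq> S"
proof -
  obtain e where e: "0 < e" "cball x e \<subseteq> S" using assms open_contains_cball by blast
  obtain M where M: "0 < M" "\<And>x r. pball x r \<subseteq> cball x (M * r)" using pball_cball by metis
  show ?thesis
  proof
    show "0 < e / M" using e M by simp
    show "pball x r \<subseteq> S" if "r \<le> e / M" for r
    proof -
      have "M * r \<le> e" using that M(1) by (simp add: field_simps)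
      then show ?thesis using M(2)[of x r] e(2) by (meson order_trans subset_cball)
    qed
  qed
qed

text \<open>Hahn-Banach in finite dimension: a hyperplane separates \<open>x\<close> from the
  sublevel set on which \<phi> is smaller, and rescaling its normal makes it touch \<phi> at
  \<open>x\<close>.\<close>

lemma support_functional:
  obtains p where "p \<bullet> x = \<phi> x" "\<And>y. p \<bullet> y \<le> \<phi> y"
proof (cases "x = 0")
  case True
  then show ?thesis using that[of 0] by auto
next
  case False
  let ?S = "{y. \<phi> y < \<phi> x}"
  have "convex ?S"
  proof (rule convexI, clarify)
    fix a b :: "real^'n" and u v :: real
    assume *: "\<phi> a < \<phi> x" "\<phi> b < \<phi> x" "0 \<le> u" "0 \<le> v" "u + v = 1"
    have "\<phi> (u *\<^sub>R a + v *\<^sub>R b) \<le> u * \<phi> a + v * \<phi> b" using * phi_triangle[of "u *\<^sub>R a" "v *\<^sub>R b"] by (simp add: phi_scale)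
    also have "\<dots> < \<phi> x" using * by (intro convex_bound_lt) auto
    finally show "\<phi> (u *\<^sub>R a + v *\<^sub>R b) < \<phi> x" .
  qed
  moreover have "?S \<noteq> {}" using phi_pos[OF False] by (auto intro!: exI[of _ 0])
  ultimately obtain a b where a: "a \<noteq> 0" "\<forall>y\<in>?S. a \<bullet> y \<le> b" "\<forall>y\<in>{x}. b \<le> a \<bullet> y"
    using separating_hyperplane_sets[of ?S "{x}"] by auto
  then have le: "a \<bullet> y \<le> a \<bullet> x" if "\<phi> y < \<phi> x" for y using that by force
  \<comment> \<open>A small positive multiple of \<open>a\<close> lies in the sublevel set, which
    forces the sign and allows the later division.\<close>
  have ax: "0 < a \<bullet> x"
  proof -
    have "0 < \<phi> a" using a(1) phi_pos by auto
    let ?t = "\<phi> x / (2 * \<phi> a)"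
    have t: "0 < ?t" using phi_pos[OF False] \<open>0 < \<phi> a\<close> by simp
    have "\<phi> (?t *\<^sub>R a) = \<phi> x / 2" using t \<open>0 < \<phi> a\<close> by (subst phi_scale) (auto simp: field_simps)
    then have "a \<bullet> (?t *\<^sub>R a) \<le> a \<bullet> x" using phi_pos[OF False] by (intro le) simp
    moreover have "0 < a \<bullet> (?t *\<^sub>R a)" using t a(1) by (metis inner_gt_zero_iff inner_scaleR_right mult_pos_pos)
    ultimately show ?thesis by linarith
  qed
  \<comment> \<open>By homogeneity \<open>y\<close> is scaled to the level
    \<open>t * \<phi> x\<close> with \<open>t < 1\<close>, inside the strict sublevel set; then
    \<open>t\<close> tends to 1.\<close>
  have main: "a \<bullet> y * \<phi> x \<le> a \<bullet> x * \<phi> y" for y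
  proof (cases "y = 0")
    case False
    then have py: "0 < \<phi> y" using phi_pos by auto
    have "t * (a \<bullet> y * \<phi> x / \<phi> y) \<le> a \<bullet> x" if t: "0 < t" "t < 1" for t
    proof -
      have "\<phi> ((t * \<phi> x / \<phi> y) *\<^sub>R y) = t * \<phi> x" using t py by (subst phi_scale) auto
      also have "\<dots> < \<phi> x" using t phi_pos[OF \<open>x \<noteq> 0\<close>] by simp
      finally have "a \<bullet> ((t * \<phi> x / \<phi> y) *\<^sub>R y) \<le> a \<bullet> x" by (rule le)
      then show ?thesis by (simp add: mult_ac)
    qed
    then have "a \<bullet> y * \<phi> x / \<phi> y \<le> a \<bullet> x" by (rule field_le_mult_one_interval)
    then show ?thesis using py by (simp add: field_simps)
  qed simp
  show ?thesis
  proof (rule that[of "(\<phi> x / (a \<bullet> x)) *\<^sub>R a"])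
    show "(\<phi> x / (a \<bullet> x)) *\<^sub>R a \<bullet> x = \<phi> x" using ax by simp
    show "(\<phi> x / (a \<bullet> x)) *\<^sub>R a \<bullet> y \<le> \<phi> y" for y using ax main[of y] by (simp add: field_simps)
  qed
qed

section \<open>The dual norm and its subdifferential\<close>

lemma bdd_dual: "bdd_above ((\<lambda>q. p \<bullet> q) ` {q. \<phi> q \<le> 1})"
proof -
  obtain M where "pball 0 1 \<subseteq> cball 0 (M * 1)" using pball_cball by metis
  then have M: "norm q \<le> M" if "\<phi> q \<le> 1" for q using that by (auto simp: pball_def)
  show ?thesis
  proof (rule bdd_aboveI2)
    fix q assume "q \<in> {q. \<phi> q \<le> 1}"
    then have "norm p * norm q \<le> norm p * M" using M by (auto intro: mult_left_mono)
    then show "p \<bullet> q \<le> norm p * M" using norm_cauchy_schwarz[of p q] by linarith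
  qed
qed

lemma inner_le_dual: "p \<bullet> q \<le> dual_norm \<phi> p * \<phi> q"
proof (cases "q = 0")
  case False
  then have q: "0 < \<phi> q" using phi_pos by auto
  have "p \<bullet> (q /\<^sub>R \<phi> q) \<le> dual_norm \<phi> p" unfolding dual_norm_def
    using q by (intro cSUP_upper[OF _ bdd_dual]) (simp add: phi_scale field_simps)
  then show ?thesis using q by (simp add: field_simps)
qed simp

lemma inner_le_dual1: "\<phi> q \<le> 1 \<Longrightarrow> p \<bullet> q \<le> dual_norm \<phi> p"
  unfolding dual_norm_def by (intro cSUP_upper[OF _ bdd_dual]) simp

lemma dual_leI: assumes "\<And>q. \<phi> q \<le> 1 \<Longrightarrow> p \<bullet> q \<le> C" shows "dual_norm \<phi> p \<le> C"
  unfolding dual_norm_def using assms by (intro cSUP_least) (auto intro!: exI[of _ 0])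

lemma dual_nonneg [simp]: "0 \<le> dual_norm \<phi> p"
  using inner_le_dual1[of 0 p] by simp

lemma dual_zero [simp]: "dual_norm \<phi> 0 = 0"
  by (rule antisym[OF dual_leI]) auto

lemma dual_attained: obtains q where "\<phi> q \<le> 1" "p \<bullet> q = dual_norm \<phi> p"
proof -
  have "continuous_on (pball 0 1) (\<lambda>q. p \<bullet> q)" by (intro continuous_intros)
  moreover have "pball 0 1 \<noteq> {}" using center_in_pball[of 1 0] by auto
  ultimately obtain q where q: "q \<in> pball 0 1" "\<And>y. y \<in> pball 0 1 \<Longrightarrow> p \<bullet> y \<le> p \<bullet> q"
    using continuous_attains_sup[OF compact_pball] by metis
  have "dual_norm \<phi> p \<le> p \<bullet> q" by (rule dual_leI) (use q in \<open>auto simp: pball_def\<close>)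
  with q inner_le_dual1[of q p] show ?thesis by (intro that[of q]) (auto simp: pball_def)
qed

lemma dual_pos: assumes "p \<noteq> 0" shows "0 < dual_norm \<phi> p"
proof -
  have "0 < p \<bullet> p" using assms by simp
  also have "\<dots> \<le> dual_norm \<phi> p * \<phi> p" by (rule inner_le_dual)
  finally show ?thesis by (metis dual_nonneg less_eq_real_def mult_zero_left order_less_irrefl)
qed

lemma dual_unit_attained:
  assumes "p \<noteq> 0" "\<phi> q \<le> 1" "p \<bullet> q = dual_norm \<phi> p" shows "\<phi> q = 1"
proof -
  have "dual_norm \<phi> p * 1 \<le> dual_norm \<phi> p * \<phi> q" using inner_le_dual[of p q] assms by simp
  then have "1 \<le> \<phi> q" using dual_pos[OF assms(1)] mult_le_cancel_left_pos by blast
  then show ?thesis using assms by simp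
qed

lemma dual_scale: assumes "0 \<le> r" shows "dual_norm \<phi> (r *\<^sub>R p) = r * dual_norm \<phi> p"
proof (rule antisym)
  show "dual_norm \<phi> (r *\<^sub>R p) \<le> r * dual_norm \<phi> p"
    by (rule dual_leI) (use assms inner_le_dual1 in \<open>auto intro: mult_left_mono\<close>)
  obtain q where "\<phi> q \<le> 1" "p \<bullet> q = dual_norm \<phi> p" by (rule dual_attained)
  then show "r * dual_norm \<phi> p \<le> dual_norm \<phi> (r *\<^sub>R p)" using inner_le_dual1[of q "r *\<^sub>R p"] by simp
qed

lemma dual_triangle: "dual_norm \<phi> (p + p') \<le> dual_norm \<phi> p + dual_norm \<phi> p'"
  by (rule dual_leI) (auto simp: inner_add_left intro: add_mono inner_le_dual1)

lemma dual_bound: obtains M where "0 < M" "\<And>p. dual_norm \<phi> p \<le> M * norm p"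
proof -
  obtain M where "0 < M" "\<And>x r. pball x r \<subseteq> cball x (M * r)" using pball_cball by metis
  then have "pball 0 1 \<subseteq> cball 0 (M * 1)" by blast
  then have M: "norm q \<le> M" if "\<phi> q \<le> 1" for q using that by (auto simp: pball_def)
  have "dual_norm \<phi> p \<le> M * norm p" for p
  proof (rule dual_leI)
    fix q assume "\<phi> q \<le> 1"
    then have "norm p * norm q \<le> norm p * M" using M by (auto intro: mult_left_mono)
    then show "p \<bullet> q \<le> M * norm p" using norm_cauchy_schwarz[of p q] by (simp add: mult.commute)
  qed
  then show ?thesis using that \<open>0 < M\<close> by blast
qed

lemma continuous_dual: "continuous_on S (dual_norm \<phi>)"
proof -
  have "convex_on UNIV (dual_norm \<phi>)"
    unfolding convex_on_def
  proof (intro conjI allI impI ballI convex_UNIV)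
    fix x y :: "real^'n" and u v :: real assume "0 \<le> u" "0 \<le> v" "u + v = 1"
    then show "dual_norm \<phi> (u *\<^sub>R x + v *\<^sub>R y) \<le> u * dual_norm \<phi> x + v * dual_norm \<phi> y"
      using dual_triangle[of "u *\<^sub>R x" "v *\<^sub>R y"] dual_scale[of u x] dual_scale[of v y] by simp
  qed
  then show ?thesis using convex_on_continuous[OF open_UNIV] continuous_on_subset by blast
qed

text \<open>Homogeneity turns the subgradient inequality at \<open>2 *\<^sub>R p\<close> and at 0
  into Euler's identity. What remains says that \<open>q\<close> is dominated by the dual norm, and
  testing with a supporting functional of \<phi> at \<open>q\<close> gives
  \<open>\<phi> q \<le> 1\<close>. At \<open>p = 0\<close> this is the whole unit ball.\<close>

lemma subdiff_dual: "q \<in> subdifferential (dual_norm \<phi>) p \<longleftrightarrow> \<phi> q \<le> 1 \<and> p \<bullet> q = dual_norm \<phi> p"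
proof
  assume "q \<in> subdifferential (dual_norm \<phi>) p"
  then have s: "dual_norm \<phi> p + q \<bullet> (p' - p) \<le> dual_norm \<phi> p'" for p' by (auto simp: subdifferential_def)
  have "dual_norm \<phi> p + q \<bullet> p \<le> 2 * dual_norm \<phi> p" using s[of "2 *\<^sub>R p"] by (simp add: dual_scale inner_diff_right)
  with s[of 0] have eq: "dual_norm \<phi> p = q \<bullet> p" by simp
  then have le: "q \<bullet> p' \<le> dual_norm \<phi> p'" for p' using s[of p'] by (simp add: inner_diff_right)
  obtain p' where p': "p' \<bullet> q = \<phi> q" "\<And>y. p' \<bullet> y \<le> \<phi> y" using support_functional by blast
  have "dual_norm \<phi> p' \<le> 1" by (rule dual_leI) (use p'(2) order_trans in blast)
  with le[of p'] p'(1) eq show "\<phi> q \<le> 1 \<and> p \<bullet> q = dual_norm \<phi> p" by (simp add: inner_commute)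
next
  assume "\<phi> q \<le> 1 \<and> p \<bullet> q = dual_norm \<phi> p"
  then show "q \<in> subdifferential (dual_norm \<phi>) p"
    using inner_le_dual1 by (auto simp: subdifferential_def inner_diff_right inner_commute[of q])
qed

lemma compact_subdiff: "compact (subdifferential (dual_norm \<phi>) p)"
proof -
  have eq: "subdifferential (dual_norm \<phi>) p = pball 0 1 \<inter> {q. p \<bullet> q = dual_norm \<phi> p}"
    by (rule set_eqI) (simp add: subdiff_dual pball_def)
  show ?thesis unfolding eq by (rule compact_Int_closed[OF compact_pball closed_hyperplane])
qed

lemma subdiff_nonempty: "subdifferential (dual_norm \<phi>) p \<noteq> {}"
proof -
  obtain q where "\<phi> q \<le> 1" "p \<bullet> q = dual_norm \<phi> p" by (rule dual_attained)
  then show ?thesis using subdiff_dual by blast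
qed

lemma continuous_quadratic_form: "continuous_on S (\<lambda>q. (X *v q) \<bullet> (q :: real ^ 'n))"
  by (intro continuous_intros matrix_vector_mult_linear_continuous_on)

lemma G_upper_ge:
  assumes "q \<in> subdifferential (dual_norm \<phi>) p" shows "(X *v q) \<bullet> q \<le> G_upper \<phi> p X"
  unfolding G_upper_def
  by (rule cSUP_upper[OF assms bounded_imp_bdd_above[OF compact_imp_bounded[OF
        compact_continuous_image[OF continuous_quadratic_form compact_subdiff]]]])

lemma G_upper_attained:
  obtains q where "q \<in> subdifferential (dual_norm \<phi>) p" "G_upper \<phi> p X = (X *v q) \<bullet> q"
proof -
  obtain q where q: "q \<in> subdifferential (dual_norm \<phi>) p"
    "\<And>y. y \<in> subdifferential (dual_norm \<phi>) p \<Longrightarrow> (X *v y) \<bullet> y \<le> (X *v q) \<bullet> q"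
    using continuous_attains_sup[OF compact_subdiff subdiff_nonempty continuous_quadratic_form] by metis
  have "G_upper \<phi> p X = (X *v q) \<bullet> q" unfolding G_upper_def
    using q by (intro cSup_eq_maximum) auto
  then show ?thesis using q by (intro that[of q]) auto
qed

section \<open>Reflection of the norm\<close>

lemma finsler_reflect: "finsler (\<lambda>x. \<phi> (- x))"
proof
  have "convex_on UNIV (\<lambda>x. \<phi> (- x))"
    unfolding convex_on_def
  proof (intro conjI allI impI ballI convex_UNIV)
    fix x y :: "real^'n" and u v :: real assume "0 \<le> u" "0 \<le> v" "u + v = 1"
    then show "\<phi> (- (u *\<^sub>R x + v *\<^sub>R y)) \<le> u * \<phi> (- x) + v * \<phi> (- y)"
      using phi_triangle[of "u *\<^sub>R - x" "v *\<^sub>R - y"] phi_scale[of u "- x"] phi_scale[of v "- y"] by simp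
  qed
  moreover have "\<forall>r>0. \<forall>x. \<phi> (- (r *\<^sub>R x)) = r * \<phi> (- x)"
  proof (intro allI impI)
    fix r :: real and x assume "r > 0"
    then show "\<phi> (- (r *\<^sub>R x)) = r * \<phi> (- x)" using phi_scale[of r "- x"] by simp
  qed
  ultimately show "finsler_norm (\<lambda>x. \<phi> (- x))" using phi_pos by (auto simp: finsler_norm_def)
qed

lemma dual_reflect: "dual_norm (\<lambda>x. \<phi> (- x)) p = dual_norm \<phi> (- p)"
proof -
  have "{q. \<phi> (- q) \<le> 1} = uminus ` {q. \<phi> q \<le> 1}"
  proof (intro equalityI subsetI)
    fix q assume "q \<in> {q. \<phi> (- q) \<le> 1}"
    then show "q \<in> uminus ` {q. \<phi> q \<le> 1}" by (intro image_eqI[where x = "- q"]) auto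
  qed auto
  then show ?thesis unfolding dual_norm_def by (simp add: image_image)
qed

end

subsection \<open>Comparison with cones and slopes\<close>

lemma USC_if_continuous: "continuous_on U u \<Longrightarrow> u \<in> USC U"
  unfolding USC_def continuous_on_def using order_tendstoD(2) by blast

lemma USC_uminus_iff: "(\<lambda>x. - u x) \<in> USC U \<longleftrightarrow> u \<in> LSC U"
proof -
  have "(\<forall>c>- u x. \<forall>\<^sub>F y in at x within U. - u y < c) \<longleftrightarrow> (\<forall>c<u x. \<forall>\<^sub>F y in at x within U. c < u y)" for x
  proof (intro iffI allI impI)
    fix c assume "\<forall>c>- u x. \<forall>\<^sub>F y in at x within U. - u y < c" "c < u x"
    then have "\<forall>\<^sub>F y in at x within U. - u y < - c" by (metis neg_less_iff_less)
    then show "\<forall>\<^sub>F y in at x within U. c < u y" by simp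
  next
    fix c assume "\<forall>c<u x. \<forall>\<^sub>F y in at x within U. c < u y" "c > - u x"
    then have "\<forall>\<^sub>F y in at x within U. - c < u y" by (metis minus_less_iff)
    then show "\<forall>\<^sub>F y in at x within U. - u y < c" by eventually_elim simp
  qed
  then show ?thesis by (simp add: USC_def LSC_def)
qed

text \<open>The reflected norm absorbs the swapped argument \<open>z - x\<close> of the downward
  cones.\<close>

lemma CCB_iff_CCA: "u \<in> CCB \<phi> U \<longleftrightarrow> (\<lambda>x. - u x) \<in> CCA (\<lambda>x. \<phi> (- x)) U"
proof -
  have Inf: "(INF x\<in>A. u x + \<mu> * \<phi> (z - x)) = - (SUP x\<in>A. - u x - \<mu> * \<phi> (- (x - z)))" for A \<mu> z
    by (simp add: Inf_real_def image_image)
  show ?thesis unfolding CCB_def CCA_def by (simp add: Inf USC_uminus_iff)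
qed

lemma frontier_nonempty_compactly_contained:
  fixes V :: "('a::euclidean_space) set"
  assumes "V \<subset>\<subset> U" "V \<noteq> {}" shows "frontier V \<noteq> {}"
proof -
  have "bounded V"
    using assms closure_subset compact_imp_bounded bounded_subset unfolding compactly_contained_def by metis
  then show ?thesis using assms(2) not_bounded_UNIV by (auto simp: frontier_eq_empty)
qed

lemma compactly_containedD:
  assumes "V \<subset>\<subset> U"
  shows "compact (closure V)" "closure V \<subseteq> U" "compact (frontier V)" "frontier V \<subseteq> U"
  using assms by (auto simp: compactly_contained_def frontier_def compact_diff)

text \<open>For continuous \<open>u\<close> both suprema are attained, so their equality can be
  tested point by point. An empty \<open>V\<close> satisfies the right-hand side vacuously, which is
  why nonemptiness disappears.\<close>

lemma (in finsler) CCA_iff: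
  assumes "continuous_on U u"
  shows "u \<in> CCA \<phi> U \<longleftrightarrow> (\<forall>V z \<mu>. open V \<and> V \<subset>\<subset> U \<and> z \<notin> V \<and> \<mu> > 0 \<longrightarrow>
     (\<forall>x\<in>V. \<exists>y\<in>frontier V. u x - \<mu> * \<phi> (x - z) \<le> u y - \<mu> * \<phi> (y - z)))"
    (is "_ \<longleftrightarrow> ?R")
proof -
  have key: "(SUP x\<in>closure V. u x - \<mu> * \<phi> (x - z)) = (SUP x\<in>frontier V. u x - \<mu> * \<phi> (x - z))
     \<longleftrightarrow> (\<forall>x\<in>V. \<exists>y\<in>frontier V. u x - \<mu> * \<phi> (x - z) \<le> u y - \<mu> * \<phi> (y - z))" (is "?L \<longleftrightarrow> ?Q")
    if V: "open V" "V \<noteq> {}" "V \<subset>\<subset> U" for V z and \<mu> :: real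
  proof -
    let ?f = "\<lambda>x. u x - \<mu> * \<phi> (x - z)"
    note cc = compactly_containedD[OF V(3)]
    have cont: "continuous_on A ?f" if "A \<subseteq> U" for A
      using continuous_on_subset[OF assms that] by (intro continuous_intros)
    have ne: "frontier V \<noteq> {}" by (rule frontier_nonempty_compactly_contained[OF V(3,2)])
    obtain b where b: "b \<in> frontier V" "\<And>y. y \<in> frontier V \<Longrightarrow> ?f y \<le> ?f b"
      using continuous_attains_sup[OF cc(3) ne cont[OF cc(4)]] by metis
    have supb: "(SUP x\<in>frontier V. ?f x) = ?f b" using b by (intro cSup_eq_maximum) auto
    have bdd: "bdd_above (?f ` closure V)"
      by (rule bounded_imp_bdd_above[OF compact_imp_bounded[OF compact_continuous_image[OF cont[OF cc(2)] cc(1)]]])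
    have sub: "V \<subseteq> closure V" by (rule closure_subset)
    have fsub: "frontier V \<subseteq> closure V" by (auto simp: frontier_def)
    show ?thesis
    proof
      assume L: ?L
      have "?f x \<le> ?f b" if "x \<in> V" for x
      proof -
        have "?f x \<le> (SUP x\<in>closure V. ?f x)" by (rule cSUP_upper[OF _ bdd]) (use that sub in blast)
        then show ?thesis using L supb by simp
      qed
      then show ?Q using b(1) by blast
    next
      assume Q: ?Q
      have "?f x \<le> ?f b" if x: "x \<in> closure V" for x
      proof (cases "x \<in> V")
        case True
        then show ?thesis using Q b(2) order_trans by blast
      next
        case False
        then have "x \<in> frontier V" using x interior_open[OF V(1)] by (auto simp: frontier_def)
        then show ?thesis using b(2) by blast
      qed
      then have "(SUP x\<in>closure V. ?f x) = ?f b" using b(1) fsub by (intro cSup_eq_maximum) auto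
      then show ?L using supb by simp
    qed
  qed
  have "(open V \<and> V \<noteq> {} \<and> V \<subset>\<subset> U \<and> z \<notin> V \<and> \<mu> > 0 \<longrightarrow>
      (SUP x\<in>closure V. u x - \<mu> * \<phi> (x - z)) = (SUP x\<in>frontier V. u x - \<mu> * \<phi> (x - z))) \<longleftrightarrow>
      (open V \<and> V \<subset>\<subset> U \<and> z \<notin> V \<and> \<mu> > 0 \<longrightarrow>
      (\<forall>x\<in>V. \<exists>y\<in>frontier V. u x - \<mu> * \<phi> (x - z) \<le> u y - \<mu> * \<phi> (y - z)))" for V z \<mu>
  proof (cases "V = {}")
    case False
    then show ?thesis using key[of V \<mu> z] by (cases "open V"; cases "V \<subset>\<subset> U") simp_all
  qed simp
  then show ?thesis unfolding CCA_def using USC_if_continuous[OF assms] by simp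
qed

section \<open>Slopes under comparison with cones from above\<close>

context finsler begin

lemma CCA_D:
  assumes "continuous_on U u" "u \<in> CCA \<phi> U" "open V" "V \<subset>\<subset> U" "z \<notin> V" "\<mu> > 0" "x \<in> V"
  obtains y where "y \<in> frontier V" "u x - \<mu> * \<phi> (x - z) \<le> u y - \<mu> * \<phi> (y - z)"
  using CCA_iff[OF assms(1)] assms(2-7) by metis

lemma CCA_subset:
  assumes "continuous_on U u" "u \<in> CCA \<phi> U" "W \<subseteq> U" shows "u \<in> CCA \<phi> W"
proof -
  have "continuous_on W u" using assms continuous_on_subset by blast
  moreover have "V \<subset>\<subset> W \<Longrightarrow> V \<subset>\<subset> U" for V using assms(3) by (auto simp: compactly_contained_def)
  ultimately show ?thesis using CCA_iff assms(1,2) by simp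
qed

text \<open>The cone with vertex \<open>y\<close> is compared on the punctured ball: it dominates
  \<open>u\<close> at the vertex trivially and on the sphere by assumption, and the boundary
  consists of these two. Removing the vertex from the open set makes the cone admissible.\<close>

lemma CCA_slope_estimate:
  assumes cont: "continuous_on U u" and cc: "u \<in> CCA \<phi> U" and r: "0 < r" "pball y r \<subseteq> U"
    and S: "0 \<le> S" "\<And>w. w \<in> pball y r \<Longrightarrow> u w \<le> u y + S * r" and x: "x \<in> pball y r"
  shows "u x \<le> u y + S * \<phi> (x - y)"
proof (cases "x = y \<or> \<phi> (x - y) = r")
  case False
  define V where "V = {x. \<phi> (x - y) < r} - {y}"
  have V: "open V" unfolding V_def using open_pball_less by (intro open_Diff) auto
  have xV: "x \<in> V" using False x by (auto simp: V_def pball_def)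
  have cl: "closure V \<subseteq> pball y r"
  proof (rule closure_minimal)
    show "closed (pball y r)" using compact_pball compact_imp_closed by blast
  qed (auto simp: V_def pball_def)
  then have sub: "V \<subset>\<subset> U"
    using r(2) compact_pball[of y r] closed_closure
    by (metis compactly_contained_def compact_Int_closed inf.absorb_iff2 order_trans)
  have "u x \<le> u y + S * \<phi> (x - y) + e" if e: "0 < e" for e
  proof -
    have px: "0 < \<phi> (x - y)" using False phi_pos by simp
    \<comment> \<open>Comparison requires a positive slope, while \<open>S\<close> may be 0; the
      excess contributes exactly \<open>e\<close> at \<open>x\<close>.\<close>
    define \<mu> where "\<mu> = S + e / \<phi> (x - y)"
    have \<mu>: "\<mu> > 0" "S \<le> \<mu>" using px e S(1) by (auto simp: \<mu>_def add_nonneg_pos)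
    obtain z where z: "z \<in> frontier V" "u x - \<mu> * \<phi> (x - y) \<le> u z - \<mu> * \<phi> (z - y)"
      using CCA_D[OF cont cc V sub _ \<mu>(1) xV, of y] by (auto simp: V_def)
    have zc: "z \<in> pball y r" "z \<notin> V" using z(1) cl interior_open[OF V] by (auto simp: frontier_def)
    then consider "z = y" | "\<phi> (z - y) = r" by (force simp: V_def pball_def)
    then have "u z - \<mu> * \<phi> (z - y) \<le> u y"
    proof cases
      case 2
      have "S * r \<le> \<mu> * r" using \<mu> r by simp
      then show ?thesis using 2 S(2)[OF zc(1)] by simp
    qed simp
    then have "u x \<le> u y + \<mu> * \<phi> (x - y)" using z(2) by linarith
    also have "\<mu> * \<phi> (x - y) = S * \<phi> (x - y) + e" using px False by (simp add: \<mu>_def field_simps)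
    finally show ?thesis by simp
  qed
  then show ?thesis by (rule field_le_epsilon)
qed (use S(2)[OF x] in auto)

text \<open>Under comparison with cones from above, \<open>CCA_slope_estimate\<close> makes
  \<open>(max u - u x) / r\<close> over \<open>pball x r\<close> nondecreasing in \<open>r\<close>,
  so this is a lower bound for its limit as \<open>r\<close> tends to 0. Asking for all radii makes
  the condition closed in \<open>x\<close>.\<close>

definition slope_ge :: "(real ^ 'n \<Rightarrow> real) \<Rightarrow> (real ^ 'n) set \<Rightarrow> real \<Rightarrow> real ^ 'n \<Rightarrow> bool" where
  "slope_ge u V \<kappa> x \<longleftrightarrow> (\<forall>r>0. pball x r \<subseteq> V \<longrightarrow> (\<exists>w\<in>pball x r. \<kappa> * r \<le> u w - u x))"

lemma pball_argmax:
  fixes u :: "real ^ 'n \<Rightarrow> real"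
  assumes "continuous_on U u" "0 \<le> r" "pball x r \<subseteq> U"
  obtains w where "w \<in> pball x r" "\<And>y. y \<in> pball x r \<Longrightarrow> u y \<le> u w"
proof -
  have "pball x r \<noteq> {}" using center_in_pball[OF assms(2)] by blast
  then show ?thesis
    using continuous_attains_sup[OF compact_pball _ continuous_on_subset[OF assms(1) assms(3)]] that by metis
qed

lemma continuous_on_at_open:
  "continuous_on U u \<Longrightarrow> open U \<Longrightarrow> x \<in> U \<Longrightarrow> (u \<longlongrightarrow> u x) (at x)"
  by (metis continuous_on_def at_within_open)

text \<open>Upper slopes of a function that satisfies comparison with cones from above dominate its
  one-sided slopes, however they are attained.\<close>

lemma slope_ge_if_frequently:
  assumes U: "open U" and cont: "continuous_on U u" and cc: "u \<in> CCA \<phi> U"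
    and freq: "\<And>k. k < \<kappa> \<Longrightarrow> \<exists>\<^sub>F y in at x. k * \<phi> (x - y) \<le> u x - u y"
  shows "slope_ge u U \<kappa> x"
  unfolding slope_ge_def
proof (intro allI impI)
  fix r :: real assume r: "0 < r" "pball x r \<subseteq> U"
  obtain w where w: "w \<in> pball x r" "\<And>y. y \<in> pball x r \<Longrightarrow> u y \<le> u w"
    using pball_argmax[OF cont _ r(2)] r(1) by (metis less_imp_le)
  have xU: "x \<in> U" using center_in_pball[of r x] r by auto
  have wx: "u x \<le> u w" using w(2) center_in_pball[of r x] r by auto
  have "\<kappa> * r \<le> u w - u x"
  proof (rule ccontr)
    assume "\<not> \<kappa> * r \<le> u w - u x"
    then have "(u w - u x) / r < \<kappa>" using r by (simp add: field_simps)
    then obtain k where k: "(u w - u x) / r < k" "k < \<kappa>" using dense by blast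
    have "0 \<le> (u w - u x) / r" using wx r by simp
    then have k0: "0 < k" using k(1) by linarith
    \<comment> \<open>The slope seen from nearby centres \<open>y\<close> varies continuously with
      \<open>y\<close> and so stays below \<open>k\<close>; a rise of slope \<open>k\<close> from
      \<open>y\<close> to \<open>x\<close> will contradict this.\<close>
    have lim: "((\<lambda>y. (u w - u y) / (r - \<phi> (y - x))) \<longlongrightarrow> (u w - u x) / (r - \<phi> (x - x))) (at x)"
      using r by (intro tendsto_intros continuous_on_at_open[OF cont U xU]) auto
    have "((\<lambda>y. \<phi> (y - x)) \<longlongrightarrow> \<phi> (x - x)) (at x)" "((\<lambda>y. \<phi> (x - y)) \<longlongrightarrow> \<phi> (x - x)) (at x)"
      by (intro tendsto_intros)+
    from order_tendstoD(2)[OF this(1), of "r/2"] order_tendstoD(2)[OF this(2), of "r/2"]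
    have ev: "\<forall>\<^sub>F y in at x. \<phi> (y - x) < r / 2" "\<forall>\<^sub>F y in at x. \<phi> (x - y) < r / 2"
      using r by simp_all
    have "\<forall>\<^sub>F y in at x. (u w - u y) / (r - \<phi> (y - x)) < k" using order_tendstoD(2)[OF lim, of k] k by simp
    moreover have "\<forall>\<^sub>F y in at x. y \<noteq> x" by (simp add: eventually_at_filter)
    ultimately have "\<forall>\<^sub>F y in at x. y \<noteq> x \<and> (u w - u y) / (r - \<phi> (y - x)) < k \<and> \<phi> (y - x) < r / 2 \<and> \<phi> (x - y) < r / 2"
      using ev by eventually_elim simp
    from frequently_eventually_frequently[OF freq[OF k(2)] this]
    obtain y where y: "k * \<phi> (x - y) \<le> u x - u y" "y \<noteq> x" "(u w - u y) / (r - \<phi> (y - x)) < k"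
        "\<phi> (y - x) < r / 2" "\<phi> (x - y) < r / 2"
      using frequently_ex by fastforce
    \<comment> \<open>By the triangle inequality the ball of this radius around \<open>y\<close>
      lies inside \<open>pball x r\<close>, where \<open>u\<close> is at most \<open>u w\<close>; it
      still contains \<open>x\<close>.\<close>
    define r' where "r' = r - \<phi> (y - x)"
    have r': "0 < r'" "r / 2 < r'" using y r by (auto simp: r'_def)
    have sub: "pball y r' \<subseteq> pball x r"
      using phi_triangle3[of _ x y] by (force simp: pball_def r'_def intro: order_trans)
    define S where "S = max 0 ((u w - u y) / r')"
    have Sk: "S < k" using y(3) k0 by (simp add: S_def r'_def)
    have "u x \<le> u y + S * \<phi> (x - y)"
    proof (rule CCA_slope_estimate[OF cont cc r'(1)])
      show "pball y r' \<subseteq> U" using sub r by blast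
      show "0 \<le> S" by (simp add: S_def)
      show "x \<in> pball y r'" using y r' by (simp add: pball_def)
      fix v assume "v \<in> pball y r'"
      then have "u v \<le> u w" using w sub by blast
      moreover have "(u w - u y) / r' * r' \<le> S * r'" using r' by (intro mult_right_mono) (auto simp: S_def)
      ultimately show "u v \<le> u y + S * r'" using r' by simp
    qed
    moreover have "S * \<phi> (x - y) < k * \<phi> (x - y)" using Sk y(2) phi_pos[of "x - y"] by simp
    ultimately show False using y(1) by linarith
  qed
  then show "\<exists>w\<in>pball x r. \<kappa> * r \<le> u w - u x" using w by blast
qed

lemma frequently_at_along_ray:
  fixes x v :: "real ^ 'n"
  assumes "v \<noteq> 0" "\<forall>\<^sub>F t in at_right 0. P (x + t *\<^sub>R v)"
  shows "\<exists>\<^sub>F y in at x. P y"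
proof -
  have "((\<lambda>t. x + t *\<^sub>R v) \<longlongrightarrow> x + 0 *\<^sub>R v) (at_right 0)" by (intro tendsto_intros)
  moreover have "\<forall>\<^sub>F t in at_right 0. x + t *\<^sub>R v \<noteq> x"
    using assms(1) by (auto simp: eventually_at_filter)
  ultimately have lim: "filterlim (\<lambda>t. x + t *\<^sub>R v) (at x) (at_right 0)"
    by (simp add: filterlim_at)
  show ?thesis
  proof (rule ccontr)
    assume "\<not> ?thesis"
    then have "\<forall>\<^sub>F y in at x. \<not> P y" by (simp add: not_frequently)
    then have "\<forall>\<^sub>F t in at_right 0. \<not> P (x + t *\<^sub>R v)" by (rule eventually_compose_filterlim[OF _ lim])
    then have "\<forall>\<^sub>F t in at_right (0::real). False" using assms(2) by eventually_elim simp
    then show False by (simp add: eventually_False)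
  qed
qed

text \<open>Let \<open>w\<close> maximize \<open>u\<close> on the ball and let \<open>S\<close> be
  the slope of this rise. On the ball \<open>u\<close> lies below the cone of slope \<open>S\<close>
  at \<open>x\<close>, while \<open>u w\<close> is at least the value of the cone at
  \<open>w\<close>. Hence the difference quotients at \<open>w\<close> from points on the way back
  to \<open>x\<close> are at least \<open>S\<close>, and the slope does not drop.\<close>

lemma slope_ge_step:
  assumes U: "open U" and cont: "continuous_on U u" and cc: "u \<in> CCA \<phi> U"
    and x: "slope_ge u U \<kappa> x" and \<kappa>: "0 < \<kappa>" and r: "0 < r" "pball x r \<subseteq> U"
  obtains w where "w \<in> pball x r" "\<kappa> * r \<le> u w - u x" "slope_ge u U \<kappa> w"
proof -
  obtain w where w: "w \<in> pball x r" "\<And>y. y \<in> pball x r \<Longrightarrow> u y \<le> u w"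
    using pball_argmax[OF cont _ r(2)] r(1) by (metis less_imp_le)
  obtain w' where "w' \<in> pball x r" "\<kappa> * r \<le> u w' - u x" using x r by (auto simp: slope_ge_def)
  then have wr: "\<kappa> * r \<le> u w - u x" using w(2) by fastforce
  define S where "S = (u w - u x) / r"
  have S: "\<kappa> \<le> S" "S * r = u w - u x" using wr r by (auto simp: S_def field_simps)
  have S0: "0 \<le> S" using S \<kappa> by simp
  have "0 < u w - u x" using wr mult_pos_pos[OF \<kappa> r(1)] by linarith
  then have ne: "x - w \<noteq> 0" by auto
  have wle: "\<phi> (w - x) \<le> r" using w by (simp add: pball_def)
  have "slope_ge u U \<kappa> w"
  proof (rule slope_ge_if_frequently[OF U cont cc])
    fix k assume k: "k < \<kappa>"
    show "\<exists>\<^sub>F y in at w. k * \<phi> (w - y) \<le> u w - u y"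
    proof (rule frequently_at_along_ray[OF ne])
      have "k * \<phi> (w - (w + t *\<^sub>R (x - w))) \<le> u w - u (w + t *\<^sub>R (x - w))" if t: "0 < t" "t < 1" for t
      proof -
        let ?y = "w + t *\<^sub>R (x - w)"
        have y1: "?y - x = (1 - t) *\<^sub>R (w - x)" and y2: "w - ?y = t *\<^sub>R (w - x)" by (simp_all add: algebra_simps)
        have py: "\<phi> (?y - x) = (1 - t) * \<phi> (w - x)" unfolding y1 using t by (simp add: phi_scale)
        have pw: "\<phi> (w - ?y) = t * \<phi> (w - x)" unfolding y2 using t by (simp add: phi_scale)
        have "(1 - t) * \<phi> (w - x) \<le> 1 * r" using wle t by (intro mult_mono) auto
        then have "?y \<in> pball x r" using py by (simp add: pball_def)
        then have "u ?y \<le> u x + S * \<phi> (?y - x)"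
          using CCA_slope_estimate[OF cont cc r S0] w(2) S(2) by simp
        also have "\<dots> = u x + S * \<phi> (w - x) - S * \<phi> (w - ?y)" unfolding py pw by (simp add: algebra_simps)
        also have "\<dots> \<le> u x + S * r - S * \<phi> (w - ?y)" using wle S0 by (simp add: mult_left_mono)
        also have "\<dots> \<le> u w - k * \<phi> (w - ?y)" using S k mult_right_mono[of k S "\<phi> (w - ?y)"] by simp
        finally show ?thesis by simp
      qed
      then show "\<forall>\<^sub>F t in at_right 0. k * \<phi> (w - (w + t *\<^sub>R (x - w))) \<le> u w - u (w + t *\<^sub>R (x - w))"
        unfolding eventually_at_right_field by (metis zero_less_one)
    qed
  qed
  then show ?thesis using that w wr by blast
qed

text \<open>A ball around \<open>x\<close> contains balls around nearby points, with radius reduced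
  by their distance from \<open>x\<close>, and the rise seen in these survives the limit.
  Consequently a maximum over the closure of the points of large slope is attained at such a point
  or on the boundary of \<open>V\<close>.\<close>

lemma slope_ge_closed:
  assumes V: "open V" and cont: "continuous_on V u" and x: "x \<in> V" "x \<in> closure {x\<in>V. slope_ge u V \<kappa> x}"
  shows "slope_ge u V \<kappa> x"
  unfolding slope_ge_def
proof (intro allI impI)
  fix r :: real assume r: "0 < r" "pball x r \<subseteq> V"
  obtain w where w: "w \<in> pball x r" "\<And>y. y \<in> pball x r \<Longrightarrow> u y \<le> u w"
    using pball_argmax[OF cont _ r(2)] r(1) by (metis less_imp_le)
  obtain X where X: "\<And>n. X n \<in> V" "\<And>n. slope_ge u V \<kappa> (X n)" "X \<longlonglongrightarrow> x"
    using x(2) unfolding closure_sequential by auto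
  have "(\<lambda>n. \<phi> (X n - x)) \<longlonglongrightarrow> \<phi> (x - x)" by (intro tendsto_intros X)
  then have ev: "\<forall>\<^sub>F n in sequentially. \<phi> (X n - x) < r" using order_tendstoD(2) r by fastforce
  have "\<forall>\<^sub>F n in sequentially. \<kappa> * (r - \<phi> (X n - x)) + u (X n) \<le> u w"
    using ev
  proof eventually_elim
    case (elim n)
    have sub: "pball (X n) (r - \<phi> (X n - x)) \<subseteq> pball x r"
      using phi_triangle3[of _ x "X n"] by (force simp: pball_def intro: order_trans)
    then obtain v where "v \<in> pball (X n) (r - \<phi> (X n - x))" "\<kappa> * (r - \<phi> (X n - x)) \<le> u v - u (X n)"
      using X(2)[of n] elim r(2) unfolding slope_ge_def by (metis diff_gt_0_iff_gt order_trans)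
    then show ?case using w(2)[of v] sub by auto
  qed
  moreover have "(\<lambda>n. u (X n)) \<longlonglongrightarrow> u x"
    using continuous_on_tendsto_compose[OF cont X(3) x(1)] X(1) by simp
  then have "(\<lambda>n. \<kappa> * (r - \<phi> (X n - x)) + u (X n)) \<longlonglongrightarrow> \<kappa> * (r - \<phi> (x - x)) + u x"
    by (intro tendsto_intros X)
  ultimately have "\<kappa> * (r - \<phi> (x - x)) + u x \<le> u w"
    using tendsto_upperbound trivial_limit_sequentially by blast
  then show "\<exists>w\<in>pball x r. \<kappa> * r \<le> u w - u x" using w by (intro bexI[of _ w]) auto
qed

lemma CCA_locally_lipschitz:
  assumes U: "open U" and cont: "continuous_on U u" and cc: "u \<in> CCA \<phi> U"
  shows "locally_lipschitz_on U u"
  unfolding locally_lipschitz_on_def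
proof
  fix x assume x: "x \<in> U"
  obtain r where r: "0 < r" "\<And>s. s \<le> r \<Longrightarrow> pball x s \<subseteq> U" using pball_subset_open[OF U x] by blast
  then have "compact (u ` pball x r)"
    using compact_continuous_image[OF continuous_on_subset[OF cont] compact_pball] by blast
  then obtain B where B: "\<And>y. y \<in> pball x r \<Longrightarrow> \<bar>u y\<bar> \<le> B"
    using compact_imp_bounded[of "u ` pball x r"] unfolding bounded_iff by auto
  have B0: "0 \<le> B" using B[OF center_in_pball[of r x]] r by auto
  obtain m M where M: "0 < M" "\<And>y. \<phi> y \<le> M * norm y" using phi_bounds by metis
  \<comment> \<open>Points within \<rho> of \<open>x\<close> are at \<phi>-distance at most
    \<open>r / 4\<close> from \<open>x\<close> and \<open>r / 2\<close> from each other.\<close>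
  define \<rho> where "\<rho> = r / (4 * M)"
  have \<rho>: "0 < \<rho>" using M r by (simp add: \<rho>_def)
  have le: "u a - u b \<le> 4 * B * M / r * norm (a - b)" if a: "a \<in> ball x \<rho>" and b: "b \<in> ball x \<rho>" for a b
  proof -
    have "\<phi> (b - x) \<le> M * norm (b - x)" by (rule M)
    also have "\<dots> \<le> M * \<rho>" using b M by (simp add: dist_norm norm_minus_commute)
    also have "\<dots> = r / 4" using M by (simp add: \<rho>_def)
    finally have bx: "\<phi> (b - x) \<le> r / 4" .
    have "norm (a - b) \<le> 2 * \<rho>" using a b dist_triangle2[of a b x] by (simp add: dist_norm norm_minus_commute)
    then have "\<phi> (a - b) \<le> M * (2 * \<rho>)" using M(2)[of "a - b"] M(1) by (meson mult_left_mono less_imp_le order_trans)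
    also have "\<dots> = r / 2" using M by (simp add: \<rho>_def)
    finally have ab: "\<phi> (a - b) \<le> r / 2" .
    have sub: "pball b (r / 2) \<subseteq> pball x r"
    proof
      fix y assume "y \<in> pball b (r / 2)"
      then show "y \<in> pball x r" using phi_triangle3[of y x b] bx r by (simp add: pball_def)
    qed
    have bb: "b \<in> pball x r" using bx r by (simp add: pball_def)
    \<comment> \<open>A rise of at most \<open>2 * B\<close> over the radius
      \<open>r / 2\<close>.\<close>
    have "u a \<le> u b + 4 * B / r * \<phi> (a - b)"
    proof (rule CCA_slope_estimate[OF cont cc])
      show "0 < r / 2" "pball b (r / 2) \<subseteq> U" "0 \<le> 4 * B / r" "a \<in> pball b (r / 2)"
        using r sub B0 ab by (auto simp: pball_def)
      fix w assume "w \<in> pball b (r / 2)"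
      then have "\<bar>u w\<bar> \<le> B" "\<bar>u b\<bar> \<le> B" using B sub bb by auto
      then show "u w \<le> u b + 4 * B / r * (r / 2)" using r by simp
    qed
    also have "4 * B / r * \<phi> (a - b) \<le> 4 * B / r * (M * norm (a - b))" using B0 r by (intro mult_left_mono M) auto
    finally show ?thesis by simp
  qed
  have "(4 * B * M / r)-lipschitz_on (ball x \<rho> \<inter> U) u"
  proof (rule lipschitz_onI)
    fix a b assume "a \<in> ball x \<rho> \<inter> U" "b \<in> ball x \<rho> \<inter> U"
    then show "dist (u a) (u b) \<le> 4 * B * M / r * dist a b"
      using le[of a b] le[of b a] by (auto simp: dist_norm norm_minus_commute abs_le_iff)
  qed (use B0 M r in auto)
  then show "\<exists>r>0. \<exists>L. L-lipschitz_on (ball x r \<inter> U) u" using \<rho> by blast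
qed

end

subsection \<open>Superjets\<close>

lemma has_derivative_grad:
  assumes "f differentiable (at x)"
  shows "(f has_derivative (\<lambda>h. grad f x \<bullet> h)) (at x)"
proof -
  let ?D = "frechet_derivative f (at x)"
  have D: "(f has_derivative ?D) (at x)" using assms frechet_derivative_works by blast
  then interpret linear ?D by (rule has_derivative_linear)
  have "?D h = grad f x \<bullet> h" for h
  proof -
    have "?D h = ?D (\<Sum>i\<in>UNIV. h $ i *\<^sub>R axis i 1)"
      using basis_expansion[of h] by (simp add: scalar_mult_eq_scaleR)
    also have "\<dots> = (\<Sum>i\<in>UNIV. h $ i * ?D (axis i 1))" by (simp add: sum scale)
    finally show ?thesis by (simp add: inner_vec_def grad_def partial_deriv_def mult.commute)
  qed
  then have "?D = (\<lambda>h. grad f x \<bullet> h)" by blast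
  with D show ?thesis by simp
qed

lemma grad_eqI:
  assumes "(f has_derivative (\<lambda>h. p \<bullet> h)) (at x)" shows "grad f x = p"
  using frechet_derivative_at[OF assms, symmetric]
  by (simp add: grad_def partial_deriv_def vec_eq_iff inner_axis)

lemma partial_deriv_eqI:
  assumes "(f has_derivative f') (at x)" shows "partial_deriv i f x = f' (axis i 1)"
  using frechet_derivative_at[OF assms, symmetric] by (simp add: partial_deriv_def)

text \<open>The mean value theorem along the ray from \<open>x\<close> reduces the remainder to the
  differentiability of \<open>grad \<eta>\<close> at \<open>x\<close>.\<close>

lemma second_order_expansion:
  fixes \<eta> :: "real ^ 'n \<Rightarrow> real"
  assumes "smooth_near x \<eta>" "0 < e"
  shows "\<forall>\<^sub>F h in nhds 0. \<bar>\<eta> (x + h) - (\<eta> x + grad \<eta> x \<bullet> h + (hessian \<eta> x *v h) \<bullet> h / 2)\<bar> \<le> e * (norm h)\<^sup>2"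
proof -
  obtain S where S: "open S" "x \<in> S" "Ck_on (Suc (Suc 0)) S \<eta>"
    using assms(1) unfolding smooth_near_def smooth_on_def by blast
  then have d1: "(\<eta> has_derivative (\<lambda>h. grad \<eta> y \<bullet> h)) (at y)" if "y \<in> S" for y
    using that by (intro has_derivative_grad) simp
  have "grad \<eta> differentiable (at x)"
    unfolding differentiable_componentwise_within[of "grad \<eta>"]
    using S by (auto simp: Basis_vec_def inner_axis grad_def)
  then have "(grad \<eta> has_derivative (\<lambda>h. hessian \<eta> x *v h)) (at x)"
    unfolding hessian_def by (simp add: jacobian_works)
  then obtain d where d: "0 < d" "\<And>y. norm (y - x) < d \<Longrightarrow>
      norm (grad \<eta> y - grad \<eta> x - hessian \<eta> x *v (y - x)) \<le> e * norm (y - x)"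
    using assms(2) unfolding has_derivative_at_alt by blast
  obtain d' where d': "0 < d'" "ball x d' \<subseteq> S" using S open_contains_ball by blast
  show ?thesis unfolding eventually_nhds_metric
  proof (intro exI[of _ "min d d'"] conjI allI impI)
    show "0 < min d d'" using d d' by simp
    fix h :: "real ^ 'n" assume h: "dist h 0 < min d d'"
    let ?X = "hessian \<eta> x"
    define f where "f t = \<eta> (x + t *\<^sub>R h) - t * (grad \<eta> x \<bullet> h) - t\<^sup>2 * ((?X *v h) \<bullet> h) / 2" for t
    define f' where "f' t = grad \<eta> (x + t *\<^sub>R h) \<bullet> h - grad \<eta> x \<bullet> h - t * ((?X *v h) \<bullet> h)" for t
    have th: "norm (t *\<^sub>R h) < min d d'" if "0 \<le> t" "t \<le> 1" for t
      using that h mult_left_le_one_le[of "norm h" t] by simp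
    have df: "(f has_real_derivative f' t) (at t)" if t: "0 \<le> t" "t \<le> 1" for t
    proof -
      have "x + t *\<^sub>R h \<in> S" using th[OF t] d' by (auto simp: dist_norm)
      then have 1: "(\<eta> has_derivative (\<lambda>k. grad \<eta> (x + t *\<^sub>R h) \<bullet> k)) (at (x + t *\<^sub>R h))" by (rule d1)
      have 2: "((\<lambda>t. x + t *\<^sub>R h) has_derivative (\<lambda>s. s *\<^sub>R h)) (at t)"
        by (auto intro!: derivative_eq_intros)
      have "((\<lambda>t. \<eta> (x + t *\<^sub>R h)) has_real_derivative grad \<eta> (x + t *\<^sub>R h) \<bullet> h) (at t)"
        using has_derivative_compose[OF 2 1] by (simp add: has_field_derivative_def mult_commute_abs)
      then show ?thesis unfolding f_def f'_def
        by (auto intro!: derivative_eq_intros simp: field_simps)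
    qed
    obtain t where t: "0 < t" "t < 1" "f 1 - f 0 = (1 - 0) * f' t"
      using MVT2[of 0 1 f f'] df by auto
    have "f' t = (grad \<eta> (x + t *\<^sub>R h) - grad \<eta> x - ?X *v (x + t *\<^sub>R h - x)) \<bullet> h"
      by (simp add: f'_def inner_diff_left matrix_vector_mult_scaleR)
    then have "\<bar>f' t\<bar> \<le> norm (grad \<eta> (x + t *\<^sub>R h) - grad \<eta> x - ?X *v (x + t *\<^sub>R h - x)) * norm h"
      using Cauchy_Schwarz_ineq2 by metis
    also have "\<dots> \<le> (e * norm (x + t *\<^sub>R h - x)) * norm h"
      by (intro mult_right_mono d(2)) (use th[of t] t in auto)
    also have "\<dots> = t * (e * (norm h)\<^sup>2)" using t by (simp add: power2_eq_square)
    also have "\<dots> \<le> e * (norm h)\<^sup>2" using t assms(2) by (intro mult_left_le_one_le) auto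
    finally show "\<bar>\<eta> (x + h) - (\<eta> x + grad \<eta> x \<bullet> h + (?X *v h) \<bullet> h / 2)\<bar> \<le> e * (norm h)\<^sup>2"
      using t(3) by (simp add: f_def algebra_simps)
  qed
qed

lemma Ck_on_const: "Ck_on k S (\<lambda>x. c)"
proof (induction k arbitrary: c)
  case (Suc k)
  have "partial_deriv i (\<lambda>x. c) = (\<lambda>x. 0)" for i :: 'a
    by (intro ext partial_deriv_eqI[THEN trans]) (auto intro: derivative_eq_intros)
  then show ?case using Suc by simp
qed simp

lemma Ck_on_affine: "Ck_on k S (\<lambda>x. c + p \<bullet> x)"
proof (cases k)
  case (Suc k)
  have d: "((\<lambda>x. c + p \<bullet> x) has_derivative (\<lambda>h. p \<bullet> h)) (at x)" for x
    by (auto intro!: derivative_eq_intros)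
  then have "partial_deriv i (\<lambda>x. c + p \<bullet> x) = (\<lambda>x. p \<bullet> axis i 1)" for i
    using partial_deriv_eqI by blast
  then show ?thesis using Suc d Ck_on_const by (auto simp: differentiable_def)
qed (auto intro!: continuous_intros)

lemma matrix_vector_mult_minus_left: "(- X) *v h = - (X *v (h :: real ^ 'n))"
  using matrix_vector_mult_diff_rdistrib[of 0 X h] by simp

lemma matrix_vector_mult_minus_right: "X *v (- h) = - (X *v (h :: real ^ 'n))"
  using matrix_vector_mult_diff_distrib[of X 0 h] by simp

lemma inner_matrix_vector_sym:
  fixes X :: "real ^ 'n ^ 'n"
  shows "(((1/2) *\<^sub>R (X + transpose X)) *v q) \<bullet> h = ((X *v q) \<bullet> h + (X *v h) \<bullet> q) / 2"
proof -
  have "(transpose X *v q) \<bullet> h = (X *v h) \<bullet> q"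
    by (metis dot_lmul_matrix inner_commute transpose_matrix_vector)
  then show ?thesis
    by (simp add: matrix_vector_mult_add_rdistrib inner_add_left scaleR_matrix_vector_assoc[symmetric])
qed

text \<open>\<open>X\<close> may be any matrix, because a superjet depends on it only through its
  quadratic form; the Hessian of the polynomial is the symmetric part, which has the same quadratic
  form.\<close>

lemma quadratic_test_function:
  fixes X :: "real ^ 'n ^ 'n" and p x0 :: "real ^ 'n" and c :: real
  defines "\<eta> \<equiv> \<lambda>x. c + p \<bullet> (x - x0) + (X *v (x - x0)) \<bullet> (x - x0) / 2"
  shows "smooth_near x0 \<eta>" "grad \<eta> x0 = p" "hessian \<eta> x0 = (1/2) *\<^sub>R (X + transpose X)"
proof -
  define S where "S = (1/2) *\<^sub>R (X + transpose X)"
  have d: "(\<eta> has_derivative (\<lambda>h. (p + S *v (x - x0)) \<bullet> h)) (at x)" for x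
  proof -
    have "((\<lambda>x. X *v (x - x0)) has_derivative (\<lambda>h. X *v h)) (at x)"
      by (rule bounded_linear.has_derivative[OF matrix_vector_mul_bounded_linear])
        (auto intro!: derivative_eq_intros)
    then have "(\<eta> has_derivative (\<lambda>h. p \<bullet> h + ((X *v (x - x0)) \<bullet> h + (X *v h) \<bullet> (x - x0)) / 2)) (at x)"
      unfolding \<eta>_def by (auto intro!: derivative_eq_intros)
    then show ?thesis by (simp add: inner_add_left S_def inner_matrix_vector_sym)
  qed
  then have g: "grad \<eta> x = p + S *v (x - x0)" for x using grad_eqI by blast
  then show "grad \<eta> x0 = p" by simp
  have g': "(grad \<eta> has_derivative (\<lambda>h. S *v h)) (at x0)"
  proof -
    have "((\<lambda>x. S *v (x - x0)) has_derivative (\<lambda>h. S *v h)) (at x0)"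
      by (rule bounded_linear.has_derivative[OF matrix_vector_mul_bounded_linear])
        (auto intro!: derivative_eq_intros)
    then show ?thesis unfolding g[abs_def] using has_derivative_add[OF has_derivative_const] by fastforce
  qed
  show "hessian \<eta> x0 = (1/2) *\<^sub>R (X + transpose X)"
    unfolding hessian_def jacobian_def unfolding frechet_derivative_at[OF g', symmetric] by (simp add: S_def)
  \<comment> \<open>The partial derivatives are affine, so smoothness reduces to
    \<open>Ck_on_affine\<close>.\<close>
  have pd: "partial_deriv i \<eta> = (\<lambda>x. (p - S *v x0) $ i + row i S \<bullet> x)" for i
  proof
    fix x
    have "partial_deriv i \<eta> x = grad \<eta> x $ i" by (simp add: grad_def)
    also have "\<dots> = (p - S *v x0) $ i + row i S \<bullet> x"
      by (simp add: g matrix_vector_mult_diff_distrib matrix_vector_mul_component row_def vec_nth_inverse)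
    finally show "partial_deriv i \<eta> x = (p - S *v x0) $ i + row i S \<bullet> x" .
  qed
  have "Ck_on k UNIV \<eta>" for k
  proof (cases k)
    case 0
    have "continuous_on UNIV \<eta>" using d has_derivative_continuous continuous_at_imp_continuous_on by blast
    then show ?thesis using 0 by simp
  next
    case (Suc k)
    then show ?thesis using d by (auto simp: pd differentiable_def intro: Ck_on_affine)
  qed
  then show "smooth_near x0 \<eta>" unfolding smooth_near_def smooth_on_def by (intro exI[of _ UNIV]) auto
qed

text \<open>Second-order superjets at \<open>x\<close>, as in the Crandall--Ishii--Lions form of viscosity theory.\<close>

definition superjet :: "(real ^ 'n \<Rightarrow> real) \<Rightarrow> real ^ 'n \<Rightarrow> real ^ 'n \<Rightarrow> real ^ 'n ^ 'n \<Rightarrow> bool" where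
  "superjet u x p X \<longleftrightarrow>
     (\<forall>e>0. \<forall>\<^sub>F h in nhds 0. u (x + h) \<le> u x + p \<bullet> h + (X *v h) \<bullet> h / 2 + e * (norm h)\<^sup>2)"

lemma eventually_nhds_shift:
  fixes x :: "'a::real_normed_vector"
  shows "(\<forall>\<^sub>F h in nhds 0. P (x + h)) \<longleftrightarrow> (\<forall>\<^sub>F y in nhds x. P y)"
proof -
  have "(\<forall>h. dist h 0 < d \<longrightarrow> P (x + h)) \<longleftrightarrow> (\<forall>y. dist y x < d \<longrightarrow> P y)" for d
  proof (intro iffI allI impI)
    fix y assume "\<forall>h. dist h 0 < d \<longrightarrow> P (x + h)" "dist y x < d"
    then show "P y" by (metis add_diff_cancel_left' diff_add_cancel dist_norm add.commute diff_zero)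
  qed (simp add: dist_norm)
  then show ?thesis unfolding eventually_nhds_metric by simp
qed

lemma superjet_smooth:
  assumes "smooth_near x \<eta>" "\<forall>\<^sub>F y in nhds x. u y - \<eta> y \<le> u x - \<eta> x"
  shows "superjet u x (grad \<eta> x) (hessian \<eta> x)"
  unfolding superjet_def
proof (intro allI impI)
  fix e :: real assume "0 < e"
  from second_order_expansion[OF assms(1) this] eventually_nhds_shift[THEN iffD2, OF assms(2)]
  show "\<forall>\<^sub>F h in nhds 0. u (x + h) \<le> u x + grad \<eta> x \<bullet> h + (hessian \<eta> x *v h) \<bullet> h / 2 + e * (norm h)\<^sup>2"
    by eventually_elim (simp add: abs_le_iff)
qed

lemma subjet_smooth:
  assumes "smooth_near x \<eta>" "\<forall>\<^sub>F y in nhds x. u x - \<eta> x \<le> u y - \<eta> y"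
  shows "superjet (\<lambda>x. - u x) x (- grad \<eta> x) (- hessian \<eta> x)"
  unfolding superjet_def
proof (intro allI impI)
  fix e :: real assume "0 < e"
  from second_order_expansion[OF assms(1) this] eventually_nhds_shift[THEN iffD2, OF assms(2)]
  show "\<forall>\<^sub>F h in nhds 0. - u (x + h) \<le> - u x + (- grad \<eta> x) \<bullet> h + ((- hessian \<eta> x) *v h) \<bullet> h / 2 + e * (norm h)\<^sup>2"
    by eventually_elim (simp add: abs_le_iff matrix_vector_mult_minus_left)
qed

text \<open>\<open>partial_deriv\<close> has no prescribed value where the function is not
  differentiable, so negation passes through it only on \<open>S\<close>; the local fact
  \<open>cong\<close> carries \<open>Ck_on\<close> across functions that agree on \<open>S\<close>
  alone.\<close>

lemma smooth_near_uminus: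
  fixes x :: "real ^ 'n"
  assumes "smooth_near x \<eta>"
  shows "smooth_near x (\<lambda>y. - \<eta> y)" "grad (\<lambda>y. - \<eta> y) x = - grad \<eta> x"
    "hessian (\<lambda>y. - \<eta> y) x = - hessian \<eta> x"
proof -
  obtain S where S: "open S" "x \<in> S" "\<And>k. Ck_on k S \<eta>"
    using assms unfolding smooth_near_def smooth_on_def by blast
  have pd: "partial_deriv i (\<lambda>y. - f y) y = - partial_deriv i f y" if "f differentiable (at y)" for f :: "real ^ 'n \<Rightarrow> real" and i y
  proof -
    obtain f' where f': "(f has_derivative f') (at y)" using \<open>f differentiable (at y)\<close> unfolding differentiable_def by blast
    show ?thesis using partial_deriv_eqI[OF has_derivative_minus[OF f']] partial_deriv_eqI[OF f'] by simp
  qed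
  have cong: "Ck_on k S f \<Longrightarrow> \<forall>y\<in>S. f y = g y \<Longrightarrow> Ck_on k S g" for k and f g :: "real ^ 'n \<Rightarrow> real"
  proof (induction k arbitrary: f g)
    case (Suc k)
    have D: "(g has_derivative f') (at y)" if "(f has_derivative f') (at y)" "y \<in> S" for f' y
      using has_derivative_transform_within_open[OF that(1) S(1) that(2)] Suc.prems(2) by blast
    have d: "g differentiable (at y)" if "y \<in> S" for y
    proof -
      have "f differentiable (at y)" using Suc.prems(1) that by simp
      then obtain f' where "(f has_derivative f') (at y)" unfolding differentiable_def by blast
      then show ?thesis using D that differentiable_def by blast
    qed
    have p: "\<forall>y\<in>S. partial_deriv i f y = partial_deriv i g y" for i
    proof
      fix y assume y: "y \<in> S"
      have "f differentiable (at y)" using Suc.prems(1) y by simp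
      then obtain f' where f': "(f has_derivative f') (at y)" unfolding differentiable_def by blast
      show "partial_deriv i f y = partial_deriv i g y"
        using partial_deriv_eqI[OF f'] partial_deriv_eqI[OF D[OF f' y]] by simp
    qed
    show ?case using d Suc.IH[OF _ p] Suc.prems(1) by simp
  qed (use continuous_on_cong in fastforce)
  have neg: "Ck_on k S f \<Longrightarrow> Ck_on k S (\<lambda>y. - f y)" for k and f :: "real ^ 'n \<Rightarrow> real"
  proof (induction k arbitrary: f)
    case (Suc k)
    then have d: "f differentiable (at y)" if "y \<in> S" for y using that by simp
    have n: "Ck_on k S (\<lambda>y. - partial_deriv i f y)" for i using Suc by simp
    have "Ck_on k S (partial_deriv i (\<lambda>y. - f y))" for i by (rule cong[OF n[of i]]) (simp add: pd d)
    then show ?case using d by (simp add: differentiable_minus)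
  qed (simp add: continuous_on_minus)
  show "smooth_near x (\<lambda>y. - \<eta> y)" using S neg unfolding smooth_near_def smooth_on_def by blast
  have S2: "Ck_on (Suc (Suc 0)) S \<eta>" by (rule S(3))
  then have g: "grad (\<lambda>y. - \<eta> y) y = - grad \<eta> y" if "y \<in> S" for y
    using pd that by (simp add: grad_def vec_eq_iff)
  then show "grad (\<lambda>y. - \<eta> y) x = - grad \<eta> x" using S by blast
  have "grad \<eta> differentiable (at x)"
    unfolding differentiable_componentwise_within[of "grad \<eta>"]
    using S2 S(2) by (auto simp: Basis_vec_def inner_axis grad_def)
  then have 1: "(grad \<eta> has_derivative (\<lambda>h. hessian \<eta> x *v h)) (at x)"
    unfolding hessian_def by (simp add: jacobian_works)
  have 2: "(grad (\<lambda>y. - \<eta> y) has_derivative (\<lambda>h. - (hessian \<eta> x *v h))) (at x)"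
    by (rule has_derivative_transform_within_open[OF has_derivative_minus[OF 1] S(1,2)]) (simp add: g)
  then have "(*v) (- hessian \<eta> x) = frechet_derivative (grad (\<lambda>y. - \<eta> y)) (at x)"
    using frechet_derivative_at[OF 2] by (simp add: matrix_vector_mult_minus_left[abs_def])
  then show "hessian (\<lambda>y. - \<eta> y) x = - hessian \<eta> x"
    unfolding hessian_def[of "\<lambda>y. - \<eta> y"] jacobian_def by (metis matrix_of_matrix_vector_mul)
qed

section \<open>Viscosity inequalities in terms of superjets\<close>

context finsler begin

lemma subdiff_norm_bound:
  obtains M where "0 < M" "\<And>p q. q \<in> subdifferential (dual_norm \<phi>) p \<Longrightarrow> norm q \<le> M"
proof -
  obtain M where M: "0 < M" "\<And>x r. pball x r \<subseteq> cball x (M * r)" using pball_cball by metis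
  show ?thesis
  proof (rule that[OF M(1)])
    fix p q assume "q \<in> subdifferential (dual_norm \<phi>) p"
    then have "q \<in> pball 0 1" by (simp add: subdiff_dual pball_def)
    then show "norm q \<le> M" using M(2)[of 0 1] by auto
  qed
qed

text \<open>A smooth function touching from above yields a superjet. Conversely, adding a small
  multiple of the identity to \<open>X\<close> turns a superjet into a quadratic polynomial that
  touches, and as the subdifferential is bounded this raises \<open>G_upper\<close> arbitrarily
  little.\<close>

lemma Sub_iff_superjet:
  assumes "continuous_on U u"
  shows "u \<in> Sub \<phi> U \<longleftrightarrow> (\<forall>x\<in>U. \<forall>p X. superjet u x p X \<longrightarrow> 0 \<le> G_upper \<phi> p X)"
proof
  assume R: "\<forall>x\<in>U. \<forall>p X. superjet u x p X \<longrightarrow> 0 \<le> G_upper \<phi> p X"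
  then show "u \<in> Sub \<phi> U"
    unfolding Sub_def using USC_if_continuous[OF assms] superjet_smooth by fastforce
next
  assume L: "u \<in> Sub \<phi> U"
  show "\<forall>x\<in>U. \<forall>p X. superjet u x p X \<longrightarrow> 0 \<le> G_upper \<phi> p X"
  proof (intro ballI allI impI)
    fix x p X assume x: "x \<in> U" and jet: "superjet u x p X"
    obtain M where M: "0 < M" "\<And>p q. q \<in> subdifferential (dual_norm \<phi>) p \<Longrightarrow> norm q \<le> M"
      using subdiff_norm_bound by metis
    have "0 \<le> G_upper \<phi> p X + e" if e: "0 < e" for e
    proof -
      \<comment> \<open>Vectors \<open>v\<close> of the subdifferential have norm at most
        \<open>M\<close>, so the added \<open>d * (norm v)^2\<close> is at most
        \<open>e\<close>.\<close>
      define d where "d = e / M\<^sup>2"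
      have d: "0 < d" using e M by (simp add: d_def)
      define Y where "Y = X + d *\<^sub>R mat 1"
      have "Y *v h = X *v h + d *\<^sub>R h" for h
        unfolding Y_def matrix_vector_mult_add_rdistrib scaleR_matrix_vector_assoc[symmetric] matrix_vector_mul_lid ..
      then have Y: "(Y *v h) \<bullet> h = (X *v h) \<bullet> h + d * (norm h)\<^sup>2" for h
        by (simp add: inner_add_left power2_norm_eq_inner)
      define \<eta> where "\<eta> = (\<lambda>y. u x + p \<bullet> (y - x) + (Y *v (y - x)) \<bullet> (y - x) / 2)"
      note q = quadratic_test_function[where ?x0.0 = x and c = "u x" and p = p and X = Y, folded \<eta>_def]
      have "0 < d / 2" using d by simp
      with jet have "\<forall>\<^sub>F h in nhds 0. u (x + h) \<le> u x + p \<bullet> h + (X *v h) \<bullet> h / 2 + (d / 2) * (norm h)\<^sup>2"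
        unfolding superjet_def by blast
      then have "\<forall>\<^sub>F h in nhds 0. u (x + h) - \<eta> (x + h) \<le> u x - \<eta> x"
        by eventually_elim (simp add: \<eta>_def Y field_simps)
      then have "\<forall>\<^sub>F y in nhds x. u y - \<eta> y \<le> u x - \<eta> x" using eventually_nhds_shift by blast
      with L x q(1) have "0 \<le> G_upper \<phi> (grad \<eta> x) (hessian \<eta> x)" unfolding Sub_def by fastforce
      then have G: "0 \<le> G_upper \<phi> p ((1/2) *\<^sub>R (Y + transpose Y))" using q by simp
      obtain v where v: "v \<in> subdifferential (dual_norm \<phi>) p" and vG:
        "G_upper \<phi> p ((1/2) *\<^sub>R (Y + transpose Y)) = (((1/2) *\<^sub>R (Y + transpose Y)) *v v) \<bullet> v"
        by (rule G_upper_attained)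
      have "0 \<le> (X *v v) \<bullet> v + d * (norm v)\<^sup>2" using G vG by (simp add: inner_matrix_vector_sym Y)
      also have "d * (norm v)\<^sup>2 \<le> d * M\<^sup>2" using M(2)[OF v] d by (intro mult_left_mono power_mono) auto
      also have "d * M\<^sup>2 = e" using M by (simp add: d_def)
      also have "(X *v v) \<bullet> v \<le> G_upper \<phi> p X" by (rule G_upper_ge[OF v])
      finally show ?thesis by simp
    qed
    then show "0 \<le> G_upper \<phi> p X" by (rule field_le_epsilon)
  qed
qed

lemma G_lower_reflect: "G_lower \<phi> p X = - G_upper (\<lambda>x. \<phi> (- x)) (- p) (- X)"
proof -
  interpret r: finsler "\<lambda>x. \<phi> (- x)" by (rule finsler_reflect)
  have iff: "q \<in> subdifferential (dual_norm (\<lambda>x. \<phi> (- x))) (- p) \<longleftrightarrow> - q \<in> subdifferential (dual_norm \<phi>) p" for q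
    by (simp add: subdiff_dual r.subdiff_dual dual_reflect)
  have eq: "subdifferential (dual_norm (\<lambda>x. \<phi> (- x))) (- p) = uminus ` subdifferential (dual_norm \<phi>) p"
  proof (intro equalityI subsetI)
    fix q assume "q \<in> subdifferential (dual_norm (\<lambda>x. \<phi> (- x))) (- p)"
    then show "q \<in> uminus ` subdifferential (dual_norm \<phi>) p" by (intro image_eqI[where x = "- q"]) (simp_all add: iff)
  next
    fix q assume "q \<in> uminus ` subdifferential (dual_norm \<phi>) p"
    then show "q \<in> subdifferential (dual_norm (\<lambda>x. \<phi> (- x))) (- p)" by (elim imageE) (simp add: iff)
  qed
  show ?thesis unfolding G_lower_def G_upper_def eq
    by (simp add: Inf_real_def image_image matrix_vector_mult_minus_left matrix_vector_mult_minus_right)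
qed

lemma Super_iff_superjet:
  assumes "continuous_on U u"
  shows "u \<in> Super \<phi> U \<longleftrightarrow> (\<lambda>x. - u x) \<in> Sub (\<lambda>x. \<phi> (- x)) U"
proof -
  interpret r: finsler "\<lambda>x. \<phi> (- x)" by (rule finsler_reflect)
  have cont: "continuous_on U (\<lambda>x. - u x)" using assms by (rule continuous_on_minus)
  have usc: "u \<in> LSC U" using USC_if_continuous[OF cont] USC_uminus_iff by blast
  show ?thesis
  proof
    assume *: "(\<lambda>x. - u x) \<in> Sub (\<lambda>x. \<phi> (- x)) U"
    show "u \<in> Super \<phi> U" unfolding Super_def mem_Collect_eq
    proof (intro conjI usc ballI allI impI)
      fix x \<eta> assume x: "x \<in> U" and "smooth_near x \<eta> \<and> (\<forall>\<^sub>F y in nhds x. u x - \<eta> x \<le> u y - \<eta> y)"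
      then have "superjet (\<lambda>x. - u x) x (- grad \<eta> x) (- hessian \<eta> x)" using subjet_smooth by blast
      then have "0 \<le> G_upper (\<lambda>x. \<phi> (- x)) (- grad \<eta> x) (- hessian \<eta> x)"
        using * x r.Sub_iff_superjet[OF cont] by blast
      then show "- G_lower \<phi> (grad \<eta> x) (hessian \<eta> x) \<ge> 0" by (simp add: G_lower_reflect)
    qed
  next
    assume *: "u \<in> Super \<phi> U"
    show "(\<lambda>x. - u x) \<in> Sub (\<lambda>x. \<phi> (- x)) U" unfolding Sub_def mem_Collect_eq
    proof (intro conjI USC_if_continuous cont ballI allI impI)
      fix x \<eta> assume x: "x \<in> U" and e: "smooth_near x \<eta> \<and> (\<forall>\<^sub>F y in nhds x. - u y - \<eta> y \<le> - u x - \<eta> x)"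
      have s: "smooth_near x (\<lambda>y. - \<eta> y)" "grad (\<lambda>y. - \<eta> y) x = - grad \<eta> x"
          "hessian (\<lambda>y. - \<eta> y) x = - hessian \<eta> x"
        using smooth_near_uminus e by auto
      have "\<forall>\<^sub>F y in nhds x. u x - (- \<eta> x) \<le> u y - (- \<eta> y)"
        using conjunct2[OF e] by eventually_elim simp
      then have "- G_lower \<phi> (grad (\<lambda>y. - \<eta> y) x) (hessian (\<lambda>y. - \<eta> y) x) \<ge> 0"
        using * x s(1) unfolding Super_def by blast
      then show "- G_upper (\<lambda>x. \<phi> (- x)) (grad \<eta> x) (hessian \<eta> x) \<le> 0"
        by (simp add: s G_lower_reflect)
    qed
  qed
qed

text \<open>Backwards along a maximizing direction \<open>q\<close> the superjet bounds
  \<open>u\<close> from above, so the slope at \<open>x\<close> is at least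
  \<open>dual_norm \<phi> p\<close>. Comparison then produces, for every small \<open>r\<close>, a
  point \<open>x + r *\<^sub>R v\<close> with \<open>\<phi> v \<le> 1\<close> at which
  \<open>u\<close> has risen by the full first-order amount. The first-order term can supply no more
  than this, so \<open>p \<bullet> v\<close> is almost maximal and the second-order term almost
  nonnegative; a limit of such \<open>v\<close> lies in the subdifferential.\<close>

lemma CCA_superjet:
  assumes U: "open U" and cont: "continuous_on U u" and cc: "u \<in> CCA \<phi> U" and x: "x \<in> U"
    and jet: "superjet u x p X"
  shows "0 \<le> G_upper \<phi> p X"
proof (cases "p = 0")
  case True
  have "0 \<in> subdifferential (dual_norm \<phi>) p" by (simp add: True subdiff_dual)
  from G_upper_ge[OF this, of X] show ?thesis by simp
next
  case False
  obtain q where q: "\<phi> q \<le> 1" "p \<bullet> q = dual_norm \<phi> p" by (rule dual_attained)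
  have q1: "\<phi> q = 1" by (rule dual_unit_attained[OF False q])
  then have q0: "- q \<noteq> 0" by auto
  define \<kappa> where "\<kappa> = dual_norm \<phi> p"
  obtain M where M: "0 < M" "\<And>x r. pball x r \<subseteq> cball x (M * r)" using pball_cball by metis
  have nM: "norm v \<le> M" if "\<phi> v \<le> 1" for v
  proof -
    have "v \<in> pball 0 1" using that by (simp add: pball_def)
    then show ?thesis using M(2)[of 0 1] by auto
  qed
  have slope: "slope_ge u U \<kappa> x"
  proof (rule slope_ge_if_frequently[OF U cont cc])
    fix k assume k: "k < \<kappa>"
    define A where "A = (X *v q) \<bullet> q / 2 + (norm q)\<^sup>2"
    show "\<exists>\<^sub>F y in at x. k * \<phi> (x - y) \<le> u x - u y"
    proof (rule frequently_at_along_ray[OF q0])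
      have "((\<lambda>t. t *\<^sub>R - q) \<longlongrightarrow> 0 *\<^sub>R - q) (at_right 0)" by (intro tendsto_intros)
      then have t0: "filterlim (\<lambda>t. t *\<^sub>R - q) (nhds 0) (at_right 0)" by simp
      have "\<forall>\<^sub>F h in nhds 0. u (x + h) \<le> u x + p \<bullet> h + (X *v h) \<bullet> h / 2 + 1 * (norm h)\<^sup>2"
        using jet[unfolded superjet_def, rule_format, OF zero_less_one] .
      from eventually_compose_filterlim[OF this t0]
      have 1: "\<forall>\<^sub>F t in at_right 0. u (x + t *\<^sub>R - q) \<le> u x - t * \<kappa> + t\<^sup>2 * A"
        by eventually_elim
          (simp add: q \<kappa>_def A_def matrix_vector_mult_minus_right matrix_vector_mult_scaleR power2_eq_square algebra_simps)
      have "((\<lambda>t. t * A) \<longlongrightarrow> 0 * A) (at_right 0)" by (intro tendsto_intros)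
      then have 2: "\<forall>\<^sub>F t in at_right 0. t * A < \<kappa> - k" using order_tendstoD(2)[of _ 0] k by fastforce
      have 3: "\<forall>\<^sub>F t in at_right 0. (0::real) < t" by (simp add: eventually_at_filter)
      from 1 2 3 show "\<forall>\<^sub>F t in at_right 0. k * \<phi> (x - (x + t *\<^sub>R - q)) \<le> u x - u (x + t *\<^sub>R - q)"
      proof eventually_elim
        case (elim t)
        have "t * (t * A) \<le> t * (\<kappa> - k)" using elim by (intro mult_left_mono) auto
        then have "t * k \<le> u x - u (x + t *\<^sub>R - q)" using elim(1) by (simp add: power2_eq_square algebra_simps)
        moreover have "\<phi> (x - (x + t *\<^sub>R - q)) = t" using elim q1 by (simp add: phi_scale)
        ultimately show ?case by (simp add: mult.commute)
      qed
    qed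
  qed
  have "\<exists>v. \<phi> v \<le> 1 \<and> \<kappa> \<le> p \<bullet> v + d \<and> - d \<le> (X *v v) \<bullet> v" if d: "0 < d" for d :: real
  proof -
    obtain B where B: "0 < B" "\<And>v. norm (X *v v) \<le> B * norm v"
      using linear_bounded_pos[OF matrix_vector_mul_linear] by metis
    \<comment> \<open>With \<open>norm v \<le> M\<close> the error term is at most
      \<open>d / 2\<close>, which becomes the slack \<open>d\<close> once the factor 1/2 of the
      quadratic form is removed.\<close>
    define e where "e = d / (2 * M\<^sup>2)"
    have e: "0 < e" using d M by (simp add: e_def)
    from jet[unfolded superjet_def, rule_format, OF this]
    obtain \<delta> where \<delta>: "0 < \<delta>" "\<And>h. norm h < \<delta> \<Longrightarrow> u (x + h) \<le> u x + p \<bullet> h + (X *v h) \<bullet> h / 2 + e * (norm h)\<^sup>2"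
      unfolding eventually_nhds_metric by auto
    obtain r0 where r0: "0 < r0" "\<And>r. r \<le> r0 \<Longrightarrow> pball x r \<subseteq> U" using pball_subset_open[OF U x] by blast
    \<comment> \<open>Small enough, in turn, for the ball to lie in \<open>U\<close>, for the
      expansion to apply, and for the second-order contribution divided by \<open>r\<close> to be at
      most \<open>d\<close>.\<close>
    define r where "r = min r0 (min (\<delta> / (2 * M)) (d / (B * M\<^sup>2 + d)))"
    have Bd: "0 < B * M\<^sup>2 + d" using B M d by (simp add: add_pos_pos)
    have r: "0 < r" "r \<le> r0" "r \<le> \<delta> / (2 * M)" "r \<le> d / (B * M\<^sup>2 + d)"
      using r0 \<delta> M d Bd by (auto simp: r_def)
    obtain w where w: "w \<in> pball x r" "\<kappa> * r \<le> u w - u x"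
      using slope r0(2)[OF r(2)] r(1) unfolding slope_ge_def by blast
    define v where "v = (w - x) /\<^sub>R r"
    have wv: "w = x + r *\<^sub>R v" using r by (simp add: v_def)
    have "\<phi> v = inverse r * \<phi> (w - x)" unfolding v_def using r by (intro phi_scale) simp
    also have "\<dots> \<le> inverse r * r" using w(1) r(1) by (intro mult_left_mono) (auto simp: pball_def)
    finally have "\<phi> v \<le> inverse r * r" .
    then have v1: "\<phi> v \<le> 1" using r(1) by simp
    then have nv: "norm v \<le> M" by (rule nM)
    have "norm (r *\<^sub>R v) \<le> r * M" using nv r by (simp add: mult_left_mono)
    also have "\<dots> \<le> \<delta> / (2 * M) * M" using r M by (intro mult_right_mono) auto
    also have "\<dots> < \<delta>" using \<delta> M by simp
    finally have "u w \<le> u x + r * (p \<bullet> v) + r\<^sup>2 * ((X *v v) \<bullet> v) / 2 + e * (r\<^sup>2 * (norm v)\<^sup>2)"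
      using \<delta>(2)[of "r *\<^sub>R v"] unfolding wv by (simp add: matrix_vector_mult_scaleR power2_eq_square mult_ac)
    then have "r * \<kappa> \<le> r * (p \<bullet> v + r * ((X *v v) \<bullet> v / 2 + e * (norm v)\<^sup>2))"
      using w(2) by (simp add: power2_eq_square algebra_simps)
    then have main: "\<kappa> \<le> p \<bullet> v + r * ((X *v v) \<bullet> v / 2 + e * (norm v)\<^sup>2)" using r(1) by simp
    have pv: "p \<bullet> v \<le> \<kappa>" unfolding \<kappa>_def by (rule inner_le_dual1[OF v1])
    have env: "e * (norm v)\<^sup>2 \<le> d / 2"
    proof -
      have "e * (norm v)\<^sup>2 \<le> e * M\<^sup>2" using nv e by (intro mult_left_mono power_mono) auto
      also have "\<dots> = d / 2" using M by (simp add: e_def)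
      finally show ?thesis .
    qed
    have "0 \<le> r * ((X *v v) \<bullet> v / 2 + e * (norm v)\<^sup>2)" using main pv by linarith
    then have lo: "0 \<le> (X *v v) \<bullet> v / 2 + e * (norm v)\<^sup>2" using r(1) by (simp add: zero_le_mult_iff)
    have "(X *v v) \<bullet> v \<le> norm (X *v v) * norm v" by (rule norm_cauchy_schwarz)
    also have "\<dots> \<le> (B * M) * M"
      using B nv M order_trans[OF B(2)[of v] mult_left_mono[OF nv, of B]] by (intro mult_mono) auto
    finally have "(X *v v) \<bullet> v \<le> B * M\<^sup>2" by (simp add: power2_eq_square mult_ac)
    moreover have "0 \<le> B * M\<^sup>2" using B by simp
    ultimately have "(X *v v) \<bullet> v / 2 + e * (norm v)\<^sup>2 \<le> B * M\<^sup>2 + d" using env d by linarith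
    then have "r * ((X *v v) \<bullet> v / 2 + e * (norm v)\<^sup>2) \<le> d / (B * M\<^sup>2 + d) * (B * M\<^sup>2 + d)"
      using r Bd lo by (intro mult_mono) auto
    then have "r * ((X *v v) \<bullet> v / 2 + e * (norm v)\<^sup>2) \<le> d" using Bd by simp
    then show ?thesis using v1 main lo env by (intro exI[of _ v]) auto
  qed
  then have "\<exists>v. \<phi> v \<le> 1 \<and> \<kappa> \<le> p \<bullet> v + inverse (Suc n) \<and> - inverse (Suc n) \<le> (X *v v) \<bullet> v" for n by simp
  then obtain v where v: "\<And>n. \<phi> (v n) \<le> 1" "\<And>n. \<kappa> \<le> p \<bullet> v n + inverse (Suc n)"
    "\<And>n. - inverse (Suc n) \<le> (X *v v n) \<bullet> v n" by metis
  have "seq_compact (pball 0 1)" using compact_pball compact_imp_seq_compact by blast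
  moreover have "\<forall>n. v n \<in> pball 0 1" using v(1) by (simp add: pball_def)
  ultimately obtain l s where l: "l \<in> pball 0 1" "strict_mono (s :: nat \<Rightarrow> nat)" "(v \<circ> s) \<longlonglongrightarrow> l"
    by (rule seq_compactE)
  have inv: "(\<lambda>n. inverse (real (Suc (s n)))) \<longlonglongrightarrow> 0"
    using LIMSEQ_subseq_LIMSEQ[OF LIMSEQ_inverse_real_of_nat l(2)] by (simp add: o_def)
  have vl: "(\<lambda>n. v (s n)) \<longlonglongrightarrow> l" using l(3) by (simp add: o_def)
  have "(\<lambda>n. p \<bullet> v (s n) + inverse (Suc (s n))) \<longlonglongrightarrow> p \<bullet> l + 0" by (intro tendsto_intros vl inv)
  then have "\<kappa> \<le> p \<bullet> l" using v(2) by (intro LIMSEQ_le_const) auto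
  moreover have "\<phi> l \<le> 1" using l(1) by (simp add: pball_def)
  ultimately have lF: "l \<in> subdifferential (dual_norm \<phi>) p"
    using inner_le_dual1[of l p] by (simp add: subdiff_dual \<kappa>_def)
  have "(\<lambda>n. X *v v (s n)) \<longlonglongrightarrow> X *v l"
    by (rule isCont_tendsto_compose[OF _ vl]) (simp add: matrix_vector_mult_linear_continuous_at)
  then have "(\<lambda>n. (X *v v (s n)) \<bullet> v (s n) + inverse (Suc (s n))) \<longlonglongrightarrow> (X *v l) \<bullet> l + 0"
    by (intro tendsto_intros vl inv)
  moreover have "0 \<le> (X *v v (s n)) \<bullet> v (s n) + inverse (Suc (s n))" for n using v(3)[of "s n"] by linarith
  ultimately have "0 \<le> (X *v l) \<bullet> l" by (intro LIMSEQ_le_const) auto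
  then show ?thesis using G_upper_ge[OF lF, of X] by linarith
qed

end

subsection \<open>Absolutely minimizing Lipschitz functions\<close>

lemma compactly_contained_mono:
  assumes "V \<subset>\<subset> U" "W \<subseteq> V" shows "W \<subset>\<subset> (U :: 'a::t2_space set)"
proof -
  have sub: "closure W \<subseteq> closure V" using assms(2) by (rule closure_mono)
  have "compact (closure V \<inter> closure W)"
    using assms(1) by (intro compact_Int_closed) (auto simp: compactly_contained_def)
  then show ?thesis using sub assms(1) by (auto simp: compactly_contained_def Int_absorb1)
qed

text \<open>Take the last parameter at which the segment from \<open>z\<close> to \<open>x\<close>
  is still outside \<open>W\<close>; beyond it the segment stays in \<open>W\<close>.\<close>

lemma exit_point:
  fixes x z :: "'a::real_normed_vector"
  assumes W: "open W" and x: "x \<in> W" and z: "z \<notin> W"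
  obtains s where "0 \<le> s" "s < 1" "z + s *\<^sub>R (x - z) \<in> frontier W"
    "\<And>t. s < t \<Longrightarrow> t \<le> 1 \<Longrightarrow> z + t *\<^sub>R (x - z) \<in> W"
proof -
  define T where "T = {0..1} \<inter> (\<lambda>t::real. z + t *\<^sub>R (x - z)) -` (- W)"
  have "closed ((\<lambda>t::real. z + t *\<^sub>R (x - z)) -` (- W))"
    using W by (intro continuous_closed_vimage) (auto intro!: continuous_intros)
  then have "compact T" unfolding T_def by (intro compact_Int_closed) auto
  moreover have T0: "0 \<in> T" using z by (simp add: T_def)
  ultimately obtain s where s: "s \<in> T" "\<And>t. t \<in> T \<Longrightarrow> t \<le> s"
    using compact_attains_sup[of T] by blast
  have "1 \<notin> T" using x by (simp add: T_def)
  then have s1: "s < 1" "0 \<le> s" using s T0 by (auto simp: T_def order_less_le)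
  have in_W: "z + t *\<^sub>R (x - z) \<in> W" if "s < t" "t \<le> 1" for t
    using s(2)[of t] that s1 by (force simp: T_def)
  have "((\<lambda>t. z + t *\<^sub>R (x - z)) \<longlongrightarrow> z + s *\<^sub>R (x - z)) (at_right s)" by (intro tendsto_intros)
  moreover have "\<forall>\<^sub>F t in at_right s. z + t *\<^sub>R (x - z) \<in> closure W"
    unfolding eventually_at_right_field using subsetD[OF closure_subset in_W] s1 by (intro exI[of _ 1]) auto
  ultimately have "z + s *\<^sub>R (x - z) \<in> closure W"
    by (intro Lim_in_closed_set[OF closed_closure]) (auto simp: trivial_limit_at_right_real)
  then have "z + s *\<^sub>R (x - z) \<in> frontier W"
    using s(1) interior_open[OF W] by (auto simp: frontier_def T_def)
  with s1 in_W show ?thesis using that by blast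
qed

context finsler begin

text \<open>If comparison fails for some cone, then it fails on an open set on whose boundary the
  function equals the cone.\<close>

lemma CCA_if_cone_boundary:
  assumes U: "open U" and cont: "continuous_on U u"
    and cone: "\<And>W z \<mu> m x y. open W \<Longrightarrow> W \<subset>\<subset> U \<Longrightarrow> z \<notin> W \<Longrightarrow> 0 < \<mu> \<Longrightarrow>
      (\<And>y. y \<in> frontier W \<Longrightarrow> u y = m + \<mu> * \<phi> (y - z)) \<Longrightarrow> x \<in> W \<Longrightarrow> y \<in> frontier W \<Longrightarrow>
      (\<And>t. 0 < t \<Longrightarrow> t \<le> 1 \<Longrightarrow> y + t *\<^sub>R (x - y) \<in> W) \<Longrightarrow> u x - u y \<le> \<mu> * \<phi> (x - y)"
  shows "u \<in> CCA \<phi> U"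
  unfolding CCA_iff[OF cont]
proof (intro allI impI ballI)
  fix V z x and \<mu> :: real assume V: "open V \<and> V \<subset>\<subset> U \<and> z \<notin> V \<and> 0 < \<mu>" and x: "x \<in> V"
  let ?f = "\<lambda>x. u x - \<mu> * \<phi> (x - z)"
  show "\<exists>y\<in>frontier V. ?f x \<le> ?f y"
  proof (rule ccontr)
    assume neg: "\<not> (\<exists>y\<in>frontier V. ?f x \<le> ?f y)"
    have contf: "continuous_on A ?f" if "A \<subseteq> U" for A
      using continuous_on_subset[OF cont that] by (intro continuous_intros)
    have VU: "V \<subseteq> U" "closure V \<subseteq> U" "compact (closure V)" "frontier V \<subseteq> U" "compact (frontier V)"
      using V compactly_containedD closure_subset by blast+
    have "frontier V \<noteq> {}" using frontier_nonempty_compactly_contained V x by blast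
    then obtain b where b: "b \<in> frontier V" "\<And>y. y \<in> frontier V \<Longrightarrow> ?f y \<le> ?f b"
      using continuous_attains_sup[OF VU(5) _ contf[OF VU(4)]] by metis
    \<comment> \<open>Points where \<open>u\<close> exceeds the cone by more than \<open>m\<close>
      stay away from the frontier of \<open>V\<close>; so on the frontier of the superlevel set
      \<open>W\<close> the function equals the cone raised by \<open>m\<close>.\<close>
    define m where "m = ?f b"
    define W where "W = V \<inter> ?f -` {m<..}"
    have W: "open W" unfolding W_def
      by (rule continuous_open_preimage[OF contf[OF VU(1)]]) (use V in auto)
    have WV: "W \<subseteq> V" by (auto simp: W_def)
    have cl: "closure W \<subseteq> closure V" using WV by (rule closure_mono)
    have WU: "W \<subset>\<subset> U" using V WV compactly_contained_mono by blast
    have "m < ?f x" using neg b(1) not_le unfolding m_def by blast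
    then have xW: "x \<in> W" using x by (simp add: W_def)
    have eq: "u y = m + \<mu> * \<phi> (y - z)" if y: "y \<in> frontier W" for y
    proof -
      have yW: "y \<in> closure W" "y \<notin> W" using y interior_open[OF W] by (auto simp: frontier_def)
      have "m \<le> ?f y"
      proof -
        have "closure W \<subseteq> closure V \<inter> ?f -` {m..}"
        proof (rule closure_minimal)
          show "W \<subseteq> closure V \<inter> ?f -` {m..}" using closure_subset by (auto simp: W_def)
          show "closed (closure V \<inter> ?f -` {m..})"
            by (rule continuous_closed_preimage[OF contf[OF VU(2)]]) auto
        qed
        then show ?thesis using yW by auto
      qed
      moreover have "?f y \<le> m"
      proof (cases "y \<in> V")
        case False
        then have "y \<in> frontier V" using yW cl interior_open[of V] V by (auto simp: frontier_def)
        then show ?thesis using b by (simp add: m_def)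
      qed (use yW in \<open>auto simp: W_def\<close>)
      ultimately show ?thesis by simp
    qed
    have zW: "z \<notin> W" using V WV by blast
    obtain s where s: "0 \<le> s" "s < 1" "z + s *\<^sub>R (x - z) \<in> frontier W"
      "\<And>t. s < t \<Longrightarrow> t \<le> 1 \<Longrightarrow> z + t *\<^sub>R (x - z) \<in> W"
      using exit_point[OF W xW zW] by metis
    \<comment> \<open>\<open>y\<close> lies on the segment from the vertex to \<open>x\<close>,
      along which \<phi> is additive; a slope of at most \<mu> from \<open>y\<close> to
      \<open>x\<close> therefore does not let \<open>u x\<close> exceed the raised cone.\<close>
    define y where "y = z + s *\<^sub>R (x - z)"
    have yz: "y - z = s *\<^sub>R (x - z)" and xy: "x - y = (1 - s) *\<^sub>R (x - z)"
      by (simp_all add: y_def algebra_simps)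
    have seg: "y + t *\<^sub>R (x - y) \<in> W" if "0 < t" "t \<le> 1" for t
    proof -
      have "y + t *\<^sub>R (x - y) = z + (s + t * (1 - s)) *\<^sub>R (x - z)"
        unfolding xy by (simp add: y_def algebra_simps)
      moreover have "0 < t * (1 - s)" "t * (1 - s) \<le> 1 * (1 - s)"
        using that s by (auto intro!: mult_right_mono)
      ultimately show ?thesis using s(4)[of "s + t * (1 - s)"] by simp
    qed
    have "u x - u y \<le> \<mu> * \<phi> (x - y)"
      by (rule cone[OF W WU zW _ eq xW _ seg]) (use V s(3) in \<open>auto simp: y_def\<close>)
    moreover have "u y = m + \<mu> * \<phi> (y - z)" using eq s(3) by (simp add: y_def)
    moreover have "\<phi> (x - y) = (1 - s) * \<phi> (x - z)" "\<phi> (y - z) = s * \<phi> (x - z)"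
      unfolding xy yz using s by (auto intro!: phi_scale)
    then have "\<phi> (x - y) + \<phi> (y - z) = \<phi> (x - z)" by (simp add: left_diff_distrib)
    then have "\<mu> * \<phi> (x - y) + \<mu> * \<phi> (y - z) = \<mu> * \<phi> (x - z)" by (metis distrib_left)
    moreover have "m < ?f x" using xW by (simp add: W_def)
    ultimately show False by linarith
  qed
qed

lemma Lip_leI:
  assumes "0 < C" "\<And>x y. x \<in> K \<Longrightarrow> y \<in> K \<Longrightarrow> v x - v y \<le> C * \<phi> (x - y)"
  shows "Lip \<phi> K v \<le> ennreal C"
  unfolding Lip_def using assms by (intro Inf_lower) blast

text \<open>\<open>Lip\<close> is an infimum over strictly positive constants and \<open>C\<close>
  may be 0, so the bound is obtained in the limit of a slack \<open>d\<close>; the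
  \<open>+ 1\<close> in its denominator covers \<open>x = y\<close>.\<close>

lemma Lip_leD:
  assumes "Lip \<phi> K v \<le> ennreal C" "0 \<le> C" "x \<in> K" "y \<in> K"
  shows "v x - v y \<le> C * \<phi> (x - y)"
proof -
  have "v x - v y \<le> C * \<phi> (x - y) + e" if e: "0 < e" for e
  proof -
    define d where "d = e / (\<phi> (x - y) + 1)"
    have p: "0 < \<phi> (x - y) + 1" by (simp add: add_nonneg_pos)
    then have d: "0 < d" using e by (simp add: d_def)
    have "Lip \<phi> K v < ennreal (C + d)"
      using assms(1,2) d by (intro le_less_trans[OF assms(1)]) (simp add: ennreal_less_iff)
    then obtain C' where C': "ennreal C' < ennreal (C + d)" "0 < C'" "\<forall>x\<in>K. \<forall>y\<in>K. v x - v y \<le> C' * \<phi> (x - y)"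
      unfolding Lip_def Inf_less_iff by blast
    then have "C' \<le> C + d" by (simp add: ennreal_less_iff)
    then have "C' * \<phi> (x - y) \<le> (C + d) * \<phi> (x - y)" by (intro mult_right_mono) auto
    also have "\<dots> = C * \<phi> (x - y) + d * \<phi> (x - y)" by (simp add: distrib_right)
    also have "d * \<phi> (x - y) \<le> d * (\<phi> (x - y) + 1)" using d by simp
    also have "\<dots> = e" using p by (simp add: d_def)
    finally show ?thesis using C'(3) assms(3,4) by fastforce
  qed
  then show ?thesis by (rule field_le_epsilon)
qed

lemma CCA_if_abs_min_Lip:
  assumes U: "open U" and cont: "continuous_on U u"
    and min: "\<And>V v. open V \<Longrightarrow> V \<subset>\<subset> U \<Longrightarrow> (\<And>x. x \<in> frontier V \<Longrightarrow> v x = u x) \<Longrightarrow>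
      Lip \<phi> (closure V) u \<le> Lip \<phi> (closure V) v"
  shows "u \<in> CCA \<phi> U"
proof (rule CCA_if_cone_boundary[OF U cont])
  fix W z \<mu> m x y
  assume W: "open W" "W \<subset>\<subset> U" and \<mu>: "0 < \<mu>" and
    eq: "\<And>y. y \<in> frontier W \<Longrightarrow> u y = m + \<mu> * \<phi> (y - z)" and xy: "x \<in> W" "y \<in> frontier W"
  have "Lip \<phi> (closure W) u \<le> Lip \<phi> (closure W) (\<lambda>y. m + \<mu> * \<phi> (y - z))"
    using min[OF W] eq by simp
  also have "\<dots> \<le> ennreal \<mu>"
  proof (rule Lip_leI[OF \<mu>])
    fix a b
    have "\<mu> * \<phi> (a - z) \<le> \<mu> * (\<phi> (a - b) + \<phi> (b - z))" using \<mu> phi_triangle3 by (intro mult_left_mono) auto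
    then show "(m + \<mu> * \<phi> (a - z)) - (m + \<mu> * \<phi> (b - z)) \<le> \<mu> * \<phi> (a - b)" by (simp add: distrib_left)
  qed
  finally show "u x - u y \<le> \<mu> * \<phi> (x - y)"
    by (rule Lip_leD) (use \<mu> xy closure_subset in \<open>auto simp: frontier_def\<close>)
qed

lemma Lip_reflect: "Lip (\<lambda>x. \<phi> (- x)) K (\<lambda>x. - v x) = Lip \<phi> K v"
proof -
  have "(\<forall>x\<in>K. \<forall>y\<in>K. - v x - - v y \<le> C * \<phi> (- (x - y))) \<longleftrightarrow> (\<forall>x\<in>K. \<forall>y\<in>K. v x - v y \<le> C * \<phi> (x - y))" for C
  proof (intro iffI ballI)
    fix x y assume "\<forall>x\<in>K. \<forall>y\<in>K. - v x - - v y \<le> C * \<phi> (- (x - y))" "x \<in> K" "y \<in> K"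
    then have "- v y - - v x \<le> C * \<phi> (- (y - x))" by blast
    then show "v x - v y \<le> C * \<phi> (x - y)" by simp
  next
    fix x y assume "\<forall>x\<in>K. \<forall>y\<in>K. v x - v y \<le> C * \<phi> (x - y)" "x \<in> K" "y \<in> K"
    then have "v y - v x \<le> C * \<phi> (y - x)" by blast
    then show "- v x - - v y \<le> C * \<phi> (- (x - y))" by simp
  qed
  then show ?thesis unfolding Lip_def by simp
qed

text \<open>A constant \<open>C\<close> valid for \<open>v\<close> holds for \<open>u\<close>
  between frontier points. Cones of slope \<open>C\<close> with vertex on the frontier extend it to
  pairs with one interior point, from above if that is the first point and from below if it is the
  second; a cone with vertex \<open>y\<close> then handles two interior points.\<close>

lemma CCA_CCB_Lip_min:
  assumes U: "open U" and cont: "continuous_on U u" and A: "u \<in> CCA \<phi> U" and B: "u \<in> CCB \<phi> U"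
    and V: "open V" "V \<subset>\<subset> U" and v: "\<And>x. x \<in> frontier V \<Longrightarrow> v x = u x"
  shows "Lip \<phi> (closure V) u \<le> Lip \<phi> (closure V) v"
proof -
  interpret r: finsler "\<lambda>x. \<phi> (- x)" by (rule finsler_reflect)
  have B': "(\<lambda>x. - u x) \<in> CCA (\<lambda>x. \<phi> (- x)) U" using B CCB_iff_CCA by blast
  have cont': "continuous_on U (\<lambda>x. - u x)" using cont by (rule continuous_on_minus)
  have "u x - u y \<le> C * \<phi> (x - y)"
    if C: "0 < C" "\<forall>x\<in>closure V. \<forall>y\<in>closure V. v x - v y \<le> C * \<phi> (x - y)"
      and x: "x \<in> closure V" and y: "y \<in> closure V" for C x y
  proof -
    have ff: "u a - u b \<le> C * \<phi> (a - b)" if "a \<in> frontier V" "b \<in> frontier V" for a b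
      using C(2) v that unfolding frontier_def by (metis DiffD1)
    have cl: "a \<in> V \<or> a \<in> frontier V" if "a \<in> closure V" for a
      using that interior_open[OF V(1)] by (auto simp: frontier_def)
    have nf: "b \<notin> V" if "b \<in> frontier V" for b using that interior_open[OF V(1)] by (auto simp: frontier_def)
    have vf: "u a - u b \<le> C * \<phi> (a - b)" if a: "a \<in> closure V" and b: "b \<in> frontier V" for a b
    proof (cases "a \<in> V")
      case True
      obtain w where w: "w \<in> frontier V" "u a - C * \<phi> (a - b) \<le> u w - C * \<phi> (w - b)"
        using CCA_D[OF cont A V nf[OF b] C(1) True] by metis
      then show ?thesis using ff[OF w(1) b] by linarith
    qed (use ff a b cl in blast)
    have fv: "u a - u b \<le> C * \<phi> (a - b)" if a: "a \<in> frontier V" and b: "b \<in> closure V" for a b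
    proof (cases "b \<in> V")
      case True
      obtain w where w: "w \<in> frontier V" "- u b - C * \<phi> (- (b - a)) \<le> - u w - C * \<phi> (- (w - a))"
        using r.CCA_D[OF cont' B' V nf[OF a] C(1) True] by metis
      then show ?thesis using ff[OF a w(1)] by simp
    qed (use ff a b cl in blast)
    show ?thesis
    proof (cases "x \<in> V \<and> y \<in> V \<and> x \<noteq> y")
      case True
      \<comment> \<open>Removing \<open>y\<close> makes it an admissible vertex; it may become a
        frontier point, where the conclusion is immediate.\<close>
      let ?V = "V - {y}"
      have V': "open ?V" using V by (simp add: open_delete)
      have c: "closure ?V \<subseteq> closure V" by (rule closure_mono) auto
      have V'': "?V \<subset>\<subset> U" using V(2) by (rule compactly_contained_mono) auto
      obtain w where w: "w \<in> frontier ?V" "u x - C * \<phi> (x - y) \<le> u w - C * \<phi> (w - y)"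
        using CCA_D[OF cont A V' V'' _ C(1), of y x] True by auto
      have "w \<in> closure V" "w \<notin> ?V" using w(1) c interior_open[OF V'] by (auto simp: frontier_def)
      then have "w = y \<or> w \<in> frontier V" using cl by blast
      then show ?thesis using w(2) fv[of w y] y by auto
    next
      case False
      then consider "x = y" | "x \<in> frontier V" | "y \<in> frontier V" using cl x y by blast
      then show ?thesis using vf[OF x] fv[OF _ y] by cases auto
    qed
  qed
  then show ?thesis unfolding Lip_def by (intro Inf_superset_mono) blast
qed

end

context finsler begin

subsection \<open>The log-Laplace transform of the polar body\<close>

text \<open>The subdifferential of \<phi> at 0; \<phi> is its support function, by
  \<open>polar_le\<close> and \<open>polar_attained\<close>.\<close>

definition polar :: "(real ^ 'n) set" where "polar = {p. dual_norm \<phi> p \<le> 1}"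

lemma polar_le: "p \<in> polar \<Longrightarrow> p \<bullet> x \<le> \<phi> x"
  using inner_le_dual[of p x] mult_right_mono[of "dual_norm \<phi> p" 1 "\<phi> x"] by (simp add: polar_def)

lemma polar_attained: obtains p where "p \<in> polar" "p \<bullet> x = \<phi> x"
proof -
  obtain p where p: "p \<bullet> x = \<phi> x" "\<And>y. p \<bullet> y \<le> \<phi> y" using support_functional by blast
  have "dual_norm \<phi> p \<le> 1" by (rule dual_leI) (use p(2) order_trans in blast)
  then show ?thesis using p(1) that by (auto simp: polar_def)
qed

lemma polar_bounded: obtains M where "0 < M" "\<And>p. p \<in> polar \<Longrightarrow> norm p \<le> M"
proof -
  obtain m M where M: "0 < M" "\<And>y. \<phi> y \<le> M * norm y" using phi_bounds by metis
  show ?thesis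
  proof (rule that[OF M(1)])
    fix p assume "p \<in> polar"
    then have "p \<bullet> p \<le> M * norm p" using polar_le[of p p] M(2)[of p] by linarith
    then show "norm p \<le> M" by (cases "p = 0") (use M(1) in \<open>auto simp: power2_norm_eq_inner[symmetric] power2_eq_square\<close>)
  qed
qed

lemma compact_polar: "compact polar"
proof -
  obtain M where "\<And>p. p \<in> polar \<Longrightarrow> norm p \<le> M" using polar_bounded by blast
  then have "bounded polar" unfolding bounded_iff by blast
  moreover have "closed polar" unfolding polar_def
    by (intro closed_Collect_le continuous_dual continuous_on_const)
  ultimately show ?thesis using compact_eq_bounded_closed by blast
qed

lemma convex_polar: "p \<in> polar \<Longrightarrow> p' \<in> polar \<Longrightarrow> 0 \<le> s \<Longrightarrow> s \<le> 1 \<Longrightarrow> p + s *\<^sub>R (p' - p) \<in> polar"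
proof -
  assume *: "p \<in> polar" "p' \<in> polar" "0 \<le> s" "s \<le> 1"
  have "p + s *\<^sub>R (p' - p) = (1 - s) *\<^sub>R p + s *\<^sub>R p'" by (simp add: algebra_simps)
  then have "dual_norm \<phi> (p + s *\<^sub>R (p' - p)) \<le> (1 - s) * dual_norm \<phi> p + s * dual_norm \<phi> p'"
    using dual_triangle[of "(1 - s) *\<^sub>R p" "s *\<^sub>R p'"] * by (simp add: dual_scale)
  also have "\<dots> \<le> (1 - s) * 1 + s * 1" using * by (intro add_mono mult_left_mono) (auto simp: polar_def)
  finally show ?thesis by (simp add: polar_def)
qed

lemma polar_integrable:
  fixes f :: "real ^ 'n \<Rightarrow> 'b::{banach,second_countable_topology}"
  assumes "continuous_on UNIV f" shows "set_integrable lborel polar f"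
  unfolding set_integrable_def
  by (rule borel_integrable_compact[OF compact_polar continuous_on_subset[OF assms]]) auto

lemma polar_measure_pos: "0 < measure lborel polar" and polar_fmeasurable: "emeasure lborel polar < \<infinity>"
proof -
  show f: "emeasure lborel polar < \<infinity>" by (rule emeasure_bounded_finite[OF compact_imp_bounded[OF compact_polar]])
  obtain M where M: "0 < M" "\<And>p. dual_norm \<phi> p \<le> M * norm p" using dual_bound by blast
  have sub: "ball 0 (1 / M) \<subseteq> polar"
  proof
    fix p :: "real ^ 'n" assume "p \<in> ball 0 (1 / M)"
    then have "M * norm p \<le> 1" using M by (simp add: field_simps)
    then show "p \<in> polar" using M(2)[of p] by (simp add: polar_def)
  qed
  have "0 < emeasure lborel (ball (0 :: real ^ 'n) (1 / M))"
    using M(1) emeasure_lborel_ball_finite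
    by (metis content_ball_pos emeasure_eq_measure2 ennreal_less_zero_iff less_irrefl measure_def not_gr_zero enn2real_0 zero_less_divide_1_iff)
  also have "\<dots> \<le> emeasure lborel polar"
    using sub compact_polar by (intro emeasure_mono) (auto simp: borel_compact)
  finally show "0 < measure lborel polar" using f
    by (simp add: measure_def enn2real_positive_iff)
qed

end

lemma lborel_integral_affine:
  fixes f :: "'a::euclidean_space \<Rightarrow> 'b::{banach,second_countable_topology}"
  assumes "c \<noteq> 0" and f: "f \<in> borel_measurable borel"
  shows "integral\<^sup>L lborel f = \<bar>c\<bar> ^ DIM('a) *\<^sub>R (\<integral>x. f (t + c *\<^sub>R x) \<partial>lborel)"
proof -
  have "integral\<^sup>L lborel f = integral\<^sup>L (density (distr lborel borel (\<lambda>x. t + c *\<^sub>R x)) (\<lambda>_. ennreal (\<bar>c\<bar> ^ DIM('a)))) f"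
    using lborel_affine[OF assms(1), of t] by (simp add: ennreal_power)
  also have "\<dots> = \<bar>c\<bar> ^ DIM('a) *\<^sub>R (\<integral>x. f (t + c *\<^sub>R x) \<partial>lborel)"
    using f by (subst integral_density) (auto simp: integral_distr)
  finally show ?thesis .
qed

context finsler begin

text \<open>The contraction towards \<open>p0\<close> with factor \<open>s\<close> maps the convex
  body into itself and multiplies volume by \<open>s ^ CARD('n)\<close>; the integral of a
  nonnegative function over the image is at most that over the body.\<close>

lemma polar_scaling:
  fixes G :: "real ^ 'n \<Rightarrow> real"
  assumes G: "continuous_on UNIV G" "\<And>p. p \<in> polar \<Longrightarrow> 0 \<le> G p" and p0: "p0 \<in> polar" and s: "0 < s" "s \<le> 1"
  shows "s ^ CARD('n) * (LINT p:polar|lborel. G (p0 + s *\<^sub>R (p - p0))) \<le> (LINT p:polar|lborel. G p)"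
proof -
  define t where "t = p0 - s *\<^sub>R p0"
  have T: "t + s *\<^sub>R p = p0 + s *\<^sub>R (p - p0)" for p by (simp add: t_def algebra_simps)
  \<comment> \<open>Extension by zero lets the substitution be carried out on the whole
    space.\<close>
  define F where "F p = indicator polar p *\<^sub>R G p" for p
  have Fi: "integrable lborel F" using polar_integrable[OF G(1)] unfolding set_integrable_def F_def .
  then have Fm: "F \<in> borel_measurable borel" by simp
  let ?P = "(\<lambda>y. (1 / s) *\<^sub>R (y - t)) ` polar"
  have Pc: "compact ?P"
    by (intro compact_continuous_image compact_polar continuous_intros)
  have P_iff: "p \<in> ?P \<longleftrightarrow> t + s *\<^sub>R p \<in> polar" for p
  proof
    assume "t + s *\<^sub>R p \<in> polar"
    then show "p \<in> ?P" by (rule rev_image_eqI) (use s in simp)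
  qed (use s in auto)
  have GT: "continuous_on UNIV (\<lambda>p. G (t + s *\<^sub>R p))"
    by (rule continuous_on_compose2[OF G(1)]) (auto intro!: continuous_intros)
  have "integrable lborel (\<lambda>p. indicator ?P p *\<^sub>R G (t + s *\<^sub>R p))"
    by (rule borel_integrable_compact[OF Pc continuous_on_subset[OF GT]]) auto
  moreover have FT: "F (t + s *\<^sub>R p) = indicator ?P p *\<^sub>R G (t + s *\<^sub>R p)" for p
    unfolding F_def using P_iff[of p] by (simp add: indicator_def)
  ultimately have FTi: "integrable lborel (\<lambda>p. F (t + s *\<^sub>R p))" by simp
  have "(LINT p:polar|lborel. G (p0 + s *\<^sub>R (p - p0))) \<le> (\<integral>p. F (t + s *\<^sub>R p) \<partial>lborel)"
    unfolding set_lebesgue_integral_def T[symmetric]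
  proof (rule integral_mono)
    show "integrable lborel (\<lambda>p. indicator polar p *\<^sub>R G (t + s *\<^sub>R p))"
      using polar_integrable[OF GT] unfolding set_integrable_def .
    fix p :: "real ^ 'n"
    show "indicator polar p *\<^sub>R G (t + s *\<^sub>R p) \<le> F (t + s *\<^sub>R p)"
    proof (cases "p \<in> polar")
      case True
      then have "t + s *\<^sub>R p \<in> polar" unfolding T using convex_polar[OF p0] s by auto
      then show ?thesis using True by (simp add: F_def)
    next
      case False
      then show ?thesis using G(2) by (simp add: F_def indicator_def)
    qed
  qed (rule FTi)
  then have "s ^ CARD('n) * (LINT p:polar|lborel. G (p0 + s *\<^sub>R (p - p0)))
      \<le> s ^ CARD('n) * (\<integral>p. F (t + s *\<^sub>R p) \<partial>lborel)"
    using s by (intro mult_left_mono) auto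
  also have "\<dots> = integral\<^sup>L lborel F"
    using lborel_integral_affine[OF _ Fm, of s t] s by simp
  also have "\<dots> = (LINT p:polar|lborel. G p)" by (simp add: F_def[abs_def] set_lebesgue_integral_def)
  finally show ?thesis .
qed

text \<open>\<open>tilt N x\<close> is the mean with respect to the probability density on \<open>polar\<close> proportional to
  \<open>exp (N * (p \<bullet> x))\<close>; the map \<open>x \<mapsto> ln (lapl N x) / N\<close> is a smooth approximation of \<open>\<phi>\<close>.\<close>

definition lapl :: "real \<Rightarrow> real ^ 'n \<Rightarrow> real" where
  "lapl N x = (LINT p:polar|lborel. exp (N * (p \<bullet> x)))"

definition tilt :: "real \<Rightarrow> real ^ 'n \<Rightarrow> (real ^ 'n \<Rightarrow> 'b::{banach,second_countable_topology}) \<Rightarrow> 'b" where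
  "tilt N x f = (1 / lapl N x) *\<^sub>R (LINT p:polar|lborel. exp (N * (p \<bullet> x)) *\<^sub>R f p)"

lemma tilt_integrable:
  fixes f :: "real ^ 'n \<Rightarrow> 'b::{banach,second_countable_topology}"
  assumes "continuous_on UNIV f"
  shows "set_integrable lborel polar (\<lambda>p. exp (N * (p \<bullet> x)) *\<^sub>R f p)"
  by (rule polar_integrable) (intro continuous_intros assms)

lemma lapl_pos: "0 < lapl N x"
proof -
  obtain M where M: "0 < M" "\<And>p. p \<in> polar \<Longrightarrow> norm p \<le> M" using polar_bounded by blast
  let ?c = "exp (- (\<bar>N\<bar> * (M * norm x)))"
  have "?c * measure lborel polar = (LINT p:polar|lborel. ?c)"
    using has_bochner_integral_integral_eq[OF has_bochner_integral_indicator[OF _ polar_fmeasurable, of ?c]] compact_polar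
    by (simp add: set_lebesgue_integral_def borel_compact mult.commute)
  also have "\<dots> \<le> lapl N x" unfolding lapl_def
  proof (rule set_integral_mono)
    fix p assume "p \<in> polar"
    then have "norm p * norm x \<le> M * norm x" using M by (intro mult_right_mono) auto
    then have "\<bar>p \<bullet> x\<bar> \<le> M * norm x" using Cauchy_Schwarz_ineq2[of p x] by linarith
    then have "\<bar>N * (p \<bullet> x)\<bar> \<le> \<bar>N\<bar> * (M * norm x)" unfolding abs_mult by (intro mult_left_mono) auto
    then show "?c \<le> exp (N * (p \<bullet> x))" by (simp add: abs_le_iff)
  qed (intro polar_integrable continuous_intros)+
  finally show ?thesis using polar_measure_pos by (smt (verit) exp_gt_zero mult_pos_pos)
qed

lemma tilt_add:
  fixes f g :: "real ^ 'n \<Rightarrow> 'b::{banach,second_countable_topology}"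
  assumes "continuous_on UNIV f" "continuous_on UNIV g"
  shows "tilt N x (\<lambda>p. f p + g p) = tilt N x f + tilt N x g"
  unfolding tilt_def scaleR_add_right
  by (subst set_integral_add(2)[OF tilt_integrable[OF assms(1)] tilt_integrable[OF assms(2)]])
    (simp add: scaleR_add_right)

lemma tilt_const: "tilt N x (\<lambda>p. c) = (c::real)"
  unfolding tilt_def using lapl_pos[of N x] by (simp add: lapl_def)

lemma tilt_scaleR:
  fixes f :: "real ^ 'n \<Rightarrow> 'b::{banach,second_countable_topology}"
  shows "tilt N x (\<lambda>p. c *\<^sub>R f p) = c *\<^sub>R tilt N x f"
proof -
  have eq: "(\<lambda>p. exp (N * (p \<bullet> x)) *\<^sub>R c *\<^sub>R f p) = (\<lambda>p. c *\<^sub>R exp (N * (p \<bullet> x)) *\<^sub>R f p)"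
    by (simp add: mult.commute)
  show ?thesis unfolding tilt_def eq set_integral_scaleR_right by (simp add: mult.commute)
qed

lemma tilt_mult_left: "tilt N x (\<lambda>p. c * f p) = c * tilt N x (f :: _ \<Rightarrow> real)"
  using tilt_scaleR[of N x c f] by simp

lemma tilt_mono:
  fixes f g :: "real ^ 'n \<Rightarrow> real"
  assumes "continuous_on UNIV f" "continuous_on UNIV g" "\<And>p. p \<in> polar \<Longrightarrow> f p \<le> g p"
  shows "tilt N x f \<le> tilt N x g"
  unfolding tilt_def using lapl_pos[of N x]
  by (auto intro!: divide_right_mono set_integral_mono assms mult_left_mono
    tilt_integrable[where f = f, unfolded real_scaleR_def] tilt_integrable[where f = g, unfolded real_scaleR_def])

lemma tilt_inner:
  assumes "continuous_on UNIV f"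
  shows "tilt N x f \<bullet> h = tilt N x (\<lambda>p. f p \<bullet> (h :: 'b::euclidean_space))"
proof -
  have "(LINT p:polar|lborel. exp (N * (p \<bullet> x)) *\<^sub>R f p) \<bullet> h = (LINT p:polar|lborel. exp (N * (p \<bullet> x)) *\<^sub>R (f p \<bullet> h))"
    unfolding set_lebesgue_integral_def
    by (subst integral_inner_left[symmetric])
      (use tilt_integrable[OF assms] in \<open>auto simp: set_integrable_def mult.assoc\<close>)
  then show ?thesis by (simp add: tilt_def)
qed

lemma lapl_shift:
  "lapl N (x + h) = lapl N x * tilt N x (\<lambda>p. exp (N * (p \<bullet> h)))"
  using lapl_pos[of N x] by (simp add: tilt_def lapl_def inner_add_right distrib_left exp_add)

text \<open>What remains in the exponent is the excess \<open>\<phi> x - p \<bullet> x\<close>,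
  which is nonnegative on \<open>polar\<close> and vanishes at a maximizer; the later estimates are
  made in terms of it.\<close>

lemma lapl_eq: "lapl N x = exp (N * \<phi> x) * (LINT p:polar|lborel. exp (- (N * (\<phi> x - p \<bullet> x))))"
proof -
  have "exp (N * (p \<bullet> x)) = exp (N * \<phi> x) * exp (- (N * (\<phi> x - p \<bullet> x)))" for p
    by (simp add: exp_add[symmetric] algebra_simps)
  then show ?thesis unfolding lapl_def by simp
qed

lemma tilt_eq:
  "tilt N x f = (LINT p:polar|lborel. exp (- (N * (\<phi> x - p \<bullet> x))) * f p) / (LINT p:polar|lborel. exp (- (N * (\<phi> x - p \<bullet> x))))"
  (is "_ = ?L / ?Z")
proof -
  have eq: "exp (N * (p \<bullet> x)) * f p = exp (N * \<phi> x) * (exp (- (N * (\<phi> x - p \<bullet> x))) * f p)" for p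
    by (simp add: mult.assoc[symmetric] exp_add[symmetric] algebra_simps)
  show ?thesis unfolding tilt_def lapl_eq real_scaleR_def eq set_integral_mult_right by simp
qed

lemma lapl_excess_pos: "0 < (LINT p:polar|lborel. exp (- (N * (\<phi> x - p \<bullet> x))))"
  using lapl_pos[of N x] unfolding lapl_eq by (simp add: zero_less_mult_iff)

text \<open>Contracting towards a maximizer \<open>p0\<close> of \<open>p \<bullet> x\<close>
  multiplies the excess by exactly \<open>s\<close>.\<close>

lemma excess_scaling:
  assumes N: "0 < N" and s: "0 < s" "s \<le> 1"
  shows "s ^ CARD('n) * (LINT p:polar|lborel. exp (- (N * s * (\<phi> x - p \<bullet> x))))
    \<le> (LINT p:polar|lborel. exp (- (N * (\<phi> x - p \<bullet> x))))"
proof -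
  obtain p0 where p0: "p0 \<in> polar" "p0 \<bullet> x = \<phi> x" using polar_attained by blast
  have "\<phi> x - (p0 + s *\<^sub>R (p - p0)) \<bullet> x = s * (\<phi> x - p \<bullet> x)" for p
    by (simp add: inner_add_left inner_diff_left p0(2) algebra_simps)
  then show ?thesis
    using polar_scaling[of "\<lambda>p. exp (- (N * (\<phi> x - p \<bullet> x)))" p0 s] p0 s
    by (simp add: mult.assoc continuous_intros)
qed

text \<open>A contraction by 1/2 halves the rate in the exponent at the cost of a factor
  \<open>2 ^ CARD('n)\<close> in volume. The bound on this exponential moment depends on neither
  \<open>N\<close> nor \<open>x\<close>, which is where the uniform constants come from.\<close>

lemma tilt_exp_excess:
  assumes N: "0 < N"
  shows "tilt N x (\<lambda>p. exp (N * (\<phi> x - p \<bullet> x) / 2)) \<le> 2 ^ CARD('n)"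
proof -
  let ?Z = "LINT p:polar|lborel. exp (- (N * (\<phi> x - p \<bullet> x)))"
  let ?H = "LINT p:polar|lborel. exp (- (N * (1/2) * (\<phi> x - p \<bullet> x)))"
  have e: "exp (- (N * (\<phi> x - p \<bullet> x))) * exp (N * (\<phi> x - p \<bullet> x) / 2) = exp (- (N * (1/2) * (\<phi> x - p \<bullet> x)))" for p
    by (simp add: exp_add[symmetric])
  have "(1/2) ^ CARD('n) * ?H \<le> ?Z" by (rule excess_scaling[OF N]) auto
  then have "?H \<le> 2 ^ CARD('n) * ?Z" by (simp add: power_one_over field_simps)
  moreover have "tilt N x (\<lambda>p. exp (N * (\<phi> x - p \<bullet> x) / 2)) = ?H / ?Z" unfolding tilt_eq e ..
  ultimately show ?thesis by (simp only: pos_divide_le_eq[OF lapl_excess_pos])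
qed

lemma tilt_excess:
  assumes N: "0 < N"
  shows "tilt N x (\<lambda>p. \<phi> x - p \<bullet> x) \<le> 2 * 2 ^ CARD('n) / N"
proof -
  have "tilt N x (\<lambda>p. \<phi> x - p \<bullet> x) \<le> tilt N x (\<lambda>p. (2 / N) * exp (N * (\<phi> x - p \<bullet> x) / 2))"
  proof (rule tilt_mono)
    fix p
    have "N * (\<phi> x - p \<bullet> x) / 2 \<le> exp (N * (\<phi> x - p \<bullet> x) / 2)"
      using exp_ge_add_one_self[of "N * (\<phi> x - p \<bullet> x) / 2"] by linarith
    then show "\<phi> x - p \<bullet> x \<le> (2 / N) * exp (N * (\<phi> x - p \<bullet> x) / 2)" using N by (simp add: field_simps)
  qed (intro continuous_intros; simp)+
  also have "\<dots> \<le> (2 / N) * 2 ^ CARD('n)"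
    unfolding tilt_mult_left using N by (intro mult_left_mono tilt_exp_excess) auto
  finally show ?thesis by simp
qed

text \<open>A nonnegative affine function satisfies a reverse Hoelder inequality with respect to the
  tilted measure. Its mean dominates its values because \<open>polar\<close> contains half-size copies of itself
  around each of its points.\<close>

lemma affine_le_tilt:
  assumes N: "0 < N" and e: "\<And>p. p \<in> polar \<Longrightarrow> 0 \<le> e p" "\<And>p. e p = a - p \<bullet> q" and p1: "p1 \<in> polar"
  shows "e p1 \<le> 2 * 2 ^ CARD('n) * exp (N * (\<phi> x - p1 \<bullet> x) / 2) * tilt N x e"
proof -
  let ?d = "\<lambda>p. \<phi> x - p \<bullet> x"
  let ?W = "\<lambda>p. exp (- (N * ?d p))"
  let ?Z = "LINT p:polar|lborel. ?W p"
  have ce: "continuous_on UNIV e" unfolding e(2)[abs_def] by (intro continuous_intros)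
  \<comment> \<open>On the copy of \<open>polar\<close> shrunk by 1/2 towards \<open>p1\<close>, the
    affine \<open>e\<close> is at least \<open>e p1 / 2\<close>, being nonnegative at the other end
    point, and the weight is at least \<open>exp (- (N * (\<phi> x - p1 \<bullet> x) / 2))\<close>
    times its value at \<open>p\<close>.\<close>
  let ?c = "e p1 / 2 * exp (- (N * ?d p1 / 2))"
  have "?c * ?Z = (LINT p:polar|lborel. ?c * ?W p)" by simp
  also have "\<dots> \<le> (LINT p:polar|lborel. ?W (p1 + (1/2) *\<^sub>R (p - p1)) * e (p1 + (1/2) *\<^sub>R (p - p1)))"
  proof (rule set_integral_mono)
    fix p assume p: "p \<in> polar"
    have "e (p1 + (1/2) *\<^sub>R (p - p1)) = e p1 / 2 + e p / 2"
      by (simp add: e(2) inner_add_left inner_diff_left field_simps)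
    then have 1: "e p1 / 2 \<le> e (p1 + (1/2) *\<^sub>R (p - p1))" using e(1)[OF p] by simp
    have "?d (p1 + (1/2) *\<^sub>R (p - p1)) = ?d p1 / 2 + ?d p / 2"
      by (simp add: inner_add_left inner_diff_left field_simps)
    also have "\<dots> \<le> ?d p1 / 2 + ?d p" using polar_le[OF p, of x] by simp
    finally have "N * ?d (p1 + (1/2) *\<^sub>R (p - p1)) \<le> N * (?d p1 / 2 + ?d p)" using N by (intro mult_left_mono) auto
    moreover have "exp (- (N * ?d p1 / 2)) * ?W p = exp (- (N * (?d p1 / 2 + ?d p)))"
      unfolding exp_add[symmetric] by (simp only: distrib_left minus_add_distrib times_divide_eq_right)
    ultimately have 2: "exp (- (N * ?d p1 / 2)) * ?W p \<le> ?W (p1 + (1/2) *\<^sub>R (p - p1))"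
      by (simp only: exp_le_cancel_iff neg_le_iff_le)
    have "exp (- (N * ?d p1 / 2)) * ?W p * (e p1 / 2) \<le> ?W (p1 + (1/2) *\<^sub>R (p - p1)) * e (p1 + (1/2) *\<^sub>R (p - p1))"
      using 1 2 e(1)[OF p1] by (intro mult_mono) auto
    then show "?c * ?W p \<le> ?W (p1 + (1/2) *\<^sub>R (p - p1)) * e (p1 + (1/2) *\<^sub>R (p - p1))" by (simp add: mult_ac)
  next
    show "set_integrable lborel polar (\<lambda>p. ?W (p1 + (1/2) *\<^sub>R (p - p1)) * e (p1 + (1/2) *\<^sub>R (p - p1)))"
      unfolding e(2) by (intro polar_integrable continuous_intros)
  qed (intro polar_integrable continuous_intros)
  finally have "(1/2) ^ CARD('n) * (?c * ?Z) \<le>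
      (1/2) ^ CARD('n) * (LINT p:polar|lborel. ?W (p1 + (1/2) *\<^sub>R (p - p1)) * e (p1 + (1/2) *\<^sub>R (p - p1)))"
    by (intro mult_left_mono) auto
  also have "\<dots> \<le> (LINT p:polar|lborel. ?W p * e p)"
  proof (rule polar_scaling[OF _ _ p1])
    show "continuous_on UNIV (\<lambda>p. ?W p * e p)" by (intro continuous_intros ce)
  qed (use e(1) in auto)
  also have "\<dots> = tilt N x e * ?Z" using lapl_excess_pos[of N x] by (simp add: tilt_eq)
  finally have "((1/2) ^ CARD('n) * ?c) * ?Z \<le> tilt N x e * ?Z" by (simp add: mult_ac)
  then have "(1/2) ^ CARD('n) * ?c \<le> tilt N x e" using lapl_excess_pos[of N x] by simp
  then have h1: "(2 * 2 ^ CARD('n) * exp (N * ?d p1 / 2)) * ((1/2) ^ CARD('n) * ?c) \<le>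
      (2 * 2 ^ CARD('n) * exp (N * ?d p1 / 2)) * tilt N x e"
    by (intro mult_left_mono) auto
  have h2: "(2 * 2 ^ CARD('n) * exp (N * ?d p1 / 2)) * ((1/2) ^ CARD('n) * ?c) = e p1"
    by (simp add: power_one_over exp_minus field_simps)
  show ?thesis by (rule ord_eq_le_trans[OF h2[symmetric] h1])
qed

lemma tilt_affine_square:
  assumes N: "0 < N" and e: "\<And>p. p \<in> polar \<Longrightarrow> 0 \<le> e p" "\<And>p. e p = a - p \<bullet> q"
  shows "tilt N x (\<lambda>p. (e p)\<^sup>2) \<le> 16 * (2 ^ CARD('n)) ^ 3 * (tilt N x e)\<^sup>2"
proof -
  let ?d = "\<lambda>p. \<phi> x - p \<bullet> x"
  let ?n = "2 ^ CARD('n) :: real"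
  obtain p0 where p0: "p0 \<in> polar" "p0 \<bullet> x = \<phi> x" using polar_attained by blast
  have ce: "continuous_on UNIV e" unfolding e(2)[abs_def] by (intro continuous_intros)
  have pt: "(e p)\<^sup>2 \<le> (16 * ?n\<^sup>2 * (tilt N x e)\<^sup>2) * exp (N * ?d p / 2)" if p: "p \<in> polar" for p
  proof -
    \<comment> \<open>Applied at \<open>p\<close> itself, the square of
      \<open>affine_le_tilt\<close> would contain
      \<open>exp (N * (\<phi> x - p \<bullet> x))\<close>, which cancels the weight. Moving halfway
      to the maximizer \<open>p0\<close> halves the excess and loses only a factor 2 in
      \<open>e\<close>; the square is then covered by \<open>tilt_exp_excess\<close>.\<close>
    let ?p = "p0 + (1/2) *\<^sub>R (p - p0)"
    have in_p: "?p \<in> polar" by (rule convex_polar[OF p0(1) p]) auto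
    have d: "?d ?p = ?d p / 2" by (simp add: inner_add_left inner_diff_left p0(2) field_simps)
    have "e ?p = e p0 / 2 + e p / 2" by (simp add: e(2) inner_add_left inner_diff_left field_simps)
    then have "e p \<le> 2 * e ?p" using e(1)[OF p0(1)] by simp
    also have "\<dots> \<le> 2 * (2 * ?n * exp (N * ?d ?p / 2) * tilt N x e)"
      by (intro mult_left_mono affine_le_tilt[OF N e in_p]) auto
    finally have "e p \<le> 4 * ?n * exp (N * ?d p / 4) * tilt N x e" unfolding d by simp
    then have "(e p)\<^sup>2 \<le> (4 * ?n * exp (N * ?d p / 4) * tilt N x e)\<^sup>2" using e(1)[OF p] by (intro power_mono)
    also have "\<dots> = 16 * ?n\<^sup>2 * (tilt N x e)\<^sup>2 * (exp (N * ?d p / 4))\<^sup>2" by (simp add: power_mult_distrib)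
    also have "(exp (N * ?d p / 4))\<^sup>2 = exp (N * ?d p / 2)" by (simp add: power2_eq_square exp_add[symmetric])
    finally show ?thesis .
  qed
  have "tilt N x (\<lambda>p. (e p)\<^sup>2) \<le> tilt N x (\<lambda>p. (16 * ?n\<^sup>2 * (tilt N x e)\<^sup>2) * exp (N * ?d p / 2))"
    by (rule tilt_mono[OF _ _ pt]) (intro continuous_intros ce; simp)+
  also have "\<dots> \<le> (16 * ?n\<^sup>2 * (tilt N x e)\<^sup>2) * ?n"
    unfolding tilt_mult_left by (intro mult_left_mono tilt_exp_excess[OF N]) auto
  finally show ?thesis by (simp add: power2_eq_square power3_eq_cube mult_ac)
qed

text \<open>The barycentre of the tilted measure, which is the gradient at \<open>x\<close> of
  \<open>ln (lapl N x) / N\<close>.\<close>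

definition bary :: "real \<Rightarrow> real ^ 'n \<Rightarrow> real ^ 'n" where "bary N x = tilt N x (\<lambda>p. p)"

lemma bary_inner: "bary N x \<bullet> h = tilt N x (\<lambda>p. p \<bullet> h)"
  unfolding bary_def by (rule tilt_inner) (rule continuous_on_id)

lemma tilt_diff:
  fixes f g :: "real ^ 'n \<Rightarrow> real"
  assumes "continuous_on UNIV f" "continuous_on UNIV g"
  shows "tilt N x (\<lambda>p. f p - g p) = tilt N x f - tilt N x g"
  using tilt_add[OF assms(1), of "\<lambda>p. - 1 * g p" N x] assms(2)
  by (simp add: tilt_mult_left[of N x "-1" g, simplified] continuous_on_minus)

text \<open>A small mean excess puts the barycentre close to the boundary of \<open>polar\<close>,
  as \<open>x\<close> is a direction in which it is nearly maximal.\<close>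

lemma bary_dual_ge:
  assumes N: "0 < N" and x: "x \<noteq> 0"
  shows "1 - dual_norm \<phi> (bary N x) \<le> 2 * 2 ^ CARD('n) / (N * \<phi> x)"
proof -
  have px: "0 < \<phi> x" using phi_pos[OF x] .
  have "\<phi> x - bary N x \<bullet> x = tilt N x (\<lambda>p. \<phi> x - p \<bullet> x)"
    unfolding bary_inner by (subst tilt_diff) (auto intro!: continuous_intros simp: tilt_const)
  also have "\<dots> \<le> 2 * 2 ^ CARD('n) / N" by (rule tilt_excess[OF N])
  finally have "\<phi> x - 2 * 2 ^ CARD('n) / N \<le> dual_norm \<phi> (bary N x) * \<phi> x"
    using inner_le_dual[of "bary N x" x] by linarith
  then have "(1 - dual_norm \<phi> (bary N x)) * \<phi> x \<le> 2 * 2 ^ CARD('n) / N" by (simp add: left_diff_distrib)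
  then have "1 - dual_norm \<phi> (bary N x) \<le> 2 * 2 ^ CARD('n) / N / \<phi> x" by (simp only: pos_le_divide_eq[OF px])
  then show ?thesis by simp
qed

lemma bary_dual_le: "dual_norm \<phi> (bary N x) \<le> 1"
proof (rule dual_leI)
  fix q assume "\<phi> q \<le> 1"
  have "bary N x \<bullet> q \<le> tilt N x (\<lambda>p. 1)" unfolding bary_inner
    by (rule tilt_mono) (use polar_le[of _ q] \<open>\<phi> q \<le> 1\<close> in \<open>auto intro!: continuous_intros intro: order_trans\<close>)
  then show "bary N x \<bullet> q \<le> 1" by (simp add: tilt_const)
qed

text \<open>Up to sign and a constant, \<open>p \<bullet> q\<close> is
  \<open>e p = 1 - p \<bullet> q\<close>. This is nonnegative on \<open>polar\<close> since
  \<open>\<phi> q \<le> 1\<close>, and its mean is \<open>1 - dual_norm \<phi> (bary N x)\<close>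
  precisely because \<open>q\<close> lies in the subdifferential. The variance is at most the second
  moment, hence controlled by the square of that mean; \<open>64 = 16 * 2^2\<close> and
  \<open>5 = 3 + 2\<close>.\<close>

lemma tilt_variance:
  assumes N: "0 < N" and x: "x \<noteq> 0" and q: "q \<in> subdifferential (dual_norm \<phi>) (bary N x)"
  shows "tilt N x (\<lambda>p. ((p - bary N x) \<bullet> q)\<^sup>2) \<le> 64 * (2 ^ CARD('n)) ^ 5 / (N * \<phi> x)\<^sup>2"
proof -
  have q1: "\<phi> q \<le> 1" "bary N x \<bullet> q = dual_norm \<phi> (bary N x)" using q by (auto simp: subdiff_dual)
  define e where "e p = 1 - p \<bullet> q" for p
  have e0: "0 \<le> e p" if "p \<in> polar" for p using polar_le[OF that, of q] q1 by (simp add: e_def)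
  have ce: "continuous_on UNIV e" unfolding e_def[abs_def] by (intro continuous_intros)
  define E where "E = tilt N x e"
  have E: "E = 1 - dual_norm \<phi> (bary N x)"
    unfolding E_def e_def q1(2)[symmetric] bary_inner
    by (subst tilt_diff) (auto intro!: continuous_intros simp: tilt_const)
  have "tilt N x (\<lambda>p. ((p - bary N x) \<bullet> q)\<^sup>2) = tilt N x (\<lambda>p. (e p)\<^sup>2 + ((- 2 * E) * e p + E\<^sup>2))"
  proof -
    have eq: "(p - bary N x) \<bullet> q = E - e p" for p by (simp add: inner_diff_left q1 E e_def)
    have "((p - bary N x) \<bullet> q)\<^sup>2 = (e p)\<^sup>2 + ((- 2 * E) * e p + E\<^sup>2)" for p
      unfolding eq by (simp add: power2_eq_square algebra_simps)
    then show ?thesis by simp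
  qed
  also have "\<dots> = tilt N x (\<lambda>p. (e p)\<^sup>2) + ((- 2 * E) * E + E\<^sup>2)"
  proof -
    have "tilt N x (\<lambda>p. (- 2 * E) * e p + E\<^sup>2) = (- 2 * E) * E + E\<^sup>2"
    proof -
      have m: "tilt N x (\<lambda>p. (- 2 * E) * e p) = (- 2 * E) * E" unfolding E_def by (rule tilt_mult_left)
      have "continuous_on UNIV (\<lambda>p. (- 2 * E) * e p)" "continuous_on UNIV (\<lambda>p::real ^ 'n. E\<^sup>2)"
        by (intro continuous_intros ce)+
      from tilt_add[OF this, of N x] show ?thesis by (simp only: m tilt_const)
    qed
    then show ?thesis by (subst tilt_add) (auto intro!: continuous_intros ce)
  qed
  also have "\<dots> \<le> tilt N x (\<lambda>p. (e p)\<^sup>2)" by (simp add: power2_eq_square)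
  also have "\<dots> \<le> 16 * (2 ^ CARD('n)) ^ 3 * E\<^sup>2" unfolding E_def
    by (rule tilt_affine_square[OF N e0 e_def])
  also have "\<dots> \<le> 16 * (2 ^ CARD('n)) ^ 3 * (2 * 2 ^ CARD('n) / (N * \<phi> x))\<^sup>2"
    using bary_dual_ge[OF N x] bary_dual_le[of N x] unfolding E by (intro mult_left_mono power_mono) auto
  also have "\<dots> = 64 * (2 ^ CARD('n)) ^ 5 / (N * \<phi> x)\<^sup>2"
    by (simp add: power_divide power_mult_distrib eval_nat_numeral)
  finally show ?thesis .
qed

end

subsection \<open>Viscosity subsolutions enjoy comparison with cones\<close>

lemma exp_le_quadratic:
  assumes "\<bar>x\<bar> \<le> (1::real)" shows "exp x \<le> 1 + x + x\<^sup>2"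
proof (cases "0 \<le> x")
  case True
  then show ?thesis using exp_bound assms by simp
next
  case False
  define t where "t = - x"
  have t: "0 \<le> t" using False by (simp add: t_def)
  \<comment> \<open>For negative arguments the claim is multiplied by \<open>exp t\<close>; even
    with the quadratic Taylor bound in place of \<open>exp t\<close> the product is at least
    1.\<close>
  have "(1 - t + t\<^sup>2) * (1 + t + t\<^sup>2 / 2) = 1 + (t\<^sup>2 / 2 + t ^ 3 / 2 + t ^ 4 / 2)"
    by (simp add: power2_eq_square power3_eq_cube power4_eq_xxxx field_simps)
  then have "1 \<le> (1 - t + t\<^sup>2) * (1 + t + t\<^sup>2 / 2)" using t by simp
  also have "\<dots> \<le> (1 - t + t\<^sup>2) * exp t"
  proof (rule mult_left_mono)
    show "1 + t + t\<^sup>2 / 2 \<le> exp t" using t by (rule exp_lower_Taylor_quadratic)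
    have "0 \<le> (t - 1/2)\<^sup>2 + 3/4" by simp
    then show "0 \<le> 1 - t + t\<^sup>2" by (simp add: power2_eq_square algebra_simps)
  qed
  finally have "exp (- t) * 1 \<le> exp (- t) * ((1 - t + t\<^sup>2) * exp t)" by (intro mult_left_mono) auto
  also have "\<dots> = 1 - t + t\<^sup>2" by (simp add: exp_minus field_simps)
  finally show ?thesis by (simp add: t_def)
qed

section \<open>A smooth approximation of the cone with second-order control\<close>

context finsler begin

definition cappr :: "real \<Rightarrow> real ^ 'n \<Rightarrow> real" where "cappr N x = ln (lapl N x) / N"

text \<open>The variance of \<open>p \<bullet> h\<close> under the tilted measure;
  \<open>N * spread N x h\<close> is the second derivative of \<open>cappr N\<close> at
  \<open>x\<close> along \<open>h\<close>.\<close>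

definition spread :: "real \<Rightarrow> real ^ 'n \<Rightarrow> real ^ 'n \<Rightarrow> real" where
  "spread N x h = tilt N x (\<lambda>p. ((p - bary N x) \<bullet> h)\<^sup>2)"

lemma bary_inner_le:
  assumes "\<And>p. p \<in> polar \<Longrightarrow> norm p \<le> M" shows "\<bar>bary N x \<bullet> h\<bar> \<le> M * norm h"
proof -
  have le: "bary N x \<bullet> k \<le> M * norm k" for k
  proof -
    have "tilt N x (\<lambda>p. p \<bullet> k) \<le> tilt N x (\<lambda>p. M * norm k)"
    proof (rule tilt_mono)
      fix p assume "p \<in> polar"
      then have "norm p * norm k \<le> M * norm k" using assms by (intro mult_right_mono) auto
      then show "p \<bullet> k \<le> M * norm k" using norm_cauchy_schwarz[of p k] by linarith
    qed (intro continuous_intros)+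
    then show ?thesis by (simp add: bary_inner tilt_const)
  qed
  show ?thesis using le[of h] le[of "- h"] by (simp add: abs_le_iff)
qed

lemma centred_inner_le:
  assumes M: "\<And>p. p \<in> polar \<Longrightarrow> norm p \<le> M" and p: "p \<in> polar"
  shows "\<bar>(p - bary N x) \<bullet> h\<bar> \<le> 2 * M * norm h"
proof -
  have "norm p * norm h \<le> M * norm h" using M[OF p] by (intro mult_right_mono) auto
  then have "\<bar>p \<bullet> h\<bar> \<le> M * norm h" using Cauchy_Schwarz_ineq2[of p h] by linarith
  then show ?thesis using bary_inner_le[OF M, of N x h] by (simp add: inner_diff_left)
qed

lemma spread_nonneg: "0 \<le> spread N x h"
  using tilt_mono[of "\<lambda>p. 0" "\<lambda>p. ((p - bary N x) \<bullet> h)\<^sup>2" N x]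
  by (simp add: spread_def tilt_const continuous_intros)

lemma spread_le:
  assumes M: "\<And>p. p \<in> polar \<Longrightarrow> norm p \<le> M"
  shows "spread N x h \<le> (2 * M * norm h)\<^sup>2"
proof -
  have "spread N x h \<le> tilt N x (\<lambda>p. (2 * M * norm h)\<^sup>2)" unfolding spread_def
  proof (rule tilt_mono)
    fix p assume "p \<in> polar"
    from centred_inner_le[OF M this, of N x h] show "((p - bary N x) \<bullet> h)\<^sup>2 \<le> (2 * M * norm h)\<^sup>2"
      by (simp add: abs_le_square_iff[symmetric])
  qed (intro continuous_intros)+
  then show ?thesis by (simp add: tilt_const)
qed

text \<open>Apply \<open>exp s \<le> 1 + s + s^2\<close> under the tilted mean: the centred linear
  term vanishes, and \<open>ln (1 + s) \<le> s\<close> finishes. The quadratic coefficient is twice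
  that of Taylor's formula, the price of a one-sided bound without third derivatives.\<close>

lemma cappr_expansion:
  assumes N: "0 < N" and M: "\<And>p. p \<in> polar \<Longrightarrow> norm p \<le> M" and h: "N * (2 * M * norm h) \<le> 1"
  shows "cappr N (x + h) \<le> cappr N x + bary N x \<bullet> h + N * spread N x h"
proof -
  let ?b = "bary N x"
  let ?y = "\<lambda>p. (p - ?b) \<bullet> h"
  have "tilt N x (\<lambda>p. exp (N * (p \<bullet> h))) \<le> tilt N x (\<lambda>p. exp (N * (?b \<bullet> h)) * (1 + (N * ?y p + N\<^sup>2 * (?y p)\<^sup>2)))"
  proof (rule tilt_mono)
    fix p assume p: "p \<in> polar"
    have "\<bar>N * ?y p\<bar> = N * \<bar>?y p\<bar>" using N by (simp add: abs_mult)
    also have "\<dots> \<le> N * (2 * M * norm h)" using centred_inner_le[OF M p] N by (intro mult_left_mono) auto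
    finally have "exp (N * ?y p) \<le> 1 + N * ?y p + (N * ?y p)\<^sup>2" using h by (intro exp_le_quadratic) linarith
    then have "exp (N * (?b \<bullet> h)) * exp (N * ?y p) \<le> exp (N * (?b \<bullet> h)) * (1 + (N * ?y p + N\<^sup>2 * (?y p)\<^sup>2))"
      by (intro mult_left_mono) (auto simp: power_mult_distrib)
    moreover have "exp (N * (?b \<bullet> h)) * exp (N * ?y p) = exp (N * (p \<bullet> h))"
      by (simp add: exp_add[symmetric] inner_diff_left algebra_simps)
    ultimately show "exp (N * (p \<bullet> h)) \<le> exp (N * (?b \<bullet> h)) * (1 + (N * ?y p + N\<^sup>2 * (?y p)\<^sup>2))" by simp
  qed (intro continuous_intros)+
  also have "\<dots> = exp (N * (?b \<bullet> h)) * (1 + N\<^sup>2 * spread N x h)"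
  proof -
    have "tilt N x ?y = 0"
      unfolding inner_diff_left by (subst tilt_diff) (auto intro!: continuous_intros simp: tilt_const bary_inner)
    then have "tilt N x (\<lambda>p. N * ?y p) = 0" unfolding tilt_mult_left by simp
    moreover have "tilt N x (\<lambda>p. N\<^sup>2 * (?y p)\<^sup>2) = N\<^sup>2 * spread N x h" unfolding tilt_mult_left spread_def ..
    moreover have "tilt N x (\<lambda>p. 1 + (N * ?y p + N\<^sup>2 * (?y p)\<^sup>2)) =
        tilt N x (\<lambda>p. 1) + (tilt N x (\<lambda>p. N * ?y p) + tilt N x (\<lambda>p. N\<^sup>2 * (?y p)\<^sup>2))"
      by (subst tilt_add, (intro continuous_intros)+)+ (rule refl)
    ultimately show ?thesis unfolding tilt_mult_left using N by (simp add: tilt_const spread_def)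
  qed
  finally have "lapl N (x + h) \<le> lapl N x * (exp (N * (?b \<bullet> h)) * (1 + N\<^sup>2 * spread N x h))"
    unfolding lapl_shift[of N x h] using lapl_pos[of N x] by (intro mult_left_mono) auto
  then have "ln (lapl N (x + h)) \<le> ln (lapl N x * (exp (N * (?b \<bullet> h)) * (1 + N\<^sup>2 * spread N x h)))"
    using lapl_pos[of N "x + h"] by (subst ln_le_cancel_iff) auto
  also have "\<dots> = ln (lapl N x) + (N * (?b \<bullet> h) + ln (1 + N\<^sup>2 * spread N x h))"
  proof -
    have "0 < 1 + N\<^sup>2 * spread N x h" using spread_nonneg[of N x h] by (simp add: add_pos_nonneg)
    then show ?thesis using lapl_pos[of N x] by (simp add: ln_mult)
  qed
  also have "ln (1 + N\<^sup>2 * spread N x h) \<le> N\<^sup>2 * spread N x h"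
    using spread_nonneg[of N x h] by (intro ln_add_one_self_le_self) auto
  finally have "ln (lapl N (x + h)) / N \<le> (ln (lapl N x) + (N * (?b \<bullet> h) + N\<^sup>2 * spread N x h)) / N"
    using N by (intro divide_right_mono) auto
  also have "\<dots> = cappr N x + ?b \<bullet> h + N * spread N x h"
    using N by (simp add: cappr_def add_divide_distrib power2_eq_square)
  finally show ?thesis by (simp add: cappr_def)
qed

lemma continuous_cappr:
  assumes N: "0 < N" shows "continuous_on S (cappr N)"
proof -
  obtain M where M: "0 < M" "\<And>p. p \<in> polar \<Longrightarrow> norm p \<le> M" using polar_bounded by blast
  have le: "cappr N x \<le> cappr N y + M * norm (x - y)" for x y
  proof -
    have "tilt N y (\<lambda>p. exp (N * (p \<bullet> (x - y)))) \<le> tilt N y (\<lambda>p. exp (N * (M * norm (x - y))))"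
    proof (rule tilt_mono)
      fix p assume "p \<in> polar"
      then have "norm p * norm (x - y) \<le> M * norm (x - y)" using M by (intro mult_right_mono) auto
      then have "p \<bullet> (x - y) \<le> M * norm (x - y)" using norm_cauchy_schwarz[of p "x - y"] by linarith
      then show "exp (N * (p \<bullet> (x - y))) \<le> exp (N * (M * norm (x - y)))" using N by simp
    qed (intro continuous_intros)+
    then have "lapl N (y + (x - y)) \<le> lapl N y * exp (N * (M * norm (x - y)))"
      unfolding lapl_shift[of N y "x - y"] tilt_const using lapl_pos[of N y] by (intro mult_left_mono) auto
    then have "ln (lapl N x) \<le> ln (lapl N y * exp (N * (M * norm (x - y))))"
      using lapl_pos[of N x] by (subst ln_le_cancel_iff) auto
    also have "\<dots> = ln (lapl N y) + N * (M * norm (x - y))" using lapl_pos[of N y] by (simp add: ln_mult)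
    finally have "ln (lapl N x) / N \<le> (ln (lapl N y) + N * (M * norm (x - y))) / N" using N by (intro divide_right_mono) auto
    then show ?thesis using N by (simp add: cappr_def add_divide_distrib)
  qed
  have "M-lipschitz_on S (cappr N)"
  proof (rule lipschitz_onI)
    show "dist (cappr N x) (cappr N y) \<le> M * dist x y" for x y
      using le[of x y] le[of y x] by (simp add: dist_norm norm_minus_commute abs_le_iff)
  qed (use M in simp)
  then show ?thesis by (rule lipschitz_on_continuous_on)
qed

text \<open>With the maximal value factored out, the integral is at most the volume of
  \<open>polar\<close>; contracting by \<open>1 / N\<close> towards a maximizer shows that it is at
  least a constant times \<open>(1 / N) ^ CARD('n)\<close>. Taking logarithms and dividing by
  \<open>N\<close> leaves an error of order \<open>ln N / N\<close>.\<close>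

lemma cappr_close:
  assumes d: "0 < d"
  shows "\<forall>\<^sub>F N in at_top. \<forall>x. \<phi> x \<le> R \<longrightarrow> \<bar>cappr N x - \<phi> x\<bar> \<le> d"
proof -
  obtain m M where M: "0 < m" "0 < M" "\<And>x. m * norm x \<le> \<phi> x" "\<And>x. \<phi> x \<le> M * norm x" using phi_bounds by metis
  \<comment> \<open>Bounds the excess \<open>\<phi> x - p \<bullet> x\<close> over
    \<open>polar\<close> as long as \<open>\<phi> x \<le> R\<close>.\<close>
  define D where "D = R + M * (R / m)"
  let ?P = "measure lborel polar"
  define C where "C = \<bar>D\<bar> + \<bar>ln ?P\<bar>"
  have "((\<lambda>N. real CARD('n) * (ln N / N) + C / N) \<longlongrightarrow> real CARD('n) * 0 + 0) at_top"
    by (intro tendsto_intros ln_x_over_x_tendsto_0 tendsto_divide_0[OF tendsto_const] filterlim_at_top_imp_at_infinity filterlim_ident)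
  then have "\<forall>\<^sub>F N in at_top. real CARD('n) * (ln N / N) + C / N < d" using order_tendstoD(2) d by fastforce
  moreover have "\<forall>\<^sub>F N in at_top. (1::real) \<le> N" by (rule eventually_ge_at_top)
  ultimately show ?thesis
  proof eventually_elim
    case (elim N)
    then have N: "0 < N" by simp
    show ?case
    proof (intro allI impI)
      fix x assume x: "\<phi> x \<le> R"
      let ?Z = "LINT p:polar|lborel. exp (- (N * (\<phi> x - p \<bullet> x)))"
      have Zpos: "0 < ?Z" by (rule lapl_excess_pos)
      have cint: "(LINT p:polar|lborel. c) = c * ?P" for c :: real
        using has_bochner_integral_integral_eq[OF has_bochner_integral_indicator[OF _ polar_fmeasurable, of c]] compact_polar
        by (simp add: set_lebesgue_integral_def borel_compact mult.commute)
      have eq: "cappr N x - \<phi> x = ln ?Z / N"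
        unfolding cappr_def lapl_eq using Zpos N by (simp add: ln_mult add_divide_distrib)
      have "?Z \<le> (LINT p:polar|lborel. 1)"
        by (rule set_integral_mono) (use N polar_le in \<open>auto intro!: polar_integrable continuous_intros\<close>)
      then have "?Z \<le> ?P" by (simp add: cint)
      then have up: "ln ?Z \<le> ln ?P" using Zpos polar_measure_pos by simp
      have dD: "\<phi> x - p \<bullet> x \<le> D" if p: "p \<in> polar" for p
      proof -
        have "- (p \<bullet> x) \<le> \<phi> (- x)" using polar_le[OF p, of "- x"] by simp
        also have "\<dots> \<le> M * norm x" using M(4)[of "- x"] by simp
        also have "norm x \<le> R / m" using M(1) M(3)[of x] x by (simp add: field_simps)
        finally show ?thesis using x M(2) by (simp add: D_def)
      qed
      have "exp (- D) * ?P = (LINT p:polar|lborel. exp (- D))" by (rule cint[symmetric])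
      also have "\<dots> \<le> (LINT p:polar|lborel. exp (- (N * (1 / N) * (\<phi> x - p \<bullet> x))))"
      proof (rule set_integral_mono)
        fix p assume "p \<in> polar"
        from dD[OF this] N show "exp (- D) \<le> exp (- (N * (1 / N) * (\<phi> x - p \<bullet> x)))" by simp
      qed (intro polar_integrable continuous_intros)+
      finally have "(1 / N) ^ CARD('n) * (exp (- D) * ?P) \<le>
          (1 / N) ^ CARD('n) * (LINT p:polar|lborel. exp (- (N * (1 / N) * (\<phi> x - p \<bullet> x))))"
        using N by (intro mult_left_mono) auto
      also have "\<dots> \<le> ?Z" using elim by (intro excess_scaling[OF N]) auto
      finally have "ln ((1 / N) ^ CARD('n) * (exp (- D) * ?P)) \<le> ln ?Z"
        using Zpos N polar_measure_pos by (subst ln_le_cancel_iff) auto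
      moreover have "ln ((1 / N) ^ CARD('n) * (exp (- D) * ?P)) = real CARD('n) * ln (1 / N) + (- D + ln ?P)"
        using N polar_measure_pos by (simp add: ln_mult ln_realpow)
      ultimately have "- (real CARD('n) * ln N) - D + ln ?P \<le> ln ?Z" using N by (simp add: ln_div)
      moreover have "0 \<le> real CARD('n) * ln N" using elim by simp
      ultimately have "\<bar>ln ?Z\<bar> \<le> real CARD('n) * ln N + C" using up unfolding C_def by linarith
      then have "\<bar>ln ?Z\<bar> / N \<le> (real CARD('n) * ln N + C) / N" using N by (intro divide_right_mono) auto
      also have "\<dots> \<le> d" using elim by (simp add: add_divide_distrib)
      finally show "\<bar>cappr N x - \<phi> x\<bar> \<le> d" unfolding eq using N by simp
    qed
  qed
qed

lemma spread_matrix: "\<exists>L :: real ^ 'n ^ 'n. \<forall>h. (L *v h) \<bullet> h = spread N x h"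
proof -
  let ?b = "bary N x"
  define l where "l h = tilt N x (\<lambda>p. ((p - ?b) \<bullet> h) *\<^sub>R (p - ?b))" for h
  have "linear l"
  proof (rule linearI)
    fix h k
    have "continuous_on UNIV (\<lambda>p. ((p - ?b) \<bullet> h) *\<^sub>R (p - ?b))" "continuous_on UNIV (\<lambda>p. ((p - ?b) \<bullet> k) *\<^sub>R (p - ?b))"
      by (intro continuous_intros)+
    from tilt_add[OF this, of N x] show "l (h + k) = l h + l k"
      by (simp add: l_def inner_add_right scaleR_add_left)
  next
    fix h and c :: real
    show "l (c *\<^sub>R h) = c *\<^sub>R l h"
      using tilt_scaleR[of N x c "\<lambda>p. ((p - ?b) \<bullet> h) *\<^sub>R (p - ?b)"] by (simp add: l_def)
  qed
  then have "matrix l *v h = l h" for h by (simp add: matrix_works linear_matrix_vector_mul_eq)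
  moreover have "l h \<bullet> h = spread N x h" for h
    unfolding l_def spread_def
    by (subst tilt_inner) (auto intro!: continuous_intros simp: power2_eq_square)
  ultimately have "\<forall>h. (matrix l *v h) \<bullet> h = spread N x h" by simp
  then show ?thesis by blast
qed

lemma rank_one_matrix:
  fixes b :: "real ^ 'n"
  shows "\<exists>B :: real ^ 'n ^ 'n. \<forall>h. (B *v h) \<bullet> h = (b \<bullet> h)\<^sup>2"
proof -
  have "linear (\<lambda>h. (b \<bullet> h) *\<^sub>R b)" by (rule linearI) (auto simp: inner_add_right scaleR_add_left)
  then have "matrix (\<lambda>h. (b \<bullet> h) *\<^sub>R b) *v h = (b \<bullet> h) *\<^sub>R b" for h by (simp add: matrix_works linear_matrix_vector_mul_eq)
  then show ?thesis by (intro exI[of _ "matrix (\<lambda>h. (b \<bullet> h) *\<^sub>R b)"]) (simp add: power2_eq_square)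
qed

text \<open>The function \<open>\<mu> * s - \<epsilon> * s^2\<close> increases for
  \<open>s \<le> \<mu> / (2 * \<epsilon>)\<close>, so the one-sided expansion of
  \<open>cappr\<close> can be inserted into it. The square contributes a negative rank-one form, the
  source of strictness; the factors 2 in \<open>X\<close> answer the division by 2 in
  \<open>superjet\<close>.\<close>

lemma superjet_concave_cappr:
  assumes N: "0 < N" and \<epsilon>: "0 < \<epsilon>" and c: "2 * \<epsilon> * cappr N x < \<mu>"
    and X: "\<And>h. (X *v h) \<bullet> h = 2 * (\<mu> - 2 * \<epsilon> * cappr N x) * N * spread N x h - 2 * \<epsilon> * (bary N x \<bullet> h)\<^sup>2"
  shows "superjet (\<lambda>y. \<mu> * cappr N y - \<epsilon> * (cappr N y)\<^sup>2) x ((\<mu> - 2 * \<epsilon> * cappr N x) *\<^sub>R bary N x) X"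
  unfolding superjet_def
proof (intro allI impI)
  fix e :: real assume e: "0 < e"
  obtain M where M: "0 < M" "\<And>p. p \<in> polar \<Longrightarrow> norm p \<le> M" using polar_bounded by blast
  let ?c = "cappr N x" and ?b = "bary N x"
  let ?t = "\<lambda>h. ?b \<bullet> h + N * spread N x h"
  \<comment> \<open>This bound and the limits below yield three conditions on \<open>h\<close>: the
    argument stays where the quadratic increases, \<open>cappr_expansion\<close> applies, and the
    cubic cross term of the square is at most \<open>e * (norm h)^2\<close>.\<close>
  have t_le: "?t h \<le> M * norm h + N * (2 * M * norm h)\<^sup>2" for h
    using bary_inner_le[OF M(2), of N x h] mult_left_mono[OF spread_le[OF M(2), of N x h], of N] N by linarith
  have nl: "((\<lambda>h::real ^ 'n. norm h) \<longlongrightarrow> norm (0 :: real ^ 'n)) (nhds 0)" by (rule tendsto_norm[OF filterlim_ident])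
  have "((\<lambda>h::real ^ 'n. M * norm h + N * (2 * M * norm h)\<^sup>2) \<longlongrightarrow> M * norm (0 :: real ^ 'n) + N * (2 * M * norm (0 :: real ^ 'n))\<^sup>2) (nhds 0)"
    by (intro tendsto_intros nl)
  then have lim1: "((\<lambda>h::real ^ 'n. M * norm h + N * (2 * M * norm h)\<^sup>2) \<longlongrightarrow> 0) (nhds 0)" by simp
  have "((\<lambda>h::real ^ 'n. N * (2 * M * norm h)) \<longlongrightarrow> N * (2 * M * norm (0 :: real ^ 'n))) (nhds 0)" by (intro tendsto_intros nl)
  then have lim2: "((\<lambda>h::real ^ 'n. N * (2 * M * norm h)) \<longlongrightarrow> 0) (nhds 0)" by simp
  have "((\<lambda>h::real ^ 'n. 2 * \<epsilon> * (M * norm h) * N * (2 * M)\<^sup>2) \<longlongrightarrow> 2 * \<epsilon> * (M * norm (0 :: real ^ 'n)) * N * (2 * M)\<^sup>2) (nhds 0)"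
    by (intro tendsto_intros nl)
  then have lim3: "((\<lambda>h::real ^ 'n. 2 * \<epsilon> * (M * norm h) * N * (2 * M)\<^sup>2) \<longlongrightarrow> 0) (nhds 0)" by simp
  have "\<forall>\<^sub>F h in nhds (0 :: real ^ 'n). M * norm h + N * (2 * M * norm h)\<^sup>2 < \<mu> / (2 * \<epsilon>) - ?c"
    by (rule order_tendstoD(2)[OF lim1]) (use c \<epsilon> in \<open>simp add: field_simps\<close>)
  moreover have "\<forall>\<^sub>F h in nhds (0 :: real ^ 'n). N * (2 * M * norm h) < 1" by (rule order_tendstoD(2)[OF lim2]) simp
  moreover have "\<forall>\<^sub>F h in nhds (0 :: real ^ 'n). 2 * \<epsilon> * (M * norm h) * N * (2 * M)\<^sup>2 < e" by (rule order_tendstoD(2)[OF lim3 e])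
  ultimately show "\<forall>\<^sub>F h in nhds 0. \<mu> * cappr N (x + h) - \<epsilon> * (cappr N (x + h))\<^sup>2 \<le> \<mu> * ?c - \<epsilon> * ?c\<^sup>2
      + ((\<mu> - 2 * \<epsilon> * ?c) *\<^sub>R ?b) \<bullet> h + (X *v h) \<bullet> h / 2 + e * (norm h)\<^sup>2"
  proof eventually_elim
    case (elim h)
    let ?Q = "spread N x h"
    have ex: "cappr N (x + h) \<le> ?c + ?t h" using cappr_expansion[OF N M(2), of h x] elim(2) by simp
    have mono: "\<mu> * s - \<epsilon> * s\<^sup>2 \<le> \<mu> * r - \<epsilon> * r\<^sup>2" if "s \<le> r" "r \<le> \<mu> / (2 * \<epsilon>)" for s r :: real
    proof -
      have "2 * \<epsilon> * r \<le> \<mu>" using that(2) \<epsilon> by (simp add: field_simps)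
      moreover have "\<epsilon> * s \<le> \<epsilon> * r" using that(1) \<epsilon> by simp
      ultimately have "0 \<le> (r - s) * (\<mu> - \<epsilon> * r - \<epsilon> * s)" using that(1) by (intro mult_nonneg_nonneg) linarith+
      then show ?thesis by (simp add: power2_eq_square algebra_simps)
    qed
    have "?c + ?t h \<le> \<mu> / (2 * \<epsilon>)" using t_le[of h] elim(1) by linarith
    from mono[OF ex this] have "\<mu> * cappr N (x + h) - \<epsilon> * (cappr N (x + h))\<^sup>2 \<le> \<mu> * (?c + ?t h) - \<epsilon> * (?c + ?t h)\<^sup>2" .
    also have "\<dots> = \<mu> * ?c - \<epsilon> * ?c\<^sup>2 + (\<mu> - 2 * \<epsilon> * ?c) * ?t h - \<epsilon> * (?t h)\<^sup>2"
      by (simp add: power2_eq_square algebra_simps)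
    finally have 1: "\<mu> * cappr N (x + h) - \<epsilon> * (cappr N (x + h))\<^sup>2
      \<le> \<mu> * ?c - \<epsilon> * ?c\<^sup>2 + (\<mu> - 2 * \<epsilon> * ?c) * ?t h - \<epsilon> * (?t h)\<^sup>2" .
    have 2: "- \<epsilon> * (?t h)\<^sup>2 \<le> - \<epsilon> * (?b \<bullet> h)\<^sup>2 + e * (norm h)\<^sup>2"
    proof -
      have bb: "\<bar>?b \<bullet> h\<bar> \<le> M * norm h" by (rule bary_inner_le[OF M(2)])
      have "- (?b \<bullet> h) * (N * ?Q) \<le> (M * norm h) * (N * ?Q)"
        using bb N spread_nonneg[of N x h] by (intro mult_right_mono) auto
      moreover have "(?t h)\<^sup>2 = (?b \<bullet> h)\<^sup>2 + 2 * ((?b \<bullet> h) * (N * ?Q)) + (N * ?Q)\<^sup>2"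
        by (simp add: power2_eq_square algebra_simps)
      moreover have "0 \<le> (N * ?Q)\<^sup>2" by simp
      ultimately have "- (?t h)\<^sup>2 \<le> - (?b \<bullet> h)\<^sup>2 + 2 * (M * norm h) * (N * ?Q)"
        by (simp only: mult_minus_left mult.assoc)
      then have "\<epsilon> * - (?t h)\<^sup>2 \<le> \<epsilon> * (- (?b \<bullet> h)\<^sup>2 + 2 * (M * norm h) * (N * ?Q))" using \<epsilon> by (intro mult_left_mono) auto
      also have "\<dots> = - \<epsilon> * (?b \<bullet> h)\<^sup>2 + 2 * \<epsilon> * (M * norm h) * N * ?Q" by (simp add: algebra_simps)
      also have "2 * \<epsilon> * (M * norm h) * N * ?Q \<le> 2 * \<epsilon> * (M * norm h) * N * (2 * M * norm h)\<^sup>2"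
        using \<epsilon> M(1) N by (intro mult_left_mono spread_le M(2)) auto
      also have "\<dots> = (2 * \<epsilon> * (M * norm h) * N * (2 * M)\<^sup>2) * (norm h)\<^sup>2" by (simp add: power_mult_distrib)
      also have "\<dots> \<le> e * (norm h)\<^sup>2" using elim(3) by (intro mult_right_mono) auto
      finally show ?thesis by simp
    qed
    have 3: "((\<mu> - 2 * \<epsilon> * ?c) *\<^sub>R ?b) \<bullet> h + (X *v h) \<bullet> h / 2 = (\<mu> - 2 * \<epsilon> * ?c) * ?t h - \<epsilon> * (?b \<bullet> h)\<^sup>2"
      unfolding X inner_scaleR_left by (simp add: field_simps)
    show ?case using 1 2 3 by (simp only: mult_minus_left)
  qed
qed

text \<open>Against a concave function of the smooth approximation the curvature of the cone in directions
  of the subdifferential, of order \<open>1 / N\<close>, is beaten by the concavity, which does not depend on \<open>N\<close>.\<close>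

lemma superjet_cone_negative:
  assumes N: "0 < N" and \<epsilon>: "0 < \<epsilon>" and x: "0 < r" "r \<le> \<phi> x"
    and c: "- \<mu> / (2 * \<epsilon>) \<le> cappr N x" "2 * \<epsilon> * cappr N x < \<mu>"
    and N1: "4 * 2 ^ CARD('n) / r \<le> N" and N2: "512 * (2 ^ CARD('n)) ^ 5 * \<mu> / (\<epsilon> * r\<^sup>2) < N"
  obtains X where "superjet (\<lambda>y. \<mu> * cappr N y - \<epsilon> * (cappr N y)\<^sup>2) x ((\<mu> - 2 * \<epsilon> * cappr N x) *\<^sub>R bary N x) X"
    "G_upper \<phi> ((\<mu> - 2 * \<epsilon> * cappr N x) *\<^sub>R bary N x) X < 0"
proof -
  let ?b = "bary N x"
  define g where "g = \<mu> - 2 * \<epsilon> * cappr N x"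
  have g: "0 < g" using c(2) by (simp add: g_def)
  \<comment> \<open>\<open>cappr\<close> may be negative, which makes \<open>g\<close> larger than
    \<mu>; the hypothesis limits this to a factor 2.\<close>
  have "- \<mu> \<le> 2 * \<epsilon> * cappr N x" using c(1) \<epsilon> by (simp add: field_simps)
  then have g2: "g \<le> 2 * \<mu>" by (simp add: g_def)
  then have \<mu>: "0 < \<mu>" using g by simp
  obtain L :: "real ^ 'n ^ 'n" where L: "\<And>h. (L *v h) \<bullet> h = spread N x h" using spread_matrix[of N x] by blast
  obtain B :: "real ^ 'n ^ 'n" where B: "\<And>h. (B *v h) \<bullet> h = (?b \<bullet> h)\<^sup>2" using rank_one_matrix[of ?b] by blast
  define X where "X = (2 * g * N) *\<^sub>R L - (2 * \<epsilon>) *\<^sub>R B"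
  have X: "(X *v h) \<bullet> h = 2 * g * N * spread N x h - 2 * \<epsilon> * (?b \<bullet> h)\<^sup>2" for h
    unfolding X_def by (simp add: matrix_vector_mult_diff_rdistrib inner_diff_left scaleR_matrix_vector_assoc[symmetric] L B)
  have jet: "superjet (\<lambda>y. \<mu> * cappr N y - \<epsilon> * (cappr N y)\<^sup>2) x (g *\<^sub>R ?b) X"
    unfolding g_def by (rule superjet_concave_cappr[OF N \<epsilon> c(2)]) (simp add: X g_def)
  have px: "0 < \<phi> x" using x by linarith
  then have x0: "x \<noteq> 0" by auto
  obtain q where q: "q \<in> subdifferential (dual_norm \<phi>) (g *\<^sub>R ?b)" "G_upper \<phi> (g *\<^sub>R ?b) X = (X *v q) \<bullet> q"
    by (rule G_upper_attained)
  \<comment> \<open>The subdifferential of the dual norm is unchanged when its argument is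
    multiplied by a positive number.\<close>
  have qb: "\<phi> q \<le> 1" "?b \<bullet> q = dual_norm \<phi> ?b"
    using q(1) g unfolding subdiff_dual by (auto simp: dual_scale)
  then have qF: "q \<in> subdifferential (dual_norm \<phi>) ?b" by (simp add: subdiff_dual)
  \<comment> \<open>By \<open>N1\<close> the barycentre has dual norm at least 1/2, so the concave
    term contributes at least \<open>\<epsilon> / 4\<close>.\<close>
  have "4 * 2 ^ CARD('n) \<le> N * r" using N1 x(1) by (simp add: field_simps)
  also have "\<dots> \<le> N * \<phi> x" using x N by simp
  finally have Nx: "4 * 2 ^ CARD('n) \<le> N * \<phi> x" .
  have "1 - dual_norm \<phi> ?b \<le> 2 * 2 ^ CARD('n) / (N * \<phi> x)" by (rule bary_dual_ge[OF N x0])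
  also have "\<dots> \<le> 1 / 2" using Nx N px by (simp add: field_simps)
  finally have "1/2 \<le> ?b \<bullet> q" using qb by simp
  then have "(1/2)\<^sup>2 \<le> (?b \<bullet> q)\<^sup>2" by (intro power_mono) auto
  then have b2: "\<epsilon> / 4 \<le> \<epsilon> * (?b \<bullet> q)\<^sup>2" using \<epsilon> by (simp add: power2_eq_square)
  have "spread N x q \<le> 64 * (2 ^ CARD('n)) ^ 5 / (N * \<phi> x)\<^sup>2"
    unfolding spread_def by (rule tilt_variance[OF N x0 qF])
  also have "\<dots> \<le> 64 * (2 ^ CARD('n)) ^ 5 / (N * r)\<^sup>2"
    using N x px by (intro divide_left_mono power_mono mult_left_mono mult_pos_pos zero_less_power) auto
  finally have sp: "spread N x q \<le> 64 * (2 ^ CARD('n)) ^ 5 / (N * r)\<^sup>2" .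
  \<comment> \<open>The curvature term is at most
    \<open>128 * (2 ^ CARD('n)) ^ 5 * \<mu> / (N * r^2)\<close>; the 512 in \<open>N2\<close> is
    four times 128 and pushes it below \<open>\<epsilon> / 4\<close>.\<close>
  have "g * N * spread N x q \<le> (2 * \<mu> * N) * (64 * (2 ^ CARD('n)) ^ 5 / (N * r)\<^sup>2)"
    using g g2 N \<mu> by (intro mult_mono sp spread_nonneg) auto
  also have "\<dots> = (512 * (2 ^ CARD('n)) ^ 5 * \<mu> / (\<epsilon> * r\<^sup>2)) * (\<epsilon> / 4) / N"
    using N \<epsilon> x(1) by (simp add: power2_eq_square field_simps)
  also have "\<dots> < N * (\<epsilon> / 4) / N" using N2 N \<epsilon> by (intro divide_strict_right_mono mult_strict_right_mono) auto
  also have "\<dots> = \<epsilon> / 4" using N by simp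
  finally have "(X *v q) \<bullet> q < 0" unfolding X using b2 by linarith
  then show ?thesis using that[of X] jet q(2) unfolding g_def by simp
qed

lemma superjet_local_max:
  assumes "superjet w x p X" "\<forall>\<^sub>F y in nhds x. u y - w y \<le> u x - w x"
  shows "superjet u x p X"
  unfolding superjet_def
proof (intro allI impI)
  fix e :: real assume "0 < e"
  from assms(1)[unfolded superjet_def, rule_format, OF this] eventually_nhds_shift[THEN iffD2, OF assms(2)]
  show "\<forall>\<^sub>F h in nhds 0. u (x + h) \<le> u x + p \<bullet> h + (X *v h) \<bullet> h / 2 + e * (norm h)\<^sup>2"
    by eventually_elim simp
qed

lemma superjet_translate:
  assumes "superjet w (x - z) p X" shows "superjet (\<lambda>y. w (y - z)) x p X"
  using assms unfolding superjet_def by (simp add: add_diff_eq[symmetric] diff_add_eq)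

text \<open>If \<open>u\<close> minus a cone is larger by \<kappa> at an interior point than on the
  frontier, there is still an interior maximum after the cone is replaced by a perturbation at
  distance at most \<open>\<kappa> / 8\<close>. At this maximum a superjet of the perturbation with
  negative \<open>G_upper\<close> passes to \<open>u\<close>.\<close>

lemma Sub_imp_CCA:
  assumes U: "open U" and cont: "continuous_on U u" and sub: "u \<in> Sub \<phi> U"
  shows "u \<in> CCA \<phi> U"
  unfolding CCA_iff[OF cont]
proof (intro allI impI ballI)
  fix V z x and \<mu> :: real assume V: "open V \<and> V \<subset>\<subset> U \<and> z \<notin> V \<and> 0 < \<mu>" and x: "x \<in> V"
  let ?f = "\<lambda>x. u x - \<mu> * \<phi> (x - z)"
  show "\<exists>y\<in>frontier V. ?f x \<le> ?f y"
  proof (rule ccontr)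
    assume neg: "\<not> (\<exists>y\<in>frontier V. ?f x \<le> ?f y)"
    have VU: "open V" "V \<subset>\<subset> U" "z \<notin> V" "0 < \<mu>" using V by auto
    note cc = compactly_containedD[OF VU(2)]
    have contf: "continuous_on A ?f" if "A \<subseteq> U" for A
      using continuous_on_subset[OF cont that] by (intro continuous_intros)
    have ne: "frontier V \<noteq> {}" using frontier_nonempty_compactly_contained[OF VU(2)] x by blast
    obtain b where b: "b \<in> frontier V" "\<And>y. y \<in> frontier V \<Longrightarrow> ?f y \<le> ?f b"
      using continuous_attains_sup[OF cc(3) ne contf[OF cc(4)]] by metis
    define m where "m = ?f b"
    define \<kappa> where "\<kappa> = ?f x - m"
    have \<kappa>: "0 < \<kappa>" using neg b(1) not_le unfolding \<kappa>_def m_def by fastforce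
    have fr: "y \<in> V \<or> ?f y \<le> m" if "y \<in> closure V" for y
      using that b(2)[of y] interior_open[OF VU(1)] by (auto simp: frontier_def m_def)
    have xcl: "x \<in> closure V" using x closure_subset by blast
    \<comment> \<open>The curvature bound of \<open>superjet_cone_negative\<close> degenerates at
      the vertex, so the maximum must be kept away from \<open>z\<close>. As \<open>z\<close> is
      outside \<open>V\<close>, near it the difference exceeds the frontier maximum by at most
      \<open>\<kappa> / 2\<close>.\<close>
    have "\<exists>S. open S \<and> z \<in> S \<and> (\<forall>y\<in>closure V \<inter> S. ?f y \<le> m + \<kappa> / 2)"
    proof (cases "z \<in> closure V")
      case True
      then have "?f z \<le> m" using fr VU(3) by blast
      obtain d where d: "0 < d" "\<And>y. y \<in> closure V \<Longrightarrow> dist y z < d \<Longrightarrow> dist (?f y) (?f z) < \<kappa> / 2"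
        using contf[OF cc(2)] True \<kappa> unfolding continuous_on_iff by (metis half_gt_zero)
      have "?f y \<le> m + \<kappa> / 2" if "y \<in> closure V \<inter> ball z d" for y
      proof -
        have "y \<in> closure V" "dist y z < d" using that by (auto simp: dist_commute)
        from d(2)[OF this] show ?thesis using \<open>?f z \<le> m\<close> unfolding dist_real_def by linarith
      qed
      then show ?thesis using d(1) by (intro exI[of _ "ball z d"]) auto
    qed (auto intro!: exI[of _ "- closure V"])
    then obtain S where S: "open S" "z \<in> S" "\<And>y. y \<in> closure V \<Longrightarrow> y \<in> S \<Longrightarrow> ?f y \<le> m + \<kappa> / 2" by blast
    obtain r where r: "0 < r" "\<And>s. s \<le> r \<Longrightarrow> pball z s \<subseteq> S" using pball_subset_open[OF S(1,2)] by blast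
    have "bounded ((\<lambda>y. \<phi> (y - z)) ` closure V)"
      by (intro compact_imp_bounded compact_continuous_image cc continuous_intros)
    then obtain R where R: "0 < R" "\<And>y. y \<in> closure V \<Longrightarrow> \<phi> (y - z) \<le> R"
      unfolding bounded_pos by (auto simp: abs_le_iff)
    \<comment> \<open>The first bound keeps the values of \<open>cappr\<close> where
      \<open>\<mu> * s - \<epsilon> * s^2\<close> increases, the second makes the concave term at
      most \<open>\<kappa> / 16\<close> on the closure of \<open>V\<close>.\<close>
    define \<epsilon> where "\<epsilon> = min (\<mu> / (4 * (R + 1))) (\<kappa> / (16 * (R + 1)\<^sup>2))"
    have \<epsilon>: "0 < \<epsilon>" "\<epsilon> \<le> \<mu> / (4 * (R + 1))" "\<epsilon> \<le> \<kappa> / (16 * (R + 1)\<^sup>2)"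
      using VU(4) \<kappa> R(1) by (auto simp: \<epsilon>_def)
    have \<epsilon>\<mu>: "\<epsilon> * (4 * (R + 1)) \<le> \<mu>" using \<epsilon>(2) R(1) by (simp add: field_simps)
    have \<epsilon>\<kappa>: "\<epsilon> * (R + 1)\<^sup>2 \<le> \<kappa> / 16"
    proof -
      have "\<epsilon> * (R + 1)\<^sup>2 \<le> \<kappa> / (16 * (R + 1)\<^sup>2) * (R + 1)\<^sup>2" using \<epsilon>(3) by (intro mult_right_mono) auto
      also have "\<dots> = \<kappa> / 16" using R(1) by simp
      finally show ?thesis .
    qed
    \<comment> \<open>The error of \<open>cappr\<close> is capped by 1/2, so that its values stay
      between \<open>- (1/2)\<close> and \<open>R + 1/2\<close>, and by a multiple of \<kappa>, so
      that it costs another \<open>\<kappa> / 16\<close>.\<close>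
    define \<delta> where "\<delta> = min (1/2) (\<kappa> / (16 * \<mu>))"
    have \<delta>: "0 < \<delta>" "\<delta> \<le> 1/2" "\<mu> * \<delta> \<le> \<kappa> / 16" using \<kappa> VU(4) by (auto simp: \<delta>_def min_def field_simps)
    have "\<forall>\<^sub>F N in at_top. 0 < N \<and> 4 * 2 ^ CARD('n) / r \<le> N \<and> 512 * (2 ^ CARD('n)) ^ 5 * \<mu> / (\<epsilon> * r\<^sup>2) < N
        \<and> (\<forall>x. \<phi> x \<le> R \<longrightarrow> \<bar>cappr N x - \<phi> x\<bar> \<le> \<delta>)"
      by (intro eventually_conj eventually_gt_at_top eventually_ge_at_top cappr_close \<delta>)
    from eventually_happens'[OF trivial_limit_at_top_linorder this]
    obtain N where NN: "0 < N \<and> 4 * 2 ^ CARD('n) / r \<le> N \<and> 512 * (2 ^ CARD('n)) ^ 5 * \<mu> / (\<epsilon> * r\<^sup>2) < N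
        \<and> (\<forall>x. \<phi> x \<le> R \<longrightarrow> \<bar>cappr N x - \<phi> x\<bar> \<le> \<delta>)" ..
    then have N: "0 < N" "4 * 2 ^ CARD('n) / r \<le> N" "512 * (2 ^ CARD('n)) ^ 5 * \<mu> / (\<epsilon> * r\<^sup>2) < N"
        "\<And>x. \<phi> x \<le> R \<Longrightarrow> \<bar>cappr N x - \<phi> x\<bar> \<le> \<delta>"
      by blast+
    define w where "w y = \<mu> * cappr N (y - z) - \<epsilon> * (cappr N (y - z))\<^sup>2" for y
    have c_bd: "- (1/2) \<le> cappr N (y - z)" "cappr N (y - z) \<le> R + 1/2" if "y \<in> closure V" for y
      using N(4)[OF R(2)[OF that]] R(2)[OF that] \<delta>(2) phi_nonneg[of "y - z"] by linarith+
    have w_close: "\<bar>w y - \<mu> * \<phi> (y - z)\<bar> \<le> \<kappa> / 8" if y: "y \<in> closure V" for y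
    proof -
      let ?c = "cappr N (y - z)"
      have "\<bar>\<mu> * ?c - \<mu> * \<phi> (y - z)\<bar> = \<mu> * \<bar>?c - \<phi> (y - z)\<bar>"
        using VU(4) by (simp add: right_diff_distrib[symmetric] abs_mult)
      also have "\<dots> \<le> \<mu> * \<delta>" using N(4)[OF R(2)[OF y]] VU(4) by (intro mult_left_mono) auto
      finally have 1: "\<bar>\<mu> * ?c - \<mu> * \<phi> (y - z)\<bar> \<le> \<kappa> / 16" using \<delta>(3) by linarith
      have "\<bar>?c\<bar> \<le> R + 1" using c_bd[OF y] R(1) by linarith
      then have "?c\<^sup>2 \<le> (R + 1)\<^sup>2" using R(1) by (simp add: abs_le_square_iff[symmetric])
      then have "\<epsilon> * ?c\<^sup>2 \<le> \<epsilon> * (R + 1)\<^sup>2" using \<epsilon> by (intro mult_left_mono) auto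
      then have 2: "\<epsilon> * ?c\<^sup>2 \<le> \<kappa> / 16" "0 \<le> \<epsilon> * ?c\<^sup>2" using \<epsilon>\<kappa> \<epsilon>(1) order_trans by (blast, simp)
      show ?thesis using 1 2 unfolding w_def by linarith
    qed
    define V1 where "V1 = V \<inter> {y. r < \<phi> (y - z)}"
    have V1: "open V1" unfolding V1_def by (intro open_Int VU open_Collect_less continuous_intros)
    have cl1: "closure V1 \<subseteq> closure V \<inter> {y. r \<le> \<phi> (y - z)}"
    proof (rule closure_minimal)
      show "closed (closure V \<inter> {y. r \<le> \<phi> (y - z)})"
        by (intro closed_Int closed_closure closed_Collect_le continuous_intros)
    qed (use closure_subset in \<open>auto simp: V1_def\<close>)
    have in1: "y \<in> V1" if y: "y \<in> closure V" "m + \<kappa> / 2 < ?f y" for y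
    proof -
      have "y \<in> V" using fr[OF y(1)] y(2) \<kappa> by linarith
      moreover have "y \<notin> pball z r" using S(3)[OF y(1)] y(2) r(2)[OF order_refl] by fastforce
      ultimately show ?thesis by (simp add: V1_def pball_def)
    qed
    have xV1: "x \<in> V1" by (rule in1[OF xcl]) (use \<kappa> in \<open>simp add: \<kappa>_def field_simps\<close>)
    have comp1: "compact (closure V1)"
      using compactly_contained_mono[OF VU(2), of V1] by (auto simp: V1_def compactly_contained_def)
    have "continuous_on (closure V1) (\<lambda>y. cappr N (y - z))"
      by (rule continuous_on_compose2[OF continuous_cappr[OF N(1), of UNIV]]) (auto intro!: continuous_intros)
    moreover have "continuous_on (closure V1) u" using continuous_on_subset[OF cont] cl1 cc(2) by blast
    ultimately have conth: "continuous_on (closure V1) (\<lambda>y. u y - w y)" unfolding w_def by (intro continuous_intros)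
    have "closure V1 \<noteq> {}" using xV1 closure_subset by blast
    then obtain x0 where x0: "x0 \<in> closure V1" "\<And>y. y \<in> closure V1 \<Longrightarrow> u y - w y \<le> u x0 - w x0"
      using continuous_attains_sup[OF comp1 _ conth] by metis
    have x0cl: "x0 \<in> closure V" using x0(1) cl1 by blast
    \<comment> \<open>Replacing the cone by \<open>w\<close> costs \<open>\<kappa> / 8\<close> at
      \<open>x\<close> and again at \<open>x0\<close>, so the difference from the true cone at
      \<open>x0\<close> still exceeds \<open>m + \<kappa> / 2\<close>; this excludes both the
      frontier of \<open>V\<close> and the neighbourhood of the vertex.\<close>
    have "?f x - \<kappa> / 8 \<le> u x - w x" using w_close[OF xcl] by linarith
    also have "\<dots> \<le> u x0 - w x0" using x0(2) xV1 closure_subset by blast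
    also have "\<dots> \<le> ?f x0 + \<kappa> / 8" using w_close[OF x0cl] by linarith
    finally have "?f x - \<kappa> / 8 \<le> ?f x0 + \<kappa> / 8" .
    moreover have "?f x = m + \<kappa>" by (simp add: \<kappa>_def)
    ultimately have "m + \<kappa> / 2 < ?f x0" using \<kappa> by linarith
    then have x0V: "x0 \<in> V1" using in1 x0cl by blast
    have "\<forall>\<^sub>F y in nhds x0. y \<in> V1" using V1 x0V by (rule eventually_nhds_in_open)
    then have loc: "\<forall>\<^sub>F y in nhds x0. u y - w y \<le> u x0 - w x0"
      by eventually_elim (use x0(2) closure_subset in blast)
    let ?p = "(\<mu> - 2 * \<epsilon> * cappr N (x0 - z)) *\<^sub>R bary N (x0 - z)"
    have rx: "r \<le> \<phi> (x0 - z)" using x0V by (simp add: V1_def)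
    have "2 * \<epsilon> * cappr N (x0 - z) \<le> 2 * \<epsilon> * (R + 1/2)" using c_bd[OF x0cl] \<epsilon> by (intro mult_left_mono) auto
    also have "\<dots> < \<mu>"
    proof -
      have "0 < \<epsilon> * R" using \<epsilon> R by simp
      then show ?thesis using \<epsilon>\<mu> \<epsilon>(1) by (simp add: algebra_simps)
    qed
    finally have c2: "2 * \<epsilon> * cappr N (x0 - z) < \<mu>" .
    have c1: "- \<mu> / (2 * \<epsilon>) \<le> cappr N (x0 - z)"
    proof -
      have "0 < \<epsilon> * R" using \<epsilon> R by simp
      then have "\<epsilon> \<le> \<mu>" using \<epsilon>\<mu> \<epsilon>(1) by (simp add: algebra_simps)
      then have "- \<mu> / (2 * \<epsilon>) \<le> - (1/2)" using \<epsilon>(1) by (simp add: field_simps)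
      then show ?thesis using c_bd[OF x0cl] by linarith
    qed
    obtain X where X: "superjet (\<lambda>y. \<mu> * cappr N y - \<epsilon> * (cappr N y)\<^sup>2) (x0 - z) ?p X" "G_upper \<phi> ?p X < 0"
      by (rule superjet_cone_negative[OF N(1) \<epsilon>(1) r(1) rx c1 c2 N(2,3)])
    have "superjet w x0 ?p X" using superjet_translate[OF X(1)] by (simp add: w_def[abs_def])
    then have "superjet u x0 ?p X" using loc by (rule superjet_local_max)
    moreover have "x0 \<in> U" using x0cl cc(2) by blast
    ultimately have "0 \<le> G_upper \<phi> ?p X" using sub Sub_iff_superjet[OF cont] by blast
    then show False using X(2) by simp
  qed
qed

end

subsection \<open>Rademacher's theorem\<close>

text \<open>An expanding Lipschitz function is a distribution function of the image of Lebesgue measure under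
  its inverse; the Radon--Nikodym density of that measure is its derivative.\<close>

lemma expanding_lipschitz_density:
  fixes F :: "real \<Rightarrow> real"
  assumes lo: "\<And>x y. x \<le> y \<Longrightarrow> y - x \<le> F y - F x" and up: "\<And>x y. x \<le> y \<Longrightarrow> F y - F x \<le> C * (y - x)"
  obtains k where "\<And>a b. k integrable_on {a..b}" "\<And>a b. a \<le> b \<Longrightarrow> integral {a..b} k = F b - F a"
proof -
  have C: "0 \<le> C" using lo[of 0 1] up[of 0 1] by simp
  have lip: "\<bar>F y - F x\<bar> \<le> C * \<bar>y - x\<bar>" for x y
    using lo[of x y] up[of x y] lo[of y x] up[of y x] by (cases "x \<le> y") auto
  have "C-lipschitz_on UNIV F" by (rule lipschitz_onI) (use lip C in \<open>auto simp: dist_real_def\<close>)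
  then have contF: "continuous_on S F" for S using lipschitz_on_continuous_on continuous_on_subset by blast
  have mono: "F x \<le> F y \<longleftrightarrow> x \<le> y" for x y using lo[of x y] lo[of y x] by linarith
  have inj: "inj F" using mono by (metis injI order_antisym order_refl)
  have "surj F"
    unfolding surj_def
  proof
    fix y
    define K where "K = \<bar>y - F 0\<bar>"
    have "y \<le> F K" "F (- K) \<le> y" using lo[of 0 K] lo[of "- K" 0] by (auto simp: K_def)
    then show "\<exists>x. y = F x" using IVT'[of F "- K" y K] contF by (force simp: K_def)
  qed
  define H where "H = inv F"
  have FH: "F (H y) = y" for y using \<open>surj F\<close> by (simp add: H_def surj_f_inv_f)
  have HF: "H (F x) = x" for x using inj by (simp add: H_def)
  have "1-lipschitz_on UNIV H"
  proof (rule lipschitz_onI)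
    fix x y show "dist (H x) (H y) \<le> 1 * dist x y"
      using lo[of "H x" "H y"] lo[of "H y" "H x"] FH[of x] FH[of y] by (cases "H x \<le> H y") (auto simp: dist_real_def)
  qed simp
  then have Hm [measurable]: "H \<in> borel_measurable borel"
    using lipschitz_on_continuous_on borel_measurable_continuous_onI by blast
  define \<nu> where "\<nu> = distr lborel borel H"
  have vim: "H -` A = F ` A" for A using FH HF by (metis (no_types, lifting) image_iff vimage_eq set_eqI)
  \<comment> \<open>\<open>F\<close> maps null sets to null sets because it is Lipschitz, and the
    preimage under \<open>H\<close> is the image under \<open>F\<close>.\<close>
  have "absolutely_continuous lborel \<nu>" unfolding absolutely_continuous_def
  proof
    fix A :: "real set" assume A: "A \<in> null_sets lborel"
    then have "negligible A" by (simp add: negligible_iff_null_sets null_sets_completionI)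
    then have "negligible (F ` A)"
      by (rule negligible_locally_Lipschitz_image[rotated]) (use lip in \<open>auto intro!: exI[of _ UNIV] exI[of _ C]\<close>)
    moreover have "F ` A \<in> sets borel" using measurable_sets[OF Hm, of A] A vim by auto
    ultimately have "emeasure lborel (H -` A) = 0"
      using vim null_sets_completion_iff by (metis negligible_iff_null_sets null_setsD1 sets_lborel)
    then show "A \<in> null_sets \<nu>" using A by (auto simp: null_sets_def \<nu>_def emeasure_distr)
  qed
  then obtain g where g [measurable]: "g \<in> borel_measurable lborel" "density lborel g = \<nu>"
    using sigma_finite_measure.Radon_Nikodym[OF sigma_finite_lborel, of \<nu>] by (auto simp: \<nu>_def)
  have ig: "(\<integral>\<^sup>+x. g x * indicator {a..b} x \<partial>lborel) = ennreal (F b - F a)" if "a \<le> b" for a b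
  proof -
    have "(\<integral>\<^sup>+x. g x * indicator {a..b} x \<partial>lborel) = emeasure \<nu> {a..b}"
      unfolding g(2)[symmetric] by (subst emeasure_density) auto
    also have "\<dots> = emeasure lborel (H -` {a..b})" unfolding \<nu>_def by (subst emeasure_distr) auto
    also have "H -` {a..b} = {F a..F b}" using mono FH by (auto simp: vimage_def) (metis FH mono)+
    finally show ?thesis using mono[of a b] that by simp
  qed
  have fin: "AE x in lborel. g x \<noteq> \<infinity>"
  proof -
    have "AE x in lborel. g x * indicator {- real n..real n} x \<noteq> \<infinity>" for n
      by (rule nn_integral_PInf_AE) (auto simp: ig)
    then have "AE x in lborel. \<forall>n. g x * indicator {- real n..real n} x \<noteq> \<infinity>" by (simp add: AE_all_countable)
    then show ?thesis
    proof eventually_elim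
      case (elim x)
      obtain n where "\<bar>x\<bar> \<le> real n" using real_arch_simple by blast
      then show ?case using elim[rule_format, of n] by (auto simp: indicator_def abs_le_iff)
    qed
  qed
  define k where "k x = enn2real (g x)" for x
  have km [measurable]: "k \<in> borel_measurable borel" unfolding k_def using g(1) by simp
  have hb: "has_bochner_integral lborel (\<lambda>x. indicator {a..b} x *\<^sub>R k x) (F b - F a)" if ab: "a \<le> b" for a b
  proof (rule has_bochner_integral_nn_integral)
    have "(\<integral>\<^sup>+x. ennreal (indicator {a..b} x *\<^sub>R k x) \<partial>lborel) = (\<integral>\<^sup>+x. g x * indicator {a..b} x \<partial>lborel)"
      by (rule nn_integral_cong_AE) (use fin in eventually_elim, auto simp: k_def indicator_def less_top)
    then show "(\<integral>\<^sup>+x. ennreal (indicator {a..b} x *\<^sub>R k x) \<partial>lborel) = ennreal (F b - F a)" using ig[OF ab] by simp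
  qed (use mono[of a b] ab in \<open>auto simp: k_def indicator_def\<close>)
  have si: "set_integrable lborel {a..b} k" "(LINT x:{a..b}|lborel. k x) = F b - F a" if "a \<le> b" for a b
    using hb[OF that] unfolding set_integrable_def set_lebesgue_integral_def has_bochner_integral_iff by auto
  show ?thesis
  proof (rule that[of k])
    show "k integrable_on {a..b}" for a b
      using set_borel_integral_eq_integral(1)[OF si(1)] by (cases "a \<le> b") auto
    show "integral {a..b} k = F b - F a" if "a \<le> b" for a b
      using set_borel_integral_eq_integral(2)[OF si(1)[OF that]] si(2)[OF that] by simp
  qed
qed

text \<open>Adding \<open>(L + 1) * x\<close> makes \<open>f\<close> expanding, hence the integral
  of a density, and Lebesgue's differentiation theorem finishes.\<close>

lemma lipschitz_real_differentiable:
  fixes f :: "real \<Rightarrow> real"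
  assumes L: "L-lipschitz_on UNIV f"
  shows "negligible {x. \<not> f differentiable (at x)}"
proof -
  define F where "F x = f x + (L + 1) * x" for x
  have fl: "\<bar>f y - f x\<bar> \<le> L * \<bar>y - x\<bar>" for x y
    using lipschitz_onD[OF L, of y x] by (simp add: dist_real_def)
  have lo: "y - x \<le> F y - F x" and up: "F y - F x \<le> (2 * L + 1) * (y - x)" if "x \<le> y" for x y
    using fl[of y x] that by (auto simp: F_def algebra_simps abs_le_iff)
  obtain k where k: "\<And>a b. k integrable_on {a..b}" "\<And>a b. a \<le> b \<Longrightarrow> integral {a..b} k = F b - F a"
    using expanding_lipschitz_density[OF lo up] by metis
  \<comment> \<open>The differentiation theorem uses intervals with \<open>x\<close> as left end
    point; the reflected density supplies the left-hand derivative.\<close>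
  have k': "(\<lambda>x. k (- x)) integrable_on {a..b}" for a b
    using k(1)[of "- b" "- a"] Henstock_Kurzweil_Integration.integrable_reflect_real[of k "- a" "- b"] by simp
  obtain N where N: "negligible N" "\<And>x e. \<lbrakk>x \<notin> N; 0 < e\<rbrakk> \<Longrightarrow>
      \<exists>d>0. \<forall>h. 0 < h \<and> h < d \<longrightarrow> norm (integral (cbox x (x + h *\<^sub>R One)) k /\<^sub>R h ^ DIM(real) - k x) < e"
    using integrable_ccontinuous_explicit[of k] k(1) by (metis box_real(2))
  obtain N' where N': "negligible N'" "\<And>x e. \<lbrakk>x \<notin> N'; 0 < e\<rbrakk> \<Longrightarrow>
      \<exists>d>0. \<forall>h. 0 < h \<and> h < d \<longrightarrow> norm (integral (cbox x (x + h *\<^sub>R One)) (\<lambda>x. k (- x)) /\<^sub>R h ^ DIM(real) - k (- x)) < e"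
    using integrable_ccontinuous_explicit[of "\<lambda>x. k (- x)"] k' by (metis box_real(2))
  have "f differentiable (at x)" if x: "x \<notin> N \<union> uminus ` N'" for x
  proof -
    have xN: "x \<notin> N" "- x \<notin> N'" using x by (auto simp: image_iff)
    have "(\<lambda>h. (F (x + h) - F x) / h) \<midarrow>0\<rightarrow> k x"
      unfolding LIM_eq
    proof (intro allI impI)
      fix e :: real assume e: "0 < e"
      obtain d where d: "0 < d" "\<And>h. 0 < h \<Longrightarrow> h < d \<Longrightarrow> \<bar>(F (x + h) - F x) / h - k x\<bar> < e"
      proof -
        obtain d where "0 < d" "\<forall>h. 0 < h \<and> h < d \<longrightarrow> norm (integral (cbox x (x + h *\<^sub>R One)) k /\<^sub>R h ^ DIM(real) - k x) < e"
          using N(2)[OF xN(1) e] by blast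
        then show ?thesis using that[of d] k(2) by (simp add: divide_inverse mult.commute)
      qed
      obtain d' where d': "0 < d'" "\<And>h. 0 < h \<Longrightarrow> h < d' \<Longrightarrow> \<bar>(F x - F (x - h)) / h - k x\<bar> < e"
      proof -
        obtain d where d: "0 < d" "\<forall>h. 0 < h \<and> h < d \<longrightarrow> norm (integral (cbox (- x) (- x + h *\<^sub>R One)) (\<lambda>x. k (- x)) /\<^sub>R h ^ DIM(real) - k (- (- x))) < e"
          using N'(2)[OF xN(2) e] by blast
        have "integral {- x..- x + h} (\<lambda>x. k (- x)) = F x - F (x - h)" if "0 < h" for h
          using Henstock_Kurzweil_Integration.integral_reflect_real[of x "x - h" k] k(2)[of "x - h" x] that by simp
        then show ?thesis using that[of d] d by (simp add: divide_inverse mult.commute)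
      qed
      show "\<exists>s>0. \<forall>h. h \<noteq> 0 \<and> norm (h - 0) < s \<longrightarrow> norm ((F (x + h) - F x) / h - k x) < e"
      proof (intro exI[of _ "min d d'"] conjI allI impI)
        fix h :: real assume h: "h \<noteq> 0 \<and> norm (h - 0) < min d d'"
        show "norm ((F (x + h) - F x) / h - k x) < e"
        proof (cases "0 < h")
          case True
          then show ?thesis using d(2)[of h] h by simp
        next
          case False
          then have h': "0 < - h" "- h < d'" using h by auto
          have "(F x - F (x - (- h))) / (- h) = (F (x + h) - F x) / h" using h by (simp add: field_simps)
          then show ?thesis using d'(2)[OF h'] by simp
        qed
      qed (use d d' in auto)
    qed
    then have "(F has_real_derivative k x) (at x)" unfolding DERIV_def .
    then have "((\<lambda>x. F x - (L + 1) * x) has_real_derivative k x - (L + 1)) (at x)"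
      by (auto intro!: derivative_eq_intros)
    then have "(f has_real_derivative k x - (L + 1)) (at x)" by (simp add: F_def)
    then show ?thesis unfolding real_differentiable_def by blast
  qed
  then have sub: "{x. \<not> f differentiable (at x)} \<subseteq> N \<union> uminus ` N'" by blast
  have "negligible (uminus ` N')"
  proof (rule negligible_locally_Lipschitz_image[OF order_refl N'(1)])
    fix x :: real
    show "\<exists>T B. open T \<and> x \<in> T \<and> (\<forall>y\<in>N' \<inter> T. norm (- y - - x) \<le> B * norm (y - x))"
      by (intro exI[of _ UNIV] exI[of _ 1]) auto
  qed
  then show ?thesis using N(1) sub negligible_Un negligible_subset by blast
qed

section \<open>Difference quotients and directional derivatives\<close>

definition dquot :: "('a::real_normed_vector \<Rightarrow> real) \<Rightarrow> 'a \<Rightarrow> 'a \<Rightarrow> real \<Rightarrow> real" where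
  "dquot f v x t = (f (x + t *\<^sub>R v) - f x) / t"

text \<open>Cauchy's criterion with thresholds \<open>1 / Suc k\<close> leaves only countable
  quantifiers outside, so that for continuous \<open>f\<close> the set where the difference
  quotients converge is a countable combination of closed sets.\<close>

lemma tendsto_at_0_iff_Cauchy:
  fixes q :: "real \<Rightarrow> real"
  shows "(\<exists>d. (q \<longlongrightarrow> d) (at 0)) \<longleftrightarrow>
    (\<forall>k::nat. \<exists>m::nat. \<forall>s t. 0 < \<bar>s\<bar> \<and> \<bar>s\<bar> < 1 / (Suc m) \<and> 0 < \<bar>t\<bar> \<and> \<bar>t\<bar> < 1 / (Suc m) \<longrightarrow> \<bar>q s - q t\<bar> \<le> 1 / (Suc k))"
    (is "?L \<longleftrightarrow> ?R")
proof
  assume ?L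
  then obtain d where d: "(q \<longlongrightarrow> d) (at 0)" ..
  show ?R
  proof
    fix k :: nat
    have "0 < 1 / (2 * real (Suc k))" by simp
    then obtain r where r: "0 < r" "\<And>t. t \<noteq> 0 \<Longrightarrow> \<bar>t\<bar> < r \<Longrightarrow> \<bar>q t - d\<bar> < 1 / (2 * real (Suc k))"
      using LIM_D[OF d] by (metis diff_zero real_norm_def)
    obtain m where m: "1 / real (Suc m) < r" using r(1) by (metis inverse_eq_divide reals_Archimedean)
    have "\<bar>q s - q t\<bar> \<le> 1 / (Suc k)" if "0 < \<bar>s\<bar>" "\<bar>s\<bar> < 1 / (Suc m)" "0 < \<bar>t\<bar>" "\<bar>t\<bar> < 1 / (Suc m)" for s t
    proof -
      have "\<bar>q s - d\<bar> < 1 / (2 * real (Suc k))" "\<bar>q t - d\<bar> < 1 / (2 * real (Suc k))" using r(2) m that by auto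
      then have "\<bar>q s - d\<bar> + \<bar>q t - d\<bar> \<le> 1 / (2 * real (Suc k)) + 1 / (2 * real (Suc k))" by (intro add_mono) auto
      also have "\<dots> = 1 / real (Suc k)" by (simp add: field_simps)
      finally have "\<bar>q s - d\<bar> + \<bar>q t - d\<bar> \<le> 1 / real (Suc k)" .
      moreover have "\<bar>q s - q t\<bar> \<le> \<bar>q s - d\<bar> + \<bar>q t - d\<bar>" by linarith
      ultimately show ?thesis by (rule order_trans[rotated])
    qed
    then show "\<exists>m::nat. \<forall>s t. 0 < \<bar>s\<bar> \<and> \<bar>s\<bar> < 1 / (Suc m) \<and> 0 < \<bar>t\<bar> \<and> \<bar>t\<bar> < 1 / (Suc m) \<longrightarrow> \<bar>q s - q t\<bar> \<le> 1 / (Suc k)" by blast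
  qed
next
  assume R: ?R
  have nb: "at (0::real) \<noteq> bot" by simp
  have ev: "\<forall>e>0. \<exists>P. eventually P (at 0) \<and> (\<forall>x y. P x \<and> P y \<longrightarrow> dist (q x) (q y) < e)"
  proof (intro allI impI)
    fix e :: real assume "0 < e"
    then obtain k where k: "1 / real (Suc k) < e" by (metis inverse_eq_divide reals_Archimedean)
    obtain m where m: "\<forall>s t. 0 < \<bar>s\<bar> \<and> \<bar>s\<bar> < 1 / (Suc m) \<and> 0 < \<bar>t\<bar> \<and> \<bar>t\<bar> < 1 / (Suc m) \<longrightarrow> \<bar>q s - q t\<bar> \<le> 1 / (Suc k)"
      using R by blast
    have "eventually (\<lambda>t. 0 < \<bar>t\<bar> \<and> \<bar>t\<bar> < 1 / (Suc m)) (at (0::real))"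
      unfolding eventually_at by (intro exI[of _ "1 / (Suc m)"]) auto
    moreover have "\<forall>x y. (0 < \<bar>x\<bar> \<and> \<bar>x\<bar> < 1 / (Suc m)) \<and> (0 < \<bar>y\<bar> \<and> \<bar>y\<bar> < 1 / (Suc m)) \<longrightarrow> dist (q x) (q y) < e"
      using m k by (fastforce simp: dist_real_def)
    ultimately show "\<exists>P. eventually P (at 0) \<and> (\<forall>x y. P x \<and> P y \<longrightarrow> dist (q x) (q y) < e)" by blast
  qed
  then have "cauchy_filter (filtermap q (at 0))" by (simp add: cauchy_filter_metric_filtermap)
  moreover have "filtermap q (at 0) \<noteq> bot" using nb by (simp add: filtermap_bot_iff)
  ultimately obtain d where "filtermap q (at 0) \<le> nhds d"
    using complete_uniform[of "UNIV :: real set"] complete_UNIV by (metis principal_eq_bot_iff top_greatest UNIV_I top_eq_principal_UNIV)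
  then show ?L unfolding filterlim_def by blast
qed

lemma borel_dquot_convergent:
  fixes f :: "'a::euclidean_space \<Rightarrow> real"
  assumes f: "continuous_on UNIV f"
  shows "{x. \<exists>d. (dquot f v x \<longlongrightarrow> d) (at 0)} \<in> sets borel"
proof -
  have "{x. \<exists>d. (dquot f v x \<longlongrightarrow> d) (at 0)} = (\<Inter>k::nat. \<Union>m::nat.
      {x. \<forall>s t. 0 < \<bar>s\<bar> \<and> \<bar>s\<bar> < 1 / (Suc m) \<and> 0 < \<bar>t\<bar> \<and> \<bar>t\<bar> < 1 / (Suc m) \<longrightarrow> \<bar>dquot f v x s - dquot f v x t\<bar> \<le> 1 / (Suc k)})"
    unfolding tendsto_at_0_iff_Cauchy by blast
  moreover have "closed {x. \<forall>s t. 0 < \<bar>s\<bar> \<and> \<bar>s\<bar> < 1 / (Suc m) \<and> 0 < \<bar>t\<bar> \<and> \<bar>t\<bar> < 1 / (Suc m) \<longrightarrow>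
      \<bar>dquot f v x s - dquot f v x t\<bar> \<le> 1 / (Suc k)}" for m k
  proof -
    have c: "continuous_on UNIV (\<lambda>x. dquot f v x s)" if "0 < \<bar>s\<bar>" for s
      unfolding dquot_def by (intro continuous_intros continuous_on_compose2[OF f]) (use that in auto)
    have "closed {x. 0 < \<bar>s\<bar> \<and> \<bar>s\<bar> < 1 / (Suc m) \<and> 0 < \<bar>t\<bar> \<and> \<bar>t\<bar> < 1 / (Suc m) \<longrightarrow>
      \<bar>dquot f v x s - dquot f v x t\<bar> \<le> 1 / (Suc k)}" for s t
    proof (cases "0 < \<bar>s\<bar> \<and> \<bar>s\<bar> < 1 / (Suc m) \<and> 0 < \<bar>t\<bar> \<and> \<bar>t\<bar> < 1 / (Suc m)")
      case True
      then have "closed {x. \<bar>dquot f v x s - dquot f v x t\<bar> \<le> 1 / (Suc k)}"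
        by (intro closed_Collect_le continuous_intros c) auto
      then show ?thesis using True by simp
    next
      case False
      then have "{x. 0 < \<bar>s\<bar> \<and> \<bar>s\<bar> < 1 / (Suc m) \<and> 0 < \<bar>t\<bar> \<and> \<bar>t\<bar> < 1 / (Suc m) \<longrightarrow>
      \<bar>dquot f v x s - dquot f v x t\<bar> \<le> 1 / (Suc k)} = UNIV" by blast
      then show ?thesis by simp
    qed
    then show ?thesis by (intro closed_Collect_all)
  qed
  ultimately show ?thesis by (auto intro!: sets.countable_INT'' borel_closed)
qed

lemma dquot_le:
  assumes "L-lipschitz_on UNIV f" shows "\<bar>dquot f v x t\<bar> \<le> L * norm v"
proof (cases "t = 0")
  case False
  have "\<bar>f (x + t *\<^sub>R v) - f x\<bar> \<le> L * (\<bar>t\<bar> * norm v)"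
    using lipschitz_onD[OF assms, of "x + t *\<^sub>R v" x] by (simp add: dist_norm)
  then show ?thesis using False by (simp add: dquot_def abs_divide divide_le_eq mult_ac)
\<comment> \<open>At \<open>t = 0\<close> division by zero makes the quotient 0, so the bound holds
  there as well.\<close>
qed (use lipschitz_on_nonneg[OF assms] in \<open>simp add: dquot_def\<close>)

lemma negligible_borel_null: "negligible A \<Longrightarrow> A \<in> sets borel \<Longrightarrow> A \<in> null_sets lborel"
  using null_sets_completion_iff[of A lborel] by (simp add: negligible_iff_null_sets)

lemma AE_lebesgue_negligible: "negligible N \<Longrightarrow> AE x in lebesgue. x \<notin> N"
  by (rule AE_not_in) (simp add: negligible_iff_null_sets)

text \<open>Each line in direction \<open>v\<close> meets the exceptional set \<open>N\<close> in a
  null set, by the one-dimensional theorem. Averaging over the translations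
  \<open>x + s *\<^sub>R v\<close> with \<open>s\<close> in the unit interval and exchanging the
  integrals gives the measure of \<open>N\<close> on one side and 0 on the other, without
  coordinates adapted to \<open>v\<close>.\<close>

lemma AE_dquot_convergent:
  fixes f :: "'a::euclidean_space \<Rightarrow> real"
  assumes L: "L-lipschitz_on UNIV f"
  shows "AE x in lborel. \<exists>d. (dquot f v x \<longlongrightarrow> d) (at 0)"
proof -
  have cont: "continuous_on UNIV f" using L by (rule lipschitz_on_continuous_on)
  define N where "N = {x. \<not> (\<exists>d. (dquot f v x \<longlongrightarrow> d) (at 0))}"
  have "N = - {x. \<exists>d. (dquot f v x \<longlongrightarrow> d) (at 0)}" by (auto simp: N_def)
  then have Nb [measurable]: "N \<in> sets borel" using borel_dquot_convergent[OF cont, of v] by auto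
  have line: "(\<integral>\<^sup>+s. indicator {0..1::real} s * indicator N (x + s *\<^sub>R v) \<partial>lborel) = 0" for x
  proof -
    let ?g = "\<lambda>s. f (x + s *\<^sub>R v)"
    have "(L * norm v)-lipschitz_on UNIV ?g"
    proof (rule lipschitz_onI)
      fix s t
      have "(x + s *\<^sub>R v) - (x + t *\<^sub>R v) = (s - t) *\<^sub>R v" by (simp add: algebra_simps)
      then show "dist (?g s) (?g t) \<le> L * norm v * dist s t"
        using lipschitz_onD[OF L, of "x + s *\<^sub>R v" "x + t *\<^sub>R v"] by (simp add: dist_norm mult_ac)
    qed (use lipschitz_on_nonneg[OF L] in simp)
    then have neg: "negligible {s. \<not> ?g differentiable (at s)}" by (rule lipschitz_real_differentiable)
    have sub: "{s. x + s *\<^sub>R v \<in> N} \<subseteq> {s. \<not> ?g differentiable (at s)}"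
    proof
      fix s assume s: "s \<in> {s. x + s *\<^sub>R v \<in> N}"
      show "s \<in> {s. \<not> ?g differentiable (at s)}"
      proof (rule ccontr)
        assume "s \<notin> {s. \<not> ?g differentiable (at s)}"
        then obtain d where "(?g has_real_derivative d) (at s)" by (auto simp: real_differentiable_def)
        then have "((\<lambda>h. (?g (s + h) - ?g s) / h) \<longlongrightarrow> d) (at 0)" by (simp add: DERIV_def)
        moreover have "(\<lambda>h. (?g (s + h) - ?g s) / h) = dquot f v (x + s *\<^sub>R v)"
          by (rule ext) (simp add: dquot_def algebra_simps)
        ultimately show False using s by (auto simp: N_def)
      qed
    qed
    have bs: "{s. x + s *\<^sub>R v \<in> N} \<in> sets borel" by measurable
    have "{s. x + s *\<^sub>R v \<in> N} \<in> null_sets lborel"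
      by (rule negligible_borel_null[OF negligible_subset[OF neg sub] bs])
    from AE_not_in[OF this] show ?thesis
      by (subst nn_integral_0_iff_AE) (auto simp: indicator_def elim!: eventually_mono)
  qed
  have inner: "(\<integral>\<^sup>+x. indicator {0..1::real} s * indicator N (x + s *\<^sub>R v) \<partial>lborel) = indicator {0..1} s * emeasure lborel N" for s
  proof -
    have "(\<integral>\<^sup>+x. indicator N (x + s *\<^sub>R v) \<partial>lborel) = (\<integral>\<^sup>+x. indicator N x \<partial>distr lborel borel (\<lambda>x. s *\<^sub>R v + x))"
      by (subst nn_integral_distr) (auto simp: add.commute)
    also have "\<dots> = emeasure lborel N" unfolding lborel_distr_plus by simp
    finally show ?thesis by (subst nn_integral_cmult) auto
  qed
  have "(\<integral>\<^sup>+s. (\<integral>\<^sup>+x. indicator {0..1::real} s * indicator N (x + s *\<^sub>R v) \<partial>lborel) \<partial>lborel) =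
        (\<integral>\<^sup>+x. (\<integral>\<^sup>+s. indicator {0..1::real} s * indicator N (x + s *\<^sub>R v) \<partial>lborel) \<partial>lborel)"
    by (rule pair_sigma_finite.Fubini'[OF pair_sigma_finite.intro[OF sigma_finite_lborel sigma_finite_lborel]]) measurable
  also have "\<dots> = 0" by (simp add: line)
  finally have "(\<integral>\<^sup>+s. indicator {0..1::real} s * emeasure lborel N \<partial>lborel) = 0" unfolding inner .
  moreover have "(\<integral>\<^sup>+s. indicator {0..1::real} s * emeasure lborel N \<partial>lborel) = emeasure lborel N"
    by (subst nn_integral_multc) auto
  ultimately have "N \<in> null_sets lborel" by (simp add: null_sets_def)
  from AE_not_in[OF this] show ?thesis by eventually_elim (simp add: N_def)
qed

text \<open>The limit is taken along one sequence, so that this is a total function, Borel for Borel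
  \<open>f\<close>, even where no directional derivative exists.\<close>

definition dird :: "('a::real_normed_vector \<Rightarrow> real) \<Rightarrow> 'a \<Rightarrow> 'a \<Rightarrow> real" where
  "dird f v x = lim (\<lambda>n. dquot f v x (inverse (real (Suc n))))"

lemma dquot_seq:
  assumes "(dquot f v x \<longlongrightarrow> d) (at 0)"
  shows "(\<lambda>n. dquot f v x (inverse (real (Suc n)))) \<longlonglongrightarrow> d" "dird f v x = d"
proof -
  have "filterlim (\<lambda>n. inverse (real (Suc n))) (at 0) sequentially"
    unfolding filterlim_at using LIMSEQ_inverse_real_of_nat by auto
  then show l: "(\<lambda>n. dquot f v x (inverse (real (Suc n)))) \<longlonglongrightarrow> d" using filterlim_compose[OF assms] by blast
  then show "dird f v x = d" unfolding dird_def by (rule limI)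
qed

lemma box_integrals:
  fixes f :: "'a::euclidean_space \<Rightarrow> real"
  assumes L: "L-lipschitz_on UNIV f"
  shows "integrable lborel (\<lambda>x. indicator (cbox a b) x * dird f v x)"
    and "\<And>n. integrable lborel (\<lambda>x. indicator (cbox a b) x * dquot f v x (inverse (real (Suc n))))"
    and "(\<lambda>n. \<integral>x. indicator (cbox a b) x * dquot f v x (inverse (real (Suc n))) \<partial>lborel)
      \<longlonglongrightarrow> (\<integral>x. indicator (cbox a b) x * dird f v x \<partial>lborel)"
proof -
  have fm [measurable]: "f \<in> borel_measurable borel"
    using lipschitz_on_continuous_on[OF L] by (rule borel_measurable_continuous_onI)
  have qm [measurable]: "(\<lambda>x. dquot f v x t) \<in> borel_measurable borel" for t
    unfolding dquot_def by measurable
  have dm [measurable]: "dird f v \<in> borel_measurable borel" unfolding dird_def[abs_def] by measurable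
  let ?w = "\<lambda>x. indicator (cbox a b) x * (L * norm v)"
  have w: "integrable lborel ?w" by (intro integrable_mult_left integrable_real_indicator emeasure_bounded_finite) auto
  have bd: "AE x in lborel. norm (indicator (cbox a b) x * dquot f v x t) \<le> ?w x" for t
    using dquot_le[OF L] by (auto simp: abs_mult indicator_def)
  have lim: "AE x in lborel. (\<lambda>n. indicator (cbox a b) x * dquot f v x (inverse (real (Suc n))))
      \<longlonglongrightarrow> indicator (cbox a b) x * dird f v x"
    using AE_dquot_convergent[OF L, of v]
  proof eventually_elim
    case (elim x)
    then obtain d where "(dquot f v x \<longlongrightarrow> d) (at 0)" by blast
    then show ?case using dquot_seq[of f v x d] by (auto intro!: tendsto_intros)
  qed
  show "integrable lborel (\<lambda>x. indicator (cbox a b) x * dird f v x)"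
    by (rule integrable_dominated_convergence[OF _ _ w lim bd]) measurable
  show "integrable lborel (\<lambda>x. indicator (cbox a b) x * dquot f v x (inverse (real (Suc n))))" for n
  proof (rule Bochner_Integration.integrable_bound[OF w])
    show "AE x in lborel. norm (indicator (cbox a b) x * dquot f v x (inverse (real (Suc n)))) \<le> norm (?w x)"
      using bd[of "inverse (real (Suc n))"] by eventually_elim (use lipschitz_on_nonneg[OF L] in \<open>simp add: abs_mult\<close>)
  qed measurable
  show "(\<lambda>n. \<integral>x. indicator (cbox a b) x * dquot f v x (inverse (real (Suc n))) \<partial>lborel)
      \<longlonglongrightarrow> (\<integral>x. indicator (cbox a b) x * dird f v x \<partial>lborel)"
    by (rule integral_dominated_convergence[OF _ _ w lim bd]) measurable
qed

text \<open>Continuity of translation in \<open>L^1\<close> for the indicator of a box, which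
  converges off the null frontier. It measures the error made when a shift is moved from the
  function to the box.\<close>

lemma box_shift_tendsto:
  fixes a b w :: "'a::euclidean_space"
  defines "s \<equiv> \<lambda>n. inverse (real (Suc n))"
  shows "(\<lambda>n. \<integral>x. \<bar>indicator (cbox a b) (x - s n *\<^sub>R w) - indicator (cbox a b) x\<bar> \<partial>lborel) \<longlonglongrightarrow> (0::real)"
    and "\<And>n. integrable lborel (\<lambda>x. \<bar>indicator (cbox a b) (x - s n *\<^sub>R w) - indicator (cbox a b) x\<bar> :: real)"
proof -
  obtain R where R: "cbox a b \<subseteq> ball 0 R" using bounded_cbox bounded_subset_ballD by blast
  let ?W = "\<lambda>x. indicator (ball 0 (R + norm w)) x :: real"
  have W: "integrable lborel ?W" by (intro integrable_real_indicator emeasure_bounded_finite) auto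
  have s1: "0 < s n" "s n \<le> 1" for n unfolding s_def by (simp, simp add: field_simps)
  have bd: "\<bar>indicator (cbox a b) (x - s n *\<^sub>R w) - indicator (cbox a b) x\<bar> \<le> ?W x" for n x
  proof -
    have 1: "x \<in> ball 0 (R + norm w)" if "x - s n *\<^sub>R w \<in> cbox a b"
    proof -
      have "norm (x - s n *\<^sub>R w) < R" using that R by (auto simp: subset_iff)
      moreover have "norm x \<le> norm (x - s n *\<^sub>R w) + norm (s n *\<^sub>R w)" using norm_triangle_ineq[of "x - s n *\<^sub>R w" "s n *\<^sub>R w"] by simp
      moreover have "norm (s n *\<^sub>R w) \<le> norm w" using s1[of n] by (simp add: mult_left_le_one_le)
      ultimately show ?thesis by simp
    qed
    have 2: "x \<in> ball 0 (R + norm w)" if "x \<in> cbox a b"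
    proof -
      have "norm x < R" using that R by (auto simp: subset_iff)
      then have "norm x < R + norm w" using norm_ge_zero[of w] by linarith
      then show ?thesis by simp
    qed
    show ?thesis using 1 2 by (auto simp: indicator_def)
  qed
  have "frontier (cbox a b) \<in> null_sets lborel"
    by (rule negligible_borel_null) (auto simp: negligible_convex_frontier borel_closed)
  from AE_not_in[OF this]
  have lim: "AE x in lborel. (\<lambda>n. \<bar>indicator (cbox a b) (x - s n *\<^sub>R w) - indicator (cbox a b) x\<bar> :: real) \<longlonglongrightarrow> 0"
  proof eventually_elim
    case (elim x)
    have "(\<lambda>n. x - s n *\<^sub>R w) \<longlonglongrightarrow> x - 0 *\<^sub>R w" unfolding s_def by (intro tendsto_intros LIMSEQ_inverse_real_of_nat)
    then have conv: "(\<lambda>n. x - s n *\<^sub>R w) \<longlonglongrightarrow> x" by simp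
    have "\<forall>\<^sub>F n in sequentially. (x - s n *\<^sub>R w \<in> cbox a b) = (x \<in> cbox a b)"
    proof (cases "x \<in> cbox a b")
      case True
      then have "x \<in> interior (cbox a b)" using elim by (auto simp: frontier_def)
      from topological_tendstoD[OF conv open_interior this] show ?thesis
        by eventually_elim (use True interior_subset in blast)
    next
      case False
      then have "x \<in> - cbox a b" "open (- cbox a b)" by (auto simp: closed_cbox)
      from topological_tendstoD[OF conv this(2,1)] show ?thesis by eventually_elim (use False in simp)
    qed
    then have "\<forall>\<^sub>F n in sequentially. \<bar>indicator (cbox a b) (x - s n *\<^sub>R w) - indicator (cbox a b) x\<bar> = (0::real)"
      by eventually_elim (simp add: indicator_def)
    then show ?case by (rule tendsto_eventually)
  qed
  have m: "(\<lambda>x. \<bar>indicator (cbox a b) (x - s n *\<^sub>R w) - indicator (cbox a b) x\<bar> :: real) \<in> borel_measurable lborel" for n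
    by measurable
  have "(\<lambda>n. \<integral>x. \<bar>indicator (cbox a b) (x - s n *\<^sub>R w) - indicator (cbox a b) x\<bar> \<partial>lborel) \<longlonglongrightarrow> integral\<^sup>L lborel (\<lambda>x::'a. 0::real)"
  proof (rule integral_dominated_convergence[where w = ?W])
    show "AE x in lborel. norm \<bar>indicator (cbox a b) (x - s n *\<^sub>R w) - indicator (cbox a b) x :: real\<bar> \<le> ?W x" for n
      using bd by simp
  qed (use m W lim in auto)
  then show "(\<lambda>n. \<integral>x. \<bar>indicator (cbox a b) (x - s n *\<^sub>R w) - indicator (cbox a b) x\<bar> \<partial>lborel) \<longlonglongrightarrow> (0::real)" by simp
  show "integrable lborel (\<lambda>x. \<bar>indicator (cbox a b) (x - s n *\<^sub>R w) - indicator (cbox a b) x\<bar> :: real)" for n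
    by (rule Bochner_Integration.integrable_bound[OF W m]) (use bd in auto)
qed

lemma box_integral_zero_imp_AE_zero:
  fixes k :: "'a::euclidean_space \<Rightarrow> real"
  assumes int: "\<And>a b. integrable lborel (\<lambda>x. indicator (cbox a b) x * k x)"
    and zero: "\<And>a b. (\<integral>x. indicator (cbox a b) x * k x \<partial>lborel) = 0"
  shows "AE x in lebesgue. k x = 0"
proof -
  have si: "set_integrable lborel (cbox a b) k" for a b using int[of a b] by (simp add: set_integrable_def)
  have io: "k integrable_on cbox a b" for a b by (rule set_borel_integral_eq_integral(1)[OF si])
  have i0: "integral (cbox a b) k = 0" for a b
    using set_borel_integral_eq_integral(2)[OF si, of a b] zero[of a b] by (simp add: set_lebesgue_integral_def)
  obtain N where N: "negligible N" "\<And>x e. \<lbrakk>x \<notin> N; 0 < e\<rbrakk> \<Longrightarrow>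
      \<exists>d>0. \<forall>h. 0 < h \<and> h < d \<longrightarrow> norm (integral (cbox x (x + h *\<^sub>R One)) k /\<^sub>R h ^ DIM('a) - k x) < e"
    using integrable_ccontinuous_explicit[of k, OF io] by metis
  have "k x = 0" if x: "x \<notin> N" for x
  proof -
    have le: "\<bar>k x\<bar> \<le> e" if e: "0 < e" for e
    proof -
      obtain d where d: "0 < d" "\<forall>h. 0 < h \<and> h < d \<longrightarrow> norm (integral (cbox x (x + h *\<^sub>R One)) k /\<^sub>R h ^ DIM('a) - k x) < e"
        using N(2)[OF x e] by blast
      have "norm (integral (cbox x (x + (d/2) *\<^sub>R One)) k /\<^sub>R (d/2) ^ DIM('a) - k x) < e" using d(2)[rule_format, of "d/2"] d(1) by simp
      then show ?thesis by (simp add: i0)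
    qed
    have "\<bar>k x\<bar> \<le> 0"
    proof (rule field_le_epsilon)
      fix e :: real assume "0 < e"
      then show "\<bar>k x\<bar> \<le> 0 + e" using le[of e] by simp
    qed
    then show ?thesis by simp
  qed
  with AE_lebesgue_negligible[OF N(1)] show ?thesis by (auto elim: eventually_mono)
qed

text \<open>The quotient along \<open>v + w\<close> at \<open>x\<close> minus the one along
  \<open>w\<close> is the quotient along \<open>v\<close> at a point shifted along \<open>w\<close>.
  Under the integral over a box the shift moves to the box and disappears in the limit; additivity
  thus holds in the mean over every box, hence almost everywhere.\<close>

lemma AE_dird_add:
  fixes f :: "'a::euclidean_space \<Rightarrow> real"
  assumes L: "L-lipschitz_on UNIV f"
  shows "AE x in lebesgue. dird f (v + w) x = dird f v x + dird f w x"
proof -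
  let ?I = "\<lambda>a b x. indicator (cbox a b) x :: real"
  define s where "s n = inverse (real (Suc n))" for n
  have fm [measurable]: "f \<in> borel_measurable borel"
    using lipschitz_on_continuous_on[OF L] by (rule borel_measurable_continuous_onI)
  have s0: "0 < s n" for n by (simp add: s_def)
  have key: "(\<integral>x. ?I a b x * dird f (v + w) x \<partial>lborel) = (\<integral>x. ?I a b x * dird f v x \<partial>lborel) + (\<integral>x. ?I a b x * dird f w x \<partial>lborel)" for a b
  proof -
    let ?D = "\<lambda>n x. \<bar>?I a b (x - s n *\<^sub>R w) - ?I a b x\<bar>"
    let ?C = "L * norm v"
    define A where "A u n = (\<integral>x. ?I a b x * dquot f u x (s n) \<partial>lborel)" for u n
    have Aint: "integrable lborel (\<lambda>x. ?I a b x * dquot f u x (s n))" for u n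
      using box_integrals(2)[OF L] by (simp add: s_def)
    have Alim: "A u \<longlonglongrightarrow> (\<integral>x. ?I a b x * dird f u x \<partial>lborel)" for u
      using box_integrals(3)[OF L, of a b u] by (simp add: A_def[abs_def] s_def)
    have Dint: "integrable lborel (?D n)" for n using box_shift_tendsto(2)[of a b n w] by (simp add: s_def)
    have Dlim: "(\<lambda>n. \<integral>x. ?D n x \<partial>lborel) \<longlonglongrightarrow> 0" using box_shift_tendsto(1)[of a b w] by (simp add: s_def)
    have est: "\<bar>A (v + w) n - (A v n + A w n)\<bar> \<le> ?C * (\<integral>x. ?D n x \<partial>lborel)" for n
    proof -
      let ?g = "\<lambda>x. ?I a b (x - s n *\<^sub>R w) * dquot f v x (s n)"
      have gm: "?g \<in> borel_measurable borel" unfolding dquot_def by measurable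
      have "A (v + w) n - A w n = (\<integral>x. ?I a b x * dquot f (v + w) x (s n) - ?I a b x * dquot f w x (s n) \<partial>lborel)"
        unfolding A_def by (rule Bochner_Integration.integral_diff[symmetric]) (rule Aint)+
      also have "\<dots> = (\<integral>x. ?g (s n *\<^sub>R w + 1 *\<^sub>R x) \<partial>lborel)"
      proof (rule Bochner_Integration.integral_cong[OF refl])
        fix x
        define y where "y = s n *\<^sub>R w + 1 *\<^sub>R x"
        have y: "y - s n *\<^sub>R w = x" "y + s n *\<^sub>R v = x + s n *\<^sub>R (v + w)" "x + s n *\<^sub>R w = y"
          by (simp_all add: y_def scaleR_add_right add_ac)
        have "?I a b x * dquot f (v + w) x (s n) - ?I a b x * dquot f w x (s n) = ?I a b (y - s n *\<^sub>R w) * dquot f v y (s n)"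
          unfolding dquot_def y by (simp add: right_diff_distrib diff_divide_distrib)
        then show "?I a b x * dquot f (v + w) x (s n) - ?I a b x * dquot f w x (s n) = ?g (s n *\<^sub>R w + 1 *\<^sub>R x)"
          by (simp only: y_def)
      qed
      also have "\<dots> = (\<integral>x. ?g x \<partial>lborel)"
        using lborel_integral_affine[OF _ gm, of 1 "s n *\<^sub>R w"] by simp
      finally have 1: "A (v + w) n - A w n = (\<integral>x. ?g x \<partial>lborel)" .
      have eq: "?g x - ?I a b x * dquot f v x (s n) = (?I a b (x - s n *\<^sub>R w) - ?I a b x) * dquot f v x (s n)" for x
        by (simp add: left_diff_distrib)
      have dint: "integrable lborel (\<lambda>x. (?I a b (x - s n *\<^sub>R w) - ?I a b x) * dquot f v x (s n))"
      proof (rule Bochner_Integration.integrable_bound[OF integrable_mult_right[OF Dint, of ?C]])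
        show "(\<lambda>x. (?I a b (x - s n *\<^sub>R w) - ?I a b x) * dquot f v x (s n)) \<in> borel_measurable lborel"
          unfolding dquot_def by measurable
        show "AE x in lborel. norm ((?I a b (x - s n *\<^sub>R w) - ?I a b x) * dquot f v x (s n)) \<le> norm (?C * ?D n x)"
        proof (intro AE_I2)
          fix x
          have "\<bar>?I a b (x - s n *\<^sub>R w) - ?I a b x\<bar> * \<bar>dquot f v x (s n)\<bar> \<le> ?D n x * ?C"
            by (intro mult_left_mono dquot_le[OF L]) auto
          then show "norm ((?I a b (x - s n *\<^sub>R w) - ?I a b x) * dquot f v x (s n)) \<le> norm (?C * ?D n x)"
            using lipschitz_on_nonneg[OF L] by (simp add: abs_mult mult_ac)
        qed
      qed
      have gint: "integrable lborel ?g"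
      proof -
        have "?g = (\<lambda>x. (?I a b (x - s n *\<^sub>R w) - ?I a b x) * dquot f v x (s n) + ?I a b x * dquot f v x (s n))"
          by (simp add: left_diff_distrib)
        then show ?thesis using Bochner_Integration.integrable_add[OF dint Aint[of v n]] by simp
      qed
      have eq2: "(\<integral>x. ?g x \<partial>lborel) - A v n = (\<integral>x. (?I a b (x - s n *\<^sub>R w) - ?I a b x) * dquot f v x (s n) \<partial>lborel)"
        unfolding A_def eq[symmetric] by (rule Bochner_Integration.integral_diff[symmetric, OF gint Aint])
      have "\<bar>(\<integral>x. ?g x \<partial>lborel) - A v n\<bar> \<le> (\<integral>x. \<bar>(?I a b (x - s n *\<^sub>R w) - ?I a b x) * dquot f v x (s n)\<bar> \<partial>lborel)"
        unfolding eq2 by (rule integral_abs_bound)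
      also have "\<dots> \<le> (\<integral>x. ?C * ?D n x \<partial>lborel)"
      proof (rule integral_mono)
        show "integrable lborel (\<lambda>x. ?C * ?D n x)" by (intro integrable_mult_right Dint)
        fix x
        have "\<bar>?I a b (x - s n *\<^sub>R w) - ?I a b x\<bar> * \<bar>dquot f v x (s n)\<bar> \<le> ?D n x * ?C"
          by (intro mult_left_mono dquot_le[OF L]) auto
        then show "\<bar>(?I a b (x - s n *\<^sub>R w) - ?I a b x) * dquot f v x (s n)\<bar> \<le> ?C * ?D n x" by (simp add: abs_mult mult_ac)
      qed (use integrable_abs[OF dint] in simp)
      also have "\<dots> = ?C * (\<integral>x. ?D n x \<partial>lborel)" by simp
      finally show ?thesis using 1 by (simp add: algebra_simps)
    qed
    have C0: "(\<lambda>n. ?C * (\<integral>x. ?D n x \<partial>lborel)) \<longlonglongrightarrow> 0" by (rule tendsto_mult_right_zero[OF Dlim])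
    have "\<forall>\<^sub>F n in sequentially. norm (A (v + w) n - (A v n + A w n)) \<le> ?C * (\<integral>x. ?D n x \<partial>lborel)"
      by (rule always_eventually) (simp only: real_norm_def est simp_thms)
    from Lim_null_comparison[OF this C0]
    have "(\<lambda>n. A (v + w) n - (A v n + A w n)) \<longlonglongrightarrow> 0" .
    moreover have "(\<lambda>n. A (v + w) n - (A v n + A w n)) \<longlonglongrightarrow> (\<integral>x. ?I a b x * dird f (v + w) x \<partial>lborel)
        - ((\<integral>x. ?I a b x * dird f v x \<partial>lborel) + (\<integral>x. ?I a b x * dird f w x \<partial>lborel))"
      by (intro tendsto_diff tendsto_add Alim)
    ultimately have "0 = (\<integral>x. ?I a b x * dird f (v + w) x \<partial>lborel)
        - ((\<integral>x. ?I a b x * dird f v x \<partial>lborel) + (\<integral>x. ?I a b x * dird f w x \<partial>lborel))"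
      by (rule LIMSEQ_unique)
    then show ?thesis by linarith
  qed
  have int: "integrable lborel (\<lambda>x. ?I a b x * dird f u x)" for a b u by (rule box_integrals(1)[OF L])
  have eq: "(\<lambda>x. ?I a b x * (dird f (v + w) x - (dird f v x + dird f w x))) =
      (\<lambda>x. ?I a b x * dird f (v + w) x - (?I a b x * dird f v x + ?I a b x * dird f w x))" for a b
    by (simp add: algebra_simps)
  have "AE x in lebesgue. dird f (v + w) x - (dird f v x + dird f w x) = 0"
  proof (rule box_integral_zero_imp_AE_zero)
    fix a b
    show "integrable lborel (\<lambda>x. ?I a b x * (dird f (v + w) x - (dird f v x + dird f w x)))"
      unfolding eq by (intro Bochner_Integration.integrable_diff Bochner_Integration.integrable_add int)
    show "(\<integral>x. ?I a b x * (dird f (v + w) x - (dird f v x + dird f w x)) \<partial>lborel) = 0"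
      unfolding eq using key[of a b] int by simp
  qed
  then show ?thesis by eventually_elim simp
qed

lemma dquot_scale:
  assumes "(dquot f v x \<longlongrightarrow> d) (at 0)" shows "(dquot f (c *\<^sub>R v) x \<longlongrightarrow> c * d) (at 0)"
proof (cases "c = 0")
  case False
  have eq: "dquot f (c *\<^sub>R v) x t = c * dquot f v x (c * t)" for t
    using False by (simp add: dquot_def mult.commute)
  have "((\<lambda>t. c * t) \<longlongrightarrow> c * 0) (at 0)" by (intro tendsto_intros)
  then have "filterlim (\<lambda>t. c * t) (at 0) (at 0)"
    using False unfolding filterlim_at by (auto simp: eventually_at_filter)
  from filterlim_compose[OF assms this] show ?thesis unfolding eq[abs_def] by (intro tendsto_intros)
qed (simp add: dquot_def[abs_def])

lemma AE_dird_linear: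
  fixes f :: "'a::euclidean_space \<Rightarrow> real"
  assumes L: "L-lipschitz_on UNIV f"
  shows "AE x in lebesgue. dird f v x = (\<Sum>b\<in>Basis. (v \<bullet> b) * dird f b x)"
proof -
  have scale: "AE x in lebesgue. dird f (c *\<^sub>R b) x = c * dird f b x" for b and c :: real
    using AE_completion[OF AE_dquot_convergent[OF L, of b]]
  proof eventually_elim
    case (elim x)
    then obtain d where d: "(dquot f b x \<longlongrightarrow> d) (at 0)" by blast
    show ?case using dquot_seq(2)[OF d] dquot_seq(2)[OF dquot_scale[OF d, of c]] by simp
  qed
  have "AE x in lebesgue. dird f (\<Sum>b\<in>S. (v \<bullet> b) *\<^sub>R b) x = (\<Sum>b\<in>S. (v \<bullet> b) * dird f b x)" if "finite S" for S :: "'a set"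
    using that
  proof (induction S)
    case empty
    show ?case using scale[of 0 0] by (auto elim: eventually_mono)
  next
    case (insert b S)
    show ?case using insert.IH scale[of "v \<bullet> b" b] AE_dird_add[OF L, of "(v \<bullet> b) *\<^sub>R b" "\<Sum>b\<in>S. (v \<bullet> b) *\<^sub>R b"]
      by eventually_elim (use insert.hyps in simp)
  qed
  from this[of Basis] show ?thesis by (simp add: euclidean_representation)
qed

text \<open>Almost everywhere the derivatives along a countable dense set of directions exist and
  come from one linear form; the Lipschitz bound and compactness of the sphere make the convergence
  uniform in the direction.\<close>

theorem rademacher:
  fixes f :: "'a::euclidean_space \<Rightarrow> real"
  assumes L: "L-lipschitz_on UNIV f"
  shows "AE x in lebesgue. f differentiable (at x)"
proof -
  obtain Q :: "'a set" where Q: "countable Q" "\<And>X. open X \<Longrightarrow> X \<noteq> {} \<Longrightarrow> \<exists>q\<in>Q. q \<in> X"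
    using countable_dense_exists by metis
  have "AE x in lebesgue. \<forall>q\<in>Q. (\<exists>d. (dquot f q x \<longlongrightarrow> d) (at 0)) \<and> dird f q x = (\<Sum>b\<in>Basis. (q \<bullet> b) * dird f b x)"
    unfolding AE_ball_countable[OF Q(1)]
  proof
    fix q
    show "AE x in lebesgue. (\<exists>d. (dquot f q x \<longlongrightarrow> d) (at 0)) \<and> dird f q x = (\<Sum>b\<in>Basis. (q \<bullet> b) * dird f b x)"
      using AE_completion[OF AE_dquot_convergent[OF L, of q]] AE_dird_linear[OF L, of q] by eventually_elim simp
  qed
  then show ?thesis
  proof eventually_elim
    case (elim x)
    define g where "g = (\<Sum>b\<in>Basis. dird f b x *\<^sub>R b)"
    have lim: "(dquot f q x \<longlongrightarrow> g \<bullet> q) (at 0)" if "q \<in> Q" for q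
    proof -
      note q = bspec[OF elim that]
      obtain d where d: "(dquot f q x \<longlongrightarrow> d) (at 0)" using conjunct1[OF q] ..
      have "d = dird f q x" by (rule dquot_seq(2)[OF d, symmetric])
      also have "\<dots> = (\<Sum>b\<in>Basis. (q \<bullet> b) * dird f b x)" by (rule conjunct2[OF q])
      also have "\<dots> = g \<bullet> q" by (simp add: g_def inner_sum_left mult.commute inner_commute[of q])
      finally show ?thesis using d by simp
    qed
    have L0: "0 \<le> L" using L by (rule lipschitz_on_nonneg)
    have "(f has_derivative (\<lambda>h. g \<bullet> h)) (at x)"
      unfolding has_derivative_at_alt
    proof (intro conjI allI impI)
      show "bounded_linear (\<lambda>h. g \<bullet> h)" by (rule bounded_linear_inner_right)
      fix e :: real assume e: "0 < e"
      \<comment> \<open>Replacing a direction by one closer than \<delta> changes the quotient by at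
        most \<open>L * \<delta>\<close> and the linear form by at most
        \<open>norm g * \<delta>\<close>, together at most \<open>e / 2\<close>; the
        \<open>+ 1\<close> avoids a zero denominator.\<close>
      define \<delta> where "\<delta> = e / 2 / (L + norm g + 1)"
      have pos: "0 < L + norm g + 1" using L0 by (simp add: add_nonneg_pos)
      have \<delta>: "0 < \<delta>" using e pos by (simp add: \<delta>_def)
      have "sphere 0 1 \<subseteq> (\<Union>q\<in>Q. ball q \<delta>)"
      proof
        fix v :: 'a
        obtain q where "q \<in> Q" "q \<in> ball v \<delta>" using Q(2)[of "ball v \<delta>"] \<delta> by auto
        then show "v \<in> (\<Union>q\<in>Q. ball q \<delta>)" by (auto simp: dist_commute)
      qed
      then obtain Q' where Q': "Q' \<subseteq> Q" "finite Q'" "sphere 0 1 \<subseteq> (\<Union>q\<in>Q'. ball q \<delta>)"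
        using compactE_image[OF compact_sphere, of Q "\<lambda>q. ball q \<delta>" 0 1] by (metis open_ball)
      have "\<forall>\<^sub>F t in at 0. \<forall>q\<in>Q'. \<bar>dquot f q x t - g \<bullet> q\<bar> < e / 2"
      proof (rule eventually_ball_finite[OF Q'(2)], rule ballI)
        fix q assume "q \<in> Q'"
        then have "(dquot f q x \<longlongrightarrow> g \<bullet> q) (at 0)" using lim Q'(1) by blast
        from tendstoD[OF this, of "e/2"] show "\<forall>\<^sub>F t in at 0. \<bar>dquot f q x t - g \<bullet> q\<bar> < e / 2"
          using e by (simp add: dist_real_def)
      qed
      then obtain d where d: "0 < d" "\<And>t q. t \<noteq> 0 \<Longrightarrow> \<bar>t\<bar> < d \<Longrightarrow> q \<in> Q' \<Longrightarrow> \<bar>dquot f q x t - g \<bullet> q\<bar> < e / 2"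
        unfolding eventually_at by (auto simp: dist_real_def)
      show "\<exists>d>0. \<forall>y. norm (y - x) < d \<longrightarrow> norm (f y - f x - g \<bullet> (y - x)) \<le> e * norm (y - x)"
      proof (intro exI[of _ d] conjI allI impI d)
        fix y assume y: "norm (y - x) < d"
        show "norm (f y - f x - g \<bullet> (y - x)) \<le> e * norm (y - x)"
        proof (cases "y = x")
          case False
          define t where "t = norm (y - x)"
          define v where "v = (y - x) /\<^sub>R t"
          have t: "0 < t" "t < d" using False y by (auto simp: t_def)
          have yv: "y = x + t *\<^sub>R v" using t by (simp add: v_def)
          have "v \<in> sphere 0 1" using t by (simp add: v_def t_def)
          then obtain q where q: "q \<in> Q'" "norm (v - q) < \<delta>" using Q'(3) by (auto simp: dist_norm norm_minus_commute)
          have 1: "\<bar>f (x + t *\<^sub>R q) - f x - t * (g \<bullet> q)\<bar> \<le> t * (e / 2)"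
          proof -
            have "f (x + t *\<^sub>R q) - f x - t * (g \<bullet> q) = t * (dquot f q x t - g \<bullet> q)" using t by (simp add: dquot_def field_simps)
            then have "\<bar>f (x + t *\<^sub>R q) - f x - t * (g \<bullet> q)\<bar> = t * \<bar>dquot f q x t - g \<bullet> q\<bar>" using t by (simp add: abs_mult)
            also have "\<dots> \<le> t * (e / 2)" using d(2)[of t q] t q by (intro mult_left_mono) auto
            finally show ?thesis .
          qed
          have vq: "(x + t *\<^sub>R v) - (x + t *\<^sub>R q) = t *\<^sub>R (v - q)" by (simp add: algebra_simps)
          have "\<bar>f (x + t *\<^sub>R v) - f (x + t *\<^sub>R q)\<bar> \<le> L * (t * norm (v - q))"
            using lipschitz_onD[OF L, of "x + t *\<^sub>R v" "x + t *\<^sub>R q"] t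
            unfolding dist_norm vq norm_scaleR by simp
          also have "\<dots> \<le> L * (t * \<delta>)" using q t L0 by (intro mult_left_mono) auto
          finally have 2: "\<bar>f (x + t *\<^sub>R v) - f (x + t *\<^sub>R q)\<bar> \<le> L * (t * \<delta>)" .
          have "\<bar>g \<bullet> (v - q)\<bar> \<le> norm g * norm (v - q)" by (rule Cauchy_Schwarz_ineq2)
          also have "\<dots> \<le> norm g * \<delta>" using q by (intro mult_left_mono) auto
          finally have "t * \<bar>g \<bullet> (v - q)\<bar> \<le> t * (norm g * \<delta>)" using t by (intro mult_left_mono) auto
          then have 3: "\<bar>t * (g \<bullet> v) - t * (g \<bullet> q)\<bar> \<le> t * (norm g * \<delta>)"
            using t by (simp add: inner_diff_right right_diff_distrib[symmetric] abs_mult)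
          have "L * (t * \<delta>) + t * (norm g * \<delta>) \<le> t * ((L + norm g + 1) * \<delta>)" using t \<delta> by (simp add: algebra_simps)
          also have "(L + norm g + 1) * \<delta> = e / 2"
          proof -
            have "P * (X / P) = X" if "0 < P" for P X :: real using that by simp
            from this[OF pos] show ?thesis unfolding \<delta>_def .
          qed
          finally have 4: "L * (t * \<delta>) + t * (norm g * \<delta>) \<le> t * (e / 2)" .
          have "\<bar>f (x + t *\<^sub>R v) - f x - t * (g \<bullet> v)\<bar> \<le> t * (e / 2) + t * (e / 2)" using 1 2 3 4 by linarith
          also have "\<dots> = e * t" by simp
          finally have "\<bar>f (x + t *\<^sub>R v) - f x - t * (g \<bullet> v)\<bar> \<le> e * t" .
          then have main: "\<bar>f y - f x - t * (g \<bullet> v)\<bar> \<le> e * t" by (simp only: yv[symmetric])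
          have "y - x = t *\<^sub>R v" by (simp add: yv)
          then have gy: "g \<bullet> (y - x) = t * (g \<bullet> v)" by simp
          show ?thesis unfolding t_def[symmetric] gy real_norm_def by (rule main)
        qed simp
      qed
    qed
    then show ?case by (auto simp: differentiable_def)
  qed
qed

section \<open>Locally Lipschitz functions\<close>

lemma locally_lipschitz_ball:
  assumes "open U" "locally_lipschitz_on U u" "x \<in> U"
  obtains r L where "0 < r" "ball x r \<subseteq> U" "L-lipschitz_on (ball x r) u"
proof -
  obtain r L where r: "0 < r" "L-lipschitz_on (ball x r \<inter> U) u"
    using assms(2,3) unfolding locally_lipschitz_on_def by blast
  obtain r' where r': "0 < r'" "ball x r' \<subseteq> U" using assms(1,3) open_contains_ball by blast
  have "ball x (min r r') \<subseteq> ball x r \<inter> U" using r' by auto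
  then show ?thesis using that[of "min r r'" L] r r' lipschitz_on_subset[OF r(2)] by auto
qed

lemma locally_lipschitz_continuous:
  assumes "open U" "locally_lipschitz_on U u" shows "continuous_on U u"
proof (rule continuous_at_imp_continuous_on, rule ballI)
  fix x assume "x \<in> U"
  then obtain r L where "0 < r" "L-lipschitz_on (ball x r) u" using locally_lipschitz_ball[OF assms] by metis
  then show "isCont u x"
    using lipschitz_on_continuous_on[of L "ball x r" u] continuous_on_eq_continuous_at[OF open_ball] by (metis centre_in_ball)
qed

lemma locally_lipschitz_compact:
  fixes u :: "'a::real_normed_vector \<Rightarrow> real"
  assumes U: "open U" and u: "locally_lipschitz_on U u" and K: "compact K" "K \<subseteq> U"
  obtains d L where "0 < d" "0 \<le> L"
    "\<And>x h. x \<in> K \<Longrightarrow> norm h < d \<Longrightarrow> x + h \<in> U \<and> \<bar>u (x + h) - u x\<bar> \<le> L * norm h"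
proof -
  have "\<forall>x\<in>K. \<exists>r L. 0 < r \<and> ball x r \<subseteq> U \<and> L-lipschitz_on (ball x r) u"
  proof
    fix x assume "x \<in> K"
    then have "x \<in> U" using K by blast
    then obtain r L where "0 < r" "ball x r \<subseteq> U" "L-lipschitz_on (ball x r) u" by (rule locally_lipschitz_ball[OF U u])
    then show "\<exists>r L. 0 < r \<and> ball x r \<subseteq> U \<and> L-lipschitz_on (ball x r) u" by blast
  qed
  then obtain r where "\<forall>x\<in>K. \<exists>L. 0 < r x \<and> ball x (r x) \<subseteq> U \<and> L-lipschitz_on (ball x (r x)) u"
    using bchoice[of K "\<lambda>x r. \<exists>L. 0 < r \<and> ball x r \<subseteq> U \<and> L-lipschitz_on (ball x r) u"] by blast
  then obtain L where rL: "\<forall>x\<in>K. 0 < r x \<and> ball x (r x) \<subseteq> U \<and> (L x)-lipschitz_on (ball x (r x)) u"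
    using bchoice[of K "\<lambda>x L. 0 < r x \<and> ball x (r x) \<subseteq> U \<and> L-lipschitz_on (ball x (r x)) u"] by blast
  \<comment> \<open>Half-radius balls form the cover, so that a displacement by less than half the
    radius stays in the ball of full radius.\<close>
  have "K \<subseteq> (\<Union>x\<in>K. ball x (r x / 2))" using rL by force
  then obtain C where C: "C \<subseteq> K" "finite C" "K \<subseteq> (\<Union>x\<in>C. ball x (r x / 2))"
    using compactE_image[OF K(1), of K "\<lambda>x. ball x (r x / 2)"] by (metis open_ball)
  define d where "d = Min (insert 1 ((\<lambda>x. r x / 2) ` C))"
  define M where "M = Max (insert 0 (L ` C))"
  have "0 < r c / 2" if "c \<in> C" for c using C(1) rL that by auto
  then have "0 < d" unfolding d_def using C(2) by (subst Min_gr_iff) auto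
  moreover have "d \<le> r c / 2" if "c \<in> C" for c unfolding d_def using C(2) that by (intro Min_le) auto
  ultimately have d: "0 < d" "\<And>c. c \<in> C \<Longrightarrow> d \<le> r c / 2" by auto
  have M: "0 \<le> M" "\<And>c. c \<in> C \<Longrightarrow> L c \<le> M" using C(2) by (auto simp: M_def)
  show ?thesis
  proof (rule that[OF d(1) M(1)])
    fix x h :: 'a assume x: "x \<in> K" and h: "norm h < d"
    then obtain c where c: "c \<in> C" "x \<in> ball c (r c / 2)" using C(3) by blast
    have cK: "c \<in> K" using c C by blast
    have "norm h < r c / 2" using d(2)[OF c(1)] h by linarith
    then have xh: "x + h \<in> ball c (r c)"
      using c(2) norm_triangle_ineq[of "x - c" h] by (simp add: dist_norm norm_minus_commute algebra_simps)
    have xx: "x \<in> ball c (r c)" using c(2) rL cK by auto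
    have "dist (u (x + h)) (u x) \<le> L c * dist (x + h) x" using rL cK xh xx lipschitz_onD by metis
    also have "\<dots> \<le> M * norm h" using M(2)[OF c(1)] by (simp add: dist_norm mult_right_mono)
    finally have "\<bar>u (x + h) - u x\<bar> \<le> M * norm h" by (simp add: dist_real_def)
    moreover have "x + h \<in> U" using rL cK xh by blast
    ultimately show "x + h \<in> U \<and> \<bar>u (x + h) - u x\<bar> \<le> M * norm h" by simp
  qed
qed

lemma differentiable_transform_open:
  assumes "f differentiable (at x)" "open S" "x \<in> S" "\<And>y. y \<in> S \<Longrightarrow> f y = g y"
  shows "g differentiable (at x)"
proof -
  obtain f' where "(f has_derivative f') (at x)" using assms(1) unfolding differentiable_def by blast
  from has_derivative_transform_within_open[OF this assms(2,3,4)] show ?thesis unfolding differentiable_def by blast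
qed

text \<open>Composition with the nearest-point projection onto a small closed ball extends
  \<open>u\<close> to a globally Lipschitz function, to which \<open>rademacher\<close> applies;
  Lindelof's theorem makes the union over balls countable.\<close>

lemma AE_locally_lipschitz_differentiable:
  fixes u :: "'a::euclidean_space \<Rightarrow> real"
  assumes U: "open U" and u: "locally_lipschitz_on U u"
  shows "AE x in lebesgue. x \<in> U \<longrightarrow> u differentiable (at x)"
proof -
  let ?S = "{x. x \<in> U \<and> \<not> u differentiable (at x)}"
  define F where "F = {B. open B \<and> negligible (B \<inter> ?S)}"
  have "x \<in> \<Union>F" if xU: "x \<in> U" for x
  proof -
    obtain r L where r: "0 < r" "ball x r \<subseteq> U" "L-lipschitz_on (ball x r) u" by (rule locally_lipschitz_ball[OF U u xU])
    let ?c = "closest_point (cball x (r / 2))"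
    have c_in: "?c y \<in> ball x r" for y
    proof -
      have "?c y \<in> cball x (r / 2)" using r by (intro closest_point_in_set) auto
      then show ?thesis using r by auto
    qed
    have "L-lipschitz_on UNIV (\<lambda>y. u (?c y))"
    proof (rule lipschitz_onI)
      fix y z
      have "dist (u (?c y)) (u (?c z)) \<le> L * dist (?c y) (?c z)" by (rule lipschitz_onD[OF r(3) c_in c_in])
      also have "\<dots> \<le> L * dist y z"
        using r lipschitz_on_nonneg[OF r(3)] by (intro mult_left_mono closest_point_lipschitz) auto
      finally show "dist (u (?c y)) (u (?c z)) \<le> L * dist y z" .
    qed (rule lipschitz_on_nonneg[OF r(3)])
    from rademacher[OF this] obtain N where N: "N \<in> null_sets lebesgue" "{y. \<not> (\<lambda>y. u (?c y)) differentiable (at y)} \<subseteq> N"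
      by (auto simp: eventually_ae_filter)
    have "ball x (r / 2) \<inter> ?S \<subseteq> {y. \<not> (\<lambda>y. u (?c y)) differentiable (at y)}"
    proof
      fix y assume y: "y \<in> ball x (r / 2) \<inter> ?S"
      have "u differentiable (at y)" if "(\<lambda>y. u (?c y)) differentiable (at y)"
        by (rule differentiable_transform_open[OF that open_ball[of x "r/2"]]) (use y in \<open>auto simp: closest_point_self\<close>)
      then show "y \<in> {y. \<not> (\<lambda>y. u (?c y)) differentiable (at y)}" using y by blast
    qed
    then have "negligible (ball x (r / 2) \<inter> ?S)" using N negligible_iff_null_sets negligible_subset by blast
    then have "ball x (r / 2) \<in> F" by (simp add: F_def)
    then show ?thesis using r(1) by (intro UnionI[of "ball x (r / 2)"]) auto
  qed
  then have UF: "U \<subseteq> \<Union>F" by blast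
  have "openin (top_of_set UNIV) B" if "B \<in> F" for B using that by (simp add: F_def)
  then obtain F' where F': "F' \<subseteq> F" "countable F'" "\<Union>F' = \<Union>F" by (rule Lindelof_openin)
  have "?S \<subseteq> \<Union>((\<lambda>B. B \<inter> ?S) ` F')" using UF F'(3) by blast
  moreover have "negligible (\<Union>((\<lambda>B. B \<inter> ?S) ` F'))"
    using F' by (intro negligible_countable_Union) (auto simp: F_def)
  ultimately have "negligible ?S" by (rule negligible_subset[rotated])
  from AE_lebesgue_negligible[OF this] show ?thesis by eventually_elim blast
qed

lemma dquot_tendsto:
  assumes "(f has_derivative f') (at x)" shows "(dquot f v x \<longlongrightarrow> f' v) (at 0)"
proof -
  have 1: "((\<lambda>t. x + t *\<^sub>R v) has_derivative (\<lambda>s. s *\<^sub>R v)) (at 0)" by (auto intro!: derivative_eq_intros)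
  have 2: "(f has_derivative f') (at (x + 0 *\<^sub>R v))" using assms by simp
  interpret f': bounded_linear f' using assms by (rule has_derivative_bounded_linear)
  have "((\<lambda>t. f (x + t *\<^sub>R v)) has_real_derivative f' v) (at 0)"
    using has_derivative_compose[OF 1 2] by (simp add: has_field_derivative_def f'.scaleR mult_commute_abs)
  then show ?thesis by (simp add: DERIV_def dquot_def[abs_def])
qed

lemma dird_eq:
  assumes "(f has_derivative f') (at x)" shows "dird f v x = f' v"
  using dquot_seq(2)[OF dquot_tendsto[OF assms]] .

lemma borel_indicator_mult:
  fixes u :: "'a::euclidean_space \<Rightarrow> real"
  assumes "A \<in> sets borel" "continuous_on A u" shows "(\<lambda>x. indicator A x * u x) \<in> borel_measurable borel"
  using borel_measurable_continuous_on_indicator[OF assms] by simp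

lemma borel_dird:
  assumes "f \<in> borel_measurable borel" shows "dird f v \<in> borel_measurable (borel :: 'a::euclidean_space measure)"
proof -
  have [measurable]: "f \<in> borel_measurable borel" by (rule assms)
  have [measurable]: "(\<lambda>x. dquot f v x t) \<in> borel_measurable borel" for t unfolding dquot_def by measurable
  show ?thesis unfolding dird_def[abs_def] by measurable
qed

lemma grad_indicator:
  assumes "open U" "x \<in> U" "u differentiable (at x)"
  shows "((\<lambda>x. indicator U x * u x) has_derivative (\<lambda>h. grad u x \<bullet> h)) (at x)"
  by (rule has_derivative_transform_within_open[OF has_derivative_grad[OF assms(3)] assms(1,2)]) simp

text \<open>Where \<open>u\<close> is not differentiable, \<open>grad u\<close> is an arbitrary
  choice, so measurability is obtained for the completed measure: almost everywhere on
  \<open>U\<close> it agrees with a Borel function built from \<open>dird\<close> of the extension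
  by zero.\<close>

lemma grad_measurable:
  fixes u :: "real ^ 'n \<Rightarrow> real"
  assumes U: "open U" and u: "locally_lipschitz_on U u"
  shows "grad u \<in> borel_measurable (lebesgue_on U)"
proof -
  let ?u = "\<lambda>x. indicator U x * u x"
  let ?g = "\<lambda>x. indicator U x *\<^sub>R (\<chi> i. dird ?u (axis i 1) x) :: real ^ 'n"
  have ub: "?u \<in> borel_measurable borel"
    using U locally_lipschitz_continuous[OF U u] by (intro borel_indicator_mult) auto
  have "(\<lambda>x. (\<chi> i. dird ?u (axis i 1) x) :: real ^ 'n) \<in> borel_measurable borel"
    unfolding borel_measurable_euclidean_space[of "\<lambda>x. (\<chi> i. dird ?u (axis i 1) x) :: real ^ 'n"]
    using borel_dird[OF ub] by (auto simp: Basis_vec_def inner_axis)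
  then have "?g \<in> borel_measurable borel" by (intro borel_measurable_scaleR borel_measurable_indicator) (use U in auto)
  then have gl: "?g \<in> borel_measurable lebesgue" by (simp add: measurable_completion)
  have ae: "AE x in lebesgue. ?g x = indicator U x *\<^sub>R grad u x"
    using AE_locally_lipschitz_differentiable[OF U u]
  proof eventually_elim
    case (elim x)
    show ?case
    proof (cases "x \<in> U")
      case True
      have "dird ?u (axis i 1) x = grad u x $ i" for i
        using dird_eq[OF grad_indicator[OF U True], of u "axis i 1"] elim True by (simp add: inner_axis)
      then show ?thesis by (simp add: vec_eq_iff)
    qed simp
  qed
  have "(\<lambda>x. indicator U x *\<^sub>R grad u x) \<in> borel_measurable lebesgue"
    by (rule borel_measurable_AE[OF gl ae])
  then show ?thesis using U by (simp add: borel_measurable_restrict_space_iff)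
qed

subsection \<open>Weak derivatives of locally Lipschitz functions\<close>

lemma AE_lebesgue_translate:
  fixes c :: "'a::euclidean_space"
  assumes "AE x in lebesgue. P x" shows "AE b in lborel. P (c + b)"
proof -
  have "AE x in lborel. P x" using assms by (simp add: AE_completion_iff)
  then obtain N where N: "N \<in> null_sets lborel" "{x. \<not> P x} \<subseteq> N" by (auto simp: eventually_ae_filter)
  have "emeasure lborel ((\<lambda>b. c + b) -` N) = emeasure (distr lborel borel (\<lambda>b. c + b)) N"
    using N(1) by (subst emeasure_distr) auto
  also have "\<dots> = 0" unfolding lborel_distr_plus using N(1) by auto
  finally have "(\<lambda>b. c + b) -` N \<in> null_sets lborel"
    using N(1) measurable_sets[of "\<lambda>b. c + b" lborel borel N] by (auto simp: null_sets_def)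
  from AE_not_in[OF this] show ?thesis by eventually_elim (use N(2) in auto)
qed

lemma compact_thickening:
  fixes S :: "'a::euclidean_space set"
  assumes "compact S" "\<And>x h. x \<in> S \<Longrightarrow> norm h < d \<Longrightarrow> x + h \<in> U" "r < d"
  obtains K where "compact K" "K \<subseteq> U" "\<And>x h. x \<in> S \<Longrightarrow> norm h \<le> r \<Longrightarrow> x + h \<in> K" 
proof (rule that[of "{x + y | x y. x \<in> S \<and> y \<in> cball 0 r}"])
  show "compact {x + y |x y. x \<in> S \<and> y \<in> cball 0 r}" by (rule compact_sums[OF assms(1) compact_cball])
  show "{x + y |x y. x \<in> S \<and> y \<in> cball 0 r} \<subseteq> U" using assms(2,3) by force
  show "x + h \<in> {x + y |x y. x \<in> S \<and> y \<in> cball 0 r}" if "x \<in> S" "norm h \<le> r" for x h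
    using that by auto
qed

lemma seq_at_0:
  fixes X :: "nat \<Rightarrow> real"
  assumes "X \<longlonglongrightarrow> 0" "\<And>n. X n \<noteq> 0" shows "filterlim X (at 0) sequentially"
  unfolding filterlim_at using assms by simp

lemma line_deriv:
  assumes "(f has_derivative f') (at (x + s *\<^sub>R v))"
  shows "((\<lambda>s. f (x + s *\<^sub>R v)) has_real_derivative f' v) (at s)"
proof -
  have "(\<lambda>h. (f (x + (s + h) *\<^sub>R v) - f (x + s *\<^sub>R v)) / h) = dquot f v (x + s *\<^sub>R v)"
    by (rule ext) (simp add: dquot_def algebra_simps)
  then show ?thesis using dquot_tendsto[OF assms, of v] by (simp add: DERIV_def)
qed

lemma test_function_bounds:
  fixes \<psi> :: "real ^ 'n \<Rightarrow> real"
  assumes "test_function U \<psi>"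
  shows "\<exists>S B C. compact S \<and> S \<subseteq> U \<and> (\<forall>x. x \<notin> S \<longrightarrow> \<psi> x = 0) \<and> (\<forall>x. x \<notin> S \<longrightarrow> partial_deriv i \<psi> x = 0) \<and>
    (\<forall>x. \<psi> differentiable (at x)) \<and> continuous_on UNIV (partial_deriv i \<psi>) \<and> continuous_on UNIV \<psi> \<and>
    0 \<le> B \<and> (\<forall>x. \<bar>\<psi> x\<bar> \<le> B) \<and> 0 \<le> C \<and> (\<forall>x t. \<bar>dquot \<psi> (axis i 1) x t\<bar> \<le> C)"
proof -
  define S where "S = closure {x. \<psi> x \<noteq> 0}"
  have S: "compact S" "S \<subseteq> U" using assms by (auto simp: S_def test_function_def compactly_contained_def)
  have "Ck_on (Suc 0) UNIV \<psi>" using assms by (auto simp: test_function_def smooth_on_def)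
  then have d: "\<psi> differentiable (at x)" and cp: "continuous_on UNIV (partial_deriv i \<psi>)" for x by auto
  have c: "continuous_on UNIV \<psi>" using d differentiable_imp_continuous_within continuous_at_imp_continuous_on by blast
  have z: "\<psi> x = 0" if "x \<notin> S" for x using that closure_subset[of "{x. \<psi> x \<noteq> 0}"] unfolding S_def by auto
  have zp: "partial_deriv i \<psi> x = 0" if x: "x \<notin> S" for x
  proof -
    have "open (- S)" using S(1) compact_imp_closed by blast
    have "(\<psi> has_derivative (\<lambda>h. 0)) (at x)"
      by (rule has_derivative_transform_within_open[OF has_derivative_const[of 0] \<open>open (- S)\<close>]) (use x z in auto)
    from partial_deriv_eqI[OF this] show ?thesis .
  qed
  have bnd: "\<exists>B\<ge>0. \<forall>x. \<bar>f x\<bar> \<le> B" if "continuous_on UNIV f" "\<And>x. x \<notin> S \<Longrightarrow> f x = 0" for f :: "real ^ 'n \<Rightarrow> real"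
  proof -
    have "bounded (f ` S)" using compact_imp_bounded[OF compact_continuous_image[OF continuous_on_subset[OF that(1)] S(1)]] by simp
    then obtain B where B: "0 < B" "\<forall>x\<in>S. \<bar>f x\<bar> \<le> B" unfolding bounded_pos by auto
    have "\<bar>f x\<bar> \<le> B" for x using B that(2)[of x] by (cases "x \<in> S") auto
    then show ?thesis using B(1) by (intro exI[of _ B]) auto
  qed
  obtain B where B: "0 \<le> B" "\<And>x. \<bar>\<psi> x\<bar> \<le> B" using bnd[OF c z] by blast
  obtain C where C: "0 \<le> C" "\<And>x. \<bar>partial_deriv i \<psi> x\<bar> \<le> C" using bnd[OF cp zp] by blast
  have dq: "\<bar>dquot \<psi> (axis i 1) x t\<bar> \<le> C" for x t
  proof (cases "t = 0")
    case False
    have dv: "((\<lambda>s. \<psi> (x + s *\<^sub>R axis i 1)) has_real_derivative partial_deriv i \<psi> (x + s *\<^sub>R axis i 1)) (at s within UNIV)" for s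
      using line_deriv[OF has_derivative_grad[OF d], of x "axis i 1" s] by (simp add: inner_axis grad_def)
    have "norm (\<psi> (x + t *\<^sub>R axis i 1) - \<psi> (x + 0 *\<^sub>R axis i 1)) \<le> C * norm (t - 0)"
      by (rule field_differentiable_bound[OF convex_UNIV dv]) (use C(2) in auto)
    then show ?thesis using False by (simp add: dquot_def abs_divide divide_le_eq)
  qed (use C in \<open>simp add: dquot_def\<close>)
  show ?thesis by (intro exI[of _ S] exI[of _ B] exI[of _ C] conjI S cp c B(1) C(1) allI impI z zp d B(2) dq)
qed

lemma integral_lebesgue_on_borel:
  fixes f :: "real ^ 'n \<Rightarrow> real"
  assumes "open U" "(\<lambda>x. indicator U x * f x) \<in> borel_measurable borel"
  shows "(LINT x|lebesgue_on U. f x) = (\<integral>x. indicator U x * f x \<partial>lborel)"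
proof -
  have "(LINT x|lebesgue_on U. f x) = (\<integral>x. indicator U x *\<^sub>R f x \<partial>lebesgue)"
    by (rule integral_restrict_space) (use assms(1) in auto)
  also have "\<dots> = (\<integral>x. indicator U x * f x \<partial>lborel)" using assms(2) by (simp add: integral_completion)
  finally show ?thesis .
qed

text \<open>For difference quotients, integration by parts is a translation of the integral;
  dominated convergence then passes to derivatives on both sides, with Rademacher's theorem on the
  side of \<open>u\<close>.\<close>

lemma weak_partial_deriv_locally_lipschitz:
  fixes u :: "real ^ 'n \<Rightarrow> real"
  assumes U: "open U" and u: "locally_lipschitz_on U u"
  shows "weak_partial_deriv U i u (partial_deriv i u)"
  unfolding weak_partial_deriv_def
proof (intro allI impI)
  fix \<psi> assume "test_function U \<psi>"
  from test_function_bounds[OF this, of i] obtain S B C where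
    "compact S \<and> S \<subseteq> U \<and> (\<forall>x. x \<notin> S \<longrightarrow> \<psi> x = 0) \<and> (\<forall>x. x \<notin> S \<longrightarrow> partial_deriv i \<psi> x = 0) \<and>
    (\<forall>x. \<psi> differentiable (at x)) \<and> continuous_on UNIV (partial_deriv i \<psi>) \<and> continuous_on UNIV \<psi> \<and>
    0 \<le> B \<and> (\<forall>x. \<bar>\<psi> x\<bar> \<le> B) \<and> 0 \<le> C \<and> (\<forall>x t. \<bar>dquot \<psi> (axis i 1) x t\<bar> \<le> C)"
    by (elim exE)
  then have S: "compact S" "S \<subseteq> U" and z: "\<And>x. x \<notin> S \<Longrightarrow> \<psi> x = 0" "\<And>x. x \<notin> S \<Longrightarrow> partial_deriv i \<psi> x = 0"
    and d: "\<And>x. \<psi> differentiable (at x)" and cp: "continuous_on UNIV (partial_deriv i \<psi>)" "continuous_on UNIV \<psi>"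
    and B: "0 \<le> B" "\<And>x. \<bar>\<psi> x\<bar> \<le> B" and C: "0 \<le> C" "\<And>x t. \<bar>dquot \<psi> (axis i 1) x t\<bar> \<le> C"
    by simp_all
  let ?e = "axis i 1 :: real ^ 'n"
  let ?v = "\<lambda>x. indicator U x * u x"
  have cu: "continuous_on U u" by (rule locally_lipschitz_continuous[OF U u])
  have vb [measurable]: "?v \<in> borel_measurable borel" using U cu by (intro borel_indicator_mult) auto
  have pb [measurable]: "\<psi> \<in> borel_measurable borel" "partial_deriv i \<psi> \<in> borel_measurable borel"
    using cp borel_measurable_continuous_onI by blast+
  obtain d0 L where dL: "0 < d0" "0 \<le> L" "\<And>x h. x \<in> S \<Longrightarrow> norm h < d0 \<Longrightarrow> x + h \<in> U \<and> \<bar>u (x + h) - u x\<bar> \<le> L * norm h"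
    using locally_lipschitz_compact[OF U u S] by metis
  \<comment> \<open>The thickening contains every point reached from \<open>S\<close> by steps of
    length at most \<open>d0 / 2\<close>; on it \<open>u\<close> is bounded and equals its extension
    by zero.\<close>
  obtain K where K: "compact K" "K \<subseteq> U" "\<And>x h. x \<in> S \<Longrightarrow> norm h \<le> d0 / 2 \<Longrightarrow> x + h \<in> K"
    using compact_thickening[OF S(1), of d0 U "d0 / 2"] dL by (metis field_sum_of_halves less_add_same_cancel2 half_gt_zero)
  have SK: "S \<subseteq> K" using K(3)[of _ 0] dL(1) by auto
  have "bounded (u ` K)" using compact_imp_bounded[OF compact_continuous_image[OF continuous_on_subset[OF cu K(2)] K(1)]] .
  then obtain A where A: "0 < A" "\<And>x. x \<in> K \<Longrightarrow> \<bar>u x\<bar> \<le> A" unfolding bounded_pos by auto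
  have "(\<lambda>n. inverse (real (Suc n))) \<longlonglongrightarrow> 0" by (rule LIMSEQ_inverse_real_of_nat)
  from order_tendstoD(2)[OF this, of "d0 / 2"] obtain n0 where n0: "\<And>n. n0 \<le> n \<Longrightarrow> inverse (real (Suc n)) < d0 / 2"
    using dL(1) unfolding eventually_sequentially by auto
  define s where "s n = inverse (real (Suc (n + n0)))" for n
  have s: "0 < s n" "s n < d0 / 2" for n using n0[of "n + n0"] by (auto simp: s_def)
  have s0: "filterlim s (at 0) sequentially"
    by (rule seq_at_0) (use LIMSEQ_ignore_initial_segment[OF LIMSEQ_inverse_real_of_nat, of n0] s(1) in \<open>auto simp: s_def[abs_def]\<close>)
  have ne: "norm ?e = 1" by simp
  have Kx: "x \<in> K" if "x \<in> S \<or> x + s n *\<^sub>R ?e \<in> S" for x n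
  proof -
    have "x \<in> K" if "x + s n *\<^sub>R ?e \<in> S" using K(3)[OF that, of "- (s n *\<^sub>R ?e)"] s[of n] by simp
    then show ?thesis using that SK by blast
  qed
  have KU: "indicator U x = (1::real)" if "x \<in> K" for x using that K(2) by auto
  have W: "integrable lborel (\<lambda>x. indicator K x * c)" for c :: real
    using has_bochner_integral_indicator[of K lborel c] emeasure_bounded_finite[OF compact_imp_bounded[OF K(1)]] K(1)
    by (auto simp: has_bochner_integral_iff borel_compact)
  define a where "a n = (\<integral>x. ?v x * dquot \<psi> ?e x (s n) \<partial>lborel)" for n
  have alim: "a \<longlonglongrightarrow> (\<integral>x. ?v x * partial_deriv i \<psi> x \<partial>lborel)"
    unfolding a_def
  proof (rule integral_dominated_convergence[where w = "\<lambda>x. indicator K x * (A * C)"])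
    show "(\<lambda>x. ?v x * dquot \<psi> ?e x (s n)) \<in> borel_measurable lborel" for n unfolding dquot_def by measurable
    show "AE x in lborel. (\<lambda>n. ?v x * dquot \<psi> ?e x (s n)) \<longlonglongrightarrow> ?v x * partial_deriv i \<psi> x"
    proof (rule AE_I2)
      fix x
      have "(dquot \<psi> ?e x \<longlongrightarrow> partial_deriv i \<psi> x) (at 0)"
        using dquot_tendsto[OF has_derivative_grad[OF d], of ?e x] by (simp add: inner_axis grad_def)
      from filterlim_compose[OF this s0] show "(\<lambda>n. ?v x * dquot \<psi> ?e x (s n)) \<longlonglongrightarrow> ?v x * partial_deriv i \<psi> x"
        by (rule tendsto_mult_left)
    qed
    show "AE x in lborel. norm (?v x * dquot \<psi> ?e x (s n)) \<le> indicator K x * (A * C)" for n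
    proof (rule AE_I2)
      fix x
      show "norm (?v x * dquot \<psi> ?e x (s n)) \<le> indicator K x * (A * C)"
      proof (cases "x \<in> K")
        case True
        have "\<bar>u x\<bar> * \<bar>dquot \<psi> ?e x (s n)\<bar> \<le> A * C" using A True C by (intro mult_mono) auto
        then show ?thesis using True KU[OF True] by (simp add: abs_mult)
      next
        case False
        then have "x \<notin> S" "x + s n *\<^sub>R ?e \<notin> S" using Kx[of x n] by auto
        then show ?thesis using z(1) False by (simp add: dquot_def)
      qed
    qed
  qed (use W in measurable)
  \<comment> \<open>Discrete integration by parts: translating by \<open>s n\<close> moves the
    quotient from \<psi> to \<open>u\<close> and reverses the direction.\<close>
  have aeq: "a n = (\<integral>x. dquot ?v (- ?e) x (s n) * \<psi> x \<partial>lborel)" for n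
  proof -
    let ?f = "\<lambda>x. ?v x * \<psi> (x + s n *\<^sub>R ?e)"
    have bI: "integrable lborel (\<lambda>x. ?v x * \<psi> (x + h *\<^sub>R ?e))" if "\<And>x. x + h *\<^sub>R ?e \<in> S \<Longrightarrow> x \<in> K" for h
    proof (rule Bochner_Integration.integrable_bound[OF W[of "A * B"]])
      show "AE x in lborel. norm (?v x * \<psi> (x + h *\<^sub>R ?e)) \<le> norm (indicator K x * (A * B))"
      proof (rule AE_I2)
        fix x
        show "norm (?v x * \<psi> (x + h *\<^sub>R ?e)) \<le> norm (indicator K x * (A * B))"
        proof (cases "x \<in> K")
          case True
          have "\<bar>u x\<bar> * \<bar>\<psi> (x + h *\<^sub>R ?e)\<bar> \<le> A * B" using A True B by (intro mult_mono) auto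
          then show ?thesis using True KU[OF True] A(1) B(1) by (simp add: abs_mult)
        next
          case False
          then show ?thesis using z(1)[of "x + h *\<^sub>R ?e"] that[of x] by auto
        qed
      qed
    qed measurable
    have i1: "integrable lborel ?f" by (rule bI) (use Kx in blast)
    have i2: "integrable lborel (\<lambda>x. ?v x * \<psi> x)" using bI[of 0] SK by auto
    have fm: "?f \<in> borel_measurable borel" by measurable
    have tr: "integral\<^sup>L lborel ?f = (\<integral>x. ?v (x - s n *\<^sub>R ?e) * \<psi> x \<partial>lborel)"
      using lborel_integral_affine[OF _ fm, of 1 "- (s n *\<^sub>R ?e)"] by (simp add: algebra_simps)
    have i3: "integrable lborel (\<lambda>x. ?v (x - s n *\<^sub>R ?e) * \<psi> x)"
    proof (rule Bochner_Integration.integrable_bound[OF W[of "A * B"]])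
      show "AE x in lborel. norm (?v (x - s n *\<^sub>R ?e) * \<psi> x) \<le> norm (indicator K x * (A * B))"
      proof (rule AE_I2)
        fix x
        show "norm (?v (x - s n *\<^sub>R ?e) * \<psi> x) \<le> norm (indicator K x * (A * B))"
        proof (cases "x \<in> S")
          case True
          have k: "x - s n *\<^sub>R ?e \<in> K" using K(3)[OF True, of "- (s n *\<^sub>R ?e)"] s[of n] by simp
          have "\<bar>u (x - s n *\<^sub>R ?e)\<bar> * \<bar>\<psi> x\<bar> \<le> A * B" using A k B by (intro mult_mono) auto
          then show ?thesis using KU[OF k] SK True A(1) B(1) by (auto simp: abs_mult)
        qed (use z(1) in auto)
      qed
    qed measurable
    have "a n = (\<integral>x. (?f x - ?v x * \<psi> x) / s n \<partial>lborel)"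
      unfolding a_def by (rule Bochner_Integration.integral_cong) (auto simp: dquot_def right_diff_distrib diff_divide_distrib)
    also have "\<dots> = (integral\<^sup>L lborel ?f - (\<integral>x. ?v x * \<psi> x \<partial>lborel)) / s n"
      using Bochner_Integration.integral_diff[OF i1 i2] by simp
    also have "\<dots> = (\<integral>x. (?v (x - s n *\<^sub>R ?e) * \<psi> x - ?v x * \<psi> x) / s n \<partial>lborel)"
      unfolding tr using Bochner_Integration.integral_diff[OF i3 i2] by simp
    also have "\<dots> = (\<integral>x. dquot ?v (- ?e) x (s n) * \<psi> x \<partial>lborel)"
      by (rule Bochner_Integration.integral_cong) (auto simp: dquot_def left_diff_distrib diff_divide_distrib)
    finally show ?thesis .
  qed
  have blim: "(\<lambda>n. \<integral>x. dquot ?v (- ?e) x (s n) * \<psi> x \<partial>lborel) \<longlonglongrightarrow> (\<integral>x. - (dird ?v ?e x * \<psi> x) \<partial>lborel)"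
  proof (rule integral_dominated_convergence[where w = "\<lambda>x. indicator K x * (L * B)"])
    have [measurable]: "dird ?v ?e \<in> borel_measurable borel" by (rule borel_dird[OF vb])
    show "(\<lambda>x. - (dird ?v ?e x * \<psi> x)) \<in> borel_measurable lborel" by measurable
    show "(\<lambda>x. dquot ?v (- ?e) x (s n) * \<psi> x) \<in> borel_measurable lborel" for n unfolding dquot_def by measurable
    have "AE x in lborel. x \<in> U \<longrightarrow> u differentiable (at x)"
      using AE_locally_lipschitz_differentiable[OF U u] by (simp add: AE_completion_iff)
    then show "AE x in lborel. (\<lambda>n. dquot ?v (- ?e) x (s n) * \<psi> x) \<longlonglongrightarrow> - (dird ?v ?e x * \<psi> x)"
    proof eventually_elim
      case (elim x)
      show ?case
      proof (cases "x \<in> S")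
        case True
        then have xU: "x \<in> U" using S by blast
        note hd = grad_indicator[OF U xU elim[rule_format, OF xU]]
        have "(dquot ?v (- ?e) x \<longlongrightarrow> - dird ?v ?e x) (at 0)"
          using dquot_tendsto[OF hd, of "- ?e"] dird_eq[OF hd, of ?e] by simp
        from tendsto_mult_right[OF filterlim_compose[OF this s0], of "\<psi> x"] show ?thesis by simp
      qed (use z(1) in simp)
    qed
    show "AE x in lborel. norm (dquot ?v (- ?e) x (s n) * \<psi> x) \<le> indicator K x * (L * B)" for n
    proof (rule AE_I2)
      fix x
      show "norm (dquot ?v (- ?e) x (s n) * \<psi> x) \<le> indicator K x * (L * B)"
      proof (cases "x \<in> S")
        case True
        have k: "x - s n *\<^sub>R ?e \<in> K" using K(3)[OF True, of "- (s n *\<^sub>R ?e)"] s[of n] by simp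
        have "\<bar>u (x - s n *\<^sub>R ?e) - u x\<bar> \<le> L * s n"
          using dL(3)[OF True, of "- (s n *\<^sub>R ?e)"] s[of n] by simp
        then have "\<bar>dquot ?v (- ?e) x (s n)\<bar> \<le> L"
          using KU[OF k] KU[of x] SK True s(1)[of n] by (auto simp: dquot_def abs_divide divide_le_eq)
        then have "\<bar>dquot ?v (- ?e) x (s n)\<bar> * \<bar>\<psi> x\<bar> \<le> L * B" using B dL(2) by (intro mult_mono) auto
        then show ?thesis using SK True by (auto simp: abs_mult)
      qed (use z(1) B dL in \<open>simp add: indicator_def\<close>)
    qed
  qed (use W in measurable)
  have "a = (\<lambda>n. \<integral>x. dquot ?v (- ?e) x (s n) * \<psi> x \<partial>lborel)" by (rule ext) (rule aeq)
  then have main: "(\<integral>x. ?v x * partial_deriv i \<psi> x \<partial>lborel) = (\<integral>x. - (dird ?v ?e x * \<psi> x) \<partial>lborel)"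
    using LIMSEQ_unique[OF alim] blim by simp
  have l: "(LINT x|lebesgue_on U. u x * partial_deriv i \<psi> x) = (\<integral>x. ?v x * partial_deriv i \<psi> x \<partial>lborel)"
  proof -
    have eq: "(\<lambda>x. indicator U x * (u x * partial_deriv i \<psi> x)) = (\<lambda>x. ?v x * partial_deriv i \<psi> x)" by (simp add: mult.assoc)
    have "(\<lambda>x. indicator U x * (u x * partial_deriv i \<psi> x)) \<in> borel_measurable borel" unfolding eq by measurable
    from integral_lebesgue_on_borel[OF U this] show ?thesis by (simp only: eq)
  qed
  \<comment> \<open>\<open>partial_deriv i u\<close> is arbitrary on a null set, so it is exchanged
    for the Borel function \<open>dird\<close> before passing from \<open>lebesgue\<close> to
    \<open>lborel\<close>.\<close>
  have r: "(LINT x|lebesgue_on U. partial_deriv i u x * \<psi> x) = (\<integral>x. dird ?v ?e x * \<psi> x \<partial>lborel)"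
  proof -
    have [measurable]: "dird ?v ?e \<in> borel_measurable borel" by (rule borel_dird[OF vb])
    have "(LINT x|lebesgue_on U. partial_deriv i u x * \<psi> x) = (\<integral>x. indicator U x *\<^sub>R (partial_deriv i u x * \<psi> x) \<partial>lebesgue)"
      by (rule integral_restrict_space) (use U in auto)
    also have "\<dots> = (\<integral>x. dird ?v ?e x * \<psi> x \<partial>lebesgue)"
    proof (rule integral_cong_AE)
      have ae: "AE x in lebesgue. dird ?v ?e x * \<psi> x = indicator U x *\<^sub>R (partial_deriv i u x * \<psi> x)"
        using AE_locally_lipschitz_differentiable[OF U u]
      proof eventually_elim
        case (elim x)
        show ?case
        proof (cases "x \<in> U")
          case True
          have "dird ?v ?e x = partial_deriv i u x"
            using dird_eq[OF grad_indicator[OF U True elim[rule_format, OF True]], of ?e] by (simp add: inner_axis grad_def)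
          then show ?thesis using True by simp
        next
          case False
          then have "\<psi> x = 0" using z(1) S(2) by blast
          then show ?thesis by simp
        qed
      qed
      have "(\<lambda>x. dird ?v ?e x * \<psi> x) \<in> borel_measurable borel" by measurable
      then show m: "(\<lambda>x. dird ?v ?e x * \<psi> x) \<in> borel_measurable lebesgue" by (simp add: measurable_completion)
      show "(\<lambda>x. indicator U x *\<^sub>R (partial_deriv i u x * \<psi> x)) \<in> borel_measurable lebesgue"
        by (rule borel_measurable_AE[OF m ae])
      show "AE x in lebesgue. indicator U x *\<^sub>R (partial_deriv i u x * \<psi> x) = dird ?v ?e x * \<psi> x"
        using ae by eventually_elim (rule sym)
    qed
    also have "\<dots> = (\<integral>x. dird ?v ?e x * \<psi> x \<partial>lborel)" by (rule integral_completion) measurable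
    finally show ?thesis .
  qed
  show "(LINT x|lebesgue_on U. u x * partial_deriv i \<psi> x) = - (LINT x|lebesgue_on U. partial_deriv i u x * \<psi> x)"
    unfolding l r main by simp
qed

lemma locally_lipschitz_W1inf:
  fixes u :: "real ^ 'n \<Rightarrow> real"
  assumes U: "open U" and u: "locally_lipschitz_on U u"
  shows "u \<in> W1inf_loc U"
proof -
  have cu: "continuous_on U u" by (rule locally_lipschitz_continuous[OF U u])
  have um: "u \<in> borel_measurable (lebesgue_on U)"
    using U by (intro continuous_imp_measurable_on_sets_lebesgue cu) auto
  have restr: "f \<in> borel_measurable (lebesgue_on V)" if "f \<in> borel_measurable (lebesgue_on U)" "V \<subseteq> U" for f :: "real ^ 'n \<Rightarrow> real" and V
    by (rule measurable_restrict_mono[OF that])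
  have lin: "Linf_norm V f < \<infinity>"
    if V: "open V" "V \<subset>\<subset> U" and f: "f \<in> borel_measurable (lebesgue_on U)" and ae: "AE x in lebesgue. x \<in> V \<longrightarrow> \<bar>f x\<bar> \<le> B" for V f B
  proof -
    have VU: "V \<subseteq> U" using V closure_subset unfolding compactly_contained_def by blast
    have fV: "f \<in> borel_measurable (lebesgue_on V)" by (rule restr[OF f VU])
    have "Linf_norm V f \<le> ennreal B" unfolding Linf_norm_def
    proof (rule esssup_I)
      show "(\<lambda>x. ennreal \<bar>f x\<bar>) \<in> borel_measurable (lebesgue_on V)" using fV by measurable
      show "AE x in lebesgue_on V. ennreal \<bar>f x\<bar> \<le> ennreal B"
        using ae V(1) by (subst AE_restrict_space_iff) (auto elim!: eventually_mono intro: ennreal_leI)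
    qed
    then show ?thesis using ennreal_less_top le_less_trans by (metis infinity_ennreal_def)
  qed
  have "u \<in> Linf_loc U" unfolding Linf_loc_def mem_Collect_eq
  proof (intro conjI um allI impI)
    fix V assume V: "open V \<and> V \<subset>\<subset> U"
    note cc = compactly_containedD[of V U]
    have "bounded (u ` closure V)"
      using V cc by (intro compact_imp_bounded compact_continuous_image continuous_on_subset[OF cu]) auto
    then obtain B where B: "\<forall>x\<in>closure V. \<bar>u x\<bar> \<le> B" unfolding bounded_pos by auto
    have "\<bar>u x\<bar> \<le> B" if "x \<in> V" for x using B subsetD[OF closure_subset that] by blast
    then show "Linf_norm V u < \<infinity>" using V by (intro lin[OF _ _ um, of V B]) auto
  qed
  moreover have "partial_deriv i u \<in> Linf_loc U" for i unfolding Linf_loc_def mem_Collect_eq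
  proof (intro conjI allI impI)
    have "(\<lambda>x. grad u x \<bullet> axis i 1) \<in> borel_measurable (lebesgue_on U)"
      using grad_measurable[OF U u] by measurable
    then show pm: "partial_deriv i u \<in> borel_measurable (lebesgue_on U)" by (simp add: inner_axis grad_def[abs_def])
    fix V assume V: "open V \<and> V \<subset>\<subset> U"
    then have cc: "compact (closure V)" "closure V \<subseteq> U" using compactly_containedD[of V U] by auto
    obtain d L where dL: "0 < d" "0 \<le> L"
      "\<And>x h. x \<in> closure V \<Longrightarrow> norm h < d \<Longrightarrow> x + h \<in> U \<and> \<bar>u (x + h) - u x\<bar> \<le> L * norm h"
      using locally_lipschitz_compact[OF U u cc] by metis
    have bd: "\<bar>partial_deriv i u x\<bar> \<le> L" if x: "x \<in> V" "u differentiable (at x)" for x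
    proof -
      have lim: "(dquot u (axis i 1) x \<longlongrightarrow> partial_deriv i u x) (at 0)"
        using dquot_tendsto[OF has_derivative_grad[OF x(2)], of "axis i 1"] by (simp add: inner_axis grad_def)
      have xc: "x \<in> closure V" by (rule subsetD[OF closure_subset x(1)])
      have "\<forall>\<^sub>F t in at 0. \<bar>dquot u (axis i 1) x t\<bar> \<le> L"
        unfolding eventually_at
      proof (intro exI[of _ d] conjI dL ballI impI)
        fix t :: real assume t: "t \<noteq> 0 \<and> dist t 0 < d"
        have "\<bar>u (x + t *\<^sub>R axis i 1) - u x\<bar> \<le> L * \<bar>t\<bar>" using dL(3)[OF xc, of "t *\<^sub>R axis i 1"] t by (simp add: dist_real_def)
        then show "\<bar>dquot u (axis i 1) x t\<bar> \<le> L" using t by (simp add: dquot_def abs_divide divide_le_eq)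
      qed
      from tendsto_upperbound[OF tendsto_rabs[OF lim] this] show ?thesis by simp
    qed
    have "AE x in lebesgue. x \<in> V \<longrightarrow> \<bar>partial_deriv i u x\<bar> \<le> L"
      using AE_locally_lipschitz_differentiable[OF U u]
      by eventually_elim (use bd cc closure_subset in blast)
    then show "Linf_norm V (partial_deriv i u) < \<infinity>" using V by (intro lin[OF _ _ pm]) auto
  qed
  ultimately show ?thesis
    unfolding W1inf_loc_def using weak_partial_deriv_locally_lipschitz[OF U u] by blast
qed

section \<open>From gradient bounds to bounds along segments\<close>

context finsler begin

text \<open>A single segment may lie inside the null set where the gradient bound fails.
  \<open>F t\<close> integrates \<open>v\<close> over a ball around the point at parameter
  \<open>t\<close> and is differentiable by dominated convergence, with \<open>L1 * norm w\<close>
  as the bound; \<open>2 * (L1 * \<delta>)\<close> is the error of replacing the values at the two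
  ends by averages.\<close>

lemma segment_estimate:
  assumes V: "open V" and v: "locally_lipschitz_on V v"
    and ae: "AE x in lebesgue. x \<in> V \<longrightarrow> dual_norm \<phi> (grad v x) \<le> C"
    and seg: "closed_segment y x \<subseteq> V"
  shows "v x - v y \<le> C * \<phi> (x - y)"
proof -
  define w where "w = x - y"
  define S where "S = closed_segment y x"
  have S: "compact S" "S \<subseteq> V" using seg by (auto simp: S_def)
  have inS: "y + t *\<^sub>R w \<in> S" if "0 \<le> t" "t \<le> 1" for t
    using that unfolding S_def w_def in_segment by (intro exI[of _ t]) (auto simp: algebra_simps)
  obtain d0 L0 where d0: "0 < d0" "\<And>x h. x \<in> S \<Longrightarrow> norm h < d0 \<Longrightarrow> x + h \<in> V \<and> \<bar>v (x + h) - v x\<bar> \<le> L0 * norm h"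
    using locally_lipschitz_compact[OF V v S] by metis
  define \<delta>0 where "\<delta>0 = d0 / 2"
  have \<delta>0: "0 < \<delta>0" "\<delta>0 < d0" using d0(1) by (auto simp: \<delta>0_def)
  obtain K where K: "compact K" "K \<subseteq> V" "\<And>x h. x \<in> S \<Longrightarrow> norm h \<le> \<delta>0 \<Longrightarrow> x + h \<in> K"
    using compact_thickening[OF S(1), of d0 V \<delta>0] d0(2) \<delta>0(2) by metis
  obtain d1 L1 where d1: "0 < d1" "0 \<le> L1"
    "\<And>x h. x \<in> K \<Longrightarrow> norm h < d1 \<Longrightarrow> x + h \<in> V \<and> \<bar>v (x + h) - v x\<bar> \<le> L1 * norm h"
    using locally_lipschitz_compact[OF V v K(1,2)] by metis
  have cv: "continuous_on V v" by (rule locally_lipschitz_continuous[OF V v])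
  let ?v = "\<lambda>x. indicator V x * v x"
  have vb: "?v \<in> borel_measurable borel" using V cv by (intro borel_indicator_mult) auto
  have ball: "measure lborel (cball (0 :: real ^ 'n) \<delta>) * (v x - v y - 2 * (L1 * \<delta>)) \<le> measure lborel (cball (0 :: real ^ 'n) \<delta>) * (C * \<phi> w)"
    if \<delta>: "0 < \<delta>" "\<delta> \<le> \<delta>0" "\<delta> < d1" for \<delta>
  proof -
    let ?B = "cball (0 :: real ^ 'n) \<delta>"
    define F where "F t = (\<integral>b. indicator ?B b * v (y + t *\<^sub>R w + b) \<partial>lborel)" for t
    have inK: "y + t *\<^sub>R w + b \<in> K" if "0 \<le> t" "t \<le> 1" "b \<in> ?B" for t b
      using K(3)[OF inS[OF that(1,2)], of b] that(3) \<delta>(2) by simp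
    have integ: "integrable lborel (\<lambda>b. indicator ?B b * v (y + t *\<^sub>R w + b))" if "\<And>b. b \<in> ?B \<Longrightarrow> y + t *\<^sub>R w + b \<in> V" for t
    proof -
      have "continuous_on ?B (\<lambda>b. v (y + t *\<^sub>R w + b))"
      proof (rule continuous_on_compose2[OF cv])
        show "(\<lambda>b. y + t *\<^sub>R w + b) ` ?B \<subseteq> V" using that by blast
      qed (intro continuous_intros)
      from borel_integrable_compact[OF compact_cball this] show ?thesis by simp
    qed
    have mB: "integrable lborel (\<lambda>b. indicator ?B b * c)" "(\<integral>b. indicator ?B b * c \<partial>lborel) = measure lborel ?B * c" for c :: real
      using has_bochner_integral_indicator[of ?B lborel c] emeasure_bounded_finite[OF bounded_cball[of "0 :: real ^ 'n" \<delta>]]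
      by (auto simp: has_bochner_integral_iff)
    define D where "D t = (\<integral>b. indicator ?B b * dird ?v w (y + t *\<^sub>R w + b) \<partial>lborel)" for t
    have deriv: "(F has_real_derivative D t) (at t) \<and> D t \<le> measure lborel ?B * (C * \<phi> w)" if t: "0 \<le> t" "t \<le> 1" for t
    proof
      let ?c = "y + t *\<^sub>R w"
      have AEd: "AE b in lborel. b \<in> ?B \<longrightarrow> (dquot v w (?c + b) \<longlongrightarrow> dird ?v w (?c + b)) (at 0) \<and> dird ?v w (?c + b) \<le> C * \<phi> w"
        using AE_lebesgue_translate[OF AE_locally_lipschitz_differentiable[OF V v], of ?c] AE_lebesgue_translate[OF ae, of ?c]
      proof eventually_elim
        case (elim b)
        show ?case
        proof
          assume "b \<in> ?B"
          then have zV: "?c + b \<in> V" using inK[OF t] K(2) by blast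
          then have df: "v differentiable (at (?c + b))" using elim by blast
          have e: "dird ?v w (?c + b) = grad v (?c + b) \<bullet> w" by (rule dird_eq[OF grad_indicator[OF V zV df]])
          have "grad v (?c + b) \<bullet> w \<le> dual_norm \<phi> (grad v (?c + b)) * \<phi> w" by (rule inner_le_dual)
          also have "\<dots> \<le> C * \<phi> w" using elim zV by (intro mult_right_mono) auto
          finally show "(dquot v w (?c + b) \<longlongrightarrow> dird ?v w (?c + b)) (at 0) \<and> dird ?v w (?c + b) \<le> C * \<phi> w"
            using dquot_tendsto[OF has_derivative_grad[OF df], of w] e by simp
        qed
      qed
      have "(\<lambda>b. dird ?v w (?c + b)) \<in> borel_measurable lborel"
        by (rule measurable_compose[OF _ borel_dird[OF vb]]) simp
      then have Dm: "(\<lambda>b. indicator ?B b * dird ?v w (?c + b)) \<in> borel_measurable lborel"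
        by (intro borel_measurable_times borel_measurable_indicator) auto
      let ?W = "\<lambda>b. indicator ?B b * (L1 * norm w)"
      have lim: "(\<lambda>n. (F (t + X n) - F t) / X n) \<longlonglongrightarrow> D t \<and> integrable lborel (\<lambda>b. indicator ?B b * dird ?v w (?c + b))"
        if X: "X \<longlonglongrightarrow> 0" "\<And>n. X n \<noteq> 0" "\<And>n. \<bar>X n\<bar> * norm w < d1" for X
      proof -
        have small: "norm (X n *\<^sub>R w) < d1" for n using X(3) by simp
        have zV: "?c + b + X n *\<^sub>R w \<in> V" "\<bar>v (?c + b + X n *\<^sub>R w) - v (?c + b)\<bar> \<le> L1 * (\<bar>X n\<bar> * norm w)" if "b \<in> ?B" for b n
          using d1(3)[OF inK[OF t that] small[of n]] by auto
        have eqz: "y + (t + X n) *\<^sub>R w + b = ?c + b + X n *\<^sub>R w" for b n by (simp add: algebra_simps)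
        have i1: "integrable lborel (\<lambda>b. indicator ?B b * v (y + (t + X n) *\<^sub>R w + b))" for n
        proof (rule integ)
          fix b :: "real ^ 'n" assume "b \<in> ?B"
          then show "y + (t + X n) *\<^sub>R w + b \<in> V" unfolding eqz by (rule zV(1))
        qed
        have i2: "integrable lborel (\<lambda>b. indicator ?B b * v (?c + b))"
          by (rule integ) (use inK[OF t] K(2) in blast)
        have pt: "(indicator ?B b * v (y + (t + X n) *\<^sub>R w + b) - indicator ?B b * v (?c + b)) / X n = indicator ?B b * dquot v w (?c + b) (X n)" for b n
          unfolding eqz dquot_def by (simp add: right_diff_distrib diff_divide_distrib)
        have qe: "(F (t + X n) - F t) / X n = (\<integral>b. indicator ?B b * dquot v w (?c + b) (X n) \<partial>lborel)" for n
          unfolding F_def Bochner_Integration.integral_diff[OF i1 i2, symmetric] pt[symmetric] by simp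
        have qi: "integrable lborel (\<lambda>b. indicator ?B b * dquot v w (?c + b) (X n))" for n
          using integrable_divide[OF Bochner_Integration.integrable_diff[OF i1[of n] i2], of "X n"] by (simp only: pt)
        have bd: "AE b in lborel. norm (indicator ?B b * dquot v w (?c + b) (X n)) \<le> ?W b" for n
        proof (rule AE_I2)
          fix b
          show "norm (indicator ?B b * dquot v w (?c + b) (X n)) \<le> ?W b"
          proof (cases "b \<in> ?B")
            case True
            have "\<bar>dquot v w (?c + b) (X n)\<bar> \<le> L1 * norm w"
              using zV(2)[OF True, of n] X(2)[of n] by (simp add: dquot_def abs_divide divide_le_eq mult_ac)
            then show ?thesis using True by simp
          qed simp
        qed
        have li: "AE b in lborel. (\<lambda>n. indicator ?B b * dquot v w (?c + b) (X n)) \<longlonglongrightarrow> indicator ?B b * dird ?v w (?c + b)"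
          using AEd
        proof eventually_elim
          case (elim b)
          show ?case
          proof (cases "b \<in> ?B")
            case True
            then have "(dquot v w (?c + b) \<longlongrightarrow> dird ?v w (?c + b)) (at 0)" using elim by blast
            from filterlim_compose[OF this seq_at_0[OF X(1,2)]] show ?thesis by (intro tendsto_mult_left)
          qed simp
        qed
        have "(\<lambda>n. \<integral>b. indicator ?B b * dquot v w (?c + b) (X n) \<partial>lborel) \<longlonglongrightarrow> D t"
          unfolding D_def by (rule integral_dominated_convergence[OF Dm _ mB(1) li bd]) (use qi in auto)
        moreover have "integrable lborel (\<lambda>b. indicator ?B b * dird ?v w (?c + b))"
          by (rule integrable_dominated_convergence[OF Dm _ mB(1) li bd]) (use qi in auto)
        ultimately show ?thesis unfolding qe by simp
      qed
      \<comment> \<open>One concrete null sequence suffices to read off integrability of the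
        directional derivative; it is scaled so that all its steps are shorter than
        \<open>d1\<close>.\<close>
      have scale: "(\<lambda>n. inverse (real (Suc n)) * (d1 / (2 * (norm w + 1)))) \<longlonglongrightarrow> 0"
        by (rule tendsto_mult_left_zero[OF LIMSEQ_inverse_real_of_nat])
      have w1: "0 < norm w + 1" by (simp add: add_nonneg_pos)
      have "\<bar>inverse (real (Suc n)) * (d1 / (2 * (norm w + 1)))\<bar> * norm w < d1" for n
      proof -
        have "\<bar>inverse (real (Suc n)) * (d1 / (2 * (norm w + 1)))\<bar> \<le> 1 * (d1 / (2 * (norm w + 1)))"
          unfolding abs_mult using w1 d1(1) by (intro mult_mono) (auto simp: field_simps)
        then have "\<bar>inverse (real (Suc n)) * (d1 / (2 * (norm w + 1)))\<bar> * norm w \<le> d1 / (2 * (norm w + 1)) * (norm w + 1)"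
          using w1 d1(1) by (intro mult_mono) auto
        also have "\<dots> = d1 / 2" using w1 by (simp add: field_simps)
        finally show ?thesis using d1(1) by linarith
      qed
      then have Di: "integrable lborel (\<lambda>b. indicator ?B b * dird ?v w (?c + b))"
        using lim[OF scale] w1 d1(1) by simp
      have "D t \<le> (\<integral>b. indicator ?B b * (C * \<phi> w) \<partial>lborel)"
        unfolding D_def
      proof (rule integral_mono_AE[OF Di mB(1)])
        show "AE b in lborel. indicator ?B b * dird ?v w (?c + b) \<le> indicator ?B b * (C * \<phi> w)"
          using AEd by eventually_elim (simp add: indicator_def)
      qed
      then show "D t \<le> measure lborel ?B * (C * \<phi> w)" by (simp add: mB)
      show "(F has_real_derivative D t) (at t)"
        unfolding DERIV_def tendsto_at_iff_sequentially
      proof (intro allI impI)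
        fix X :: "nat \<Rightarrow> real" assume X0: "\<forall>i. X i \<in> UNIV - {0}" and X: "X \<longlonglongrightarrow> 0"
        have "(\<lambda>n. \<bar>X n\<bar> * norm w) \<longlonglongrightarrow> 0 * norm w" by (intro tendsto_intros tendsto_rabs_zero X)
        then have "\<forall>\<^sub>F n in sequentially. \<bar>X n\<bar> * norm w < d1" using order_tendstoD(2)[of _ 0] d1(1) by simp
        then obtain n0 where n0: "\<And>n. n0 \<le> n \<Longrightarrow> \<bar>X n\<bar> * norm w < d1" unfolding eventually_sequentially by blast
        have "(\<lambda>n. (F (t + X (n + n0)) - F t) / X (n + n0)) \<longlonglongrightarrow> D t"
          using lim[OF LIMSEQ_ignore_initial_segment[OF X, of n0]] X0 n0 by simp
        then have "(\<lambda>n. (F (t + X n) - F t) / X n) \<longlonglongrightarrow> D t" by (rule LIMSEQ_offset)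
        then show "((\<lambda>h. (F (t + h) - F t) / h) \<circ> X) \<longlonglongrightarrow> D t" by (simp add: o_def)
      qed
    qed
    obtain t where t: "0 < t" "t < 1" "F 1 - F 0 = (1 - 0) * D t"
      using MVT2[of 0 1 F D] deriv by auto
    then have FD: "F 1 - F 0 \<le> measure lborel ?B * (C * \<phi> w)" using deriv[of t] by simp
    have xS: "x \<in> S" "y \<in> S" by (simp_all add: S_def)
    have "0 \<in> cball (0 :: real ^ 'n) \<delta>0" using \<delta>0 by simp
    have xK: "x \<in> K" "y \<in> K" using K(3)[OF xS(1), of 0] K(3)[OF xS(2), of 0] \<delta>0 by auto
    have i1: "integrable lborel (\<lambda>b. indicator ?B b * v (y + 1 *\<^sub>R w + b))"
      and i0: "integrable lborel (\<lambda>b. indicator ?B b * v (y + 0 *\<^sub>R w + b))"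
      by (rule integ, use inK[of 1] K(2) in force, rule integ, use inK[of 0] K(2) in force)
    have "measure lborel ?B * (v x - v y - 2 * (L1 * \<delta>)) = (\<integral>b. indicator ?B b * (v x - v y - 2 * (L1 * \<delta>)) \<partial>lborel)"
      by (simp add: mB)
    also have "\<dots> \<le> (\<integral>b. indicator ?B b * v (y + 1 *\<^sub>R w + b) - indicator ?B b * v (y + 0 *\<^sub>R w + b) \<partial>lborel)"
    proof (rule integral_mono[OF mB(1) Bochner_Integration.integrable_diff[OF i1 i0]])
      fix b :: "real ^ 'n"
      show "indicator ?B b * (v x - v y - 2 * (L1 * \<delta>)) \<le> indicator ?B b * v (y + 1 *\<^sub>R w + b) - indicator ?B b * v (y + 0 *\<^sub>R w + b)"
      proof (cases "b \<in> ?B")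
        case True
        then have b: "norm b \<le> \<delta>" "norm b < d1" using \<delta> by auto
        have "L1 * norm b \<le> L1 * \<delta>" using b d1(2) by (intro mult_left_mono)
        then have "\<bar>v (x + b) - v x\<bar> \<le> L1 * \<delta>" "\<bar>v (y + b) - v y\<bar> \<le> L1 * \<delta>"
          using d1(3)[OF xK(1) b(2)] d1(3)[OF xK(2) b(2)] by auto
        moreover have "y + 1 *\<^sub>R w + b = x + b" "y + 0 *\<^sub>R w + b = y + b" by (simp_all add: w_def)
        ultimately show ?thesis using True by simp
      qed simp
    qed
    also have "\<dots> = F 1 - F 0" unfolding F_def by (rule Bochner_Integration.integral_diff[OF i1 i0])
    finally show ?thesis using FD by linarith
  qed
  have "v x - v y \<le> C * \<phi> w + e" if e: "0 < e" for e
  proof -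
    \<comment> \<open>The last bound makes the end-point error at most \<open>e\<close>;
      \<open>L1 + 1\<close> avoids division by zero.\<close>
    define \<delta> where "\<delta> = min (min \<delta>0 (d1 / 2)) (e / (2 * (L1 + 1)))"
    have \<delta>: "0 < \<delta>" "\<delta> \<le> \<delta>0" "\<delta> < d1" "\<delta> \<le> e / (2 * (L1 + 1))"     proof -
      have p: "0 < e / (2 * (L1 + 1))" using e d1(2) by simp
      then show "0 < \<delta>" using \<delta>0(1) d1(1) by (simp add: \<delta>_def)
      have "\<delta> \<le> min \<delta>0 (d1 / 2)" unfolding \<delta>_def by (rule min.cobounded1)
      then show "\<delta> \<le> \<delta>0" "\<delta> < d1" using d1(1) by auto
      show "\<delta> \<le> e / (2 * (L1 + 1))" unfolding \<delta>_def by (rule min.cobounded2)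
    qed
    have "\<delta> * (2 * (L1 + 1)) \<le> e" using \<delta>(4) d1(2) by (simp add: field_simps)
    then have Le: "2 * (L1 * \<delta>) \<le> e" using \<delta>(1) by (simp add: algebra_simps)
    have "0 < measure lborel (cball (0 :: real ^ 'n) \<delta>)" using content_cball_pos[OF \<delta>(1), of "0 :: real ^ 'n"] by (simp add: measure_completion)
    from mult_left_le_imp_le[OF ball[OF \<delta>(1-3)] this] show ?thesis using Le by linarith
  qed
  then have "v x - v y \<le> C * \<phi> w" by (rule field_le_epsilon)
  then show ?thesis by (simp add: w_def)
qed

end

subsection \<open>Bump functions and mollification\<close>

text \<open>The powers of \<open>inverse t\<close> close the family under differentiation up to
  linear combinations, see \<open>DERIV_expinv\<close>.\<close>

definition expinv :: "nat \<Rightarrow> real \<Rightarrow> real" where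
  "expinv m t = (if 0 < t then exp (- inverse t) * inverse t ^ m else 0)"

lemma expinv_tendsto_0: "(expinv m \<longlongrightarrow> 0) (at 0)"
proof (rule filterlim_split_at)
  show "(expinv m \<longlongrightarrow> 0) (at_left 0)"
    by (rule tendsto_eventually) (auto simp: eventually_at_filter expinv_def)
  have "((\<lambda>t. inverse t ^ m / exp (inverse t)) \<longlongrightarrow> (0::real)) (at_right 0)"
    by (rule filterlim_compose[OF tendsto_power_div_exp_0 filterlim_inverse_at_top_right])
  moreover have "\<forall>\<^sub>F t in at_right 0. inverse t ^ m / exp (inverse t) = expinv m t"
    by (auto simp: eventually_at_filter expinv_def exp_minus divide_inverse mult.commute)
  ultimately show "(expinv m \<longlongrightarrow> 0) (at_right 0)" by (rule Lim_transform_eventually)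
qed

lemma DERIV_expinv: "(expinv m has_real_derivative expinv (m + 2) t - real m * expinv (m + 1) t) (at t)"
proof -
  consider "0 < t" | "t < 0" | "t = 0" by linarith
  then show ?thesis
  proof cases
    case 1
    then have t0: "t \<noteq> 0" by simp
    have i: "(inverse has_real_derivative - (inverse t)\<^sup>2) (at t)"
      using DERIV_inverse[OF t0] by (simp add: numeral_2_eq_2)
    have e: "((\<lambda>t. exp (- inverse t)) has_real_derivative exp (- inverse t) * (inverse t)\<^sup>2) (at t)"
      by (rule DERIV_cong[OF DERIV_fun_exp[OF DERIV_minus[OF i]]]) simp
    have p: "((\<lambda>t. inverse t ^ m) has_real_derivative real m * inverse t ^ (m - 1) * - (inverse t)\<^sup>2) (at t)"
      by (rule DERIV_cong[OF DERIV_power[OF i, of m]]) simp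
    have "((\<lambda>t. exp (- inverse t) * inverse t ^ m) has_real_derivative expinv (m + 2) t - real m * expinv (m + 1) t) (at t)"
      by (rule DERIV_cong[OF DERIV_mult[OF e p]])
        (use 1 in \<open>cases m; simp add: expinv_def power2_eq_square algebra_simps\<close>)
    then show ?thesis
      by (rule has_field_derivative_transform_within_open[of _ _ _ "{0<..}"]) (use 1 in \<open>auto simp: expinv_def\<close>)
  next
    case 2
    have "((\<lambda>t. 0) has_real_derivative 0) (at t)" by (rule DERIV_const)
    then have "(expinv m has_real_derivative 0) (at t)"
      by (rule has_field_derivative_transform_within_open[of _ _ _ "{..<0}"]) (use 2 in \<open>auto simp: expinv_def\<close>)
    then show ?thesis using 2 by (simp add: expinv_def)
  next
    case 3
    have "(\<lambda>h. (expinv m (0 + h) - expinv m 0) / h) = expinv (m + 1)"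
      by (rule ext) (simp add: expinv_def divide_inverse)
    then have "(expinv m has_real_derivative 0) (at 0)"
      unfolding DERIV_def using expinv_tendsto_0[of "m + 1"] by simp
    then show ?thesis using 3 by (simp add: expinv_def)
  qed
qed

text \<open>Generated so that every member has a derivative in the class; smoothness then follows by
  induction, without computing higher derivatives.\<close>

inductive bumpy :: "(real \<Rightarrow> real) \<Rightarrow> bool" where
  bumpy_expinv: "bumpy (\<lambda>t. expinv m (a + b * t))"
| bumpy_mult: "bumpy f \<Longrightarrow> bumpy g \<Longrightarrow> bumpy (\<lambda>t. f t * g t)"
| bumpy_add: "bumpy f \<Longrightarrow> bumpy g \<Longrightarrow> bumpy (\<lambda>t. f t + g t)"
| bumpy_cmult: "bumpy f \<Longrightarrow> bumpy (\<lambda>t. c * f t)"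

lemma bumpy_deriv: "bumpy f \<Longrightarrow> \<exists>f'. bumpy f' \<and> (\<forall>t. (f has_real_derivative f' t) (at t))"
proof (induction rule: bumpy.induct)
  case (bumpy_expinv m a b)
  let ?f' = "\<lambda>t. b * expinv (m + 2) (a + b * t) + (- (b * real m)) * expinv (m + 1) (a + b * t)"
  have "((\<lambda>t. expinv m (a + b * t)) has_real_derivative ?f' t) (at t)" for t
  proof -
    have "((\<lambda>t. a + b * t) has_real_derivative b) (at t)" by (auto intro!: derivative_eq_intros)
    from DERIV_chain2[OF DERIV_expinv this] show ?thesis by (rule DERIV_cong) (simp add: algebra_simps)
  qed
  moreover have "bumpy ?f'" by (intro bumpy.intros)
  ultimately show ?case by blast
next
  case (bumpy_mult f g)
  then obtain f' g' where fg: "bumpy f'" "bumpy g'" "\<And>t. (f has_real_derivative f' t) (at t)" "\<And>t. (g has_real_derivative g' t) (at t)" by blast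
  have "bumpy (\<lambda>t. f' t * g t + f t * g' t)" using fg bumpy_mult.hyps by (intro bumpy.intros)
  moreover have "((\<lambda>t. f t * g t) has_real_derivative f' t * g t + f t * g' t) (at t)" for t
    by (rule DERIV_cong[OF DERIV_mult[OF fg(3,4)]]) (simp add: algebra_simps)
  ultimately show ?case by blast
next
  case (bumpy_add f g)
  then obtain f' g' where fg: "bumpy f'" "bumpy g'" "\<And>t. (f has_real_derivative f' t) (at t)" "\<And>t. (g has_real_derivative g' t) (at t)" by blast
  then show ?case using bumpy.bumpy_add[OF fg(1,2)] DERIV_add[OF fg(3,4)] by blast
next
  case (bumpy_cmult f c)
  then obtain f' where f: "bumpy f'" "\<And>t. (f has_real_derivative f' t) (at t)" by blast
  then show ?case using bumpy.bumpy_cmult[OF f(1), of c] DERIV_cmult[OF f(2), of c] by blast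
qed

text \<open>A partial derivative of such a product is again one, with a single factor replaced by
  its derivative, so an induction on the order of differentiability closes.\<close>

definition prodfun :: "('n \<Rightarrow> real \<Rightarrow> real) \<Rightarrow> real ^ 'n \<Rightarrow> real" where
  "prodfun f x = (\<Prod>j\<in>UNIV. f j (x $ j))"

lemma prodfun_partial:
  fixes f :: "'n::finite \<Rightarrow> real \<Rightarrow> real"
  assumes f': "\<And>j t. (f j has_real_derivative f' j t) (at t)"
  shows "prodfun f differentiable (at x)" "partial_deriv i (prodfun f) x = prodfun (f(i := f' i)) x"
proof -
  have c: "((\<lambda>x. f j (x $ j)) has_derivative (\<lambda>h. f' j (x $ j) * h $ j)) (at x)" for j
    using has_derivative_compose[OF bounded_linear.has_derivative[OF bounded_linear_vec_nth has_derivative_ident] f'[unfolded has_field_derivative_def], of j] .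
  have d: "(prodfun f has_derivative (\<lambda>h. \<Sum>j\<in>UNIV. f' j (x $ j) * h $ j * (\<Prod>k\<in>UNIV - {j}. f k (x $ k)))) (at x)"
    unfolding prodfun_def[abs_def] by (rule has_derivative_prod) (rule c)
  then show "prodfun f differentiable (at x)" by (auto simp: differentiable_def)
  have "partial_deriv i (prodfun f) x = (\<Sum>j\<in>UNIV. f' j (x $ j) * axis i 1 $ j * (\<Prod>k\<in>UNIV - {j}. f k (x $ k)))"
    by (rule partial_deriv_eqI[OF d])
  also have "\<dots> = (\<Sum>j\<in>UNIV. if j = i then f' i (x $ i) * (\<Prod>k\<in>UNIV - {i}. f k (x $ k)) else 0)"
    by (rule sum.cong) (auto simp: axis_def)
  also have "\<dots> = f' i (x $ i) * (\<Prod>k\<in>UNIV - {i}. f k (x $ k))" by simp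
  also have "\<dots> = prodfun (f(i := f' i)) x"
    unfolding prodfun_def by (subst prod.remove[of UNIV i]) (auto intro!: prod.cong)
  finally show "partial_deriv i (prodfun f) x = prodfun (f(i := f' i)) x" .
qed

lemma prodfun_smooth:
  fixes f :: "'n::finite \<Rightarrow> real \<Rightarrow> real"
  assumes "\<And>j. bumpy (f j)" shows "Ck_on k UNIV (prodfun f)"
  using assms
proof (induction k arbitrary: f)
  case 0
  have "continuous_on UNIV (f j)" for j
  proof -
    obtain f' where "\<And>t. (f j has_real_derivative f' t) (at t)" using bumpy_deriv[OF 0, of j] by blast
    then show ?thesis by (intro continuous_at_imp_continuous_on ballI) (rule DERIV_isCont)
  qed
  then have "continuous_on UNIV (\<lambda>x::real ^ 'n. f j (x $ j))" for j
    by (rule continuous_on_compose2) (auto intro!: continuous_intros)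
  then show ?case unfolding Ck_on.simps prodfun_def[abs_def] by (rule continuous_on_prod)
next
  case (Suc k)
  have "\<forall>j. \<exists>f'. bumpy f' \<and> (\<forall>t. (f j has_real_derivative f' t) (at t))" using bumpy_deriv[OF Suc.prems] by blast
  then obtain f' where f': "\<And>j. bumpy (f' j)" "\<And>j t. (f j has_real_derivative f' j t) (at t)" by metis
  have "Ck_on k UNIV (prodfun (f(i := f' i)))" for i by (rule Suc.IH) (use Suc.prems f'(1) in simp)
  moreover have "partial_deriv i (prodfun f) = prodfun (f(i := f' i))" for i
    using prodfun_partial(2)[of f f', OF f'(2)] by blast
  ultimately show ?case using prodfun_partial(1)[of f f', OF f'(2)] by simp
qed

text \<open>It vanishes outside the cube of half-side \<open>e\<close>. Its integral is not
  normalized to 1; it is carried along as a positive factor and cancelled in the end.\<close>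

definition bump :: "real \<Rightarrow> real ^ 'n \<Rightarrow> real" where
  "bump e z = (\<Prod>j\<in>UNIV. expinv 0 (1 + z $ j / e) * expinv 0 (1 - z $ j / e))"

lemma bump_nonneg: "0 \<le> bump e z"
  unfolding bump_def by (intro prod_nonneg) (simp add: expinv_def)

lemma bump_pos: "0 < e \<Longrightarrow> 0 < bump e 0"
  by (simp add: bump_def expinv_def)

lemma bump_zero:
  assumes "0 < e" "\<bar>z $ j\<bar> \<ge> e" shows "bump e z = 0"
proof -
  have "1 + z $ j / e \<le> 0 \<or> 1 - z $ j / e \<le> 0" using assms by (auto simp: field_simps abs_if split: if_splits)
  then have "expinv 0 (1 + z $ j / e) * expinv 0 (1 - z $ j / e) = 0" by (auto simp: expinv_def)
  then show ?thesis unfolding bump_def by (subst prod_zero_iff) auto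
qed

lemma bump_smooth: "Ck_on k UNIV (\<lambda>y. bump e (y - c))"
proof -
  let ?f = "\<lambda>j t. expinv 0 ((1 - c $ j / e) + (1 / e) * t) * expinv 0 ((1 + c $ j / e) + (- (1 / e)) * t)"
  have "(\<lambda>y. bump e (y - c)) = prodfun ?f"
    by (rule ext) (simp add: bump_def prodfun_def diff_divide_distrib algebra_simps)
  moreover have "Ck_on k UNIV (prodfun ?f)" by (rule prodfun_smooth) (intro bumpy.intros)
  ultimately show ?thesis by simp
qed

lemma bump_test_function:
  assumes e: "0 < e" and sub: "cbox (c - (\<chi> i. e)) (c + (\<chi> i. e)) \<subseteq> U"
  shows "test_function U (\<lambda>y. bump e (y - c))"
proof -
  let ?K = "cbox (c - (\<chi> i. e)) (c + (\<chi> i. e))"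
  have "{y. bump e (y - c) \<noteq> 0} \<subseteq> ?K"
  proof
    fix y assume "y \<in> {y. bump e (y - c) \<noteq> 0}"
    then have "\<bar>(y - c) $ j\<bar> < e" for j using bump_zero[OF e, of "y - c" j] by force
    then show "y \<in> ?K" by (auto simp: mem_box_cart abs_less_iff less_imp_le) (smt (verit) less_imp_le)+
  qed
  then have "closure {y. bump e (y - c) \<noteq> 0} \<subseteq> ?K" by (intro closure_minimal) auto
  moreover have "compact (closure {y. bump e (y - c) \<noteq> 0})"
    using compact_Int_closed[OF compact_cbox closed_closure] calculation by (metis inf.absorb2)
  ultimately show ?thesis
    unfolding test_function_def smooth_on_def compactly_contained_def using sub bump_smooth by blast
qed

lemma partial_deriv_shift:
  fixes f :: "real ^ 'n \<Rightarrow> real"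
  assumes "f differentiable (at (y - c))"
  shows "((\<lambda>y. f (y - c)) has_derivative (\<lambda>h. grad f (y - c) \<bullet> h)) (at y)"
    "partial_deriv i (\<lambda>y. f (y - c)) y = grad f (y - c) $ i"
proof -
  have "((\<lambda>y. y - c) has_derivative (\<lambda>h. h)) (at y)" by (auto intro!: derivative_eq_intros)
  from has_derivative_compose[OF this has_derivative_grad[OF assms]]
  show d: "((\<lambda>y. f (y - c)) has_derivative (\<lambda>h. grad f (y - c) \<bullet> h)) (at y)" .
  show "partial_deriv i (\<lambda>y. f (y - c)) y = grad f (y - c) $ i"
    using partial_deriv_eqI[OF d] by (simp add: inner_axis)
qed

lemma bump_differentiable: "bump e differentiable (at z)" and continuous_grad_bump: "continuous_on UNIV (grad (bump e))"
proof -
  have "Ck_on (Suc 0) UNIV (\<lambda>y. bump e (y - 0))" by (rule bump_smooth)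
  then have "Ck_on (Suc 0) UNIV (bump e)" by simp
  then have d: "\<And>z. bump e differentiable (at z)" and c: "\<And>i. continuous_on UNIV (partial_deriv i (bump e))" by auto
  show "bump e differentiable (at z)" by (rule d)
  show "continuous_on UNIV (grad (bump e))" unfolding grad_def[abs_def]
    by (intro continuous_on_vec_lambda c)
qed

lemma continuous_bump: "continuous_on S (bump e)"
  using bump_differentiable differentiable_imp_continuous_within continuous_at_imp_continuous_on by blast

lemma bump_integrable: 
  assumes "0 < e" shows "integrable lborel (\<lambda>y. bump e (y - c))"
proof -
  let ?K = "cbox (c - (\<chi> i. e)) (c + (\<chi> i. e))"
  have "integrable lborel (\<lambda>y. indicator ?K y *\<^sub>R bump e (y - c))"
    by (rule borel_integrable_compact[OF compact_cbox])
      (rule continuous_on_compose2[OF continuous_bump[of UNIV]], auto intro!: continuous_intros)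
  moreover have "(\<lambda>y. indicator ?K y *\<^sub>R bump e (y - c)) = (\<lambda>y. bump e (y - c))"
  proof
    fix y
    show "indicator ?K y *\<^sub>R bump e (y - c) = bump e (y - c)"
    proof (cases "y \<in> ?K")
      case False
      then obtain j where "\<not> ((c - (\<chi> i. e)) $ j \<le> y $ j \<and> y $ j \<le> (c + (\<chi> i. e)) $ j)" unfolding mem_box_cart by blast
      then have "e \<le> \<bar>(y - c) $ j\<bar>" by auto
      from bump_zero[OF assms this] show ?thesis by simp
    qed simp
  qed
  ultimately show ?thesis by simp
qed

lemma bump_integral_shift:
  fixes c :: "real ^ 'n"
  shows "(\<integral>y. bump e (y - c) \<partial>lborel) = (\<integral>y. bump e y \<partial>(lborel :: (real ^ 'n) measure))"
proof -
  have m: "(\<lambda>y. bump e (y - c)) \<in> borel_measurable borel"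
    by (rule borel_measurable_continuous_onI, rule continuous_on_compose2[OF continuous_bump[of UNIV]])
      (auto intro!: continuous_intros)
  show ?thesis using lborel_integral_affine[OF _ m, of 1 c] by simp
qed

lemma bump_integral_pos:
  assumes "0 < e" shows "0 < (\<integral>y. bump e y \<partial>(lborel :: (real ^ 'n) measure))"
proof -
  let ?b = "bump e :: real ^ 'n \<Rightarrow> real"
  have i: "integrable lborel ?b" using bump_integrable[OF assms, of 0] by simp
  have "(\<integral>y. ?b y \<partial>lborel) \<noteq> 0"
  proof
    assume "(\<integral>y. ?b y \<partial>lborel) = 0"
    then have "AE y in lborel. ?b y = 0"
      using integral_nonneg_eq_0_iff_AE[OF i AE_I2[OF bump_nonneg]] by blast
    then have ae: "AE y in lebesgue. ?b y = 0" by (rule AE_completion)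
    have o: "open {y. ?b y \<noteq> 0}"
      by (rule open_Collect_neq) (auto intro: continuous_bump continuous_on_const)
    then have "{y. ?b y \<noteq> 0} \<in> sets lebesgue" by (simp add: borel_open)
    then have "{y. ?b y \<noteq> 0} \<in> null_sets lebesgue"
      using AE_iff_null[of lebesgue "\<lambda>y. ?b y = 0"] ae by simp
    then have "negligible {y. ?b y \<noteq> 0}" by (simp add: negligible_iff_null_sets)
    moreover have "0 \<in> {y. ?b y \<noteq> 0}" using bump_pos[OF assms] by (metis less_irrefl mem_Collect_eq)
    ultimately show False using open_not_negligible[OF o] by blast
  qed
  moreover have "0 \<le> (\<integral>y. ?b y \<partial>lborel)" by (rule integral_nonneg_AE) (simp add: bump_nonneg)
  ultimately show ?thesis by simp
qed

text \<open>Differentiating the mollification of \<open>u\<close> along a segment turns the weak derivative bound into a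
  Lipschitz bound that does not depend on the mollification.\<close>

lemma mollified_bound:
  fixes u :: "real ^ 'n \<Rightarrow> real" and g :: "'n \<Rightarrow> real ^ 'n \<Rightarrow> real"
  assumes U: "open U" and cu: "continuous_on U u"
    and Q: "cbox a b \<subseteq> U"
    and g: "\<And>i. g i \<in> borel_measurable (lebesgue_on U)" "\<And>i. weak_partial_deriv U i u (g i)"
    and M: "0 \<le> M" "\<And>i. AE x in lebesgue. x \<in> cbox a b \<longrightarrow> \<bar>g i x\<bar> \<le> M"
    and e: "0 < e" and inQ: "\<And>s. 0 \<le> s \<Longrightarrow> s \<le> 1 \<Longrightarrow>
      cbox (c + s *\<^sub>R v - (\<chi> i. e)) (c + s *\<^sub>R v + (\<chi> i. e)) \<subseteq> cbox a b"
  shows "\<bar>(\<integral>y. indicator (cbox a b) y * (u y * bump e (y - (c + v))) \<partial>lborel) - (\<integral>y. indicator (cbox a b) y * (u y * bump e (y - c)) \<partial>lborel)\<bar>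
    \<le> real CARD('n) * M * norm v * (\<integral>y. bump e y \<partial>(lborel :: (real ^ 'n) measure))"
proof -
  let ?Q = "cbox a b"
  let ?I = "\<integral>y. bump e y \<partial>(lborel :: (real ^ 'n) measure)"
  have cuQ: "continuous_on ?Q u" by (rule continuous_on_subset[OF cu Q])
  define F where "F s = integral ?Q (\<lambda>y. u y * bump e (y - (c + s *\<^sub>R v)))" for s
  define f' where "f' s y = u y * (grad (bump e) (y - (c + s *\<^sub>R v)) \<bullet> - v)" for s y
  have lb: "(\<integral>y. indicator ?Q y * h y \<partial>lborel) = integral ?Q h" if "continuous_on ?Q h" for h :: "real ^ 'n \<Rightarrow> real"
  proof -
    have "set_integrable lborel ?Q h" unfolding set_integrable_def by (rule borel_integrable_compact[OF compact_cbox that])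
    from set_borel_integral_eq_integral(2)[OF this] show ?thesis by (simp add: set_lebesgue_integral_def)
  qed
  have cb: "continuous_on ?Q (\<lambda>y. u y * bump e (y - k))" for k
    by (intro continuous_intros cuQ continuous_on_compose2[OF continuous_bump[of UNIV]]) auto
  \<comment> \<open>Differentiating under the integral puts the derivative on the smooth factor, the
    form in which the weak derivative can be used.\<close>
  have dF: "(F has_real_derivative integral ?Q (f' s)) (at s within {0..1})" if s: "s \<in> {0..1}" for s
    unfolding F_def[abs_def]
  proof (rule leibniz_rule_field_derivative)
    fix s y assume "s \<in> {0..1::real}"
    have "((\<lambda>s. bump e ((y - c) + s *\<^sub>R - v)) has_real_derivative grad (bump e) ((y - c) + s *\<^sub>R - v) \<bullet> - v) (at s)"
      by (rule line_deriv[OF has_derivative_grad[OF bump_differentiable]])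
    then have "((\<lambda>s. bump e (y - (c + s *\<^sub>R v))) has_real_derivative grad (bump e) (y - (c + s *\<^sub>R v)) \<bullet> - v) (at s)"
      by (simp add: algebra_simps)
    from DERIV_cmult[OF this, of "u y"] show "((\<lambda>s. u y * bump e (y - (c + s *\<^sub>R v))) has_real_derivative f' s y) (at s within {0..1})"
      unfolding f'_def by (rule has_field_derivative_at_within)
  next
    show "(\<lambda>y. u y * bump e (y - (c + s *\<^sub>R v))) integrable_on cbox a b" for s
      by (rule integrable_continuous[OF cb])
    have "continuous_on ({0..1} \<times> ?Q) (\<lambda>p. u (snd p) * (grad (bump e) (snd p - (c + fst p *\<^sub>R v)) \<bullet> - v))"
      by (intro continuous_intros continuous_on_compose2[OF cuQ] continuous_on_compose2[OF continuous_grad_bump]) auto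
    then show "continuous_on ({0..1} \<times> cbox a b) (\<lambda>(x, t). f' x t)" by (simp add: f'_def split_beta)
  qed (use s in auto)
  have bound: "\<bar>integral ?Q (f' s)\<bar> \<le> real CARD('n) * M * norm v * ?I" if s: "s \<in> {0..1}" for s
  proof -
    let ?k = "c + s *\<^sub>R v"
    let ?\<psi> = "\<lambda>y. bump e (y - ?k)"
    have kQ: "cbox (?k - (\<chi> i. e)) (?k + (\<chi> i. e)) \<subseteq> ?Q" using inQ s by auto
    have test: "test_function U ?\<psi>" using bump_test_function[OF e] kQ Q by blast
    have z: "?\<psi> y = 0" if "y \<notin> ?Q" for y
    proof -
      have "y \<notin> cbox (?k - (\<chi> i. e)) (?k + (\<chi> i. e))" using that kQ by blast
      then obtain j where "\<not> ((?k - (\<chi> i. e)) $ j \<le> y $ j \<and> y $ j \<le> (?k + (\<chi> i. e)) $ j)" unfolding mem_box_cart by blast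
      then have "e \<le> \<bar>(y - ?k) $ j\<bar>" by auto
      from bump_zero[OF e this] show ?thesis .
    qed
    have pd: "partial_deriv i ?\<psi> y = grad (bump e) (y - ?k) $ i" for i y
      by (rule partial_deriv_shift(2)[OF bump_differentiable])
    have zp: "partial_deriv i ?\<psi> y = 0" if y: "y \<notin> ?Q" for i y
    proof -
      have "(?\<psi> has_derivative (\<lambda>h. 0)) (at y)"
        by (rule has_derivative_transform_within_open[OF has_derivative_const[of 0], of "- ?Q"]) (use y z in \<open>auto simp: closed_cbox\<close>)
      from partial_deriv_eqI[OF this] show ?thesis .
    qed
    have cpd: "continuous_on S (partial_deriv i ?\<psi>)" for i S
      unfolding pd[abs_def]
      by (intro continuous_intros continuous_on_compose2[OF continuous_grad_bump]) auto
    \<comment> \<open>The shifted bump is a test function because its support stays in the box;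
      summing these bounds over the coordinates gives the factor \<open>CARD('n)\<close>.\<close>
    have weak: "\<bar>integral ?Q (\<lambda>y. u y * partial_deriv i ?\<psi> y)\<bar> \<le> M * ?I" for i
    proof -
      have cq: "continuous_on ?Q (\<lambda>y. u y * partial_deriv i ?\<psi> y)" by (intro continuous_intros cuQ cpd)
      have eqi: "(\<lambda>x. indicator U x * (u x * partial_deriv i ?\<psi> x)) = (\<lambda>x. indicator ?Q x * (u x * partial_deriv i ?\<psi> x))"
        using zp Q by (auto simp: indicator_def fun_eq_iff)
      have "integral ?Q (\<lambda>y. u y * partial_deriv i ?\<psi> y) = (\<integral>x. indicator U x * (u x * partial_deriv i ?\<psi> x) \<partial>lborel)"
        unfolding eqi by (rule lb[OF cq, symmetric])
      also have "\<dots> = (LINT x|lebesgue_on U. u x * partial_deriv i ?\<psi> x)"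
      proof (rule integral_lebesgue_on_borel[OF U, symmetric])
        show "(\<lambda>x. indicator U x * (u x * partial_deriv i ?\<psi> x)) \<in> borel_measurable borel"
          by (rule borel_indicator_mult) (use U in \<open>auto intro!: continuous_intros cu cpd\<close>)
      qed
      also have "\<dots> = - (LINT x|lebesgue_on U. g i x * ?\<psi> x)" using g(2)[of i] test unfolding weak_partial_deriv_def by blast
      finally have 1: "integral ?Q (\<lambda>y. u y * partial_deriv i ?\<psi> y) = - (LINT x|lebesgue_on U. g i x * ?\<psi> x)" .
      have \<psi>b: "?\<psi> \<in> borel_measurable borel"
        by (rule borel_measurable_continuous_onI, rule continuous_on_compose2[OF continuous_bump[of UNIV]]) (auto intro!: continuous_intros)
      have \<psi>l: "integrable lebesgue ?\<psi>" using bump_integrable[OF e, of ?k] \<psi>b by (simp add: integrable_completion)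
      have \<psi>i: "integrable (lebesgue_on U) ?\<psi>"
      proof -
        have "(\<lambda>x. indicator U x *\<^sub>R ?\<psi> x) = ?\<psi>" using z Q by (auto simp: indicator_def fun_eq_iff)
        then show ?thesis using \<psi>l U by (subst integrable_restrict_space) auto
      qed
      have ae: "AE x in lebesgue_on U. \<bar>g i x * ?\<psi> x\<bar> \<le> M * ?\<psi> x"
      proof -
        have "AE x in lebesgue. x \<in> U \<longrightarrow> \<bar>g i x * ?\<psi> x\<bar> \<le> M * ?\<psi> x"
          using M(2)[of i]
        proof eventually_elim
          case (elim x)
          show ?case using elim z[of x] bump_nonneg[of e "x - ?k"] M(1)
            by (cases "x \<in> ?Q") (auto simp: abs_mult intro: mult_right_mono)
        qed
        then show ?thesis using U by (subst AE_restrict_space_iff) auto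
      qed
      have gm: "(\<lambda>x. g i x * ?\<psi> x) \<in> borel_measurable (lebesgue_on U)"
        by (rule borel_measurable_times[OF g(1)]) (use \<psi>i in auto)
      have gi: "integrable (lebesgue_on U) (\<lambda>x. g i x * ?\<psi> x)"
        by (rule Bochner_Integration.integrable_bound[OF integrable_mult_right[OF \<psi>i, of M] gm])
          (use ae in eventually_elim, simp)
      have "\<bar>LINT x|lebesgue_on U. g i x * ?\<psi> x\<bar> \<le> (LINT x|lebesgue_on U. \<bar>g i x * ?\<psi> x\<bar>)" by (rule integral_abs_bound)
      also have "\<dots> \<le> (LINT x|lebesgue_on U. M * ?\<psi> x)"
        by (rule integral_mono_AE[OF integrable_abs[OF gi] integrable_mult_right[OF \<psi>i] ae])
      also have "\<dots> = M * (LINT x|lebesgue_on U. ?\<psi> x)" by simp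
      also have "(LINT x|lebesgue_on U. ?\<psi> x) = ?I"
      proof -
        have eq: "(\<lambda>x. indicator U x * ?\<psi> x) = ?\<psi>" using z Q by (auto simp: indicator_def fun_eq_iff)
        have "(LINT x|lebesgue_on U. ?\<psi> x) = (\<integral>x. indicator U x * ?\<psi> x \<partial>lborel)"
          by (rule integral_lebesgue_on_borel[OF U]) (simp only: eq \<psi>b)
        then show ?thesis by (simp only: eq bump_integral_shift)
      qed
      finally show ?thesis unfolding 1 by simp
    qed
    have "f' s = (\<lambda>y. - (\<Sum>i\<in>UNIV. v $ i * (u y * partial_deriv i ?\<psi> y)))"
      by (rule ext) (simp add: f'_def pd inner_vec_def sum_distrib_left sum_negf mult_ac)
    then have "integral ?Q (f' s) = - integral ?Q (\<lambda>y. \<Sum>i\<in>UNIV. v $ i * (u y * partial_deriv i ?\<psi> y))" by simp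
    also have "\<dots> = - (\<Sum>i\<in>UNIV. v $ i * integral ?Q (\<lambda>y. u y * partial_deriv i ?\<psi> y))"
    proof -
      have "(\<lambda>y. v $ i * (u y * partial_deriv i ?\<psi> y)) integrable_on ?Q" for i
        by (intro integrable_continuous continuous_intros cuQ cpd)
      then show ?thesis by (subst Henstock_Kurzweil_Integration.integral_sum) auto
    qed
    finally have "\<bar>integral ?Q (f' s)\<bar> \<le> (\<Sum>i\<in>UNIV. \<bar>v $ i * integral ?Q (\<lambda>y. u y * partial_deriv i ?\<psi> y)\<bar>)"
      by (simp only: abs_minus_cancel sum_abs)
    also have "\<dots> \<le> (\<Sum>i\<in>(UNIV :: 'n set). norm v * (M * ?I))"
    proof (rule sum_mono)
      fix i
      show "\<bar>v $ i * integral ?Q (\<lambda>y. u y * partial_deriv i ?\<psi> y)\<bar> \<le> norm v * (M * ?I)"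
        unfolding abs_mult by (rule mult_mono[OF component_le_norm_cart weak]) auto
    qed
    also have "\<dots> = real CARD('n) * M * norm v * ?I" by simp
    finally show ?thesis .
  qed
  have "norm (F 1 - F 0) \<le> (real CARD('n) * M * norm v * ?I) * norm (1 - 0 :: real)"
    by (rule field_differentiable_bound[of "{0..1}" F "\<lambda>s. integral ?Q (f' s)"]) (use dF bound in auto)
  then have "\<bar>F 1 - F 0\<bar> \<le> real CARD('n) * M * norm v * ?I" by simp
  moreover have "F 1 = (\<integral>y. indicator ?Q y * (u y * bump e (y - (c + v))) \<partial>lborel)" using lb[OF cb[of "c + v"]] by (simp add: F_def)
  moreover have "F 0 = (\<integral>y. indicator ?Q y * (u y * bump e (y - c)) \<partial>lborel)" using lb[OF cb[of c]] by (simp add: F_def)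
  ultimately show ?thesis by simp
qed

text \<open>The bound of \<open>mollified_bound\<close> survives as the width of the bump tends to
  0, because weighted averages of the continuous \<open>u\<close> converge to its values; the
  integral of the bump then cancels.\<close>

lemma W1inf_locally_lipschitz:
  fixes u :: "real ^ 'n \<Rightarrow> real"
  assumes U: "open U" and cu: "continuous_on U u" and W: "u \<in> W1inf_loc U"
  shows "locally_lipschitz_on U u"
  unfolding locally_lipschitz_on_def
proof
  fix x0 assume x0: "x0 \<in> U"
  let ?N = "real CARD('n)"
  have N: "0 < ?N" by simp
  obtain r where r: "0 < r" "cball x0 r \<subseteq> U" using U x0 open_contains_cball by blast
  \<comment> \<open>The box of half-side \<open>3 * \<rho>\<close> fits into the ball of radius
    \<open>r\<close>, as the norm is at most the sum of the absolute coordinates. Centres stay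
    within \<rho> of \<open>x0\<close> and bumps have width at most \<rho>, so their supports stay
    in the box.\<close>
  define \<rho> where "\<rho> = r / (4 * ?N)"
  have \<rho>: "0 < \<rho>" "?N * (3 * \<rho>) < r" using r(1) N by (auto simp: \<rho>_def field_simps)
  let ?a = "x0 - (\<chi> i. 3 * \<rho>)" and ?b = "x0 + (\<chi> i. 3 * \<rho>)"
  let ?Q = "cbox ?a ?b"
  have nb: "norm z \<le> ?N * k" if "\<And>i. \<bar>z $ i\<bar> \<le> k" for z :: "real ^ 'n" and k
  proof -
    have "norm z \<le> (\<Sum>i\<in>UNIV. \<bar>z $ i\<bar>)" by (rule norm_le_l1_cart)
    also have "\<dots> \<le> (\<Sum>i\<in>(UNIV :: 'n set). k)" by (rule sum_mono) (rule that)
    finally show ?thesis by simp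
  qed
  have QV: "?Q \<subseteq> ball x0 r"
  proof
    fix y assume "y \<in> ?Q"
    then have "\<bar>(y - x0) $ i\<bar> \<le> 3 * \<rho>" for i by (auto simp: mem_box_cart abs_le_iff algebra_simps)
    from nb[OF this] have "norm (y - x0) < r" using \<rho>(2) by linarith
    then show "y \<in> ball x0 r" by (simp add: dist_norm norm_minus_commute)
  qed
  have Q: "?Q \<subseteq> U" using QV r(2) by (meson ball_subset_cball order_trans)
  have V: "open (ball x0 r)" "ball x0 r \<subset>\<subset> U" using r by (auto simp: compactly_contained_def)
  have "\<forall>i. \<exists>g. g \<in> Linf_loc U \<and> weak_partial_deriv U i u g" using W by (simp add: W1inf_loc_def)
  then obtain g where g: "\<And>i. g i \<in> Linf_loc U" "\<And>i. weak_partial_deriv U i u (g i)" by metis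
  have gm: "g i \<in> borel_measurable (lebesgue_on U)" for i using g(1)[of i] by (simp add: Linf_loc_def)
  define M where "M = (\<Sum>i\<in>UNIV. enn2real (Linf_norm (ball x0 r) (g i)))"
  have M0: "0 \<le> M" by (simp add: M_def sum_nonneg)
  have M: "AE x in lebesgue. x \<in> ?Q \<longrightarrow> \<bar>g i x\<bar> \<le> M" for i
  proof -
    have fin: "Linf_norm (ball x0 r) (g i) < \<infinity>" using g(1)[of i] V by (auto simp: Linf_loc_def)
    have "AE x in lebesgue_on (ball x0 r). ennreal \<bar>g i x\<bar> \<le> Linf_norm (ball x0 r) (g i)"
      unfolding Linf_norm_def by (rule esssup_AE)
    then have "AE x in lebesgue. x \<in> ball x0 r \<longrightarrow> ennreal \<bar>g i x\<bar> \<le> Linf_norm (ball x0 r) (g i)"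
      by (subst (asm) AE_restrict_space_iff) auto
    then show ?thesis
    proof eventually_elim
      case (elim x)
      show ?case
      proof
        assume "x \<in> ?Q"
        then have "ennreal \<bar>g i x\<bar> \<le> Linf_norm (ball x0 r) (g i)" using elim QV by blast
        then have "enn2real (ennreal \<bar>g i x\<bar>) \<le> enn2real (Linf_norm (ball x0 r) (g i))"
          using fin by (intro enn2real_mono) auto
        also have "\<dots> \<le> M" unfolding M_def by (rule member_le_sum) auto
        finally show "\<bar>g i x\<bar> \<le> M" by simp
      qed
    qed
  qed
  have cuQ: "continuous_on ?Q u" by (rule continuous_on_subset[OF cu Q])
  have inb: "\<bar>(c - x0) $ i\<bar> < \<rho>" if "c \<in> ball x0 \<rho>" for c i
    using component_le_norm_cart[of "c - x0" i] that by (simp add: dist_norm norm_minus_commute)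
  \<comment> \<open>The error is measured relative to the integral of the bump, which depends on
    \<open>e\<close>, so that it can be divided out.\<close>
  have avg: "\<exists>e0>0. \<forall>e. 0 < e \<longrightarrow> e \<le> e0 \<longrightarrow>
      \<bar>(\<integral>y. indicator ?Q y * (u y * bump e (y - c)) \<partial>lborel) - u c * (\<integral>y. bump e y \<partial>(lborel :: (real ^ 'n) measure))\<bar> \<le> \<eta> * (\<integral>y. bump e y \<partial>(lborel :: (real ^ 'n) measure))"
    if c: "c \<in> ball x0 \<rho>" and \<eta>: "0 < \<eta>" for c \<eta>
  proof -
    have "c \<in> ?Q"
    proof -
      have "?a $ i \<le> c $ i \<and> c $ i \<le> ?b $ i" for i using inb[OF c, of i] \<rho>(1) by (simp add: abs_less_iff)
      then show ?thesis by (simp add: mem_box_cart)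
    qed
    then have "c \<in> U" using Q by blast
    then have "continuous (at c) u" using cu U by (simp add: continuous_on_eq_continuous_at)
    then obtain d where d: "0 < d" "\<And>y. dist y c < d \<Longrightarrow> dist (u y) (u c) < \<eta>"
      using \<eta> unfolding continuous_at_eps_delta by blast
    define e0 where "e0 = min \<rho> (d / (2 * ?N))"
    have e0: "0 < e0" "e0 \<le> \<rho>" "?N * e0 < d"
    proof -
      show "0 < e0" "e0 \<le> \<rho>" using \<rho>(1) d(1) N by (auto simp: e0_def)
      have "?N * e0 \<le> ?N * (d / (2 * ?N))" by (rule mult_left_mono) (auto simp: e0_def)
      then show "?N * e0 < d" using d(1) by simp
    qed
    have "\<bar>(\<integral>y. indicator ?Q y * (u y * bump e (y - c)) \<partial>lborel) - u c * (\<integral>y. bump e y \<partial>(lborel :: (real ^ 'n) measure))\<bar> \<le> \<eta> * (\<integral>y. bump e y \<partial>(lborel :: (real ^ 'n) measure))"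
      if e: "0 < e" "e \<le> e0" for e
    proof -
      have "integrable lborel (\<lambda>y. indicator ?Q y *\<^sub>R (u y * bump e (y - c)))"
        by (rule borel_integrable_compact[OF compact_cbox])
          (intro continuous_intros cuQ continuous_on_compose2[OF continuous_bump[of UNIV]], auto)
      then have i1: "integrable lborel (\<lambda>y. indicator ?Q y * (u y * bump e (y - c)))" by simp
      have i2: "integrable lborel (\<lambda>y. u c * bump e (y - c))" by (rule integrable_mult_right[OF bump_integrable[OF e(1)]])
      have i3: "integrable lborel (\<lambda>y. \<eta> * bump e (y - c))" by (rule integrable_mult_right[OF bump_integrable[OF e(1)]])
      have i4: "integrable lborel (\<lambda>y. indicator ?Q y * (u y * bump e (y - c)) - u c * bump e (y - c))"
        by (rule Bochner_Integration.integrable_diff[OF i1 i2])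
      have pt: "\<bar>indicator ?Q y * (u y * bump e (y - c)) - u c * bump e (y - c)\<bar> \<le> \<eta> * bump e (y - c)" for y
      proof (cases "\<exists>j. e \<le> \<bar>(y - c) $ j\<bar>")
        case True
        then have "bump e (y - c) = 0" using bump_zero[OF e(1)] by blast
        then show ?thesis by simp
      next
        case False
        then have lt: "\<bar>(y - c) $ j\<bar> \<le> e" for j by (meson le_cases)
        have "norm (y - c) \<le> ?N * e" by (rule nb[OF lt])
        also have "\<dots> \<le> ?N * e0" using e(2) by (intro mult_left_mono) auto
        also have "\<dots> < d" by (rule e0(3))
        finally have "\<bar>u y - u c\<bar> < \<eta>" using d(2)[of y] by (simp add: dist_norm)
        moreover have "y \<in> ?Q"
        proof -
          have "?a $ i \<le> y $ i \<and> y $ i \<le> ?b $ i" for i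
          proof -
            have "\<bar>y $ i - c $ i\<bar> \<le> \<rho>" using lt[of i] e(2) e0(2) by simp
            moreover have "\<bar>c $ i - x0 $ i\<bar> < \<rho>" using inb[OF c, of i] by simp
            ultimately have "- (3 * \<rho>) \<le> y $ i - x0 $ i \<and> y $ i - x0 $ i \<le> 3 * \<rho>" using \<rho>(1) by linarith
            then show ?thesis by simp
          qed
          then show ?thesis by (simp add: mem_box_cart)
        qed
        moreover have "\<bar>u y * bump e (y - c) - u c * bump e (y - c)\<bar> = \<bar>u y - u c\<bar> * bump e (y - c)"
          by (simp only: left_diff_distrib[symmetric] abs_mult abs_of_nonneg[OF bump_nonneg])
        moreover have "\<bar>u y - u c\<bar> * bump e (y - c) \<le> \<eta> * bump e (y - c)"
          using \<open>\<bar>u y - u c\<bar> < \<eta>\<close> by (intro mult_right_mono bump_nonneg) simp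
        ultimately show ?thesis by simp
      qed
      define D where "D y = indicator ?Q y * (u y * bump e (y - c)) - u c * bump e (y - c)" for y
      have "(\<integral>y. indicator ?Q y * (u y * bump e (y - c)) \<partial>lborel) - u c * (\<integral>y. bump e y \<partial>(lborel :: (real ^ 'n) measure)) = (\<integral>y. D y \<partial>lborel)"
        unfolding D_def Bochner_Integration.integral_diff[OF i1 i2] by (simp add: bump_integral_shift)
      moreover have "\<bar>\<integral>y. D y \<partial>lborel\<bar> \<le> (\<integral>y. \<bar>D y\<bar> \<partial>lborel)"
        by (rule integral_abs_bound)
      moreover have "(\<integral>y. \<bar>D y\<bar> \<partial>lborel) \<le> (\<integral>y. \<eta> * bump e (y - c) \<partial>lborel)"
      proof (rule integral_mono)
        show "integrable lborel (\<lambda>y. \<bar>D y\<bar>)" by (rule integrable_abs) (use i4 in \<open>simp only: D_def\<close>)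
        show "integrable lborel (\<lambda>y. \<eta> * bump e (y - c))" by (rule i3)
        show "\<bar>D y\<bar> \<le> \<eta> * bump e (y - c)" for y unfolding D_def by (rule pt)
      qed
      moreover have "(\<integral>y. \<eta> * bump e (y - c) \<partial>lborel) = \<eta> * (\<integral>y. bump e y \<partial>(lborel :: (real ^ 'n) measure))" by (simp add: bump_integral_shift)
      ultimately show ?thesis by linarith
    qed
    then show ?thesis using e0(1) by blast
  qed
  have lip: "\<bar>u c' - u c\<bar> \<le> ?N * M * norm (c' - c)" if c: "c \<in> ball x0 \<rho>" "c' \<in> ball x0 \<rho>" for c c'
  proof (rule field_le_epsilon)
    fix \<eta> :: real assume "0 < \<eta>"
    then have h: "0 < \<eta> / 2" by simp
    obtain e1 where e1: "0 < e1" "\<And>e. 0 < e \<Longrightarrow> e \<le> e1 \<Longrightarrow>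
      \<bar>(\<integral>y. indicator ?Q y * (u y * bump e (y - c)) \<partial>lborel) - u c * (\<integral>y. bump e y \<partial>(lborel :: (real ^ 'n) measure))\<bar> \<le> \<eta> / 2 * (\<integral>y. bump e y \<partial>(lborel :: (real ^ 'n) measure))"
      using avg[OF c(1) h] by blast
    obtain e2 where e2: "0 < e2" "\<And>e. 0 < e \<Longrightarrow> e \<le> e2 \<Longrightarrow>
      \<bar>(\<integral>y. indicator ?Q y * (u y * bump e (y - c')) \<partial>lborel) - u c' * (\<integral>y. bump e y \<partial>(lborel :: (real ^ 'n) measure))\<bar> \<le> \<eta> / 2 * (\<integral>y. bump e y \<partial>(lborel :: (real ^ 'n) measure))"
      using avg[OF c(2) h] by blast
    define e where "e = min \<rho> (min e1 e2)"
    have e: "0 < e" "e \<le> \<rho>" "e \<le> e1" "e \<le> e2" using \<rho>(1) e1(1) e2(1) by (auto simp: e_def)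
    let ?I = "\<integral>y. bump e y \<partial>(lborel :: (real ^ 'n) measure)"
    let ?A = "\<lambda>k. \<integral>y. indicator ?Q y * (u y * bump e (y - k)) \<partial>lborel"
    have I: "0 < ?I" by (rule bump_integral_pos[OF e(1)])
    have "\<bar>?A (c + (c' - c)) - ?A c\<bar> \<le> ?N * M * norm (c' - c) * ?I"
    proof (rule mollified_bound[OF U cu Q gm g(2) M0 M e(1)])
      fix s :: real assume s: "0 \<le> s" "s \<le> 1"
      have "c + s *\<^sub>R (c' - c) = (1 - s) *\<^sub>R c + s *\<^sub>R c'" by (simp add: algebra_simps)
      then have k: "c + s *\<^sub>R (c' - c) \<in> ball x0 \<rho>" using convex_ball[of x0 \<rho>] c s by (simp add: convex_alt)
      define k where "k = c + s *\<^sub>R (c' - c)"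
      have "?a $ i \<le> y $ i \<and> y $ i \<le> ?b $ i" if "y \<in> cbox (k - (\<chi> i. e)) (k + (\<chi> i. e))" for y i
      proof -
        have "k $ i - e \<le> y $ i" "y $ i \<le> k $ i + e" using that by (auto simp: mem_box_cart)
        moreover have "\<bar>k $ i - x0 $ i\<bar> < \<rho>" using inb[OF k[folded k_def], of i] by simp
        ultimately have "- (3 * \<rho>) \<le> y $ i - x0 $ i \<and> y $ i - x0 $ i \<le> 3 * \<rho>" using \<rho>(1) e(2) by linarith
        then show ?thesis by simp
      qed
      then show "cbox (c + s *\<^sub>R (c' - c) - (\<chi> i. e)) (c + s *\<^sub>R (c' - c) + (\<chi> i. e)) \<subseteq> ?Q"
        unfolding k_def[symmetric] by (intro subsetI) (simp only: mem_box_cart, blast)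
    qed
    then have "\<bar>?A c' - ?A c\<bar> \<le> ?N * M * norm (c' - c) * ?I" by simp
    then have "\<bar>u c' * ?I - u c * ?I\<bar> \<le> ?N * M * norm (c' - c) * ?I + \<eta> / 2 * ?I + \<eta> / 2 * ?I"
      using e1(2)[OF e(1,3)] e2(2)[OF e(1,4)] by linarith
    then have "\<bar>u c' - u c\<bar> * ?I \<le> (?N * M * norm (c' - c) + \<eta>) * ?I"
      using I by (simp only: left_diff_distrib[symmetric] abs_mult abs_of_pos distrib_right)
    then show "\<bar>u c' - u c\<bar> \<le> ?N * M * norm (c' - c) + \<eta>" using I by (simp only: mult_le_cancel_right_pos)
  qed
  have "(?N * M)-lipschitz_on (ball x0 \<rho> \<inter> U) u"
    using lip M0 by (intro lipschitz_onI) (auto simp: dist_norm simp del: mem_ball)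
  then show "\<exists>r>0. \<exists>L. L-lipschitz_on (ball x0 r \<inter> U) u" using \<rho>(1) by blast
qed

subsection \<open>Minimizing the gradient\<close>

lemma Linf_norm_leI:
  assumes "open V" "f \<in> borel_measurable (lebesgue_on V)" "AE x in lebesgue. x \<in> V \<longrightarrow> \<bar>f x\<bar> \<le> C"
  shows "Linf_norm V f \<le> ennreal C"
  unfolding Linf_norm_def
proof (rule esssup_I)
  show "(\<lambda>x. ennreal \<bar>f x\<bar>) \<in> borel_measurable (lebesgue_on V)" using assms(2) by measurable
  have "AE x in lebesgue. x \<in> V \<longrightarrow> ennreal \<bar>f x\<bar> \<le> ennreal C"
    using assms(3) by eventually_elim (auto intro: ennreal_leI)
  then show "AE x in lebesgue_on V. ennreal \<bar>f x\<bar> \<le> ennreal C"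
    using assms(1) by (subst AE_restrict_space_iff) auto
qed

lemma Linf_norm_leD:
  assumes "open V" "Linf_norm V f \<le> ennreal C" "0 \<le> C"
  shows "AE x in lebesgue. x \<in> V \<longrightarrow> \<bar>f x\<bar> \<le> C"
proof -
  have "AE x in lebesgue_on V. ennreal \<bar>f x\<bar> \<le> esssup (lebesgue_on V) (\<lambda>x. ennreal \<bar>f x\<bar>)" by (rule esssup_AE)
  then have "AE x in lebesgue. x \<in> V \<longrightarrow> ennreal \<bar>f x\<bar> \<le> esssup (lebesgue_on V) (\<lambda>x. ennreal \<bar>f x\<bar>)"
    using assms(1) by (subst (asm) AE_restrict_space_iff) auto
  then show ?thesis
  proof eventually_elim
    case (elim x)
    show ?case
    proof
      assume "x \<in> V"
      then have "ennreal \<bar>f x\<bar> \<le> ennreal C" using elim assms(2) unfolding Linf_norm_def by (meson order_trans)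
      then show "\<bar>f x\<bar> \<le> C" using assms(3) by (simp add: ennreal_le_iff)
    qed
  qed
qed

lemma locally_lipschitz_on_subset:
  "locally_lipschitz_on U u \<Longrightarrow> V \<subseteq> U \<Longrightarrow> locally_lipschitz_on V u"
  unfolding locally_lipschitz_on_def by (meson Int_mono order_refl lipschitz_on_subset subsetD)

lemma locally_lipschitz_on_uminus:
  fixes v :: "'a::metric_space \<Rightarrow> real"
  shows "locally_lipschitz_on V (\<lambda>x. - v x) \<longleftrightarrow> locally_lipschitz_on V v"
  by (simp add: locally_lipschitz_on_def lipschitz_on_def dist_minus)

lemma grad_uminus:
  assumes "f differentiable (at x)" shows "grad (\<lambda>x. - f x) x = - grad f x"
  by (rule grad_eqI) (use has_derivative_minus[OF has_derivative_grad[OF assms]] in simp)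

context finsler begin

lemma dual_grad_measurable:
  "open V \<Longrightarrow> locally_lipschitz_on V v \<Longrightarrow> (\<lambda>x. dual_norm \<phi> (grad v x)) \<in> borel_measurable (lebesgue_on V)"
  by (rule measurable_compose[OF grad_measurable borel_measurable_continuous_onI[OF continuous_dual]])

text \<open>The increment bound is one-sided, as \<phi> is not symmetric, so the derivative along
  \<open>q\<close> is tested with \<open>t\<close> tending to 0 from the right.\<close>

lemma dual_grad_le:
  assumes d: "v differentiable (at x)" and le: "\<And>h. v (x + h) - v x \<le> C * \<phi> h" and C: "0 \<le> C"
  shows "dual_norm \<phi> (grad v x) \<le> C"
proof (rule dual_leI)
  fix q assume q: "\<phi> q \<le> 1"
  have "(dquot v q x \<longlongrightarrow> grad v x \<bullet> q) (at_right 0)"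
    by (rule tendsto_mono[OF _ dquot_tendsto[OF has_derivative_grad[OF d]]]) (simp add: at_le)
  moreover have "\<forall>\<^sub>F t in at_right 0. dquot v q x t \<le> C"
    unfolding eventually_at_filter
  proof (intro always_eventually allI impI)
    fix t :: real assume "t \<noteq> 0" "t \<in> {0<..}"
    then have t: "0 < t" by simp
    have "v (x + t *\<^sub>R q) - v x \<le> C * (t * \<phi> q)" using le[of "t *\<^sub>R q"] t by (simp add: phi_scale)
    also have "\<dots> \<le> C * (t * 1)" using q t C by (intro mult_left_mono) auto
    finally show "dquot v q x t \<le> C" using t by (simp add: dquot_def divide_le_eq)
  qed
  ultimately show "grad v x \<bullet> q \<le> C" by (rule tendsto_upperbound) simp
qed

text \<open>On the set from \<open>CCA_if_cone_boundary\<close> the cone is a competitor with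
  gradient bound \<mu>. Minimality transfers the bound to \<open>u\<close>, but only inside
  \<open>W\<close>, while \<open>y\<close> lies on the frontier; so the segment estimate starts
  slightly inside and is continued to \<open>y\<close>.\<close>

lemma CCA_if_abs_min_grad:
  assumes U: "open U" and cont: "continuous_on U u" and lip: "locally_lipschitz_on U u"
    and min: "\<And>V v. open V \<Longrightarrow> V \<subset>\<subset> U \<Longrightarrow> continuous_on (closure V) v \<Longrightarrow> locally_lipschitz_on V v \<Longrightarrow>
      (\<And>x. x \<in> frontier V \<Longrightarrow> v x = u x) \<Longrightarrow>
      Linf_norm V (\<lambda>x. dual_norm \<phi> (grad u x)) \<le> Linf_norm V (\<lambda>x. dual_norm \<phi> (grad v x))"
  shows "u \<in> CCA \<phi> U"
proof (rule CCA_if_cone_boundary[OF U cont])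
  fix W z \<mu> m x y
  assume W: "open W" "W \<subset>\<subset> U" and \<mu>: "0 < \<mu>" and bd: "\<And>y. y \<in> frontier W \<Longrightarrow> u y = m + \<mu> * \<phi> (y - z)"
    and x: "x \<in> W" and y: "y \<in> frontier W" and seg: "\<And>t. 0 < t \<Longrightarrow> t \<le> 1 \<Longrightarrow> y + t *\<^sub>R (x - y) \<in> W"
  let ?v = "\<lambda>y. m + \<mu> * \<phi> (y - z)"
  have WU: "W \<subseteq> U" "frontier W \<subseteq> U" using compactly_containedD[OF W(2)] closure_subset by blast+
  have le: "?v a - ?v b \<le> \<mu> * \<phi> (a - b)" for a b
    using mult_left_mono[OF phi_triangle3[of a z b], of \<mu>] \<mu> by (simp add: algebra_simps)
  obtain k M where M: "0 < k" "0 < M" "\<And>x. k * norm x \<le> \<phi> x" "\<And>x. \<phi> x \<le> M * norm x" by (rule phi_bounds) blast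
  have le': "?v a - ?v b \<le> \<mu> * M * norm (a - b)" for a b
    using le[of a b] mult_left_mono[OF M(4)[of "a - b"] less_imp_le[OF \<mu>]] unfolding mult.assoc by (rule order_trans)
  have "(\<mu> * M)-lipschitz_on S ?v" for S
  proof (rule lipschitz_onI)
    fix a b
    show "dist (?v a) (?v b) \<le> \<mu> * M * dist a b"
      using le'[of a b] le'[of b a] by (simp add: dist_real_def dist_norm norm_minus_commute abs_le_iff)
  qed (use \<mu> M in simp)
  then have lv: "locally_lipschitz_on W ?v" unfolding locally_lipschitz_on_def by (meson zero_less_one)
  have cv: "continuous_on (closure W) ?v" by (intro continuous_intros)
  have "AE x in lebesgue. x \<in> W \<longrightarrow> \<bar>dual_norm \<phi> (grad ?v x)\<bar> \<le> \<mu>"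
    using AE_locally_lipschitz_differentiable[OF W(1) lv]
  proof eventually_elim
    case (elim x)
    show ?case
    proof
      assume "x \<in> W"
      then have "?v differentiable (at x)" using elim by blast
      then have "dual_norm \<phi> (grad ?v x) \<le> \<mu>"
        by (rule dual_grad_le) (use le[of "x + h" x for h] \<mu> in \<open>simp_all add: algebra_simps\<close>)
      then show "\<bar>dual_norm \<phi> (grad ?v x)\<bar> \<le> \<mu>" by simp
    qed
  qed
  then have "Linf_norm W (\<lambda>x. dual_norm \<phi> (grad ?v x)) \<le> ennreal \<mu>"
    by (rule Linf_norm_leI[OF W(1) dual_grad_measurable[OF W(1) lv]])
  moreover have "Linf_norm W (\<lambda>x. dual_norm \<phi> (grad u x)) \<le> Linf_norm W (\<lambda>x. dual_norm \<phi> (grad ?v x))"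
    by (rule min[OF W cv lv]) (simp add: bd)
  ultimately have "Linf_norm W (\<lambda>x. dual_norm \<phi> (grad u x)) \<le> ennreal \<mu>" by (rule order_trans[rotated])
  from Linf_norm_leD[OF W(1) this] \<mu>
  have ae: "AE x in lebesgue. x \<in> W \<longrightarrow> dual_norm \<phi> (grad u x) \<le> \<mu>" by simp
  have lu: "locally_lipschitz_on W u" by (rule locally_lipschitz_on_subset[OF lip WU(1)])
  have est: "u x - u (y + t *\<^sub>R (x - y)) \<le> \<mu> * \<phi> (x - (y + t *\<^sub>R (x - y)))" if t: "0 < t" "t \<le> 1" for t
  proof (rule segment_estimate[OF W(1) lu ae])
    show "closed_segment (y + t *\<^sub>R (x - y)) x \<subseteq> W"
    proof
      fix a assume "a \<in> closed_segment (y + t *\<^sub>R (x - y)) x"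
      then obtain s where s: "0 \<le> s" "s \<le> 1" "a = (1 - s) *\<^sub>R (y + t *\<^sub>R (x - y)) + s *\<^sub>R x" unfolding in_segment by blast
      have "a = y + (t + s * (1 - t)) *\<^sub>R (x - y)" unfolding s(3) by (simp add: algebra_simps)
      moreover have "0 < t + s * (1 - t)" using s t by (simp add: add_pos_nonneg)
      moreover have "t + s * (1 - t) \<le> 1"
        using mult_right_mono[OF s(2), of "1 - t"] t by simp
      ultimately show "a \<in> W" using seg by simp
    qed
  qed
  have ray: "((\<lambda>t. y + t *\<^sub>R (x - y)) \<longlongrightarrow> y) (at_right 0)"
    by (rule tendsto_eq_intros refl | simp)+
  have "isCont u y" using cont U WU(2) y by (meson continuous_on_eq_continuous_at subsetD)
  from isCont_tendsto_compose[OF this ray]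
  have l1: "((\<lambda>t. u x - u (y + t *\<^sub>R (x - y))) \<longlongrightarrow> u x - u y) (at_right 0)" by (intro tendsto_intros)
  have l2: "((\<lambda>t. \<mu> * \<phi> (x - (y + t *\<^sub>R (x - y)))) \<longlongrightarrow> \<mu> * \<phi> (x - y)) (at_right 0)"
    by (intro tendsto_intros ray)
  have "\<forall>\<^sub>F t in at_right 0. u x - u (y + t *\<^sub>R (x - y)) \<le> \<mu> * \<phi> (x - (y + t *\<^sub>R (x - y)))"
    unfolding eventually_at_right_field using est by (intro exI[of _ 1]) auto
  from tendsto_le[OF _ l2 l1 this] show "u x - u y \<le> \<mu> * \<phi> (x - y)" by simp
qed

text \<open>The slope is read off backwards, along \<open>- q\<close> for a direction
  \<open>q\<close> of steepest ascent, since \<open>slope_ge_if_frequently\<close> asks for rises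
  that arrive at \<open>x\<close>.\<close>

lemma slope_ge_dual_grad:
  assumes U: "open U" and cont: "continuous_on U u" and cc: "u \<in> CCA \<phi> U"
    and d: "u differentiable (at x)" and nz: "grad u x \<noteq> 0"
  shows "slope_ge u U (dual_norm \<phi> (grad u x)) x"
proof (rule slope_ge_if_frequently[OF U cont cc])
  fix k assume k: "k < dual_norm \<phi> (grad u x)"
  obtain q where q: "\<phi> q \<le> 1" "grad u x \<bullet> q = dual_norm \<phi> (grad u x)" by (rule dual_attained)
  have q1: "\<phi> q = 1" by (rule dual_unit_attained[OF nz q])
  have "(dquot u (- q) x \<longlongrightarrow> grad u x \<bullet> - q) (at_right 0)"
    by (rule tendsto_mono[OF _ dquot_tendsto[OF has_derivative_grad[OF d]]]) (simp add: at_le)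
  then have "\<forall>\<^sub>F t in at_right 0. dquot u (- q) x t < - k"
    by (rule order_tendstoD(2)) (use k q(2) in simp)
  then have "\<forall>\<^sub>F t in at_right 0. k * \<phi> (x - (x + t *\<^sub>R - q)) \<le> u x - u (x + t *\<^sub>R - q)"
    unfolding eventually_at_filter
  proof eventually_elim
    case (elim t)
    show ?case
    proof (intro impI)
      assume "t \<noteq> 0" "t \<in> {0<..}"
      then have t: "0 < t" and l: "dquot u (- q) x t < - k" using elim by auto
      have "\<phi> (x - (x + t *\<^sub>R - q)) = t" using t by (simp add: phi_scale q1)
      moreover have "u (x + t *\<^sub>R - q) - u x < - k * t" using l t by (simp add: dquot_def divide_less_eq)
      ultimately show "k * \<phi> (x - (x + t *\<^sub>R - q)) \<le> u x - u (x + t *\<^sub>R - q)" by simp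
    qed
  qed
  then show "\<exists>\<^sub>F y in at x. k * \<phi> (x - y) \<le> u x - u y"
    by (rule frequently_at_along_ray[rotated]) (use q1 in auto)
qed

text \<open>Along steps in which \<open>u\<close> rises with slope \<open>\<kappa>\<close>, \<open>v\<close> rises with slope at most \<open>L < \<kappa>\<close>, so
  \<open>u - v\<close> can only be maximal over the points of large slope at the boundary.\<close>

lemma less_if_slope_ge:
  assumes V: "open V" "compact (closure V)"
    and u: "continuous_on (closure V) u" "u \<in> CCA \<phi> V"
    and v: "continuous_on (closure V) v" "locally_lipschitz_on V v"
    and bd: "\<And>x. x \<in> frontier V \<Longrightarrow> v x = u x"
    and ae: "AE x in lebesgue. x \<in> V \<longrightarrow> dual_norm \<phi> (grad v x) \<le> L"
    and L: "0 \<le> L" "L < \<kappa>" and x0: "x0 \<in> V" "slope_ge u V \<kappa> x0"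
  shows "u x0 < v x0"
proof -
  define A where "A = {x\<in>V. slope_ge u V \<kappa> x}"
  have cV: "continuous_on V u" using u(1) closure_subset by (rule continuous_on_subset)
  have step: "\<exists>w\<in>A. u x - v x < u w - v w" if x: "x \<in> A" for x
  proof -
    have xV: "x \<in> V" "slope_ge u V \<kappa> x" using x by (auto simp: A_def)
    obtain r where r: "0 < r" "\<And>s. s \<le> r \<Longrightarrow> pball x s \<subseteq> V" by (rule pball_subset_open[OF V(1) xV(1)]) blast
    have rV: "pball x r \<subseteq> V" by (rule r(2)) simp
    have \<kappa>: "0 < \<kappa>" using L by simp
    obtain w where w: "w \<in> pball x r" "\<kappa> * r \<le> u w - u x" "slope_ge u V \<kappa> w"
      by (rule slope_ge_step[OF V(1) cV u(2) xV(2) \<kappa> r(1) rV]) blast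
    have wr: "\<phi> (w - x) \<le> r" using w(1) by (simp add: pball_def)
    have "closed_segment x w \<subseteq> V"
    proof
      fix a assume "a \<in> closed_segment x w"
      then obtain t where t: "0 \<le> t" "t \<le> 1" "a = (1 - t) *\<^sub>R x + t *\<^sub>R w" unfolding in_segment by blast
      have "a - x = t *\<^sub>R (w - x)" unfolding t(3) by (simp add: algebra_simps)
      then have "\<phi> (a - x) = t * \<phi> (w - x)" using t(1) by (simp add: phi_scale)
      also have "\<dots> \<le> 1 * \<phi> (w - x)" by (rule mult_right_mono[OF t(2)]) simp
      finally have "a \<in> pball x r" using wr by (simp add: pball_def)
      then show "a \<in> V" using rV by blast
    qed
    then have "v w - v x \<le> L * \<phi> (w - x)" by (rule segment_estimate[OF V(1) v(2) ae])
    also have "\<dots> \<le> L * r" by (rule mult_left_mono[OF wr L(1)])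
    also have "\<dots> < \<kappa> * r" using L(2) r(1) by simp
    finally have "u x - v x < u w - v w" using w(2) by linarith
    moreover have "w \<in> A" using w(1,3) rV by (auto simp: A_def)
    ultimately show ?thesis by blast
  qed
  have x0A: "x0 \<in> A" using x0 by (simp add: A_def)
  have AV: "closure A \<subseteq> closure V" by (rule closure_mono) (auto simp: A_def)
  have "compact (closure A)" using V(2) AV by (meson closed_closure closed_subset compact_closure bounded_subset compact_imp_bounded closure_closure compact_eq_bounded_closed)
  moreover have "closure A \<noteq> {}" using x0A closure_subset by blast
  moreover have "continuous_on (closure A) (\<lambda>x. u x - v x)"
    by (intro continuous_intros continuous_on_subset[OF u(1) AV] continuous_on_subset[OF v(1) AV])
  ultimately obtain m where m: "m \<in> closure A" "\<And>x. x \<in> closure A \<Longrightarrow> u x - v x \<le> u m - v m"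
    using continuous_attains_sup[of "closure A" "\<lambda>x. u x - v x"] by metis
  \<comment> \<open>The maximum of \<open>u - v\<close> cannot sit in \<open>A\<close>, where a step
    increases it; as \<open>A\<close> is relatively closed in \<open>V\<close>, it sits on the
    frontier, where \<open>u = v\<close>.\<close>
  have "m \<notin> A" using step[of m] m(2) closure_subset[of A] by (meson not_le subsetD)
  then have "m \<notin> V" using slope_ge_closed[OF V(1) cV, of m \<kappa>] m(1) by (auto simp: A_def)
  then have "m \<in> frontier V" using m(1) AV V(1) by (auto simp: frontier_def interior_open)
  then have m0: "u m - v m = 0" using bd by simp
  \<comment> \<open>One further step from \<open>x0\<close> makes the inequality strict.\<close>
  obtain w where w: "w \<in> A" "u x0 - v x0 < u w - v w" using step[OF x0A] by blast
  have "u w - v w \<le> 0" using m(2)[of w] w(1) closure_subset[of A] m0 by auto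
  then show ?thesis using w(2) by linarith
qed

text \<open>Negation commutes with \<open>grad\<close> at points of differentiability, so the two
  functions agree almost everywhere, which is all an essential supremum sees.\<close>

lemma Linf_norm_dual_grad_reflect:
  assumes V: "open V" and v: "locally_lipschitz_on V v"
  shows "Linf_norm V (\<lambda>x. dual_norm (\<lambda>x. \<phi> (- x)) (grad (\<lambda>x. - v x) x)) = Linf_norm V (\<lambda>x. dual_norm \<phi> (grad v x))"
  unfolding Linf_norm_def
proof (rule esssup_AE_cong)
  interpret R: finsler "\<lambda>x. \<phi> (- x)" by (rule finsler_reflect)
  have v': "locally_lipschitz_on V (\<lambda>x. - v x)" using v by (simp add: locally_lipschitz_on_uminus)
  show "(\<lambda>x. ennreal \<bar>dual_norm (\<lambda>x. \<phi> (- x)) (grad (\<lambda>x. - v x) x)\<bar>) \<in> borel_measurable (lebesgue_on V)"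
    using R.dual_grad_measurable[OF V v'] by measurable
  show "(\<lambda>x. ennreal \<bar>dual_norm \<phi> (grad v x)\<bar>) \<in> borel_measurable (lebesgue_on V)"
    using dual_grad_measurable[OF V v] by measurable
  have "AE x in lebesgue. x \<in> V \<longrightarrow> ennreal \<bar>dual_norm (\<lambda>x. \<phi> (- x)) (grad (\<lambda>x. - v x) x)\<bar> = ennreal \<bar>dual_norm \<phi> (grad v x)\<bar>"
    using AE_locally_lipschitz_differentiable[OF V v]
    by eventually_elim (auto simp: grad_uminus dual_reflect)
  then show "AE x in lebesgue_on V. ennreal \<bar>dual_norm (\<lambda>x. \<phi> (- x)) (grad (\<lambda>x. - v x) x)\<bar> = ennreal \<bar>dual_norm \<phi> (grad v x)\<bar>"
    using V by (subst AE_restrict_space_iff) auto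
qed

lemma CCA_CCB_grad_min:
  assumes U: "open U" and cont: "continuous_on U u" and A: "u \<in> CCA \<phi> U" and B: "u \<in> CCB \<phi> U"
    and V: "open V" "V \<subset>\<subset> U" and v: "continuous_on (closure V) v" "locally_lipschitz_on V v"
    and bd: "\<And>x. x \<in> frontier V \<Longrightarrow> v x = u x"
  shows "Linf_norm V (\<lambda>x. dual_norm \<phi> (grad u x)) \<le> Linf_norm V (\<lambda>x. dual_norm \<phi> (grad v x))"
proof (cases "Linf_norm V (\<lambda>x. dual_norm \<phi> (grad v x)) = top")
  case False
  interpret R: finsler "\<lambda>x. \<phi> (- x)" by (rule finsler_reflect)
  \<comment> \<open>The norm of the competitor is finite here, the infinite case being trivial, so
    slopes can be compared with a real number.\<close>
  define L where "L = enn2real (Linf_norm V (\<lambda>x. dual_norm \<phi> (grad v x)))"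
  have L: "0 \<le> L" and eL: "Linf_norm V (\<lambda>x. dual_norm \<phi> (grad v x)) = ennreal L"
    using False by (auto simp: L_def less_top)
  have ae: "AE x in lebesgue. x \<in> V \<longrightarrow> dual_norm \<phi> (grad v x) \<le> L"
    using Linf_norm_leD[OF V(1) eq_refl[OF eL] L] by simp
  have ae': "AE x in lebesgue. x \<in> V \<longrightarrow> dual_norm (\<lambda>x. \<phi> (- x)) (grad (\<lambda>x. - v x) x) \<le> L"
    using ae AE_locally_lipschitz_differentiable[OF V(1) v(2)]
    by eventually_elim (auto simp: grad_uminus dual_reflect)
  have VU: "V \<subseteq> U" "closure V \<subseteq> U" "compact (closure V)"
    using compactly_containedD[OF V(2)] closure_subset by blast+
  have cV: "continuous_on (closure V) u" "continuous_on V u" using cont VU by (auto intro: continuous_on_subset)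
  have AV: "u \<in> CCA \<phi> V" by (rule CCA_subset[OF cont A VU(1)])
  have cont': "continuous_on U (\<lambda>x. - u x)" by (intro continuous_intros cont)
  have BV: "(\<lambda>x. - u x) \<in> CCA (\<lambda>x. \<phi> (- x)) V"
    by (rule R.CCA_subset[OF cont' _ VU(1)]) (use B in \<open>simp add: CCB_iff_CCA\<close>)
  have lu: "locally_lipschitz_on V u" by (rule CCA_locally_lipschitz[OF V(1) cV(2) AV])
  have key: "dual_norm \<phi> (grad u x) \<le> L" if x: "x \<in> V" and d: "u differentiable (at x)" for x
  proof (rule ccontr)
    assume "\<not> ?thesis"
    then have gt: "L < dual_norm \<phi> (grad u x)" by simp
    then have nz: "grad u x \<noteq> 0" using L by auto
    have "u x < v x"
      by (rule less_if_slope_ge[OF V(1) VU(3) cV(1) AV v bd ae L gt x slope_ge_dual_grad[OF V(1) cV(2) AV d nz]])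
    moreover have "- u x < - v x"
    proof (rule R.less_if_slope_ge[OF V(1) VU(3) _ BV _ _ _ ae' L gt x])
      have d': "(\<lambda>x. - u x) differentiable (at x)" using d by simp
      have nz': "grad (\<lambda>x. - u x) x \<noteq> 0" using nz by (simp add: grad_uminus[OF d])
      have cV': "continuous_on V (\<lambda>x. - u x)" by (intro continuous_intros cV)
      show "R.slope_ge (\<lambda>x. - u x) V (dual_norm \<phi> (grad u x)) x"
        using R.slope_ge_dual_grad[OF V(1) cV' BV d' nz'] by (simp add: dual_reflect grad_uminus[OF d])
    qed (use v cV bd in \<open>auto intro: continuous_intros simp: locally_lipschitz_on_uminus\<close>)
    ultimately show False by simp
  qed
  have "AE x in lebesgue. x \<in> V \<longrightarrow> \<bar>dual_norm \<phi> (grad u x)\<bar> \<le> L"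
    using AE_locally_lipschitz_differentiable[OF V(1) lu] by eventually_elim (auto simp: key)
  then show ?thesis unfolding eL by (rule Linf_norm_leI[OF V(1) dual_grad_measurable[OF V(1) lu]])
qed simp

end

section \<open>The equivalence of minimality, comparison with cones and the viscosity
  inequalities\<close>

theorem corollary1:
  fixes \<phi> :: "real ^ 'n \<Rightarrow> real" and U :: "(real ^ 'n) set" and u :: "real ^ 'n \<Rightarrow> real"
  assumes "finsler_norm \<phi>" and "open U" and "continuous_on U u"
  shows "(u \<in> abs_min_Lip \<phi> U \<longleftrightarrow> u \<in> abs_min_grad \<phi> U) \<and>
         (u \<in> abs_min_grad \<phi> U \<longleftrightarrow> u \<in> CCA \<phi> U \<inter> CCB \<phi> U) \<and>
         (u \<in> CCA \<phi> U \<inter> CCB \<phi> U \<longleftrightarrow> u \<in> Sub \<phi> U \<inter> Super \<phi> U)"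
proof -
  interpret finsler \<phi> by (rule finsler.intro[OF assms(1)])
  interpret R: finsler "\<lambda>x. \<phi> (- x)" by (rule finsler_reflect)
  note U = assms(2) and cont = assms(3)
  have cont': "continuous_on U (\<lambda>x. - u x)" by (intro continuous_intros cont)
  have minL: "u \<in> CCA \<phi> U \<inter> CCB \<phi> U" if "u \<in> abs_min_Lip \<phi> U"
  proof -
    have min: "Lip \<phi> (closure V) u \<le> Lip \<phi> (closure V) v"
      if "open V" "V \<subset>\<subset> U" "\<And>x. x \<in> frontier V \<Longrightarrow> v x = u x" for V v
      using \<open>u \<in> abs_min_Lip \<phi> U\<close> that unfolding abs_min_Lip_def is_minimum_def by blast
    have "u \<in> CCA \<phi> U" by (rule CCA_if_abs_min_Lip[OF U cont min])
    moreover have "(\<lambda>x. - u x) \<in> CCA (\<lambda>x. \<phi> (- x)) U"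
    proof (rule R.CCA_if_abs_min_Lip[OF U cont'])
      fix V v assume "open V" "V \<subset>\<subset> U" "\<And>x. x \<in> frontier V \<Longrightarrow> v x = - u x"
      then have "Lip \<phi> (closure V) u \<le> Lip \<phi> (closure V) (\<lambda>x. - v x)" by (intro min) auto
      then show "Lip (\<lambda>x. \<phi> (- x)) (closure V) (\<lambda>x. - u x) \<le> Lip (\<lambda>x. \<phi> (- x)) (closure V) v"
        using Lip_reflect[of "closure V" u] Lip_reflect[of "closure V" "\<lambda>x. - v x"] by simp
    qed
    ultimately show ?thesis by (simp add: CCB_iff_CCA)
  qed
  have minG: "u \<in> CCA \<phi> U \<inter> CCB \<phi> U" if mem: "u \<in> abs_min_grad \<phi> U"
  proof -
    have min: "Linf_norm V (\<lambda>x. dual_norm \<phi> (grad u x)) \<le> Linf_norm V (\<lambda>x. dual_norm \<phi> (grad v x))"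
      if "open V" "V \<subset>\<subset> U" "continuous_on (closure V) v" "locally_lipschitz_on V v" "\<And>x. x \<in> frontier V \<Longrightarrow> v x = u x" for V v
      using mem that unfolding abs_min_grad_def is_minimum_def by blast
    have lip: "locally_lipschitz_on U u"
      by (rule W1inf_locally_lipschitz[OF U cont]) (use mem in \<open>simp add: abs_min_grad_def\<close>)
    have "u \<in> CCA \<phi> U" by (rule CCA_if_abs_min_grad[OF U cont lip min])
    moreover have "(\<lambda>x. - u x) \<in> CCA (\<lambda>x. \<phi> (- x)) U"
    proof (rule R.CCA_if_abs_min_grad[OF U cont'])
      show "locally_lipschitz_on U (\<lambda>x. - u x)" using lip by (simp add: locally_lipschitz_on_uminus)
      fix V v assume V: "open V" "V \<subset>\<subset> U" and v: "continuous_on (closure V) v" "locally_lipschitz_on V v"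
        and bd: "\<And>x. x \<in> frontier V \<Longrightarrow> v x = - u x"
      have v': "locally_lipschitz_on V (\<lambda>x. - v x)" using v(2) by (simp add: locally_lipschitz_on_uminus)
      have VU: "V \<subseteq> U" using compactly_containedD(2)[OF V(2)] closure_subset by blast
      have "Linf_norm V (\<lambda>x. dual_norm \<phi> (grad u x)) \<le> Linf_norm V (\<lambda>x. dual_norm \<phi> (grad (\<lambda>x. - v x) x))"
        by (rule min[OF V _ v']) (use v(1) bd in \<open>auto intro: continuous_intros\<close>)
      then show "Linf_norm V (\<lambda>x. dual_norm (\<lambda>x. \<phi> (- x)) (grad (\<lambda>x. - u x) x)) \<le> Linf_norm V (\<lambda>x. dual_norm (\<lambda>x. \<phi> (- x)) (grad v x))"
        using Linf_norm_dual_grad_reflect[OF V(1) locally_lipschitz_on_subset[OF lip VU]]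
          Linf_norm_dual_grad_reflect[OF V(1) v'] by simp
    qed
    ultimately show ?thesis by (simp add: CCB_iff_CCA)
  qed
  have conv: "u \<in> abs_min_Lip \<phi> U \<and> u \<in> abs_min_grad \<phi> U" if "u \<in> CCA \<phi> U \<inter> CCB \<phi> U"
  proof -
    have A: "u \<in> CCA \<phi> U" and B: "u \<in> CCB \<phi> U" using that by auto
    have lip: "locally_lipschitz_on U u" by (rule CCA_locally_lipschitz[OF U cont A])
    have W: "u \<in> W1inf_loc U" by (rule locally_lipschitz_W1inf[OF U lip])
    have "u \<in> abs_min_Lip \<phi> U"
      unfolding abs_min_Lip_def is_minimum_def
      using W CCA_CCB_Lip_min[OF U cont A B] by blast
    moreover have "u \<in> abs_min_grad \<phi> U"
      unfolding abs_min_grad_def is_minimum_def mem_Collect_eq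
    proof (intro conjI W allI impI)
      fix V assume "open V \<and> V \<subset>\<subset> U"
      then have V: "open V" "V \<subset>\<subset> U" by auto
      have VU: "V \<subseteq> U" "closure V \<subseteq> U" using compactly_containedD(2)[OF V(2)] closure_subset by blast+
      \<comment> \<open>\<open>u\<close> itself is an admissible competitor, being locally Lipschitz
        by comparison with cones.\<close>
      show "\<exists>v. Linf_norm V (\<lambda>x. dual_norm \<phi> (grad u x)) = Linf_norm V (\<lambda>x. dual_norm \<phi> (grad v x)) \<and>
          continuous_on (closure V) v \<and> locally_lipschitz_on V v \<and> (\<forall>x\<in>frontier V. v x = u x)"
        using continuous_on_subset[OF cont VU(2)] locally_lipschitz_on_subset[OF lip VU(1)] by blast
      show "\<forall>s\<in>{Linf_norm V (\<lambda>x. dual_norm \<phi> (grad v x)) |v. continuous_on (closure V) v \<and>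
          locally_lipschitz_on V v \<and> (\<forall>x\<in>frontier V. v x = u x)}. Linf_norm V (\<lambda>x. dual_norm \<phi> (grad u x)) \<le> s"
        using CCA_CCB_grad_min[OF U cont A B V] by blast
    qed
    ultimately show ?thesis by blast
  qed
  \<comment> \<open>Stated for an arbitrary norm, as it is used both for \<phi> with
    \<open>u\<close> and for the reflected norm with \<open>- u\<close>.\<close>
  have Sub: "v \<in> CCA \<psi> U \<longleftrightarrow> v \<in> Sub \<psi> U" if "finsler \<psi>" "continuous_on U v" for \<psi> :: "real ^ 'n \<Rightarrow> real" and v
  proof -
    interpret P: finsler \<psi> by (rule that(1))
    show ?thesis
      using P.Sub_iff_superjet[OF that(2)] P.CCA_superjet[OF U that(2)] P.Sub_imp_CCA[OF U that(2)] by blast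
  qed
  have "u \<in> CCA \<phi> U \<inter> CCB \<phi> U \<longleftrightarrow> u \<in> Sub \<phi> U \<inter> Super \<phi> U"
    using Sub[OF finsler_axioms cont] Sub[OF R.finsler_axioms cont'] Super_iff_superjet[OF cont] by (simp add: CCB_iff_CCA)
  then show ?thesis using minL minG conv by blast
qed

end
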